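(* Let $\mathbf{k}$ be a commutative ring and let $V$ be an $\mathbf{FI}$-module over $\mathbf{k}$ that is presented in finite degrees and is not $H_0^{\mathbf{FI}}$-acyclic. Write $\gamma := \operatorname{crit}(V)$. Then $t_a(V) - a = \operatorname{reg}(V)$ for every integer $a$ satisfying $$a \ge \begin{cases} \max\{1,\; h^{\gamma}(V) - \gamma\} & \text{if } 2 \text{ is invertible in } \mathbf{k},\\ \max\{1,\; 2h^{\gamma}(V) - \gamma\} & \text{otherwise.}\end{cases}$$
   Context: $\mathbf{FI}$ is the category of finite sets and injections. An $\mathbf{FI}$-module over $\mathbf{k}$ is a functor $V\colon \mathbf{FI} \to \mathbf{k}\text{-Mod}$; write $V_S$ for its value at $S$. These form an abelian category $[\mathbf{FI},\mathbf{k}\text{-Mod}]$. The degree of an $\mathbf{FI}$-module $W$ is $\deg(W) := \min\{d \ge -1 : W_S = 0 \text{ for } |S| > d\} \in \{-1,0,1,\dots\}\cup\{\infty\}$. $\mathbf{FI}$-homology: $H_0^{\mathbf{FI}}(V)$ is the quotient $\mathbf{FI}$-module of $V$ with $H_0^{\mathbf{FI}}(V)_S := \operatorname{coker}\big(\bigoplus_{A \subsetneq S} V_A \to V_S\big)$. The functor $H_0^{\mathbf{FI}}$ is right exact, and $H_i^{\mathbf{FI}}$ denotes its $i$-th left derived functor. Set $t_i(V) := \deg(H_i^{\mathbf{FI}}(V))$. $V$ is presented in finite degrees if $t_0(V)$ and $t_1(V)$ are finite. $V$ is $H_0^{\mathbf{FI}}$-acyclic if $H_i^{\mathbf{FI}}(V)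 = 0$ for all $i \ge 1$. The regularity is $\operatorname{reg}(V) := \max\{t_i(V) - i : i \ge 1\} \in \{-2,-1,0,\dots\}\cup\{\infty\}$; it is known to be finite when $V$ is presented in finite degrees. Local cohomology: $V$ is torsion if for every finite set $S$ and $x \in V_S$ there is an injection $\alpha\colon S \hookrightarrow T$ with $V_\alpha(x) = 0$. $H_{\mathfrak m}^0$ is the left exact endofunctor sending an $\mathbf{FI}$-module to its largest torsion $\mathbf{FI}$-submodule, and $H^j_{\mathfrak m}$ is its $j$-th right derived functor ($j \ge 0$). Set $h^j(V) := \deg(H^j_{\mathfrak m}(V))$. Critical index: for $V$ presented in finite degrees and not $H_0^{\mathbf{FI}}$-acyclic, it is known (Nagpal–Sam–Snowden) that $\operatorname{reg}(V) = \max\{h^j(V) + j : h^j(V) \ge 0\} < \infty$; hence $\operatorname{crit}(V) := \min\{ j : h^j(V) \ge 0 \text{ and } h^j(V) + j = \operatorname{reg}(V)\}$ is well defined. *)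

theory Defs
  imports
    "HOL-Algebra.Module"
    "HOL-Algebra.AbelCoset"
    "HOL-Library.FuncSet"
    "HOL-Library.Extended_Real"
begin

section \<open>FI-modules\<close>

text \<open>
  FI is represented by its full subcategory on the finite subsets of \<open>nat\<close>, to which it is
  equivalent. Injections are extensional functions, so that a morphism \<open>S \<rightarrow> T\<close> is determined by
  its values on \<open>S\<close>. Values of the fields below at infinite sets or at functions that are not
  morphisms are irrelevant, and so are the (inherited) ring multiplication and unit of the
  modules.
\<close>

record ('k, 'a) fi_mod =
  obj :: "nat set \<Rightarrow> ('k, 'a) module"
  mor :: "nat set \<Rightarrow> nat set \<Rightarrow> (nat \<Rightarrow> nat) \<Rightarrow> 'a \<Rightarrow> 'a"

definition FI_hom :: "nat set \<Rightarrow> nat set \<Rightarrow> (nat \<Rightarrow> nat) set" where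
  "FI_hom S T = {f \<in> S \<rightarrow>\<^sub>E T. inj_on f S}"

definition FI_incl :: "nat set \<Rightarrow> nat \<Rightarrow> nat" where
  "FI_incl A = (\<lambda>x\<in>A. x)"

definition mod_hom ::
  "('k, 'r) ring_scheme \<Rightarrow> ('k, 'a) module \<Rightarrow> ('k, 'b) module \<Rightarrow> ('a \<Rightarrow> 'b) set" where
  "mod_hom R M N = {f \<in> carrier M \<rightarrow> carrier N.
     (\<forall>x\<in>carrier M. \<forall>y\<in>carrier M. f (x \<oplus>\<^bsub>M\<^esub> y) = f x \<oplus>\<^bsub>N\<^esub> f y) \<and>
     (\<forall>c\<in>carrier R. \<forall>x\<in>carrier M. f (c \<odot>\<^bsub>M\<^esub> x) = c \<odot>\<^bsub>N\<^esub> f x)}"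

locale FI_module =
  fixes R :: "('k, 'r) ring_scheme" and V :: "('k, 'a) fi_mod"
  assumes cring: "cring R"
    and obj_module: "finite S \<Longrightarrow> Module.module R (obj V S)"
    and mor_hom: "\<lbrakk>finite S; finite T; f \<in> FI_hom S T\<rbrakk>
          \<Longrightarrow> mor V S T f \<in> mod_hom R (obj V S) (obj V T)"
    and mor_id: "\<lbrakk>finite S; x \<in> carrier (obj V S)\<rbrakk> \<Longrightarrow> mor V S S (FI_incl S) x = x"
    and mor_comp: "\<lbrakk>finite S; finite T; finite U; f \<in> FI_hom S T; g \<in> FI_hom T U;
          x \<in> carrier (obj V S)\<rbrakk>
          \<Longrightarrow> mor V S U (compose S g f) x = mor V T U g (mor V S T f x)"

definition FI_map ::
  "('k, 'r) ring_scheme \<Rightarrow> ('k, 'a) fi_mod \<Rightarrow> ('k, 'b) fi_mod \<Rightarrow> (nat set \<Rightarrow> 'a \<Rightarrow> 'b) \<Rightarrow> bool"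
where
  "FI_map R V W \<phi> \<longleftrightarrow>
     (\<forall>S. finite S \<longrightarrow> \<phi> S \<in> mod_hom R (obj V S) (obj W S)) \<and>
     (\<forall>S T f x. finite S \<longrightarrow> finite T \<longrightarrow> f \<in> FI_hom S T \<longrightarrow> x \<in> carrier (obj V S) \<longrightarrow>
        \<phi> T (mor V S T f x) = mor W S T f (\<phi> S x))"

definition FI_zero :: "('k, 'a) fi_mod \<Rightarrow> bool" where
  "FI_zero W \<longleftrightarrow> (\<forall>S. finite S \<longrightarrow> carrier (obj W S) = {\<zero>\<^bsub>obj W S\<^esub>})"

text \<open>The degree takes values in \<open>{-1, 0, 1, \<dots>} \<union> {\<infinity>}\<close>; the infimum of the empty set is \<open>\<infinity>\<close>.\<close>

definition FI_deg :: "('k, 'a) fi_mod \<Rightarrow> ereal" where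
  "FI_deg W = Inf {ereal (of_int d) | d::int. - 1 \<le> d \<and>
     (\<forall>S. finite S \<longrightarrow> d < int (card S) \<longrightarrow> carrier (obj W S) = {\<zero>\<^bsub>obj W S\<^esub>})}"


section \<open>Subobjects, quotients and homology\<close>

definition FI_submodule ::
  "('k, 'r) ring_scheme \<Rightarrow> ('k, 'a) fi_mod \<Rightarrow> (nat set \<Rightarrow> 'a set) \<Rightarrow> bool" where
  "FI_submodule R V N \<longleftrightarrow>
     (\<forall>S. finite S \<longrightarrow> submodule (N S) R (obj V S)) \<and>
     (\<forall>S T f. finite S \<longrightarrow> finite T \<longrightarrow> f \<in> FI_hom S T \<longrightarrow> mor V S T f ` N S \<subseteq> N T)"

definition FI_sub :: "('k, 'a) fi_mod \<Rightarrow> (nat set \<Rightarrow> 'a set) \<Rightarrow> ('k, 'a) fi_mod" where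
  "FI_sub V N = \<lparr>obj = (\<lambda>S. (obj V S)\<lparr>carrier := N S\<rparr>), mor = mor V\<rparr>"

definition mod_quot :: "('k, 'a) module \<Rightarrow> 'a set \<Rightarrow> ('k, 'a set) module" where
  "mod_quot M N = \<lparr>carrier = A_RCOSETS M N, mult = undefined, one = undefined,
     zero = N, add = set_add M, smult = (\<lambda>c X. \<Union>x\<in>X. N +>\<^bsub>M\<^esub> (c \<odot>\<^bsub>M\<^esub> x))\<rparr>"

definition FI_quot :: "('k, 'a) fi_mod \<Rightarrow> (nat set \<Rightarrow> 'a set) \<Rightarrow> ('k, 'a set) fi_mod" where
  "FI_quot V N = \<lparr>obj = (\<lambda>S. mod_quot (obj V S) (N S)),
     mor = (\<lambda>S T f X. \<Union>x\<in>X. N T +>\<^bsub>obj V T\<^esub> mor V S T f x)\<rparr>"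

definition FI_ker ::
  "('k, 'a) fi_mod \<Rightarrow> ('k, 'b) fi_mod \<Rightarrow> (nat set \<Rightarrow> 'a \<Rightarrow> 'b) \<Rightarrow> nat set \<Rightarrow> 'a set" where
  "FI_ker V W \<phi> S = {x \<in> carrier (obj V S). \<phi> S x = \<zero>\<^bsub>obj W S\<^esub>}"

definition FI_im :: "('k, 'a) fi_mod \<Rightarrow> (nat set \<Rightarrow> 'a \<Rightarrow> 'b) \<Rightarrow> nat set \<Rightarrow> 'b set" where
  "FI_im V \<phi> S = \<phi> S ` carrier (obj V S)"

text \<open>For \<open>B \<subseteq> Z \<subseteq> V\<close>, the subquotient \<open>Z / B\<close>.\<close>

definition FI_subquot ::
  "('k, 'a) fi_mod \<Rightarrow> (nat set \<Rightarrow> 'a set) \<Rightarrow> (nat set \<Rightarrow> 'a set) \<Rightarrow> ('k, 'a set) fi_mod" where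
  "FI_subquot V Z B = FI_quot (FI_sub V Z) B"


section \<open>The functors \<open>H\<^sub>0\<^sup>F\<^sup>I\<close> and \<open>H\<^sub>m\<^sup>0\<close>\<close>

text \<open>The image of \<open>\<Oplus>A\<subset>S. V\<^sub>A \<rightarrow> V\<^sub>S\<close>, the sum of the maps induced by the inclusions.\<close>

definition FI_decomp :: "('k, 'a) fi_mod \<Rightarrow> nat set \<Rightarrow> 'a set" where
  "FI_decomp V S =
     (\<lambda>v. finsum (obj V S) (\<lambda>A. mor V A S (FI_incl A) (v A)) {A. A \<subset> S}) `
       (\<Pi>\<^sub>E A\<in>{A. A \<subset> S}. carrier (obj V A))"

definition FI_H0 :: "('k, 'a) fi_mod \<Rightarrow> ('k, 'a set) fi_mod" where
  "FI_H0 V = FI_quot V (FI_decomp V)"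

definition FI_H0_map ::
  "('k, 'b) fi_mod \<Rightarrow> (nat set \<Rightarrow> 'a \<Rightarrow> 'b) \<Rightarrow> nat set \<Rightarrow> 'a set \<Rightarrow> 'b set" where
  "FI_H0_map W \<phi> S X = (\<Union>x\<in>X. FI_decomp W S +>\<^bsub>obj W S\<^esub> \<phi> S x)"

definition FI_torsion :: "('k, 'a) fi_mod \<Rightarrow> bool" where
  "FI_torsion V \<longleftrightarrow> (\<forall>S x. finite S \<longrightarrow> x \<in> carrier (obj V S) \<longrightarrow>
     (\<exists>T f. finite T \<and> f \<in> FI_hom S T \<and> mor V S T f x = \<zero>\<^bsub>obj V T\<^esub>))"

text \<open>
  The largest torsion submodule, as the union of all torsion submodules. On morphisms the functor
  \<open>H\<^sub>m\<^sup>0\<close> is restriction, so it needs no separate definition.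
\<close>

definition torsion_part :: "('k, 'r) ring_scheme \<Rightarrow> ('k, 'a) fi_mod \<Rightarrow> nat set \<Rightarrow> 'a set" where
  "torsion_part R V S = \<Union>{N S | N. FI_submodule R V N \<and> FI_torsion (FI_sub V N)}"

definition FI_Hm0 :: "('k, 'r) ring_scheme \<Rightarrow> ('k, 'a) fi_mod \<Rightarrow> ('k, 'a) fi_mod" where
  "FI_Hm0 R V = FI_sub V (torsion_part R V)"


section \<open>Resolutions\<close>

text \<open>
  The lifting and extension properties range over the FI-modules carried by the same type as the
  module under consideration. For FI-modules with carriers in a type \<open>'a\<close>, resolutions are taken
  in the type \<open>univ\<close>, of cardinality \<open>\<kappa> = |'a option| ^ (|nat| + |'k|)\<close>.
  As \<open>\<kappa> ^ (|nat| + |'k|) = \<kappa>\<close>, up to isomorphism the FI-modules carried by this type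
  are exactly those all of whose values have at most \<open>\<kappa>\<close> elements. These are closed under free
  covers and under embeddings into injectives (countable products of modules \<open>Hom\<^sub>\<int>(k, D)\<close>), hence
  every FI-module carried by \<open>'a\<close> has resolutions in \<open>univ\<close>. They contain free covers of all their
  members and all submodules of the representable FI-modules, so by splitting a free cover,
  respectively by Baer's criterion, projectivity and injectivity among them agree with
  projectivity and injectivity among all FI-modules.
\<close>

type_synonym ('k, 'a) univ = "nat + 'k \<Rightarrow> 'a option"

definition FI_projective :: "('k, 'r) ring_scheme \<Rightarrow> ('k, 'u) fi_mod \<Rightarrow> bool" where
  "FI_projective R P \<longleftrightarrow> FI_module R P \<and>
     (\<forall>(M :: ('k, 'u) fi_mod) (N :: ('k, 'u) fi_mod) p f.
        FI_module R M \<longrightarrow> FI_module R N \<longrightarrow> FI_map R M N p \<longrightarrow> FI_map R P N f \<longrightarrow>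
        (\<forall>S. finite S \<longrightarrow> p S ` carrier (obj M S) = carrier (obj N S)) \<longrightarrow>
        (\<exists>g. FI_map R P M g \<and>
          (\<forall>S. finite S \<longrightarrow> (\<forall>x\<in>carrier (obj P S). p S (g S x) = f S x))))"

definition FI_injective :: "('k, 'r) ring_scheme \<Rightarrow> ('k, 'u) fi_mod \<Rightarrow> bool" where
  "FI_injective R I \<longleftrightarrow> FI_module R I \<and>
     (\<forall>(M :: ('k, 'u) fi_mod) (N :: ('k, 'u) fi_mod) i f.
        FI_module R M \<longrightarrow> FI_module R N \<longrightarrow> FI_map R M N i \<longrightarrow> FI_map R M I f \<longrightarrow>
        (\<forall>S. finite S \<longrightarrow> inj_on (i S) (carrier (obj M S))) \<longrightarrow>
        (\<exists>g. FI_map R N I g \<and>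
          (\<forall>S. finite S \<longrightarrow> (\<forall>x\<in>carrier (obj M S). g S (i S x) = f S x))))"

text \<open>A projective resolution \<open>\<dots> \<rightarrow> P 2 \<rightarrow> P 1 \<rightarrow> P 0 \<rightarrow> V \<rightarrow> 0\<close>, with \<open>d n : P (n + 1) \<rightarrow> P n\<close>.\<close>

definition proj_resolution ::
  "('k, 'r) ring_scheme \<Rightarrow> ('k, 'a) fi_mod \<Rightarrow> (nat \<Rightarrow> ('k, 'u) fi_mod) \<Rightarrow>
   (nat \<Rightarrow> nat set \<Rightarrow> 'u \<Rightarrow> 'u) \<Rightarrow> (nat set \<Rightarrow> 'u \<Rightarrow> 'a) \<Rightarrow> bool" where
  "proj_resolution R V P d e \<longleftrightarrow>
     (\<forall>n. FI_projective R (P n)) \<and>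
     (\<forall>n. FI_map R (P (Suc n)) (P n) (d n)) \<and> FI_map R (P 0) V e \<and>
     (\<forall>S. finite S \<longrightarrow>
        FI_im (P 0) e S = carrier (obj V S) \<and>
        FI_im (P 1) (d 0) S = FI_ker (P 0) V e S \<and>
        (\<forall>n. FI_im (P (Suc (Suc n))) (d (Suc n)) S = FI_ker (P (Suc n)) (P n) (d n) S))"

text \<open>An injective resolution \<open>0 \<rightarrow> V \<rightarrow> I 0 \<rightarrow> I 1 \<rightarrow> \<dots>\<close>, with \<open>d n : I n \<rightarrow> I (n + 1)\<close>.\<close>

definition inj_resolution ::
  "('k, 'r) ring_scheme \<Rightarrow> ('k, 'a) fi_mod \<Rightarrow> (nat \<Rightarrow> ('k, 'u) fi_mod) \<Rightarrow>
   (nat \<Rightarrow> nat set \<Rightarrow> 'u \<Rightarrow> 'u) \<Rightarrow> (nat set \<Rightarrow> 'a \<Rightarrow> 'u) \<Rightarrow> bool" where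
  "inj_resolution R V I d e \<longleftrightarrow>
     (\<forall>n. FI_injective R (I n)) \<and>
     (\<forall>n. FI_map R (I n) (I (Suc n)) (d n)) \<and> FI_map R V (I 0) e \<and>
     (\<forall>S. finite S \<longrightarrow>
        inj_on (e S) (carrier (obj V S)) \<and>
        FI_im V e S = FI_ker (I 0) (I 1) (d 0) S \<and>
        (\<forall>n. FI_im (I n) (d n) S = FI_ker (I (Suc n)) (I (Suc (Suc n))) (d (Suc n)) S))"

definition some_proj_resolution ::
  "('k, 'r) ring_scheme \<Rightarrow> ('k, 'a) fi_mod \<Rightarrow>
   (nat \<Rightarrow> ('k, ('k, 'a) univ) fi_mod) \<times> (nat \<Rightarrow> nat set \<Rightarrow> ('k, 'a) univ \<Rightarrow> ('k, 'a) univ)" where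
  "some_proj_resolution R V = (SOME (P, d). \<exists>e. proj_resolution R V P d e)"

definition some_inj_resolution ::
  "('k, 'r) ring_scheme \<Rightarrow> ('k, 'a) fi_mod \<Rightarrow>
   (nat \<Rightarrow> ('k, ('k, 'a) univ) fi_mod) \<times> (nat \<Rightarrow> nat set \<Rightarrow> ('k, 'a) univ \<Rightarrow> ('k, 'a) univ)" where
  "some_inj_resolution R V = (SOME (I, d). \<exists>e. inj_resolution R V I d e)"


section \<open>FI-homology and local cohomology\<close>

text \<open>The left derived functors of \<open>FI_H0\<close>.\<close>

definition FI_homology ::
  "('k, 'r) ring_scheme \<Rightarrow> nat \<Rightarrow> ('k, 'a) fi_mod \<Rightarrow> ('k, ('k, 'a) univ set set) fi_mod" where
  "FI_homology R i V = (case some_proj_resolution R V of (P, d) \<Rightarrow>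
     FI_subquot (FI_H0 (P i))
       (case i of 0 \<Rightarrow> \<lambda>S. carrier (obj (FI_H0 (P 0)) S)
        | Suc j \<Rightarrow> FI_ker (FI_H0 (P (Suc j))) (FI_H0 (P j)) (FI_H0_map (P j) (d j)))
       (FI_im (FI_H0 (P (Suc i))) (FI_H0_map (P i) (d i))))"

text \<open>The right derived functors of \<open>FI_Hm0 R\<close>.\<close>

definition local_cohomology ::
  "('k, 'r) ring_scheme \<Rightarrow> nat \<Rightarrow> ('k, 'a) fi_mod \<Rightarrow> ('k, ('k, 'a) univ set) fi_mod" where
  "local_cohomology R j V = (case some_inj_resolution R V of (I, d) \<Rightarrow>
     FI_subquot (FI_Hm0 R (I j))
       (FI_ker (FI_Hm0 R (I j)) (FI_Hm0 R (I (Suc j))) (d j))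
       (case j of 0 \<Rightarrow> \<lambda>S. {\<zero>\<^bsub>obj (I 0) S\<^esub>}
        | Suc i \<Rightarrow> FI_im (FI_Hm0 R (I i)) (d i)))"

text \<open>
  For \<open>i = 0\<close> the functor \<open>FI_H0\<close> itself is used; being right exact, it is isomorphic to its
  0-th left derived functor.
\<close>

definition FI_t :: "('k, 'r) ring_scheme \<Rightarrow> nat \<Rightarrow> ('k, 'a) fi_mod \<Rightarrow> ereal" where
  "FI_t R i V = (if i = 0 then FI_deg (FI_H0 V) else FI_deg (FI_homology R i V))"

definition FI_h :: "('k, 'r) ring_scheme \<Rightarrow> nat \<Rightarrow> ('k, 'a) fi_mod \<Rightarrow> ereal" where
  "FI_h R j V = FI_deg (local_cohomology R j V)"

definition presented_in_finite_degrees :: "('k, 'r) ring_scheme \<Rightarrow> ('k, 'a) fi_mod \<Rightarrow> bool" where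
  "presented_in_finite_degrees R V \<longleftrightarrow> FI_t R 0 V < \<infinity> \<and> FI_t R 1 V < \<infinity>"

definition H0_acyclic :: "('k, 'r) ring_scheme \<Rightarrow> ('k, 'a) fi_mod \<Rightarrow> bool" where
  "H0_acyclic R V \<longleftrightarrow> (\<forall>i\<ge>1. FI_zero (FI_homology R i V))"

text \<open>
  The supremum is a maximum unless it is \<open>\<infinity>\<close>, since all terms lie in \<open>\<int> \<union> {\<infinity>}\<close>.
\<close>

definition FI_reg :: "('k, 'r) ring_scheme \<Rightarrow> ('k, 'a) fi_mod \<Rightarrow> ereal" where
  "FI_reg R V = (SUP i\<in>{1..}. FI_t R i V - ereal (real i))"

definition FI_crit :: "('k, 'r) ring_scheme \<Rightarrow> ('k, 'a) fi_mod \<Rightarrow> nat" where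
  "FI_crit R V = (LEAST j. FI_h R j V \<ge> 0 \<and> FI_h R j V + ereal (real j) = FI_reg R V)"

end

theory Submission
	imports Defs "HOL-Algebra.Free_Abelian_Groups" "HOL-Library.Function_Algebras" "HOL-Combinatorics.Permutations"
begin

text \<open>
 FI-homology is Koszul homology: an FI-module with natural retractions of all \<open>V(S - p) \<rightarrow> V(S)\<close> is Koszul-acyclic,
 in particular projectives and torsion-free injectives are. Presentation in finite degrees bounds the Koszul homology
 linearly, and a torsion element of top degree \<open>h\<close> forces \<open>H\<^sub>i \<noteq> 0\<close> in degree \<open>h + i\<close> for \<open>i \<ge> h\<close>. So \<open>V\<close> embeds into
 an injective \<open>X = T(X) \<oplus> C\<close> with \<open>T(X)\<close> torsion of bounded degree and \<open>C\<close> torsion-free, and the cokernel is of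
 the same kind. Writing \<open>Z\<^sub>j\<close> for the iterated cokernels and \<open>U\<^sub>j\<close> for the image of \<open>T(X\<^sub>j\<^sub>-\<^sub>1)\<close> in \<open>Z\<^sub>j\<close>, local
 cohomology is \<open>T(Z\<^sub>j) / U\<^sub>j\<close>, and \<open>H\<^sub>i(Z\<^sub>j / T(Z\<^sub>j)) = H\<^sub>i\<^sub>+\<^sub>1(Z\<^sub>j\<^sub>+\<^sub>1 / U\<^sub>j\<^sub>+\<^sub>1)\<close> for \<open>i > 0\<close>. Climbing this tower gives
 \<open>t\<^sub>i - i \<le> max (h\<^sup>j + j)\<close>; descending it from the non-vanishing result at a stage \<open>j\<close> where the maximum is attained
 gives equality as soon as \<open>i \<ge> max 1 (h\<^sup>j - j)\<close>.
\<close>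

text \<open>Homology groups and long exact sequences are never formed. The proof manipulates a
  single predicate, the vanishing of H_i(B/A) at one finite set S for submodules A <= B, and the
  exact sequence of N <= B <= C enters as implications between such predicates. Along the tower the
  set S stays fixed and the level j moves together with the index i, so a nonzero class at level j
  is carried down to V at the same S. The bound i >= h - j reflects the room needed by the signed
  sum over involutions: a torsion element over a set C of size h needs h partners among the i + j
  points of S outside C. The element occurs in that sum with coefficient 1 and nothing is divided,
  which makes the argument uniform in the ring. A second obstacle is size. Projectivity and
  injectivity are tested against one type only, so all terms of a resolution are coded into
  \<open>univ\<close>, and quotients are made of representatives instead of cosets. The resolutions
  picked by \<open>SOME\<close> are harmless: any projective one computes Koszul homology, and any
  two injective ones are homotopy equivalent.\<close>

abbreviation (input) iff_ascii :: "bool => bool => bool" (infixr "<->" 25) where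
 "A <-> B == A = B"

section \<open>Alternating functions on lists\<close>

abbreviation swp :: "nat=>nat=>nat=>nat" where
 "swp a b \<equiv> Transposition.transpose a b"

definition dlists :: "nat set=>nat=>nat list set" where
 "dlists S i = {L. distinct L&set L<=S&length L = i}"

text \<open>Orientation signs without chosen orderings: \<open>swp a b\<close> acts on the entries,
  which for a distinct list exchanges two positions. The value 0 outside \<open>dlists S i\<close>
  makes chains on different sets comparable as plain functions. Lists with repetitions are excluded
  rather than cancelled, so no condition on 2-torsion arises.\<close>

definition alternating :: "nat set=>nat=>(nat list=>'g::ab_group_add)=>bool" where
 "alternating S i z<->(ALL L. L~:dlists S i-->z L = 0) \<and>
	 (ALL L a b. a:set L-->b:set L-->a~=b-->z (map (swp a b) L) = - z L)"

lemma alternatingD0: "alternating S i z==>L~:dlists S i==>z L = 0"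
 by (auto simp: alternating_def)

lemma alternatingD: "alternating S i z==>a:set L==>b:set L==>a~=b==>z (map (swp a b) L) = - z L"
 by (auto simp: alternating_def)

lemma set_map_swp: "a:set L==>b:set L==>set (map (swp a b) L) = set L"
 by (auto simp: Transposition.transpose_def image_iff)

lemma distinct_map_swp [simp]: "distinct (map (swp a b) L) = distinct L"
 by (auto simp: distinct_map inj_on_def Transposition.transpose_def split: if_splits)

lemma dlists_map_swp: "a:set L==>b:set L==>map (swp a b) L:dlists S i<->L:dlists S i"
 unfolding dlists_def using set_map_swp[of a L b] by auto

lemma map_swp_id: "a~:set L==>b~:set L==>map (swp a b) L = L"
 by (rule map_idI) (auto simp: Transposition.transpose_def)

lemma alternating_permute:
 assumes "alternating S i z" "distinct L" "p permutes set L"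
 shows "z (map p L) = (if evenperm p then z L else - z L)"
 using assms(3) finite_set
proof (induction p rule: permutes_induct)
 case id
 then show ?case by simp
next
 case (swap a b p)
 have s: "set (map p L) = set L" using swap.hyps by (simp add: permutes_image)
 have "z (map (swp a b\<circ>p) L) = z (map (swp a b) (map p L))" by simp
 also have "... = - z (map p L)"
	using alternatingD[OF assms(1), of a "map p L" b] swap.hyps s by metis
 finally have fin: "z (map (swp a b\<circ>p) L) = - z (map p L)" .
 have pp: "permutation p" using swap.hyps permutation_permutes by blast
 have ev: "evenperm (swp a b\<circ>p)<->\<not> evenperm p"
	unfolding evenperm_comp[OF permutation_swap_id pp] evenperm_swap using swap.hyps by blast
 show ?case unfolding fin ev using swap.IH by (cases "evenperm p") simp_all
qed

lemma permutes_between_lists: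
 assumes "distinct L" "distinct M" "set L = set M"
 shows "EX p. p permutes set L&map p M = L"
proof -
 have len: "length L = length M" using assms by (metis distinct_card)
 define p where "p x = (case map_of (zip M L) x of Some y=>y | None=>x)" for x
 have m: "map p M = L"
	by (rule nth_equalityI) (auto simp: len p_def map_of_zip_nth[OF len[symmetric] assms(2)])
 have "p ` set L = set L" using m assms(3) by (metis set_map)
 then have "bij_betw p (set L) (set L)"
	by (simp add: bij_betw_def eq_card_imp_inj_on)
 moreover have "p x = x" if "x~:set L" for x
	using that assms(3) len by (auto simp: p_def split: option.split dest: map_of_SomeD set_zip_leftD)
 ultimately show ?thesis using m bij_imp_permutes by blast
qed

text \<open>One ordering for each finite set. It is kept abstract because splitting off a point uses
  an ordering other than the sorted one.\<close>

definition enumeration :: "(nat set=>nat list)=>bool" where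
 "enumeration E<->(ALL B. finite B-->distinct (E B)&set (E B) = B)"

lemma enumeration_sorted: "enumeration sorted_list_of_set"
 by (simp add: enumeration_def)

lemma alternating_value:
 assumes "alternating S i z" "enumeration E" "distinct L"
 shows "z L = z (E (set L))\<or>z L = - z (E (set L))"
proof -
 have E: "distinct (E (set L))" "set (E (set L)) = set L"
	using assms(2) by (auto simp: enumeration_def)
 obtain p where p: "p permutes set L" "map p (E (set L)) = L"
	using permutes_between_lists[of L "E (set L)"] assms(3) E by auto
 show ?thesis using alternating_permute[OF assms(1) E(1), of p] p E by auto
qed

lemma alternating_eqI:
 assumes "alternating S i z" "alternating S i w" "enumeration E"
	"!!B. B<=S==>finite B==>card B = i==>z (E B) = w (E B)"
 shows "z = w"
proof
 fix L
 show "z L = w L"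
 proof (cases "L:dlists S i")
	case True
	then have L: "distinct L" "set L<=S" "length L = i" by (auto simp: dlists_def)
	have E: "distinct (E (set L))" "set (E (set L)) = set L"
	 using assms(3) by (auto simp: enumeration_def)
	obtain p where p: "p permutes set L" "map p (E (set L)) = L"
	 using permutes_between_lists[of L "E (set L)"] L E by auto
	have "z (E (set L)) = w (E (set L))" using assms(4)[of "set L"] L distinct_card by fastforce
	then show ?thesis
	 using alternating_permute[OF assms(1) E(1), of p] alternating_permute[OF assms(2) E(1), of p] p E by auto
 qed (use assms alternatingD0 in metis)
qed

text \<open>The permutation that carries the chosen ordering to \<open>L\<close> and fixes
  everything outside \<open>set L\<close> is unique, so its sign depends on \<open>L\<close> alone
  and can be used to spread the prescribed values.\<close>

lemma alternating_extension:
 assumes "enumeration E" "finite S"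
 shows "EX z. alternating S i z&(ALL B. B<=S-->card B = i-->z (E B) = v B)"
proof -
 define P where "P L p<->p permutes set L&map p (E (set L)) = L" for L p
 have E: "distinct (E (set L))" "set (E (set L)) = set L" for L
	using assms(1) by (auto simp: enumeration_def)
 have ex: "EX p. P L p" if "distinct L" for L
	unfolding P_def using permutes_between_lists[OF that E(1)] E(2) by auto
 have uniq: "p = q" if "P L p" "P L q" for L p q
 proof
	fix x show "p x = q x"
	proof (cases "x:set L")
	 case True
	 then have "x:set (E (set L))" using E by simp
	 moreover have "map p (E (set L)) = map q (E (set L))" using that by (simp add: P_def)
	 ultimately show ?thesis by simp
	next
	 case False then show ?thesis using that permutes_not_in[of p "set L" x] permutes_not_in[of q "set L" x] by (simp add: P_def)
	qed
 qed
 define pm where "pm L = (SOME p. P L p)" for L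
 have pm: "P L (pm L)" if "distinct L" for L
	unfolding pm_def using ex[OF that] by (rule someI_ex)
 define z where "z L = (if L:dlists S i then (if evenperm (pm L) then v (set L) else - v (set L)) else 0)" for L
 have "z (map (swp a b) L) = - z L" if ab: "a:set L" "b:set L" "a~=b" for L a b
 proof (cases "L:dlists S i")
	case True
	then have d: "distinct L" by (simp add: dlists_def)
	have s: "set (map (swp a b) L) = set L" by (rule set_map_swp) fact+
	have PL: "P L (pm L)" using pm[OF d] .
	have "P (map (swp a b) L) (swp a b\<circ>pm L)"
	 unfolding P_def s
	proof
	 show "swp a b\<circ>pm L permutes set L"
		using permutes_compose[OF _ permutes_swap_id[OF ab(1,2)]] PL unfolding P_def by auto
	 have "map (pm L) (E (set L)) = L" using PL by (simp add: P_def)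
	 then show "map (swp a b\<circ>pm L) (E (set L)) = map (swp a b) L"
		by (metis map_map)
	qed
	\<comment> \<open>Uniqueness identifies the permutation chosen for the swapped list with this
	  composite, which has the opposite sign.\<close>
	then have "pm (map (swp a b) L) = swp a b\<circ>pm L"
	 using uniq pm[of "map (swp a b) L"] d by simp
	moreover have "evenperm (swp a b\<circ>pm L)<->\<not> evenperm (pm L)"
	proof -
	 have pp: "permutation (pm L)" using PL permutation_permutes unfolding P_def by blast
	 show ?thesis unfolding evenperm_comp[OF permutation_swap_id pp] evenperm_swap using ab by blast
	qed
	ultimately show ?thesis
	 using True dlists_map_swp[of a L b S i] ab s unfolding z_def by auto
 next
	case False
	then show ?thesis using dlists_map_swp[of a L b S i] ab unfolding z_def by simp
 qed
 moreover have "z (E B) = v B" if B: "B<=S" "card B = i" for B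
 proof -
	have fB: "finite B" using B assms(2) finite_subset by blast
	then have EB: "distinct (E B)" "set (E B) = B" using assms(1) by (auto simp: enumeration_def)
	have "P (E B) id" unfolding P_def using EB by (simp add: permutes_id)
	then have "pm (E B) = id" using uniq pm EB by blast
	then show ?thesis using EB B unfolding z_def dlists_def by (auto simp: distinct_card[symmetric])
 qed
 ultimately show ?thesis unfolding alternating_def z_def by (intro exI[of _ z]) (auto simp: z_def)
qed

lemma alternating_diff: "alternating S i z==>alternating S i w==>alternating S i (z - w)"
 by (simp add: alternating_def)

lemma alternating_zero: "alternating S i 0"
 by (simp add: alternating_def)

lemma alternating_head:
 assumes "alternating S i z" "L:dlists S i" "p:set L"
 obtains M where "distinct (p # M)" "set (p # M) = set L" "z L = z (p # M)\<or>z L = - z (p # M)"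
proof (cases L)
 case Nil then show ?thesis using assms by simp
next
 case (Cons h t)
 show ?thesis
 proof (cases "h = p")
	case True then show ?thesis using that[of t] Cons assms(2) by (auto simp: dlists_def)
 next
	case False
	have eq: "map (swp h p) L = p # map (swp h p) t" using Cons by simp
	have "z (map (swp h p) L) = - z L"
	 by (rule alternatingD[OF assms(1)]) (use Cons assms False in auto)
	then have "z L = - z (p # map (swp h p) t)" using eq by (metis minus_minus)
	moreover have "set (map (swp h p) L) = set L" by (rule set_map_swp) (use Cons assms in auto)
	moreover have "distinct (map (swp h p) L)" using assms(2) by (simp add: dlists_def)
	ultimately show ?thesis using that[of "map (swp h p) t"] eq by simp
 qed
qed

text \<open>Induction removes one row and the matching column, which cancel. Showing only that twice
  the sum vanishes would not suffice in the presence of 2-torsion.\<close>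

lemma sum_antisymmetric:
 fixes f :: "'i=>'i=>'g::ab_group_add"
 assumes "finite A" "!!x y. x:A==>y:A==>x~=y==>f x y = - f y x"
 shows "(\<Sum>x\<in>A. \<Sum>y\<in>A - {x}. f x y) = 0"
 using assms
proof (induction A rule: finite_induct)
 case empty then show ?case by simp
next
 case (insert a A)
 have "(\<Sum>x\<in>A. \<Sum>y\<in>insert a A - {x}. f x y) = (\<Sum>x\<in>A. f x a + (\<Sum>y\<in>A - {x}. f x y))"
 proof (rule sum.cong[OF refl])
	fix x assume x: "x:A"
	have "insert a A - {x} = insert a (A - {x})" using insert.hyps x by auto
	then show "(\<Sum>y\<in>insert a A - {x}. f x y) = f x a + (\<Sum>y\<in>A - {x}. f x y)"
	 using insert.hyps by simp
 qed
 also have "... = (\<Sum>x\<in>A. f x a) + (\<Sum>x\<in>A. \<Sum>y\<in>A - {x}. f x y)" by (simp add: sum.distrib)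
 also have "(\<Sum>x\<in>A. \<Sum>y\<in>A - {x}. f x y) = 0" by (rule insert.IH, rule insert.prems) auto
 also have "(\<Sum>x\<in>A. f x a) + 0 = (\<Sum>x\<in>A. f x a)" by simp
 also have "... = - (\<Sum>x\<in>A. f a x)"
	unfolding sum_negf[symmetric] by (rule sum.cong[OF refl], rule insert.prems) (use insert.hyps in auto)
 finally have "(\<Sum>x\<in>A. \<Sum>y\<in>insert a A - {x}. f x y) = - (\<Sum>x\<in>A. f a x)" .
 moreover have "insert a A - {a} = A" using insert.hyps by auto
 ultimately show ?case using insert.hyps by simp
qed

section \<open>Functors from injections to abelian groups and their Koszul complexes\<close>

definition emb :: "(nat=>nat)=>nat set=>nat set=>bool" where
 "emb f S T<->inj_on f S&f ` S<=T"

lemma emb_id: "S<=T==>emb id S T"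
 by (auto simp: emb_def)

lemma emb_comp: "emb f S T==>emb g T U==>emb (g\<circ>f) S U"
 unfolding emb_def by (auto intro: comp_inj_on inj_on_subset)

text \<open>Degree i of the Koszul complex at S: the sum over the i-subsets B of S of the groups V(S
  - B), twisted by the orientation of B.\<close>

definition kchains :: "(nat set=>'g::ab_group_add set)=>nat set=>nat=>(nat list=>'g) set" where
 "kchains G S i = {z. alternating S i z&(\<forall>L\<in>dlists S i. z L:G (S - set L))}"

lemma kchainsD: "z:kchains A S i==>L:dlists S i==>z L:A (S - set L)"
 by (simp add: kchains_def)

lemma kchains_alternating: "z:kchains A S i==>alternating S i z"
 by (simp add: kchains_def)

lemma kchains_mono: "z:kchains A S i==>(!!L. L:dlists S i==>A (S - set L)<=B (S - set L))==>z:kchains B S i"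
 by (auto simp: kchains_def)

lemma kchains_mono_finite: "finite S==>z:kchains A S i==>(!!T. finite T==>A T<=B T)==>z:kchains B S i"
 by (rule kchains_mono) auto

text \<open>Koszul homology sees only the additive structure, so scalars are dropped and all values
  lie in one type class group. The ground set is a parameter because splitting off a point p leads
  to functors on subsets of \<open>Om - {p}\<close>. Injections are total functions here, hence the
  axiom \<open>m_cong\<close>.\<close>

locale fi_group =
 fixes Om :: "nat set" and G :: "nat set=>'g::ab_group_add set"
	and m :: "nat set=>nat set=>(nat=>nat)=>'g=>'g"
 assumes infinite_Om: "infinite Om"
	and G_zero: "finite S==>S<=Om==>0:G S"
	and G_diff: "finite S==>S<=Om==>x:G S==>y:G S==>x - y:G S"
	and m_in: "finite S==>S<=Om==>finite T==>T<=Om==>emb f S T==>x:G S==>m S T f x:G T"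
	and m_diff: "finite S==>S<=Om==>finite T==>T<=Om==>emb f S T==>x:G S==>y:G S ==>
	 m S T f (x - y) = m S T f x - m S T f y"
	and m_id: "finite S==>S<=Om==>x:G S==>m S S id x = x"
	and m_comp: "finite S==>S<=Om==>finite T==>T<=Om==>finite U==>U<=Om ==>
	 emb f S T==>emb g T U==>x:G S==>m T U g (m S T f x) = m S U (g\<circ>f) x"
	and m_cong: "finite S==>S<=Om==>finite T==>T<=Om==>emb f S T==>x:G S ==>
	 (!!s. s:S==>f s = g s)==>m S T f x = m S T g x"
begin

definition fi_sub :: "(nat set=>'g set)=>bool" where
 "fi_sub A<->(ALL S. finite S-->S<=Om-->A S<=G S&0:A S&(\<forall>x\<in>A S. \<forall>y\<in>A S. x - y:A S)) \<and>
	 (ALL S T f x. finite S-->S<=Om-->finite T-->T<=Om-->emb f S T-->x:A S-->m S T f x:A T)"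

text \<open>Prepending the new point, instead of inserting it at a position, leaves all signs to the
  alternation of \<open>z\<close>.\<close>

definition bd :: "nat set=>(nat list=>'g)=>nat list=>'g" where
 "bd S z L = (if distinct L&set L<=S
	 then \<Sum>x\<in>S - set L. m (S - insert x (set L)) (S - set L) id (z (x # L)) else 0)"

text \<open>Vanishing of the \<open>i\<close>-th Koszul homology of \<open>B / A\<close> at \<open>S\<close>.\<close>

definition hvan :: "(nat set=>'g set)=>(nat set=>'g set)=>nat set=>nat=>bool" where
 "hvan A B S i<->(\<forall>z\<in>kchains B S i. bd S z:kchains A S (i - 1) -->
	 (\<exists>w\<in>kchains B S (Suc i). z - bd S w:kchains A S i))"

lemma fi_sub_G: "fi_sub G"
 unfolding fi_sub_def using G_zero G_diff m_in by blast

lemma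
 assumes "fi_sub A" "finite S" "S<=Om"
 shows fi_subD: "x:A S==>x:G S"
	and fi_sub_zero: "0:A S"
	and fi_sub_diff: "x:A S==>y:A S==>x - y:A S"
	and fi_sub_uminus: "x:A S==>- x:A S"
	and fi_sub_add: "x:A S==>y:A S==>x + y:A S"
proof -
 have *: "0:A S" "!!x y. x:A S==>y:A S==>x - y:A S" "A S<=G S"
	using assms unfolding fi_sub_def by blast+
 have n: "- x:A S" if "x:A S" for x using *(2)[OF *(1) that] by simp
 show "x:A S==>x:G S" "0:A S" "x:A S==>y:A S==>x - y:A S" using * by auto
 show "x:A S==>- x:A S" by (rule n)
 show "x:A S==>y:A S==>x + y:A S" using *(2)[of x "- y"] n[of y] by simp
qed

lemma fi_sub_m: "fi_sub A==>finite S==>S<=Om==>finite T==>T<=Om==>emb f S T==>x:A S==>m S T f x:A T"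
 by (simp add: fi_sub_def)

lemma fi_sub_sum: "fi_sub A==>finite S==>S<=Om==>(!!i. i:I==>f i:A S)==>sum f I:A S"
 by (induction I rule: infinite_finite_induct) (auto simp: fi_sub_zero fi_sub_add)

lemma m_zero: "finite S==>S<=Om==>finite T==>T<=Om==>emb f S T==>m S T f 0 = 0"
 using m_diff[of S T f 0 0] G_zero[of S] by simp

lemma m_uminus: "finite S==>S<=Om==>finite T==>T<=Om==>emb f S T==>x:G S==>m S T f (- x) = - m S T f x"
 using m_diff[of S T f 0 x] G_zero[of S] m_zero[of S T f] by simp

lemma m_add: "finite S==>S<=Om==>finite T==>T<=Om==>emb f S T==>x:G S==>y:G S ==>
	m S T f (x + y) = m S T f x + m S T f y"
 using m_diff[of S T f x "- y"] m_uminus[of S T f y] fi_sub_uminus[OF fi_sub_G, of S y] by simp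

lemma m_sum: "finite S==>S<=Om==>finite T==>T<=Om==>emb f S T==>(!!i. i:I==>x i:G S) ==>
	m S T f (sum x I) = (\<Sum>i\<in>I. m S T f (x i))"
proof (induction I rule: infinite_finite_induct)
 case (insert a I)
 then show ?case using m_add[of S T f "x a" "sum x I"] fi_sub_sum[OF fi_sub_G, of S I x] by simp
qed (auto simp: m_zero)

lemma m_incl_comp: "finite U==>U<=Om==>S<=T==>T<=U==>x:G S==>m T U id (m S T id x) = m S U id x"
 using m_comp[of S T U id id x] finite_subset[of S T] finite_subset[of T U] by (simp add: emb_id)

lemma kchains_in: "fi_sub A==>finite S==>S<=Om==>z:kchains A S i==>z L:A (S - set L)"
 using kchainsD[of z A S i L] alternatingD0[of S i z L] fi_sub_zero[of A "S - set L"]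
 by (cases "L:dlists S i") (auto simp: kchains_def)

lemma kchains_sub: "fi_sub A==>finite S==>S<=Om==>z:kchains A S i==>z:kchains G S i"
 by (erule kchains_mono) (auto dest: fi_subD)

lemma kchains_diff: "fi_sub A==>finite S==>S<=Om==>z:kchains A S i==>w:kchains A S i==>z - w:kchains A S i"
 unfolding kchains_def by (auto intro!: alternating_diff fi_sub_diff)

lemma kchains_zero: "fi_sub A==>finite S==>S<=Om==>0:kchains A S i"
 unfolding kchains_def by (auto intro!: alternating_zero fi_sub_zero)

lemma kchains_uminus: "fi_sub A==>finite S==>S<=Om==>z:kchains A S i==>- z:kchains A S i"
 using kchains_diff[of A S 0 i z] kchains_zero by simp

lemma kchains_add: "fi_sub A==>finite S==>S<=Om==>z:kchains A S i==>w:kchains A S i==>z + w:kchains A S i"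
 using kchains_diff[of A S z i "- w"] kchains_uminus by simp

lemma kchainsI:
 assumes "fi_sub A" "finite S" "S<=Om" "alternating S i z" "enumeration E"
	"!!B. B<=S==>card B = i==>z (E B):A (S - B)"
 shows "z:kchains A S i"
proof -
 have "z L:A (S - set L)" if L: "L:dlists S i" for L
 proof -
	have d: "distinct L" "set L<=S" "card (set L) = i" using L distinct_card by (auto simp: dlists_def)
	have "z (E (set L)):A (S - set L)" using assms(6) d by blast
	moreover have "S - set L<=Om" using assms by blast
	ultimately show ?thesis
	 using alternating_value[OF assms(4,5) d(1)] fi_sub_uminus[OF assms(1), of "S - set L"] assms(2) by auto
 qed
 then show ?thesis using assms(4) by (simp add: kchains_def)
qed

section \<open>The boundary map of the Koszul complex\<close>

lemma dlists_Cons: "x # L:dlists S (Suc i)<->x:S - set L&L:dlists S i"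
 by (auto simp: dlists_def)

lemma bd_term:
 assumes "fi_sub A" "finite S" "S<=Om" "z:kchains A S i" "x:S - set L"
 shows "z (x # L):A (S - insert x (set L))"
	"m (S - insert x (set L)) (S - set L) id (z (x # L)):A (S - set L)"
proof -
 show 1: "z (x # L):A (S - insert x (set L))"
	using kchains_in[OF assms(1-4), of "x # L"] by simp
 show "m (S - insert x (set L)) (S - set L) id (z (x # L)):A (S - set L)"
	by (rule fi_sub_m[OF assms(1)]) (use assms 1 in \<open>auto simp: emb_def\<close>)
qed

lemma bd_in: "fi_sub A==>finite S==>S<=Om==>z:kchains A S i==>bd S z L:A (S - set L)"
 unfolding bd_def using bd_term[of A S z i _ L] fi_sub_sum[of A "S - set L"] fi_sub_zero[of A "S - set L"]
 by (auto intro!: fi_sub_sum)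

lemma bd_chains:
 assumes "fi_sub A" "finite S" "S<=Om" "z:kchains A S (Suc i)"
 shows "bd S z:kchains A S i"
proof -
 have z: "alternating S (Suc i) z" using assms by (simp add: kchains_def)
 have "alternating S i (bd S z)"
	unfolding alternating_def
 proof (intro conjI allI impI)
	fix L assume "L~:dlists S i"
	then have "x # L~:dlists S (Suc i)" for x by (simp add: dlists_Cons)
	then have "z (x # L) = 0" for x using z alternatingD0 by blast
	then show "bd S z L = 0" unfolding bd_def using assms
	 by (auto intro!: sum.neutral m_zero simp: emb_def)
 next
	fix L a b assume ab: "a:set L" "b:set L" "(a::nat)~=b"
	have s: "set (map (swp a b) L) = set L" by (rule set_map_swp) fact+
	show "bd S z (map (swp a b) L) = - bd S z L"
	proof (cases "distinct L&set L<=S")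
	 case True
	 have "bd S z (map (swp a b) L) = (\<Sum>x\<in>S - set L. m (S - insert x (set L)) (S - set L) id (z (x # map (swp a b) L)))"
		using True unfolding bd_def s by simp
	 also have "... = (\<Sum>x\<in>S - set L. - m (S - insert x (set L)) (S - set L) id (z (x # L)))"
	 proof (rule sum.cong[OF refl])
		fix x assume x: "x:S - set L"
		have "x # map (swp a b) L = map (swp a b) (x # L)" using x ab by (auto simp: Transposition.transpose_def)
		then have "z (x # map (swp a b) L) = - z (x # L)"
		 using alternatingD[OF z, of a "x # L" b] ab by simp
		moreover have "z (x # L):G (S - insert x (set L))"
		 using bd_term(1)[OF fi_sub_G assms(2,3) kchains_sub[OF assms] x] .
		ultimately show "m (S - insert x (set L)) (S - set L) id (z (x # map (swp a b) L)) =
			- m (S - insert x (set L)) (S - set L) id (z (x # L))"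
		 using assms(2,3) x by (auto intro!: m_uminus simp: emb_def)
	 qed
	 also have "... = - bd S z L" using True unfolding bd_def by (simp add: sum_negf)
	 finally show ?thesis .
	next
	 case False then show ?thesis unfolding bd_def using s by auto
	qed
 qed
 then show ?thesis using bd_in[OF assms] by (simp add: kchains_def)
qed

text \<open>In \<open>hvan\<close> with i = 0 the index \<open>i - 1\<close> is again 0; the cycle
  condition is then vacuous, as it should be, because the boundary is 0.\<close>

lemma bd_zero_chain: "finite S==>S<=Om==>z:kchains G S 0==>bd S z = 0"
proof (rule ext)
 fix L assume S: "finite S" "S<=Om" and z: "z:kchains G S 0"
 have "z (x # L) = 0" for x using alternatingD0[OF kchains_alternating[OF z], of "x # L"] by (simp add: dlists_def)
 then show "bd S z L = 0 L" unfolding bd_def using S by (auto intro!: sum.neutral m_zero simp: emb_def)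
qed

lemma bd_diff:
 assumes "finite S" "S<=Om" "z:kchains G S i" "w:kchains G S i"
 shows "bd S (z - w) = bd S z - bd S w"
proof (rule ext)
 fix L
 have "m (S - insert x (set L)) (S - set L) id (z (x # L) - w (x # L)) =
	 m (S - insert x (set L)) (S - set L) id (z (x # L)) - m (S - insert x (set L)) (S - set L) id (w (x # L))"
	if "x:S - set L" for x
	using assms(1,2) that bd_term(1)[OF fi_sub_G assms(1-3) that] bd_term(1)[OF fi_sub_G assms(1,2,4) that]
	by (intro m_diff) (auto simp: emb_def)
 then show "bd S (z - w) L = (bd S z - bd S w) L"
	unfolding bd_def by (simp add: sum_subtractf)
qed

lemma bd_zero: "finite S==>S<=Om==>bd S 0 = 0"
 using bd_diff[of S 0 0 0] kchains_zero[OF fi_sub_G, of S 0] by simp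

lemma bd_uminus: "finite S==>S<=Om==>z:kchains G S i==>bd S (- z) = - bd S z"
 using bd_diff[of S 0 i z] kchains_zero[OF fi_sub_G, of S i] bd_zero[of S] by simp

lemma bd_add: "finite S==>S<=Om==>z:kchains G S i==>w:kchains G S i==>bd S (z + w) = bd S z + bd S w"
 using bd_diff[of S z i "- w"] kchains_uminus[OF fi_sub_G, of S w i] bd_uminus[of S w i] by simp

text \<open>The double sum runs over ordered pairs of distinct points. Exchanging the two points
  flips the sign of \<open>z\<close> and leaves the structure map unchanged.\<close>

lemma bd_bd:
 assumes "finite S" "S<=Om" "z:kchains G S i"
 shows "bd S (bd S z) = 0"
proof (rule ext)
 fix L
 show "bd S (bd S z) L = 0 L"
 proof (cases "distinct L&set L<=S")
	case True
	define A where "A = S - set L"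
	define f where "f x y = m (A - {x,y}) A id (z (y # x # L))" for x y
	have sub: "S - insert x (set L) = A - {x}" for x by (auto simp: A_def)
	have sub2: "S - insert y (set (x # L)) = A - {x, y}" for x y by (auto simp: A_def)
	have AO: "finite A" "A<=Om" using assms by (auto simp: A_def)
	have zin: "z (y # x # L):G (A - {x,y})" if "x:A" "y:A - {x}" for x y
	 using kchains_in[OF fi_sub_G assms, of "y # x # L"] sub2[of y x] by simp
	have "bd S (bd S z) L = (\<Sum>x\<in>A. m (A - {x}) A id (bd S z (x # L)))"
	 using True unfolding bd_def[of S "bd S z" L] sub A_def[symmetric] by simp
	also have "... = (\<Sum>x\<in>A. \<Sum>y\<in>A - {x}. f x y)"
	proof (rule sum.cong[OF refl])
	 fix x assume x: "x:A"
	 have "distinct (x # L)&set (x # L)<=S" using True x by (auto simp: A_def)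
	 then have "bd S z (x # L) = (\<Sum>y\<in>S - set (x # L). m (S - insert y (set (x # L))) (S - set (x # L)) id (z (y # x # L)))"
		unfolding bd_def by argo
	 then have "bd S z (x # L) = (\<Sum>y\<in>A - {x}. m (A - {x,y}) (A - {x}) id (z (y # x # L)))"
		unfolding sub2 unfolding list.set sub .
	 then have "m (A - {x}) A id (bd S z (x # L)) = (\<Sum>y\<in>A - {x}. m (A - {x}) A id (m (A - {x,y}) (A - {x}) id (z (y # x # L))))"
		using AO zin x by (simp, intro m_sum) (auto simp: emb_def intro!: m_in)
	 also have "... = (\<Sum>y\<in>A - {x}. f x y)"
		unfolding f_def using AO zin x by (intro sum.cong[OF refl] m_incl_comp) auto
	 finally show "m (A - {x}) A id (bd S z (x # L)) = (\<Sum>y\<in>A - {x}. f x y)" .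
	qed
	also have "... = 0"
	proof (rule sum_antisymmetric)
	 fix x y assume xy: "x:A" "y:A" "x~=y"
	 have "map (swp x y) (x # y # L) = y # x # L"
		using xy map_swp_id[of x L y] by (auto simp: A_def)
	 then have "z (y # x # L) = - z (x # y # L)"
		using alternatingD[OF kchains_alternating[OF assms(3)], of x "x # y # L" y] xy by simp
	 then show "f x y = - f y x"
		unfolding f_def using AO zin[of y x] xy by (simp add: insert_commute, intro m_uminus) (auto simp: emb_def insert_commute)
	qed (use AO in auto)
	finally show ?thesis by simp
 next
	case False
	then show ?thesis unfolding bd_def[of S "bd S z" L] by (simp only: if_False zero_fun_apply)
 qed
qed

section \<open>Vanishing for reasons of size, and the long exact sequence of a triple\<close>

lemma hvan_beyond_card:
 assumes "fi_sub A" "finite S" "S<=Om" "card S < i"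
 shows "hvan A B S i"
proof -
 have e: "dlists S j = {}" if "card S < j" for j
 proof -
	have "L~:dlists S j" for L
	 using card_mono[OF assms(2), of "set L"] distinct_card[of L] that by (auto simp: dlists_def)
	then show ?thesis by auto
 qed
 have "z = 0" if "z:kchains B S i" for z
 proof
	fix L show "z L = 0 L" using that e[OF assms(4)] alternatingD0[OF kchains_alternating[OF that], of L] by simp
 qed
 moreover have "(0::nat list=>'g):kchains B S (Suc i)"
	using e[of "Suc i"] assms(4) alternating_zero by (simp add: kchains_def)
 ultimately show ?thesis unfolding hvan_def using bd_zero[OF assms(2,3)] kchains_zero[OF assms(1-3)]
	by (intro ballI impI bexI[of _ 0]) auto
qed

text \<open>Chains of degree i take values only at sets with i points fewer than S.\<close>

lemma hvan_zero:
 assumes "fi_sub A" "fi_sub B" "finite S" "S<=Om"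
	"!!T. T<=S==>card T + i = card S==>B T<=A T"
 shows "hvan A B S i"
 unfolding hvan_def
proof (intro ballI impI)
 fix z assume z: "z:kchains B S i"
 have "z:kchains A S i"
 proof (rule kchains_mono[OF z])
	fix L assume "L:dlists S i"
	then have "card (S - set L) + i = card S" using assms(3)
	 by (auto simp: dlists_def card_Diff_subset distinct_card[symmetric] card_mono)
	then show "B (S - set L)<=A (S - set L)" using assms(5) by auto
 qed
 then show "\<exists>w\<in>kchains B S (Suc i). z - bd S w:kchains A S i"
	using kchains_zero[OF assms(2-4), of "Suc i"] bd_zero[OF assms(3,4)] by (intro bexI[of _ 0]) auto
qed

text \<open>Exactness of H_i(B/N) -> H_i(C/N) -> H_i(C/B) in the middle. This and the next three
  lemmas are all that is used of the long exact sequence.\<close>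

lemma hvan_middle:
 assumes sub: "fi_sub N" "fi_sub B" "fi_sub C" "!!S. finite S==>N S<=B S" "!!S. finite S==>B S<=C S"
	and S: "finite S" "S<=Om" and "hvan N B S i" "hvan B C S i"
 shows "hvan N C S i"
 unfolding hvan_def
proof (intro ballI impI)
 fix z assume z: "z:kchains C S i" and dz: "bd S z:kchains N S (i - 1)"
 have "bd S z:kchains B S (i - 1)" by (rule kchains_mono_finite[OF S(1) dz sub(4)])
 then obtain w where w: "w:kchains C S (Suc i)" "z - bd S w:kchains B S i"
	using assms(9) z unfolding hvan_def by blast
 have "bd S (z - bd S w) = bd S z"
	using bd_diff[OF S kchains_sub[OF sub(3) S z] bd_chains[OF fi_sub_G S kchains_sub[OF sub(3) S w(1)]]]
	 bd_bd[OF S kchains_sub[OF sub(3) S w(1)]] by simp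
 then obtain v where v: "v:kchains B S (Suc i)" "z - bd S w - bd S v:kchains N S i"
	using assms(8) w(2) dz unfolding hvan_def by force
 have v': "v:kchains C S (Suc i)" by (rule kchains_mono_finite[OF S(1) v(1) sub(5)])
 have "z - bd S (w + v) = z - bd S w - bd S v"
	using bd_add[OF S kchains_sub[OF sub(3) S w(1)] kchains_sub[OF sub(3) S v']] by simp
 then show "\<exists>w\<in>kchains C S (Suc i). z - bd S w:kchains N S i"
	using v kchains_add[OF sub(3) S w(1) v'] by metis
qed

text \<open>Exactness of H_{i+1}(C/N) -> H_{i+1}(C/B) -> H_i(B/N). The boundary of \<open>z\<close>
  represents the connecting class; filling it by \<open>w\<close> in B turns \<open>z - w\<close>
  into a cycle modulo N.\<close>

lemma hvan_quotient:
 assumes sub: "fi_sub N" "fi_sub B" "fi_sub C" "!!S. finite S==>N S<=B S" "!!S. finite S==>B S<=C S"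
	and S: "finite S" "S<=Om" and "hvan N C S (Suc i)" "hvan N B S i"
 shows "hvan B C S (Suc i)"
 unfolding hvan_def
proof (intro ballI impI)
 fix z assume z: "z:kchains C S (Suc i)" and dz: "bd S z:kchains B S (Suc i - 1)"
 note zG = kchains_sub[OF sub(3) S z]
 have "bd S (bd S z):kchains N S (i - 1)" using bd_bd[OF S zG] kchains_zero[OF sub(1) S] by simp
 then obtain w where w: "w:kchains B S (Suc i)" "bd S z - bd S w:kchains N S i"
	using assms(9) dz unfolding hvan_def by auto
 have w': "w:kchains C S (Suc i)" by (rule kchains_mono_finite[OF S(1) w(1) sub(5)])
 have "bd S (z - w):kchains N S (Suc i - 1)"
	using bd_diff[OF S zG kchains_sub[OF sub(3) S w']] w(2) by simp
 then obtain v where v: "v:kchains C S (Suc (Suc i))" "z - w - bd S v:kchains N S (Suc i)"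
	using assms(8) kchains_diff[OF sub(3) S z w'] unfolding hvan_def by blast
 have "z - w - bd S v + w:kchains B S (Suc i)"
	by (rule kchains_add[OF sub(2) S kchains_mono_finite[OF S(1) v(2) sub(4)] w(1)])
 then show "\<exists>w\<in>kchains C S (Suc (Suc i)). z - bd S w:kchains B S (Suc i)"
	using v(1) by (auto simp: algebra_simps)
qed

text \<open>Exactness of H_{i+1}(C/B) -> H_i(B/N) -> H_i(C/N). A filling in C of a cycle of B is
  itself a cycle modulo B, and subtracting a boundary moves it into B.\<close>

lemma hvan_kernel:
 assumes sub: "fi_sub N" "fi_sub B" "fi_sub C" "!!S. finite S==>N S<=B S" "!!S. finite S==>B S<=C S"
	and S: "finite S" "S<=Om" and "hvan B C S (Suc i)" "hvan N C S i"
 shows "hvan N B S i"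
 unfolding hvan_def
proof (intro ballI impI)
 fix z assume z: "z:kchains B S i" and dz: "bd S z:kchains N S (i - 1)"
 have z': "z:kchains C S i" by (rule kchains_mono_finite[OF S(1) z sub(5)])
 then obtain w where w: "w:kchains C S (Suc i)" "z - bd S w:kchains N S i"
	using assms(9) dz unfolding hvan_def by blast
 have "z - (z - bd S w):kchains B S i"
	by (rule kchains_diff[OF sub(2) S z kchains_mono_finite[OF S(1) w(2) sub(4)]])
 then have "bd S w:kchains B S (Suc i - 1)" by simp
 then obtain v where v: "v:kchains C S (Suc (Suc i))" "w - bd S v:kchains B S (Suc i)"
	using assms(8) w(1) unfolding hvan_def by blast
 note vG = kchains_sub[OF sub(3) S v(1)]
 have "bd S (w - bd S v) = bd S w"
	using bd_diff[OF S kchains_sub[OF sub(3) S w(1)] bd_chains[OF fi_sub_G S vG]] bd_bd[OF S vG] by simp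
 then show "\<exists>w\<in>kchains B S (Suc i). z - bd S w:kchains N S i"
	using v(2) w(2) by metis
qed

text \<open>If H_1(C/N) = 0, then H_1(C/B) is the kernel of H_0(B/N) -> H_0(C/N). The right-hand
  side is the injectivity of this map written with boundaries, the form that later matches
  decomposable elements.\<close>

lemma hvan_one_quotient_iff:
 assumes sub: "fi_sub N" "fi_sub B" "fi_sub C" "!!S. finite S==>N S<=B S" "!!S. finite S==>B S<=C S"
	and S: "finite S" "S<=Om" and "hvan N C S (Suc 0)"
 shows "hvan B C S (Suc 0)<->(\<forall>w\<in>kchains C S (Suc 0). bd S w:kchains B S 0 -->
	 (\<exists>v\<in>kchains B S (Suc 0). bd S w - bd S v:kchains N S 0))" (is "?l = ?r")
proof
 assume l: ?l
 show ?r
 proof (intro ballI impI)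
	fix w assume w: "w:kchains C S (Suc 0)" "bd S w:kchains B S 0"
	then obtain v where v: "v:kchains C S (Suc (Suc 0))" "w - bd S v:kchains B S (Suc 0)"
	 using l unfolding hvan_def by force
	note vG = kchains_sub[OF sub(3) S v(1)]
	have "bd S (w - bd S v) = bd S w"
	 using bd_diff[OF S kchains_sub[OF sub(3) S w(1)] bd_chains[OF fi_sub_G S vG]] bd_bd[OF S vG] by simp
	then show "\<exists>v\<in>kchains B S (Suc 0). bd S w - bd S v:kchains N S 0"
	 using v(2) kchains_zero[OF sub(1) S, of 0] by (intro bexI[of _ "w - bd S v"]) (auto simp: zero_fun_def)
 qed
next
 assume r: ?r
 show ?l unfolding hvan_def
 proof (intro ballI impI)
	fix z assume z: "z:kchains C S (Suc 0)" and "bd S z:kchains B S (Suc 0 - 1)"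
	then obtain w where w: "w:kchains B S (Suc 0)" "bd S z - bd S w:kchains N S 0"
	 using r by auto
	note zG = kchains_sub[OF sub(3) S z]
	have w': "w:kchains C S (Suc 0)" by (rule kchains_mono_finite[OF S(1) w(1) sub(5)])
	have "bd S (z - w):kchains N S (Suc 0 - 1)"
	 using bd_diff[OF S zG kchains_sub[OF sub(3) S w']] w(2) by simp
	then obtain v where v: "v:kchains C S (Suc (Suc 0))" "z - w - bd S v:kchains N S (Suc 0)"
	 using assms(8) kchains_diff[OF sub(3) S z w'] unfolding hvan_def by blast
	have "z - w - bd S v + w:kchains B S (Suc 0)"
	 by (rule kchains_add[OF sub(2) S kchains_mono_finite[OF S(1) v(2) sub(4)] w(1)])
	then show "\<exists>w\<in>kchains C S (Suc (Suc 0)). z - bd S w:kchains B S (Suc 0)"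
	 using v(1) by (auto simp: algebra_simps)
 qed
qed

end

subsection \<open>Splitting off a point\<close>

text \<open>\<open>slant\<close> and \<open>avoid\<close> are the two halves of a chain on S + p:
  the coefficients of lists beginning with p and of lists avoiding p. They present the complex of V
  on S + p as the cone of V -> V(- + p) on S.\<close>

definition slant :: "nat=>(nat list=>'g::ab_group_add)=>nat list=>'g" where
 "slant p z L = (if p:set L then 0 else z (p # L))"

definition avoid :: "nat=>(nat list=>'g::ab_group_add)=>nat list=>'g" where
 "avoid p z L = (if p:set L then 0 else z L)"

lemma alternating_slant:
 assumes "alternating (insert p S) (Suc i) z"
 shows "alternating S i (slant p z)"
 unfolding alternating_def
proof (intro conjI allI impI)
 fix L assume "L~:dlists S i"
 then have "p:set L\<or>p # L~:dlists (insert p S) (Suc i)" by (auto simp: dlists_def)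
 then show "slant p z L = 0" using alternatingD0[OF assms] by (auto simp: slant_def)
next
 fix L a b assume ab: "a:set L" "b:set L" "(a::nat)~=b"
 show "slant p z (map (swp a b) L) = - slant p z L"
 proof (cases "p:set L")
	case True
	then show ?thesis unfolding slant_def set_map_swp[OF ab(1,2)] by simp
 next
	case False
	then have "p # map (swp a b) L = map (swp a b) (p # L)" using ab by (auto simp: Transposition.transpose_def)
	then have "z (p # map (swp a b) L) = - z (p # L)"
	 using alternatingD[OF assms, of a "p # L" b] ab by simp
	then show ?thesis using False unfolding slant_def set_map_swp[OF ab(1,2)] by simp
 qed
qed

lemma alternating_avoid:
 assumes "alternating (insert p S) i z"
 shows "alternating S i (avoid p z)"
 unfolding alternating_def
proof (intro conjI allI impI)
 fix L assume "L~:dlists S i"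
 then have "p:set L\<or>L~:dlists (insert p S) i" by (auto simp: dlists_def)
 then show "avoid p z L = 0" using alternatingD0[OF assms] by (auto simp: avoid_def)
next
 fix L a b assume ab: "a:set L" "b:set L" "(a::nat)~=b"
 show "avoid p z (map (swp a b) L) = - avoid p z L"
	unfolding avoid_def set_map_swp[OF ab(1,2)] using alternatingD[OF assms ab] by simp
qed

lemma alternating_mono: "alternating S i z==>S<=T==>alternating T i z"
 unfolding alternating_def dlists_def by auto

lemma alternating_insert_point:
 assumes "alternating S i u" "p~:S" "finite S"
 shows "EX w. alternating (insert p S) (Suc i) w&avoid p w = 0&slant p w = u"
proof -
 \<comment> \<open>With p listed first, the prescribed values are the values at \<open>p # L\<close>
   themselves, and \<open>slant\<close> reads them off without a sign.\<close>
 define E where "E B = (if p:B then p # sorted_list_of_set (B - {p}) else sorted_list_of_set B)" for B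
 have E: "enumeration E" by (auto simp: enumeration_def E_def)
 obtain w where w: "alternating (insert p S) (Suc i) w"
	"!!B. B<=insert p S==>card B = Suc i==>w (E B) = (if p:B then u (sorted_list_of_set (B - {p})) else 0)"
	using alternating_extension[OF E, of "insert p S" "Suc i" "%B. if p:B then u (sorted_list_of_set (B - {p})) else 0"] assms(3) by auto
 have "avoid p w L = 0" for L
 proof (cases "p:set L\<or>L~:dlists (insert p S) (Suc i)")
	case True then show ?thesis using alternatingD0[OF w(1)] by (auto simp: avoid_def)
 next
	case False
	then have "w (E (set L)) = 0" "distinct L" using w(2)[of "set L"] distinct_card[of L] by (auto simp: dlists_def)
	then show ?thesis using alternating_value[OF w(1) E, of L] by (auto simp: avoid_def)
 qed
 moreover have "slant p w = u"
 proof (rule alternating_eqI[OF alternating_slant[OF w(1)] assms(1) enumeration_sorted])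
	fix B assume B: "B<=S" "finite B" "card B = i"
	have pB: "p~:B" using B assms(2) by auto
	have "w (E (insert p B)) = u (sorted_list_of_set B)"
	 using w(2)[of "insert p B"] B pB by auto
	then show "slant p w (sorted_list_of_set B) = u (sorted_list_of_set B)"
	 using pB B by (simp add: slant_def E_def)
 qed
 ultimately show ?thesis using w(1) by (intro exI[of _ w]) (auto simp: fun_eq_iff)
qed

section \<open>The derivative V(S + p) / V(S)\<close>

context fi_group
begin

definition D_G :: "nat=>nat set=>'g set" where
 "D_G p S = G (insert p S)"

definition D_m :: "nat=>nat set=>nat set=>(nat=>nat)=>'g=>'g" where
 "D_m p S T f = m (insert p S) (insert p T) (f(p := p))"

text \<open>Made so that \<open>D_G / D_sub\<close> is the cokernel of V(S) -> V(S + p) for V = G/N,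
  although only submodules of a fixed functor are available.\<close>

definition D_sub :: "(nat set=>'g set)=>nat=>nat set=>'g set" where
 "D_sub N p S = {a + m S (insert p S) id b | a b. a:N (insert p S)&b:G S}"

lemma emb_upd: "emb f S T==>p~:S==>p~:T==>emb (f(p := p)) (insert p S) (insert p T)"
 unfolding emb_def inj_on_def by auto

lemma fi_group_D:
 assumes p: "p:Om"
 shows "fi_group (Om - {p}) (D_G p) (D_m p)"
proof
 show "infinite (Om - {p})" using infinite_Om by simp
next
 fix S assume "finite S" "S<=Om - {p}"
 then have S: "finite (insert p S)" "insert p S<=Om" "p~:S" using p by auto
 show "0:D_G p S" using S by (simp add: D_G_def G_zero)
 show "x - y:D_G p S" if "x:D_G p S" "y:D_G p S" for x y using S that by (simp add: D_G_def G_diff)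
 show "D_m p S S id x = x" if "x:D_G p S" for x
	using m_id[of "insert p S" x] m_cong[of "insert p S" "insert p S" id x "id(p:=p)"] S that
	by (simp add: D_m_def D_G_def emb_def)
 fix T f assume "finite T" "T<=Om - {p}" and f: "emb f S T"
 then have T: "finite (insert p T)" "insert p T<=Om" "p~:T" using p by auto
 note e = emb_upd[OF f S(3) T(3)]
 show "D_m p S T f x:D_G p T" if "x:D_G p S" for x
	using m_in[OF S(1,2) T(1,2) e] that by (simp add: D_m_def D_G_def)
 show "D_m p S T f (x - y) = D_m p S T f x - D_m p S T f y" if "x:D_G p S" "y:D_G p S" for x y
	using m_diff[OF S(1,2) T(1,2) e] that by (simp add: D_m_def D_G_def)
 show "D_m p S T f x = D_m p S T g x" if "x:D_G p S" "!!s. s:S==>f s = g s" for x g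
	unfolding D_m_def by (rule m_cong[OF S(1,2) T(1,2) e]) (use that in \<open>auto simp: D_G_def\<close>)
 fix U g assume "finite U" "U<=Om - {p}" and g: "emb g T U"
 then have U: "finite (insert p U)" "insert p U<=Om" "p~:U" using p by auto
 note e' = emb_upd[OF g T(3) U(3)]
 show "D_m p T U g (D_m p S T f x) = D_m p S U (g\<circ>f) x" if "x:D_G p S" for x
 proof -
	have "D_m p T U g (D_m p S T f x) = m (insert p S) (insert p U) (g(p:=p)\<circ>f(p:=p)) x"
	 unfolding D_m_def using m_comp[OF S(1,2) T(1,2) U(1,2) e e'] that by (simp add: D_G_def)
	also have "... = D_m p S U (g\<circ>f) x"
	 unfolding D_m_def by (rule m_cong[OF S(1,2) U(1,2) emb_comp[OF e e']])
		(use that f T S in \<open>auto simp: D_G_def emb_def\<close>)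
	finally show ?thesis .
 qed
qed

lemma D_sub_fi_sub:
 assumes p: "p:Om" and N: "fi_sub N"
 shows "fi_group.fi_sub (Om - {p}) (D_G p) (D_m p) (D_sub N p)"
proof -
 interpret D: fi_group "Om - {p}" "D_G p" "D_m p" by (rule fi_group_D[OF p])
 have "D_sub N p S<=D_G p S&0:D_sub N p S&(\<forall>x\<in>D_sub N p S. \<forall>y\<in>D_sub N p S. x - y:D_sub N p S)"
	if "finite S" "S<=Om - {p}" for S
 proof -
	have S: "finite S" "S<=Om" "finite (insert p S)" "insert p S<=Om" "emb id S (insert p S)" using that p by (auto simp: emb_def)
	have 1: "D_sub N p S<=D_G p S"
	 unfolding D_sub_def D_G_def using fi_subD[OF N S(3,4)] m_in[OF S] fi_sub_add[OF fi_sub_G S(3,4)] by auto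
	have 2: "0:D_sub N p S"
	 unfolding D_sub_def using fi_sub_zero[OF N S(3,4)] G_zero[OF S(1,2)] m_zero[OF S]
	 by (intro CollectI exI[of _ 0]) auto
	have 3: "x - y:D_sub N p S" if xy: "x:D_sub N p S" "y:D_sub N p S" for x y
	proof -
	 obtain a b a' b' where ab: "x = a + m S (insert p S) id b" "y = a' + m S (insert p S) id b'"
		"a:N (insert p S)" "a':N (insert p S)" "b:G S" "b':G S"
		using xy unfolding D_sub_def by auto
	 have "x - y = (a - a') + m S (insert p S) id (b - b')"
		using m_diff[OF S, of b b'] ab by simp
	 then show ?thesis unfolding D_sub_def
		using fi_sub_diff[OF N S(3,4) ab(3,4)] G_diff[OF S(1,2) ab(5,6)] by blast
	qed
	show ?thesis using 1 2 3 by blast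
 qed
 moreover have "D_m p S T f x:D_sub N p T"
	if S': "finite S" "S<=Om - {p}" and T': "finite T" "T<=Om - {p}" and f: "emb f S T" and x: "x:D_sub N p S" for S T f x
 proof -
	have S: "finite S" "S<=Om" "finite (insert p S)" "insert p S<=Om" "emb id S (insert p S)" "p~:S" using S' p by (auto simp: emb_def)
	have T: "finite T" "T<=Om" "finite (insert p T)" "insert p T<=Om" "emb id T (insert p T)" "p~:T" using T' p by (auto simp: emb_def)
	note e = emb_upd[OF f S(6) T(6)]
	obtain a b where ab: "x = a + m S (insert p S) id b" "a:N (insert p S)" "b:G S"
	 using x unfolding D_sub_def by auto
	have "m (insert p S) (insert p T) (f(p:=p)) (m S (insert p S) id b) = m S (insert p T) (f(p:=p)\<circ>id) b"
	 by (rule m_comp[OF S(1-4) T(3,4) S(5) e ab(3)])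
	also have "... = m S (insert p T) (id\<circ>f) b"
	 by (rule m_cong[OF S(1,2) T(3,4) emb_comp[OF S(5) e] ab(3)]) (use S in auto)
	also have "... = m T (insert p T) id (m S T f b)"
	 using m_comp[OF S(1,2) T(1-4) f T(5) ab(3)] by simp
	finally have "D_m p S T f x = m (insert p S) (insert p T) (f(p:=p)) a + m T (insert p T) id (m S T f b)"
	 unfolding D_m_def ab(1)
	 using m_add[OF S(3,4) T(3,4) e fi_subD[OF N S(3,4) ab(2)] m_in[OF S(1-5) ab(3)]] by simp
	then show ?thesis unfolding D_sub_def
	 using fi_sub_m[OF N S(3,4) T(3,4) e ab(2)] m_in[OF S(1,2) T(1,2) f ab(3)] by blast
 qed
 ultimately show ?thesis unfolding D.fi_sub_def by blast
qed

lemma zero_chain: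
 assumes "x:G S" "finite S" "S<=Om"
 shows "(%L. if L = [] then x else 0):kchains G S 0"
 using assms unfolding kchains_def alternating_def dlists_def by auto

lemma chain_0_eqI: "finite S==>S<=Om==>fi_sub N==>alternating S 0 z==>z []:N S==>z:kchains N S 0"
 by (auto simp: kchains_def dlists_def)

section \<open>Chains on S + p as a mapping cone over S\<close>

context
 fixes p S
 assumes p: "p:Om" and S: "finite S" "S<=Om - {p}"
begin

interpretation D: fi_group "Om - {p}" "D_G p" "D_m p" by (rule fi_group_D[OF p])

lemma pS: "p~:S" "S<=Om" "finite (insert p S)" "insert p S<=Om"
 using p S by auto

lemma insert_Diff_set: "p~:set L==>insert p S - set L = insert p (S - set L)"
 by auto

lemma insert_Diff_Cons: "insert p S - set (p # L) = S - set L"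
 using S by auto

lemma avoid_chains: "z:kchains G (insert p S) i==>avoid p z:kchains (D_G p) S i"
 unfolding kchains_def
proof (intro CollectI conjI ballI)
 assume z: "z:{z. alternating (insert p S) i z&(\<forall>L\<in>dlists (insert p S) i. z L:G (insert p S - set L))}"
 show "alternating S i (avoid p z)" using z alternating_avoid by blast
 fix L assume L: "L:dlists S i"
 have "p~:set L" "L:dlists (insert p S) i" using L pS by (auto simp: dlists_def)
 then show "avoid p z L:D_G p (S - set L)"
	using z unfolding D_G_def avoid_def by (auto simp: insert_Diff_set)
qed

lemma slant_chains_gen: "z:kchains A (insert p S) (Suc i)==>slant p z:kchains A S i"
 unfolding kchains_def
proof (intro CollectI conjI ballI)
 assume z: "z:{z. alternating (insert p S) (Suc i) z&(\<forall>L\<in>dlists (insert p S) (Suc i). z L:A (insert p S - set L))}"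
 show "alternating S i (slant p z)" using z alternating_slant by blast
 fix L assume L: "L:dlists S i"
 then have "p~:set L" "p # L:dlists (insert p S) (Suc i)" using pS by (auto simp: dlists_def)
 then show "slant p z L:A (S - set L)"
	using z insert_Diff_Cons[of L] unfolding slant_def by force
qed

lemma D_chains: "w:kchains (D_G p) S i==>w:kchains G (insert p S) i"
 unfolding kchains_def
proof (intro CollectI conjI ballI)
 assume w: "w:{z. alternating S i z&(\<forall>L\<in>dlists S i. z L:D_G p (S - set L))}"
 then show "alternating (insert p S) i w" using alternating_mono by blast
 fix L assume L: "L:dlists (insert p S) i"
 show "w L:G (insert p S - set L)"
 proof (cases "p:set L")
	case True
	then have "w L = 0" using w alternatingD0[of S i w L] pS(1) by (auto simp: dlists_def)
	then show ?thesis using pS by (auto intro!: G_zero)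
 next
	case False
	then have "L:dlists S i" using L by (auto simp: dlists_def)
	then show ?thesis using w False by (auto simp: D_G_def insert_Diff_set)
 qed
qed

lemma avoid_D_chain: "w:kchains (D_G p) S i==>avoid p w = w"
 using alternatingD0[of S i w] pS(1) by (auto simp: kchains_def avoid_def fun_eq_iff dlists_def)

lemma slant_D_chain: "w:kchains (D_G p) S i==>slant p w = 0"
proof
 fix L assume w: "w:kchains (D_G p) S i"
 have "w (p # L) = 0" using w alternatingD0[of S i w "p # L"] pS(1) by (auto simp: kchains_def dlists_def)
 then show "slant p w L = 0 L" by (simp add: slant_def)
qed

lemma kchains_insertI:
 assumes A: "fi_sub A" and z: "alternating (insert p S) i z"
	and 1: "!!L. L:dlists S i==>z L:A (insert p (S - set L))"
	and 2: "!!L. p # L:dlists (insert p S) i==>z (p # L):A (S - set L)"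
 shows "z:kchains A (insert p S) i"
 unfolding kchains_def
proof (intro CollectI conjI ballI z)
 fix L assume L: "L:dlists (insert p S) i"
 show "z L:A (insert p S - set L)"
 proof (cases "p:set L")
	case True
	obtain M where M: "distinct (p # M)" "set (p # M) = set L" "z L = z (p # M)\<or>z L = - z (p # M)"
	 using alternating_head[OF z L True] by blast
	have "length (p # M) = length L" using M(1,2) L distinct_card unfolding dlists_def by (metis mem_Collect_eq)
	then have pM: "p # M:dlists (insert p S) i" using M(1,2) L unfolding dlists_def by auto
	have "insert p S - set L = S - set M" using M(1,2) pS(1) by auto
	moreover have "- z (p # M):A (S - set M)"
	 by (rule fi_sub_uminus[OF A _ _ 2[OF pM]]) (use S in auto)
	ultimately show ?thesis using 2[OF pM] M(3) by auto
 next
	case False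
	then have "L:dlists S i" using L by (auto simp: dlists_def)
	then show ?thesis using 1 False by (simp add: insert_Diff_set)
 qed
qed

text \<open>The chain "p wedge u": it embeds the chains of V on S, raised by one degree, as a
  summand of the cone.\<close>

lemma insert_point_chain:
 assumes A: "fi_sub A" and u: "u:kchains A S i"
 shows "\<exists>w\<in>kchains A (insert p S) (Suc i). avoid p w = 0&slant p w = u"
proof -
 obtain w where w: "alternating (insert p S) (Suc i) w" "avoid p w = 0" "slant p w = u"
	using alternating_insert_point[OF kchains_alternating[OF u] pS(1) S(1)] by blast
 have "w:kchains A (insert p S) (Suc i)"
 proof (rule kchains_insertI[OF A w(1)])
	fix L assume "L:dlists S (Suc i)"
	then have "p~:set L" using pS(1) by (auto simp: dlists_def)
	then have "w L = 0" using fun_cong[OF w(2), of L] by (simp add: avoid_def)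
	then show "w L:A (insert p (S - set L))" using fi_sub_zero[OF A, of "insert p (S - set L)"] pS by auto
 next
	fix L assume "p # L:dlists (insert p S) (Suc i)"
	then have L: "p~:set L" "L:dlists S i" by (auto simp: dlists_def)
	then have "w (p # L) = u L" using fun_cong[OF w(3), of L] by (simp add: slant_def)
	then show "w (p # L):A (S - set L)" using kchainsD[OF u L(2)] by simp
 qed
 then show ?thesis using w by blast
qed

text \<open>One component of the cone differential. The summand of the boundary for x = p is the
  image of the p-part under V(S - L) -> V(S + p - L).\<close>

lemma bd_insert_avoid:
 assumes z: "z:kchains G (insert p S) i" and L: "distinct L" "set L<=S"
 shows "bd (insert p S) z L = D.bd S (avoid p z) L + m (S - set L) (insert p (S - set L)) id (slant p z L)"
proof -
 have pL: "p~:set L" using L pS(1) by auto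
 have s: "insert p S - set L = insert p (S - set L)" using insert_Diff_set[OF pL] .
 have s2: "insert p S - insert p (set L) = S - set L" using insert_Diff_Cons[of L] by simp
 have "bd (insert p S) z L = (\<Sum>x\<in>insert p (S - set L). m (insert p S - insert x (set L)) (insert p (S - set L)) id (z (x # L)))"
	unfolding bd_def s using L by auto
 also have "... = m (S - set L) (insert p (S - set L)) id (z (p # L)) +
	 (\<Sum>x\<in>S - set L. m (insert p S - insert x (set L)) (insert p (S - set L)) id (z (x # L)))"
	using S pS(1) s2 by (subst sum.insert) auto
 also have "(\<Sum>x\<in>S - set L. m (insert p S - insert x (set L)) (insert p (S - set L)) id (z (x # L))) = D.bd S (avoid p z) L"
 proof -
	have "m (insert p S - insert x (set L)) (insert p (S - set L)) id (z (x # L)) =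
		D_m p (S - insert x (set L)) (S - set L) id (avoid p z (x # L))" if x: "x:S - set L" for x
	proof -
	 have "p~:set (x # L)" using x pL pS(1) by auto
	 then have "insert p S - insert x (set L) = insert p (S - insert x (set L))"
		 "avoid p z (x # L) = z (x # L)" using insert_Diff_set[of "x # L"] by (auto simp: avoid_def)
	 moreover have "(id(p := p)) = id" by auto
	 ultimately show ?thesis unfolding D_m_def by simp
	qed
	then show ?thesis unfolding D.bd_def using L by simp
 qed
 finally show ?thesis unfolding slant_def using pL by (simp only: if_False add.commute)
qed

text \<open>The other component of the cone differential; the sign comes from moving p past the
  prepended point.\<close>

lemma bd_insert_slant:
 assumes z: "z:kchains G (insert p S) i" and L: "distinct L" "set L<=S"
 shows "bd (insert p S) z (p # L) = - bd S (slant p z) L"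
proof -
 have pL: "p~:set L" using L pS(1) by auto
 have s: "insert p S - insert p (set L) = S - set L" using insert_Diff_Cons[of L] by simp
 have "bd (insert p S) z (p # L) = (\<Sum>x\<in>S - set L. m (insert p S - insert x (set (p # L))) (S - set L) id (z (x # p # L)))"
	unfolding bd_def using L s pL by auto
 also have "... = (\<Sum>x\<in>S - set L. - m (S - insert x (set L)) (S - set L) id (slant p z (x # L)))"
 proof (rule sum.cong[OF refl])
	fix x assume x: "x:S - set L"
	have xp: "x~=p" using x pS(1) by auto
	have "map (swp x p) (x # p # L) = p # x # L" using x pL map_swp_id[of x L p] by auto
	then have e: "z (p # x # L) = - z (x # p # L)"
	 using alternatingD[OF kchains_alternating[OF z], of x "x # p # L" p] xp by simp
	have sl: "slant p z (x # L) = z (p # x # L)" using xp pL by (simp add: slant_def)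
	have s': "insert p S - insert x (set (p # L)) = S - insert x (set L)" using pS(1) by auto
	have "z (p # x # L):G (insert p S - set (p # x # L))"
	 by (rule kchains_in[OF fi_sub_G pS(3,4) z])
	moreover have "insert p S - set (p # x # L) = S - insert x (set L)" using pS(1) by auto
	ultimately have "z (p # x # L):G (S - insert x (set L))" by simp
	then have "m (S - insert x (set L)) (S - set L) id (- z (p # x # L)) = - m (S - insert x (set L)) (S - set L) id (z (p # x # L))"
	 using S x by (intro m_uminus) (auto simp: emb_def)
	then show "m (insert p S - insert x (set (p # L))) (S - set L) id (z (x # p # L)) =
		- m (S - insert x (set L)) (S - set L) id (slant p z (x # L))"
	 unfolding s' sl e by simp
 qed
 also have "... = - bd S (slant p z) L" unfolding bd_def using L by (simp add: sum_negf)
 finally show ?thesis .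
qed

text \<open>Decompositions into an element of N and an image from V(S) are not unique or additive,
  so they are chosen on sorted lists only and extended by signs. A reordering multiplies both terms
  of the difference by the same sign.\<close>

lemma D_lift:
 assumes N: "fi_sub N" and y: "y:kchains (D_sub N p) S i"
 shows "\<exists>u\<in>kchains G S i. \<forall>L\<in>dlists S i. y L - m (S - set L) (insert p (S - set L)) id (u L):N (insert p (S - set L))"
proof -
 let ?E = "sorted_list_of_set :: nat set=>nat list"
 define v where "v B = (SOME b. b:G (S - B)&y (?E B) - m (S - B) (insert p (S - B)) id b:N (insert p (S - B)))" for B
 have v: "v B:G (S - B)&y (?E B) - m (S - B) (insert p (S - B)) id (v B):N (insert p (S - B))" if B: "B<=S" "card B = i" for B
 proof -
	have fB: "finite B" using B S finite_subset by blast
	then have "?E B:dlists S i" using B by (auto simp: dlists_def)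
	then have "y (?E B):D_sub N p (S - B)" using kchainsD[OF y] fB by fastforce
	then have "EX b. b:G (S - B)&y (?E B) - m (S - B) (insert p (S - B)) id b:N (insert p (S - B))"
	 unfolding D_sub_def by auto
	then show ?thesis unfolding v_def by (rule someI_ex)
 qed
 obtain u where u: "alternating S i u" "!!B. B<=S==>card B = i==>u (?E B) = v B"
	using alternating_extension[OF enumeration_sorted S(1), of i v] by blast
 have uG: "u:kchains G S i"
	by (rule kchainsI[OF fi_sub_G S(1) pS(2) u(1) enumeration_sorted]) (use u v in auto)
 have "y L - m (S - set L) (insert p (S - set L)) id (u L):N (insert p (S - set L))" if L: "L:dlists S i" for L
 proof -
	have d: "distinct L" "set L<=S" "card (set L) = i" "finite (set L)" using L distinct_card by (auto simp: dlists_def)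
	let ?M = "?E (set L)"
	have M: "distinct ?M" "set ?M = set L" using d by auto
	obtain q where q: "q permutes set L" "map q ?M = L" using permutes_between_lists[OF d(1) M(1)] M(2) by auto
	have T: "finite (S - set L)" "S - set L<=Om" "finite (insert p (S - set L))" "insert p (S - set L)<=Om"
	 "emb id (S - set L) (insert p (S - set L))" using pS S by (auto simp: emb_def)
	have base: "y ?M - m (S - set L) (insert p (S - set L)) id (u ?M):N (insert p (S - set L))"
	 using v[OF d(2,3)] u(2)[OF d(2,3)] by simp
	have uM: "u ?M:G (S - set L)" using u(2)[OF d(2,3)] v[OF d(2,3)] by simp
	show ?thesis
	proof (cases "evenperm q")
	 case True
	 then have "y L = y ?M" "u L = u ?M"
		using alternating_permute[OF kchains_alternating[OF y] M(1), of q] alternating_permute[OF u(1) M(1), of q] q M by auto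
	 then show ?thesis using base by simp
	next
	 case False
	 then have "y L = - y ?M" "u L = - u ?M"
		using alternating_permute[OF kchains_alternating[OF y] M(1), of q] alternating_permute[OF u(1) M(1), of q] q M by auto
	 then have "y L - m (S - set L) (insert p (S - set L)) id (u L) = - (y ?M - m (S - set L) (insert p (S - set L)) id (u ?M))"
		using m_uminus[OF T uM] by simp
	 then show ?thesis using fi_sub_uminus[OF N T(3,4) base] by simp
	qed
 qed
 then show ?thesis using uG by blast
qed

lemma avoid_diff: "avoid p (z - w) = avoid p z - avoid p w" and slant_diff: "slant p (z - w) = slant p z - slant p w"
 by (auto simp: avoid_def slant_def fun_eq_iff)

text \<open>A cycle of the derivative is a boundary only up to N and up to images from V(S). The
  filling \<open>w\<close> takes care of the derivative, and p wedge \<open>u\<close> absorbs the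
  images, so that the p-free part of the chain ends up in N.\<close>

lemma D_reduce:
 assumes N: "fi_sub N" and z: "z:kchains G (insert p S) i"
	and dz: "D.bd S (avoid p z):kchains (D_sub N p) S (i - 1)"
	and D: "D.hvan (D_sub N p) (D_G p) S i"
 shows "\<exists>v\<in>kchains G (insert p S) (Suc i). \<forall>L\<in>dlists S i. z L - bd (insert p S) v L:N (insert p (S - set L))"
proof -
 obtain w where w: "w:kchains (D_G p) S (Suc i)" "avoid p z - D.bd S w:kchains (D_sub N p) S i"
	using D avoid_chains[OF z] dz unfolding D.hvan_def by blast
 obtain u where u: "u:kchains G S i"
	"!!L. L:dlists S i==>(avoid p z - D.bd S w) L - m (S - set L) (insert p (S - set L)) id (u L):N (insert p (S - set L))"
	using D_lift[OF N w(2)] by blast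
 obtain w1 where w1: "w1:kchains G (insert p S) (Suc i)" "avoid p w1 = 0" "slant p w1 = u"
	using insert_point_chain[OF fi_sub_G u(1)] by blast
 note w' = D_chains[OF w(1)]
 have "z L - bd (insert p S) (w + w1) L:N (insert p (S - set L))" if L: "L:dlists S i" for L
 proof -
	have d: "distinct L" "set L<=S" "p~:set L" using L pS(1) by (auto simp: dlists_def)
	have T: "finite (S - set L)" "S - set L<=Om" "finite (insert p (S - set L))" "insert p (S - set L)<=Om"
	 "emb id (S - set L) (insert p (S - set L))" using pS S by (auto simp: emb_def)
	have a: "avoid p z L = z L" using d by (simp add: avoid_def)
	have "bd (insert p S) (w + w1) L = bd (insert p S) w L + bd (insert p S) w1 L"
	 using bd_add[OF pS(3,4) w' w1(1)] by simp
	also have "bd (insert p S) w L = D.bd S w L"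
	 using bd_insert_avoid[OF w' d(1,2)] avoid_D_chain[OF w(1)] slant_D_chain[OF w(1)] m_zero[OF T] by simp
	also have "bd (insert p S) w1 L = m (S - set L) (insert p (S - set L)) id (u L)"
	 using bd_insert_avoid[OF w1(1) d(1,2)] w1(2,3) D.bd_zero[OF S] by simp
	finally have "z L - bd (insert p S) (w + w1) L = (avoid p z - D.bd S w) L - m (S - set L) (insert p (S - set L)) id (u L)"
	 unfolding minus_apply a by (simp only: diff_diff_eq)
	then show ?thesis using u(2)[OF L] by (simp only:)
 qed
 then show ?thesis using kchains_add[OF fi_sub_G pS(3,4) w' w1(1)] by blast
qed

lemma D_bd_avoid_in:
 assumes z: "z:kchains G (insert p S) i" "!!L. L:dlists S i==>z L:N (insert p (S - set L))" and N: "fi_sub N"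
	and L: "L:dlists S (i - 1)" "i > 0"
 shows "D.bd S (avoid p z) L:N (insert p (S - set L))"
proof -
 obtain j where j: "i = Suc j" using L(2) by (cases i) auto
 have "D_m p (S - insert x (set L)) (S - set L) id (avoid p z (x # L)):N (insert p (S - set L))" if x: "x:S - set L" for x
 proof -
	have 1: "x # L:dlists S i" "p~:set (x # L)" using x L j pS(1) by (auto simp: dlists_def)
	then have "avoid p z (x # L):N (insert p (S - insert x (set L)))" using z(2)[OF 1(1)] by (simp add: avoid_def)
	then show ?thesis unfolding D_m_def
	 using S p x pS by (intro fi_sub_m[OF N]) (auto simp: emb_def inj_on_def)
 qed
 then show ?thesis unfolding D.bd_def
	using pS S by (auto intro!: fi_sub_sum[OF N] fi_sub_zero[OF N])
qed

text \<open>Once the p-free part of a cycle lies in N, its p-part takes values in the kernels of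
  V(T) -> V(T + p), where T has j points fewer than S. The hypothesis \<open>K\<close> says that
  these kernels are zero.\<close>

lemma hvan_insert:
 assumes N: "fi_sub N" and D: "D.hvan (D_sub N p) (D_G p) S (Suc j)"
	and K: "!!T x. T<=S==>card T + j = card S==>x:G T==>m T (insert p T) id x:N (insert p T)==>x:N T"
 shows "hvan N G (insert p S) (Suc j)"
 unfolding hvan_def
proof (intro ballI impI)
 fix z assume z: "z:kchains G (insert p S) (Suc j)" and "bd (insert p S) z:kchains N (insert p S) (Suc j - 1)"
 then have dz: "bd (insert p S) z:kchains N (insert p S) j" by simp
 have mem: "D.bd S (avoid p z):kchains (D_sub N p) S j"
 proof -
	have "D.bd S (avoid p z):kchains (D_G p) S j"
	 using D.bd_chains[OF D.fi_sub_G S avoid_chains[OF z]] .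
	moreover have "D.bd S (avoid p z) L:D_sub N p (S - set L)" if L: "L:dlists S j" for L
	proof -
	 have d: "distinct L" "set L<=S" "p~:set L" "L:dlists (insert p S) j" using L pS(1) by (auto simp: dlists_def)
	 have T: "finite (S - set L)" "S - set L<=Om" "finite (insert p (S - set L))" "insert p (S - set L)<=Om"
		"emb id (S - set L) (insert p (S - set L))" using pS S by (auto simp: emb_def)
	 have sl: "slant p z L:G (S - set L)"
		using kchainsD[OF slant_chains_gen[OF z] L] .
	 have "D.bd S (avoid p z) L = bd (insert p S) z L + m (S - set L) (insert p (S - set L)) id (- slant p z L)"
		using bd_insert_avoid[OF z d(1,2)] m_uminus[OF T sl] by simp
	 moreover have "bd (insert p S) z L:N (insert p (S - set L))"
		using kchainsD[OF dz d(4)] insert_Diff_set[OF d(3)] by simp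
	 ultimately show ?thesis unfolding D_sub_def using fi_sub_uminus[OF fi_sub_G T(1,2) sl] by blast
	qed
	ultimately show ?thesis by (simp add: kchains_def)
 qed
 obtain v where v: "v:kchains G (insert p S) (Suc (Suc j))"
	"!!L. L:dlists S (Suc j)==>z L - bd (insert p S) v L:N (insert p (S - set L))"
	using D_reduce[OF N z _ D] mem by auto
 define z' where "z' = z - bd (insert p S) v"
 have z': "z':kchains G (insert p S) (Suc j)"
	unfolding z'_def using kchains_diff[OF fi_sub_G pS(3,4) z bd_chains[OF fi_sub_G pS(3,4) v(1)]] .
 have bz': "bd (insert p S) z' = bd (insert p S) z"
	unfolding z'_def using bd_diff[OF pS(3,4) z bd_chains[OF fi_sub_G pS(3,4) v(1)]] bd_bd[OF pS(3,4) v(1)] by simp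
 have z'N: "z' L:N (insert p (S - set L))" if "L:dlists S (Suc j)" for L
	using v(2)[OF that] by (simp add: z'_def)
 have "z':kchains N (insert p S) (Suc j)"
 proof (rule kchains_insertI[OF N kchains_alternating[OF z'] z'N])
	fix L assume L: "p # L:dlists (insert p S) (Suc j)"
	then have d: "distinct L" "set L<=S" "p~:set L" "L:dlists (insert p S) j" "L:dlists S j" by (auto simp: dlists_def)
	have T: "finite (insert p (S - set L))" "insert p (S - set L)<=Om" using pS S by auto
	have "bd (insert p S) z L:N (insert p (S - set L))"
	 using kchainsD[OF dz d(4)] insert_Diff_set[OF d(3)] by simp
	moreover have "D.bd S (avoid p z') L:N (insert p (S - set L))"
	 by (rule D_bd_avoid_in[OF z' z'N N]) (use d in auto)
	ultimately have "m (S - set L) (insert p (S - set L)) id (slant p z' L):N (insert p (S - set L))"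
	 using bd_insert_avoid[OF z' d(1,2)] bz' fi_sub_diff[OF N T] by (metis add_diff_cancel_left')
	moreover have "card (S - set L) + j = card S"
	 using d(5) S by (auto simp: dlists_def card_Diff_subset distinct_card[symmetric] card_mono)
	ultimately have "slant p z' L:N (S - set L)"
	 using K[of "S - set L"] kchainsD[OF slant_chains_gen[OF z'] d(5)] by auto
	then show "z' (p # L):N (S - set L)" using d(3) by (simp add: slant_def)
 qed
 then show "\<exists>w\<in>kchains G (insert p S) (Suc (Suc j)). z - bd (insert p S) w:kchains N (insert p S) (Suc j)"
	using v(1) unfolding z'_def by blast
qed

lemma D_hvan_of_insert:
 assumes N: "fi_sub N" and z0: "z0:kchains (D_G p) S i" and z: "z:kchains G (insert p S) i" "avoid p z = z0"
	and w: "w:kchains G (insert p S) (Suc i)" "z - bd (insert p S) w:kchains N (insert p S) i"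
 shows "z0 - D.bd S (avoid p w):kchains (D_sub N p) S i"
proof -
 have "z0 - D.bd S (avoid p w):kchains (D_G p) S i"
	using D.kchains_diff[OF D.fi_sub_G S z0 D.bd_chains[OF D.fi_sub_G S avoid_chains[OF w(1)]]] .
 moreover have "(z0 - D.bd S (avoid p w)) L:D_sub N p (S - set L)" if L: "L:dlists S i" for L
 proof -
	have d: "distinct L" "set L<=S" "p~:set L" "L:dlists (insert p S) i" using L pS(1) by (auto simp: dlists_def)
	have "z0 L = z L" using z(2) d(3) by (auto simp: avoid_def)
	moreover have "z L - bd (insert p S) w L:N (insert p (S - set L))"
	 using kchainsD[OF w(2) d(4)] insert_Diff_set[OF d(3)] by simp
	moreover have "slant p w L:G (S - set L)" using kchainsD[OF slant_chains_gen[OF w(1)] L] .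
	ultimately show ?thesis unfolding D_sub_def using bd_insert_avoid[OF w(1) d(1,2)]
	 by (intro CollectI exI[of _ "z L - bd (insert p S) w L"] exI[of _ "slant p w L"]) (simp add: algebra_simps)
 qed
 ultimately show ?thesis by (simp add: kchains_def)
qed

lemma D_hvan_0:
 assumes N: "fi_sub N" and "hvan N G (insert p S) 0"
 shows "D.hvan (D_sub N p) (D_G p) S 0"
 unfolding D.hvan_def
proof (intro ballI impI)
 fix z assume z: "z:kchains (D_G p) S 0"
 note z' = D_chains[OF z]
 have "bd (insert p S) z:kchains N (insert p S) (0 - 1)"
	using bd_zero_chain[OF pS(3,4) z'] kchains_zero[OF N pS(3,4), of 0] by simp
 then obtain w where "w:kchains G (insert p S) (Suc 0)" "z - bd (insert p S) w:kchains N (insert p S) 0"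
	using assms(2) z' unfolding hvan_def by blast
 then show "\<exists>w\<in>kchains (D_G p) S (Suc 0). z - D.bd S w:kchains (D_sub N p) S 0"
	using D_hvan_of_insert[OF N z z' avoid_D_chain[OF z]] avoid_chains by blast
qed

text \<open>A 1-cycle of the derivative lifts to S + p because its p-part sits in degree 0, where it
  has to satisfy no further condition. In higher degrees this lifting would be obstructed, so only
  H_0 and H_1 pass to the derivative.\<close>

lemma D_hvan_1:
 assumes N: "fi_sub N" and h: "hvan N G (insert p S) (Suc 0)"
 shows "D.hvan (D_sub N p) (D_G p) S (Suc 0)"
 unfolding D.hvan_def
proof (intro ballI impI)
 fix z0 assume z0: "z0:kchains (D_G p) S (Suc 0)" and "D.bd S z0:kchains (D_sub N p) S (Suc 0 - 1)"
 then have dz0: "D.bd S z0:kchains (D_sub N p) S 0" by simp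
 obtain u where u: "u:kchains G S 0"
	"!!L. L:dlists S 0==>D.bd S z0 L - m (S - set L) (insert p (S - set L)) id (u L):N (insert p (S - set L))"
	using D_lift[OF N dz0] by blast
 obtain w1 where w1: "w1:kchains G (insert p S) (Suc 0)" "avoid p w1 = 0" "slant p w1 = u"
	using insert_point_chain[OF fi_sub_G u(1)] by blast
 note z0' = D_chains[OF z0]
 \<comment> \<open>The boundary of \<open>z0\<close> is the image of \<open>u\<close> modulo N;
   subtracting p wedge \<open>u\<close> removes it without changing the p-free part.\<close>
 define z where "z = z0 - w1"
 have z: "z:kchains G (insert p S) (Suc 0)" unfolding z_def by (rule kchains_diff[OF fi_sub_G pS(3,4) z0' w1(1)])
 have az: "avoid p z = z0" unfolding z_def avoid_diff avoid_D_chain[OF z0] w1(2) by simp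
 have sz: "slant p z = - u" unfolding z_def slant_diff slant_D_chain[OF z0] w1(3) by simp
 have nil: "[]:dlists S 0" by (simp add: dlists_def)
 have uS: "u []:G S" using kchainsD[OF u(1) nil] by simp
 have "bd (insert p S) z [] = D.bd S z0 [] - m S (insert p S) id (u [])"
	using bd_insert_avoid[OF z, of "[]"] az sz m_uminus[OF S(1) pS(2-4) _ uS] by (simp add: emb_def subset_insertI)
 then have "bd (insert p S) z []:N (insert p S)" using u(2)[OF nil] by simp
 then have "bd (insert p S) z:kchains N (insert p S) (Suc 0 - 1)"
	using kchains_alternating[OF bd_chains[OF fi_sub_G pS(3,4) z]] pS N by (auto intro!: chain_0_eqI)
 then obtain w where "w:kchains G (insert p S) (Suc (Suc 0))" "z - bd (insert p S) w:kchains N (insert p S) (Suc 0)"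
	using h z unfolding hvan_def by blast
 then show "\<exists>w\<in>kchains (D_G p) S (Suc (Suc 0)). z0 - D.bd S w:kchains (D_sub N p) S (Suc 0)"
	using D_hvan_of_insert[OF N z0 z az] avoid_chains by blast
qed

text \<open>The sets T + p and T + q are isomorphic relative to T.\<close>

lemma kernel_any_point:
 assumes N: "fi_sub N" and T: "finite T" "T<=Om" "p~:T" "q:Om" "q~:T"
	and x: "x:G T" "m T (insert p T) id x:N (insert p T)"
 shows "m T (insert q T) id x:N (insert q T)"
proof -
 have e: "emb id T (insert p T)" "emb (id(p := q)) (insert p T) (insert q T)" "emb id T (insert q T)"
	using T unfolding emb_def inj_on_def by auto
 have f: "finite (insert p T)" "insert p T<=Om" "finite (insert q T)" "insert q T<=Om" using T p by auto
 have "m (insert p T) (insert q T) (id(p := q)) (m T (insert p T) id x) = m T (insert q T) (id(p := q)\<circ>id) x"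
	using m_comp[OF T(1,2) f e(1,2) x(1)] .
 also have "... = m T (insert q T) id x"
	by (rule m_cong[OF T(1,2) f(3,4) emb_comp[OF e(1,2)] x(1)]) (use T in auto)
 finally show ?thesis using fi_sub_m[OF N f e(2) x(2)] by simp
qed

text \<open>If x dies in V(S + p), then p wedge x is a 1-cycle on S + p, hence the boundary of some
  \<open>w\<close>. Since H_2 of the derivative vanishes, \<open>w\<close> may be taken with p-free
  part in N. Then x is, up to sign and N, the boundary of the p-part of \<open>w\<close>, whose
  values lie in kernels that already die in V(S).\<close>

lemma kernel_vanishes:
 assumes N: "fi_sub N" and h: "hvan N G (insert p S) (Suc 0)"
	and D: "D.hvan (D_sub N p) (D_G p) S (Suc (Suc 0))"
	and x: "x:G S" "m S (insert p S) id x:N (insert p S)"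
 shows "x:N S"
proof -
 have e: "emb id S (insert p S)" by (auto simp: emb_def)
 have nil: "[]:dlists S 0" by (simp add: dlists_def)
 obtain z where z: "z:kchains G (insert p S) (Suc 0)" "avoid p z = 0" "slant p z = (%L. if L = [] then x else 0)"
	using insert_point_chain[OF fi_sub_G zero_chain[OF x(1) S(1) pS(2)]] by blast
 have zp: "z [p] = x" using fun_cong[OF z(3), of "[]"] by (simp add: slant_def)
 have "bd (insert p S) z [] = m S (insert p S) id x"
	using bd_insert_avoid[OF z(1), of "[]"] z(2,3) D.bd_zero[OF S] by simp
 then have "bd (insert p S) z:kchains N (insert p S) (Suc 0 - 1)"
	using kchains_alternating[OF bd_chains[OF fi_sub_G pS(3,4) z(1)]] x(2) by (auto simp: kchains_def dlists_def)
 then obtain w where w: "w:kchains G (insert p S) (Suc (Suc 0))" "z - bd (insert p S) w:kchains N (insert p S) (Suc 0)"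
	using h z(1) unfolding hvan_def by blast
 have wL: "bd (insert p S) w L:N (insert p (S - set L))" if L: "L:dlists S (Suc 0)" for L
 proof -
	have d: "p~:set L" "L:dlists (insert p S) (Suc 0)" using L pS(1) by (auto simp: dlists_def)
	have "z L = 0" using fun_cong[OF z(2), of L] d by (simp add: avoid_def)
	then have "- bd (insert p S) w L:N (insert p (S - set L))"
	 using kchainsD[OF w(2) d(2)] insert_Diff_set[OF d(1)] by simp
	then show ?thesis using fi_sub_uminus[OF N, of "insert p (S - set L)" "- bd (insert p S) w L"] pS S by auto
 qed
 have "D.bd S (avoid p w):kchains (D_sub N p) S (Suc (Suc 0) - 1)"
 proof -
	have "D.bd S (avoid p w) L:D_sub N p (S - set L)" if L: "L:dlists S (Suc 0)" for L
	proof -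
	 have d: "distinct L" "set L<=S" using L by (auto simp: dlists_def)
	 have T: "finite (S - set L)" "S - set L<=Om" "finite (insert p (S - set L))" "insert p (S - set L)<=Om"
		"emb id (S - set L) (insert p (S - set L))" using pS S by (auto simp: emb_def)
	 have sl: "slant p w L:G (S - set L)" using kchainsD[OF slant_chains_gen[OF w(1)] L] .
	 have "D.bd S (avoid p w) L = bd (insert p S) w L + m (S - set L) (insert p (S - set L)) id (- slant p w L)"
		using bd_insert_avoid[OF w(1) d] m_uminus[OF T sl] by simp
	 then show ?thesis unfolding D_sub_def using wL[OF L] fi_sub_uminus[OF fi_sub_G T(1,2) sl] by blast
	qed
	then show ?thesis using D.bd_chains[OF D.fi_sub_G S avoid_chains[OF w(1)]] by (simp add: kchains_def)
 qed
 then obtain v where v: "v:kchains G (insert p S) (Suc (Suc (Suc 0)))"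
	"!!L. L:dlists S (Suc (Suc 0))==>w L - bd (insert p S) v L:N (insert p (S - set L))"
	using D_reduce[OF N w(1) _ D] by blast
 define w' where "w' = w - bd (insert p S) v"
 have w': "w':kchains G (insert p S) (Suc (Suc 0))"
	unfolding w'_def using kchains_diff[OF fi_sub_G pS(3,4) w(1) bd_chains[OF fi_sub_G pS(3,4) v(1)]] .
 have bw': "bd (insert p S) w' = bd (insert p S) w"
	unfolding w'_def using bd_diff[OF pS(3,4) w(1) bd_chains[OF fi_sub_G pS(3,4) v(1)]] bd_bd[OF pS(3,4) v(1)] by simp
 have w'N: "w' L:N (insert p (S - set L))" if "L:dlists S (Suc (Suc 0))" for L
	using v(2)[OF that] by (simp add: w'_def)
 define y where "y = slant p w'"
 have y: "y:kchains G S (Suc 0)" unfolding y_def by (rule slant_chains_gen[OF w'])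
 \<comment> \<open>The value at \<open>[q]\<close> dies in V(S - q + p); by
   \<open>kernel_any_point\<close> it also dies when q itself is put back.\<close>
 have yK: "m (S - {q}) S id (y [q]):N S" if q: "q:S" for q
 proof -
	have L: "[q]:dlists S (Suc 0)" using q by (auto simp: dlists_def)
	have T: "finite (insert p (S - {q}))" "insert p (S - {q})<=Om" using pS S by auto
	have "D.bd S (avoid p w') [q]:N (insert p (S - set [q]))"
	 by (rule D_bd_avoid_in[OF w' w'N N]) (use L in auto)
	then have "m (S - {q}) (insert p (S - {q})) id (y [q]):N (insert p (S - {q}))"
	 using bd_insert_avoid[OF w', of "[q]"] bw' wL[OF L] q fi_sub_diff[OF N T] unfolding y_def
	 by (metis add_diff_cancel_left' distinct_singleton empty_set empty_subsetI insert_subset list.simps(15))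
	moreover have "y [q]:G (S - {q})" using kchainsD[OF y L] by simp
	moreover have "insert q (S - {q}) = S" using q by auto
	ultimately show ?thesis using kernel_any_point[OF N, of "S - {q}" q "y [q]"] S pS q by auto
 qed
 have "bd S y []:N S" unfolding bd_def using yK by (auto intro!: fi_sub_sum[OF N S(1) pS(2)])
 moreover have "z [p] - bd (insert p S) w [p]:N (insert p S - set [p])"
	using kchainsD[OF w(2), of "[p]"] by (simp add: dlists_def)
 then have "x + bd S y []:N S"
	using bd_insert_slant[OF w', of "[]"] bw' zp pS(1) unfolding y_def by simp
 ultimately show ?thesis using fi_sub_diff[OF N S(1) pS(2)] by (metis add_diff_cancel_right')
qed

end

end

subsection \<open>Finite regularity\<close>

text \<open>Nakayama's lemma by induction on S: boundaries of 1-chains involve only values at S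
  minus a point, which lie in N already.\<close>

lemma (in fi_group) sub_eq_if_hvan_0:
 assumes N: "fi_sub N" and h: "!!S. finite S==>S<=Om==>hvan N G S 0" and S: "finite S" "S<=Om"
 shows "G S<=N S"
 using S
proof (induction S rule: finite_psubset_induct)
 case (psubset S)
 show ?case
 proof
	fix x assume x: "x:G S"
	let ?z = "%L::nat list. if L = [] then x else 0"
	have z: "?z:kchains G S 0" by (rule zero_chain[OF x psubset.hyps(1) psubset.prems])
	have "bd S ?z:kchains N S (0 - 1)"
	 using bd_zero_chain[OF psubset.hyps(1) psubset.prems z] kchains_zero[OF N psubset.hyps(1) psubset.prems, of 0] by simp
	then obtain w where w: "w:kchains G S (Suc 0)" "?z - bd S w:kchains N S 0"
	 using h[OF psubset.hyps(1) psubset.prems] z unfolding hvan_def by blast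
	have "m (S - {q}) S id (w [q]):N S" if q: "q:S" for q
	proof -
	 have "w [q]:G (S - {q})" using kchainsD[OF w(1), of "[q]"] q by (auto simp: dlists_def)
	 moreover have "G (S - {q})<=N (S - {q})" by (rule psubset.IH) (use q psubset.prems in auto)
	 ultimately show ?thesis
		by (intro fi_sub_m[OF N]) (use psubset.hyps(1) psubset.prems in \<open>auto simp: emb_def\<close>)
	qed
	then have "bd S w []:N S" unfolding bd_def
	 by (auto intro!: fi_sub_sum[OF N psubset.hyps(1) psubset.prems])
	moreover have "x - bd S w []:N S" using kchainsD[OF w(2), of "[]"] by (simp add: dlists_def)
	ultimately show "x:N S" using fi_sub_add[OF N psubset.hyps(1) psubset.prems] by fastforce
 qed
qed

text \<open>Church's induction on the generation degree: the derivative \<open>V(S + p) / V(S)\<close> is generated in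
 smaller degree, and its second homology controls the kernel of \<open>V(S) \<rightarrow> V(S + p)\<close>.\<close>

theorem fi_group_regularity:
 fixes G :: "nat set=>'g::ab_group_add set"
 assumes "fi_group Om G m" "fi_group.fi_sub Om G m N"
	and "!!S. finite S==>S<=Om==>k\<le>card S==>fi_group.hvan m N G S 0"
	and "!!S. finite S==>S<=Om==>d\<le>card S==>fi_group.hvan m N G S (Suc 0)"
	and "finite S" "S<=Om" "2 * k + d + Suc j\<le>card S"
 shows "fi_group.hvan m N G S (Suc j)"
 using assms
proof (induction k arbitrary: Om G m N S j)
 case 0
 interpret fi_group Om G m by fact
 have "G T<=N T" if "finite T" "T<=Om" for T
	by (rule sub_eq_if_hvan_0[OF 0(2) _ that]) (use 0(3) in auto)
 then show ?case using 0(5,6)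
	by (intro hvan_zero[OF 0(2) fi_sub_G]) (auto dest: finite_subset)
next
 case (Suc k)
 interpret fi_group Om G m by fact
 note N = Suc.prems(2)
 obtain p where p: "p:S" using Suc.prems(7) by (cases "S = {}") auto
 define S' where "S' = S - {p}"
 have pO: "p:Om" using p Suc.prems by auto
 have S': "S = insert p S'" "finite S'" "S'<=Om - {p}" "card S = Suc (card S')"
	using p Suc.prems by (auto simp: S'_def card_Suc_Diff1)
 have D: "fi_group (Om - {p}) (D_G p) (D_m p)" by (rule fi_group_D[OF pO])
 note DN = D_sub_fi_sub[OF pO N]
 have cins: "card (insert p T) = Suc (card T)" "finite (insert p T)" "insert p T<=Om" if "finite T" "T<=Om - {p}" for T
	using that pO by (auto intro!: card_insert_disjoint)
 \<comment> \<open>The set T + p has one point more than T, so the bound for H_0 drops from k + 1 to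
   k on passing to the derivative, while the bound d for H_1 persists.\<close>
 have D0: "fi_group.hvan (D_m p) (D_sub N p) (D_G p) T 0" if "finite T" "T<=Om - {p}" "k\<le>card T" for T
	using D_hvan_0[OF pO that(1,2) N Suc.prems(3)] cins[OF that(1,2)] that by auto
 have D1: "fi_group.hvan (D_m p) (D_sub N p) (D_G p) T (Suc 0)" if "finite T" "T<=Om - {p}" "d\<le>card T" for T
	using D_hvan_1[OF pO that(1,2) N Suc.prems(4)] cins[OF that(1,2)] that by auto
 note IH = Suc.IH[OF D DN D0 D1]
 have K: "x:N T" if T: "T<=S'" "card T + j = card S'" and x: "x:G T" "m T (insert p T) id x:N (insert p T)" for T x
 proof -
	have T': "finite T" "T<=Om - {p}" using T S' finite_subset by auto
	\<comment> \<open>The slope 2 originates here: T has 1 + j points fewer than S, and the induction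
	  hypothesis is needed for H_2 of the derivative at T, which requires 2k + d + 2 points.\<close>
	have c: "2 * k + d + Suc (Suc 0)\<le>card T" using T(2) S'(4) Suc.prems(7) by simp
	show ?thesis
	 by (rule kernel_vanishes[OF pO T' N Suc.prems(4) IH x]) (use cins[OF T'] c T' in auto)
 qed
 have "fi_group.hvan (D_m p) (D_sub N p) (D_G p) S' (Suc j)"
	by (rule IH) (use S' Suc.prems(7) in auto)
 then show ?case unfolding S'(1)
	using hvan_insert[OF pO S'(2,3) N _ K] by blast
qed

subsection \<open>Non-vanishing from torsion elements\<close>

text \<open>An element \<open>x\<close> of \<open>V(C)\<close> killed by all larger sets is a Koszul cycle. If it were a boundary, its
 signed average over the involutions exchanging points of \<open>C\<close> with points outside \<open>C\<close> would be \<open>0\<close>,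
 although that average only sees the component \<open>x\<close>.\<close>

lemma sum_Pow_involution:
 fixes F :: "'i set=>'g::ab_group_add"
 assumes "finite C" "c:C" "!!P. P<=C==>c~:P==>F (insert c P) = - F P"
 shows "(\<Sum>P\<in>Pow C. F P) = 0"
proof -
 have e: "Pow C = Pow (C - {c})\<union>insert c ` Pow (C - {c})"
	using assms(2) Pow_insert[of c "C - {c}"] by (simp add: insert_absorb)
 have inj: "inj_on (insert c) (Pow (C - {c}))" by (auto simp: inj_on_def)
 have "(\<Sum>P\<in>Pow C. F P) = (\<Sum>P\<in>Pow (C - {c}). F P) + (\<Sum>P\<in>insert c ` Pow (C - {c}). F P)"
	unfolding e by (rule sum.union_disjoint) (use assms(1) in auto)
 also have "(\<Sum>P\<in>insert c ` Pow (C - {c}). F P) = (\<Sum>P\<in>Pow (C - {c}). F (insert c P))"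
	using inj by (simp add: sum.reindex)
 also have "... = (\<Sum>P\<in>Pow (C - {c}). - F P)" by (rule sum.cong[OF refl]) (use assms(3) in auto)
 finally show ?thesis by (simp add: sum_negf)
qed

lemma (in fi_group) nonvanishing:
 assumes N: "fi_sub N" and C: "finite C" "C<=Om" and x: "x:G C" "x~:N C"
	and kill: "!!q. q:Om - C==>m C (insert q C) id x:N (insert q C)"
	and S: "finite S" "S<=Om" "C<=S" "card S = card C + i" "card C\<le>i"
 shows "\<not> hvan N G S i"
proof
 assume h: "hvan N G S i"
 define B where "B = S - C"
 have B: "finite B" "card B = i" "B<=S" "S - B = C" "B\<inter>C = {}" using S C by (auto simp: B_def card_Diff_subset)
 \<comment> \<open>Partners outside C for all points of C; their existence is exactly the condition
   that C has at most i points.\<close>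
 obtain b where b: "b ` C<=B" "inj_on b C"
	using card_le_inj[OF C(1) B(1)] S(5) B(2) by auto
 \<comment> \<open>\<open>tw P\<close> exchanges c with \<open>b c\<close> for all c in P and fixes
   every other point; it is an involution of S.\<close>
 define tw where "tw P y = (if y:P then b y else if y:b ` P then inv_into C b y else y)" for P y
 have twc: "tw P c = (if c:P then b c else c)" if "P<=C" "c:C" for P c
	using that b B by (auto simp: tw_def)
 have twb: "tw P (b c) = (if c:P then c else b c)" if "P<=C" "c:C" for P c
 proof -
	have "b c~:P" using that b B by auto
	moreover have "b c:b ` P<->c:P" using that b by (auto dest: inj_onD)
	moreover have "inv_into C b (b c) = c" using that b by simp
	ultimately show ?thesis by (simp add: tw_def)
 qed
 have two: "tw P y = y" if "P<=C" "y~:C" "y~:b ` C" for P y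
	using that by (auto simp: tw_def)
 have inv: "tw P (tw P y) = y" if P: "P<=C" for P y
 proof (cases "y:C\<or>y:b ` C")
	case True
	then show ?thesis using twc[OF P] twb[OF P] by auto
 next
	case False then show ?thesis using two[OF P] by simp
 qed
 have twS: "tw P y:S" if "P<=C" "y:S" for P y
	proof -
	have CS: "C<=S" "b ` C<=S" using b(1) B(3) S(3) by auto
	show ?thesis using that twc[of P y] twb[of P] two[of P y] CS by (cases "y:C\<or>y:b ` C") (auto split: if_splits)
 qed
 have twinj: "inj (tw P)" if "P<=C" for P using inv[OF that] by (metis injI)
 define L0 where "L0 = sorted_list_of_set B"
 have L0: "distinct L0" "set L0 = B" "length L0 = i" using B by (auto simp: L0_def)
 define L where "L P = map (tw P) L0" for P
 have L: "distinct (L P)" "set (L P) = tw P ` B" "length (L P) = i" "set (L P)<=S" if "P<=C" for P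
	using L0 twinj[OF that] twS[OF that] B(3) by (auto simp: L_def distinct_map inj_on_def inj_def)
 have Ld: "L P:dlists S i" if "P<=C" for P using L[OF that] by (simp add: dlists_def)
 have comp: "S - set (L P) = tw P ` C" if P: "P<=C" for P
 proof -
	have "tw P ` S = S"
	proof
	 show "tw P ` S<=S" using twS[OF P] by auto
	 show "S<=tw P ` S"
	 proof
		fix y assume "y:S"
		then show "y:tw P ` S" using twS[OF P] inv[OF P, of y] by (metis imageI)
	 qed
	qed
	then have "tw P ` (S - B) = S - tw P ` B" using image_set_diff[OF twinj[OF P]] by metis
	then show ?thesis using L[OF P] B(4) by simp
 qed
 have compS: "finite (tw P ` C)" "tw P ` C<=Om" "emb (tw P) (tw P ` C) C" if P: "P<=C" for P
 proof -
	show "finite (tw P ` C)" using C by simp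
	show "tw P ` C<=Om" using twS[OF P] S by auto
	show "emb (tw P) (tw P ` C) C" using inv[OF P] twinj[OF P] by (auto simp: emb_def intro: inj_on_subset)
 qed
 define Lm where "Lm z = (\<Sum>P\<in>Pow C. m (tw P ` C) C (tw P) (z (L P)))" for z
 have val: "z (L P):A (tw P ` C)" if "z:kchains A S i" "P<=C" for z A P
	using kchainsD[OF that(1) Ld[OF that(2)]] comp[OF that(2)] by simp
 have LmN: "Lm z:N C" if "z:kchains N S i" for z
	unfolding Lm_def using val[OF that] compS C
	by (intro fi_sub_sum[OF N C] fi_sub_m[OF N]) auto
 have Lmdiff: "Lm (z - w) = Lm z - Lm w" if "z:kchains G S i" "w:kchains G S i" for z w
	unfolding Lm_def sum_subtractf[symmetric] minus_apply
	using val[OF that(1)] val[OF that(2)] compS C by (intro sum.cong[OF refl] m_diff) auto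
 have Lmbd: "Lm (bd S w) = 0" if w: "w:kchains G S (Suc i)" for w
 proof -
	define F where "F c P = m (tw P ` C - {tw P c}) C (tw P) (w (tw P c # L P))" for c P
	have mem: "w (tw P c # L P):G (tw P ` C - {tw P c})" if P: "P<=C" "c:C" for P c
	proof -
	 have "S - set (tw P c # L P) = tw P ` C - {tw P c}" unfolding comp[OF P(1), symmetric] by auto
	 then show ?thesis using kchains_in[OF fi_sub_G S(1,2) w, of "tw P c # L P"] by (simp only:)
	qed
	have "m (tw P ` C) C (tw P) (bd S w (L P)) = (\<Sum>c\<in>C. F c P)" if P: "P<=C" for P
	proof -
	 have s: "S - insert y (set (L P)) = tw P ` C - {y}" for y using comp[OF P] by auto
	 have "bd S w (L P) = (\<Sum>y\<in>tw P ` C. m (tw P ` C - {y}) (tw P ` C) id (w (y # L P)))"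
		unfolding bd_def s comp[OF P] using L[OF P] by simp
	 also have "... = (\<Sum>c\<in>C. m (tw P ` C - {tw P c}) (tw P ` C) id (w (tw P c # L P)))"
		using inj_on_subset[OF twinj[OF P]] by (simp add: sum.reindex)
	 finally have "m (tw P ` C) C (tw P) (bd S w (L P)) =
		 (\<Sum>c\<in>C. m (tw P ` C) C (tw P) (m (tw P ` C - {tw P c}) (tw P ` C) id (w (tw P c # L P))))"
		using compS[OF P] C mem[OF P]
		by (simp only:) (intro m_sum m_in; auto simp: emb_def)
	 also have "... = (\<Sum>c\<in>C. F c P)"
		unfolding F_def
	 proof (rule sum.cong[OF refl])
		fix c assume c: "c:C"
		have "m (tw P ` C) C (tw P) (m (tw P ` C - {tw P c}) (tw P ` C) id (w (tw P c # L P))) =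
		 m (tw P ` C - {tw P c}) C (tw P\<circ>id) (w (tw P c # L P))"
		 using compS[OF P] C mem[OF P c] by (intro m_comp) (auto simp: emb_def)
		then show "m (tw P ` C) C (tw P) (m (tw P ` C - {tw P c}) (tw P ` C) id (w (tw P c # L P))) =
		 m (tw P ` C - {tw P c}) C (tw P) (w (tw P c # L P))" by (simp only: comp_id)
	 qed
	 finally show ?thesis .
	qed
	then have "Lm (bd S w) = (\<Sum>P\<in>Pow C. \<Sum>c\<in>C. F c P)" unfolding Lm_def by (intro sum.cong) auto
	also have "... = (\<Sum>c\<in>C. \<Sum>P\<in>Pow C. F c P)" by (rule sum.swap)
	also have "... = 0"
	\<comment> \<open>For fixed c the terms of P and P + c cancel. Their lists differ by the exchange
	  of c and \<open>b c\<close>; the structure maps agree because the point of the complement where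
	  the involutions differ has been removed.\<close>
	proof (rule sum.neutral, rule ballI)
	 fix c assume c: "c:C"
	 show "(\<Sum>P\<in>Pow C. F c P) = 0"
	 proof (rule sum_Pow_involution[OF C(1) c])
		fix P assume P: "P<=C" "c~:P"
		let ?Q = "insert c P"
		have Q: "?Q<=C" using P c by auto
		have bc: "b c:B" "b c~:C" "c~:B" using b c B by auto
		have QP: "tw ?Q y = swp c (b c) (tw P y)" for y
		proof (cases "y:C")
		 case True
		 show ?thesis
		 proof (cases "y = c")
			case True then show ?thesis using twc[OF P(1) c] twc[OF Q c] P by simp
		 next
			case False
			then have "b y~=b c" "b y~=c" "y~=b c" using True c b bc B by (auto dest: inj_onD)
			then show ?thesis using twc[OF P(1) True] twc[OF Q True] False by (simp add: Transposition.transpose_def)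
		 qed
		next
		 case False
		 show ?thesis
		 proof (cases "y:b ` C")
			case True
			then obtain c' where c': "c':C" "y = b c'" by auto
			show ?thesis
			proof (cases "c' = c")
			 case True then show ?thesis using c' twb[OF P(1) c] twb[OF Q c] P by simp
			next
			 case False
			 then have "b c'~=b c" "b c'~=c" "c'~=b c" using c' c b bc B by (auto dest: inj_onD)
			 then show ?thesis using twb[OF P(1) c'(1)] twb[OF Q c'(1)] False c' by (simp add: Transposition.transpose_def)
			qed
		 next
			case nb: False
			then have "y~=c" "y~=b c" using False c by auto
			then show ?thesis using two[OF P(1) False nb] two[OF Q False nb] by (simp add: Transposition.transpose_def)
		 qed
		qed
		have Pc: "tw P c = c" "tw P (b c) = b c" "tw ?Q c = b c" using twc[OF P(1) c] twb[OF P(1) c] twc[OF Q c] P by auto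
		have list: "tw ?Q c # L ?Q = map (swp c (b c)) (tw P c # L P)"
		 unfolding L_def using QP Pc by simp
		have bL: "b c:set (L P)" using L(2)[OF P(1)] bc Pc by force
		have wneg: "w (tw ?Q c # L ?Q) = - w (tw P c # L P)"
		 unfolding list by (rule alternatingD[OF kchains_alternating[OF w]]) (use bL Pc bc c in auto)
		have dom: "tw ?Q ` C - {tw ?Q c} = tw P ` C - {tw P c}"
		proof -
		 have "tw ?Q ` (C - {c}) = tw P ` (C - {c})"
		 proof (rule image_cong[OF refl])
			fix y assume y: "y:C - {c}"
			then show "tw ?Q y = tw P y" using twc[OF P(1)] twc[OF Q] by auto
		 qed
		 moreover have "tw R ` C - {tw R c} = tw R ` (C - {c})" if "R<=C" for R
			using twinj[OF that] by (auto simp: inj_def)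
		 ultimately show ?thesis using P Q by simp
		qed
		have e: "emb (tw P) (tw P ` C - {tw P c}) C"
		 using compS(3)[OF P(1)] by (auto simp: emb_def intro: inj_on_subset)
		have f: "finite (tw P ` C - {tw P c})" "tw P ` C - {tw P c}<=Om" using compS[OF P(1)] by auto
		have agree: "tw P s = tw ?Q s" if s: "s:tw P ` C - {tw P c}" for s
		proof -
		 obtain y where y: "y:C" "s = tw P y" "y~=c" using s by auto
		 have "tw P s = y" using inv[OF P(1)] y by simp
		 moreover have "y~=b c" using y bc by auto
		 ultimately show ?thesis using QP[of s] y by (simp add: Transposition.transpose_def)
		qed
		have "F c ?Q = m (tw P ` C - {tw P c}) C (tw ?Q) (- w (tw P c # L P))"
		 unfolding F_def dom wneg ..
		also have "... = m (tw P ` C - {tw P c}) C (tw P) (- w (tw P c # L P))"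
		 by (rule m_cong[OF f C e _ agree, symmetric]) (use fi_sub_uminus[OF fi_sub_G f mem[OF P(1) c]] in auto)
		also have "... = - F c P" unfolding F_def by (rule m_uminus[OF f C e mem[OF P(1) c]])
		finally show "F c ?Q = - F c P" .
	 qed
	qed
	finally show ?thesis .
 qed
 \<comment> \<open>The chain with value x on B = S - C and 0 on all other i-subsets.\<close>
 obtain z where z: "alternating S i z"
	"!!M. M<=S==>card M = i==>z (sorted_list_of_set M) = (if M = B then x else 0)"
	using alternating_extension[OF enumeration_sorted S(1), of i "%M. if M = B then x else 0"] by auto
 have zG: "z:kchains G S i"
	by (rule kchainsI[OF fi_sub_G S(1,2) z(1) enumeration_sorted]) (use z(2) x B S C in \<open>auto intro!: G_zero\<close>)
 have zL0: "z L0 = x" unfolding L0_def using z(2)[OF B(3,2)] by simp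
 have zoff: "z M = 0" if "set M~=B" for M
 proof (cases "M:dlists S i")
	case True
	then have "z (sorted_list_of_set (set M)) = 0" "distinct M"
	 using z(2)[of "set M"] that distinct_card[of M] by (auto simp: dlists_def)
	then show ?thesis using alternating_value[OF z(1) enumeration_sorted, of M] by auto
 qed (rule alternatingD0[OF z(1)])
 have zon: "z M = x\<or>z M = - x" if "set M = B" "distinct M" for M
	using alternating_value[OF z(1) enumeration_sorted that(2)] that zL0 by (simp add: L0_def)
 have "bd S z M:N (S - set M)" for M
 proof (cases "distinct M&set M<=S")
	case True
	have fM: "finite (S - set M)" "S - set M<=Om" using S by auto
	have "m (S - insert y (set M)) (S - set M) id (z (y # M)):N (S - set M)" if y: "y:S - set M" for y
	\<comment> \<open>Only when adding y completes the list to B does x appear, and then through its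
	  image in V(C + y), which lies in N by \<open>kill\<close>.\<close>
	proof (cases "insert y (set M) = B")
	 case True2: True
	 have s1: "S - insert y (set M) = C" using True2 B by simp
	 have s2: "S - set M = insert y C" using True2 B y by auto
	 have yC: "y:Om - C" using y True2 B S by auto
	 have "z (y # M) = x\<or>z (y # M) = - x" using zon[of "y # M"] True2 True y by simp
	 moreover have "m C (insert y C) id x:N (insert y C)" using kill[OF yC] .
	 moreover have "m C (insert y C) id (- x) = - m C (insert y C) id x"
		using C yC x by (intro m_uminus) (auto simp: emb_def)
	 ultimately show ?thesis unfolding s1 s2
		using fi_sub_uminus[OF N, of "insert y C"] C yC by auto
	next
	 case False
	 then have "z (y # M) = 0" using zoff[of "y # M"] by simp
	 moreover have "m (S - insert y (set M)) (S - set M) id 0 = 0" using S by (intro m_zero) (auto simp: emb_def)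
	 ultimately show ?thesis using fi_sub_zero[OF N fM] by simp
	qed
	then show ?thesis unfolding bd_def using True by (auto intro!: fi_sub_sum[OF N fM])
 next
	case False
	then have "bd S z M = 0" by (auto simp: bd_def)
	then show ?thesis using fi_sub_zero[OF N, of "S - set M"] S by auto
 qed
 moreover have "alternating S (i - 1) (bd S z)"
 proof (cases i)
	case 0
	then show ?thesis using bd_zero_chain[OF S(1,2)] zG alternating_zero by simp
 next
	case (Suc j)
	then show ?thesis using bd_chains[OF fi_sub_G S(1,2)] zG kchains_alternating by fastforce
 qed
 ultimately have "bd S z:kchains N S (i - 1)" by (simp add: kchains_def)
 then obtain w where w: "w:kchains G S (Suc i)" "z - bd S w:kchains N S i"
	using h zG unfolding hvan_def by blast
 have "Lm (z - bd S w) = Lm z"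
	using Lmdiff[OF zG bd_chains[OF fi_sub_G S(1,2) w(1)]] Lmbd[OF w(1)] by simp
 then have "Lm z:N C" using LmN[OF w(2)] by simp
 \<comment> \<open>For nonempty P the list \<open>L P\<close> contains a point of C, so
   \<open>z\<close> vanishes on it; the term of P = {} is x.\<close>
 moreover have "Lm z = x"
 proof -
	have "m (tw P ` C) C (tw P) (z (L P)) = 0" if P: "P:Pow C - {{}}" for P
	proof -
	 obtain c where c: "c:P" "c:C" using P by auto
	 have PC: "P<=C" using P by auto
	 have "tw P (b c) = c" "b c:B" using twb[OF PC c(2)] c b by auto
	 then have "c:set (L P)" unfolding L(2)[OF PC] by force
	 then have "set (L P)~=B" using c B by auto
	 then have "z (L P) = 0" by (rule zoff)
	 then show ?thesis using m_zero compS[OF PC] C by simp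
	qed
	then have "Lm z = m (tw {} ` C) C (tw {}) (z (L {}))"
	 unfolding Lm_def using C by (subst sum.remove[of _ "{}"]) auto
	moreover have "tw {} = id" by (auto simp: tw_def)
	ultimately show ?thesis using zL0 m_id[OF C x(1)] by (simp add: L_def)
 qed
 ultimately show False using x by simp
qed

subsection \<open>Acyclicity from retractions\<close>

context fi_group
begin

text \<open>Inserting \<open>p\<close> and retracting is a homotopy that moves a cycle to one supported on
 lists avoiding \<open>p\<close> only up to elements vanishing after retraction; doing this for every point of \<open>S\<close>
 kills every cycle of positive degree.\<close>

lemma hvan_retraction:
 assumes N: "fi_sub N" and S: "finite S" "S<=Om"
	and r_in: "!!S p x. finite S==>S<=Om==>p:S==>x:G S==>r S p x:G (S - {p})"
	and r_diff: "!!S p x y. finite S==>S<=Om==>p:S==>x:G S==>y:G S==>r S p (x - y) = r S p x - r S p y"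
	and r_N: "!!S p x. finite S==>S<=Om==>p:S==>x:N S==>r S p x:N (S - {p})"
	and r_ret: "!!S p x. finite S==>S<=Om==>p:S==>x:G (S - {p})==>r S p (m (S - {p}) S id x) - x:N (S - {p})"
	and r_nat: "!!S p q x. finite S==>S<=Om==>p:S==>q:S==>p~=q==>x:G (S - {q}) ==>
	 r S p (m (S - {q}) S id x) - m (S - {q} - {p}) (S - {p}) id (r (S - {q}) p x):N (S - {p})"
 shows "hvan N G S (Suc j)"
 unfolding hvan_def
proof (intro ballI impI)
 fix z assume z: "z:kchains G S (Suc j)" and "bd S z:kchains N S (Suc j - 1)"
 then have dz: "bd S z:kchains N S j" by simp
 have r_zero: "r S p 0 = 0" if "finite S" "S<=Om" "p:S" for S p
	using r_diff[OF that, of 0 0] G_zero[OF that(1,2)] by simp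
 have r_uminus: "r S p (- x) = - r S p x" if "finite S" "S<=Om" "p:S" "x:G S" for S p x
	using r_diff[OF that(1-3), of 0 x] G_zero[OF that(1,2)] that r_zero by simp
 have r_sum: "r S p (sum f I) = (\<Sum>i\<in>I. r S p (f i))" if "finite S" "S<=Om" "p:S" "!!i. i:I==>f i:G S" for S p f and I :: "nat set"
	using that(4)
 proof (induction I rule: infinite_finite_induct)
	case (insert a I)
	have s: "sum f I:G S" by (rule fi_sub_sum[OF fi_sub_G that(1,2)]) (use insert in auto)
	have "r S p (f a + sum f I) = r S p (f a - (- sum f I))" by simp
	also have "... = r S p (f a) + r S p (sum f I)"
	 using r_diff[OF that(1-3) _ fi_sub_uminus[OF fi_sub_G that(1,2) s]] r_uminus[OF that(1-3) s] insert.prems by simp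
	finally show ?case using insert by simp
 qed (use r_zero that in auto)
 \<comment> \<open>X collects the points already treated: modulo a boundary, \<open>z\<close> has
   values in N on all lists meeting X. For X = S this covers every nonempty list.\<close>
 have "\<exists>w\<in>kchains G S (Suc (Suc j)). \<forall>L\<in>dlists S (Suc j). set L\<inter>X~={}-->(z - bd S w) L:N (S - set L)"
	if "finite X" "X<=S" for X
	using that
 proof (induction X rule: finite_induct)
	case empty
	show ?case using kchains_zero[OF fi_sub_G S] by auto
 next
	case (insert p X)
	then obtain w where w: "w:kchains G S (Suc (Suc j))"
	 "!!L. L:dlists S (Suc j)==>set L\<inter>X~={}==>(z - bd S w) L:N (S - set L)" by auto
	define y where "y = z - bd S w"
	have y: "y:kchains G S (Suc j)" unfolding y_def
	 using kchains_diff[OF fi_sub_G S z bd_chains[OF fi_sub_G S w(1)]] .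
	have dy: "bd S y:kchains N S j"
	 unfolding y_def using bd_diff[OF S z bd_chains[OF fi_sub_G S w(1)]] bd_bd[OF S w(1)] dz by simp
	define S' where "S' = S - {p}"
	have p: "p:S" "p:Om" using insert S by auto
	have S': "finite S'" "S'<=Om - {p}" "insert p S' = S" "p~:S'" "S'<=Om" using S p by (auto simp: S'_def)
	interpret D: fi_group "Om - {p}" "D_G p" "D_m p" by (rule fi_group_D[OF p(2)])
	\<comment> \<open>The homotopy is p wedge the retraction of the p-free part of
	  \<open>y\<close>.\<close>
	define u where "u L = (if L:dlists S' (Suc j) then r (S - set L) p (y L) else 0)" for L
	have memL: "finite (S - set L)" "S - set L<=Om" "p:S - set L" "S - set L - {p} = S' - set L"
	 "y L:G (S - set L)" if "L:dlists S' (Suc j)" for L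
	 using that S p kchains_in[OF fi_sub_G S y, of L] by (auto simp: dlists_def S'_def)
	have u: "u:kchains G S' (Suc j)"
	 unfolding kchains_def alternating_def
	proof (intro CollectI conjI allI impI ballI)
	 show "u L = 0" if "L~:dlists S' (Suc j)" for L using that by (simp add: u_def)
	 show "u L:G (S' - set L)" if "L:dlists S' (Suc j)" for L
		using r_in[OF memL(1-3,5)[OF that]] memL(4)[OF that] that by (simp add: u_def)
	 fix L a b assume ab: "a:set L" "b:set L" "(a::nat)~=b"
	 show "u (map (swp a b) L) = - u L"
	 proof (cases "L:dlists S' (Suc j)")
		case True
		have "y (map (swp a b) L) = - y L" by (rule alternatingD[OF kchains_alternating[OF y] ab])
		then show ?thesis unfolding u_def set_map_swp[OF ab(1,2)] dlists_map_swp[OF ab(1,2)]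
		 using True r_uminus[OF memL(1-3,5)[OF True]] by simp
	 next
		case False
		then show ?thesis unfolding u_def dlists_map_swp[OF ab(1,2)] by simp
	 qed
	qed
	obtain w1 where w1: "w1:kchains G S (Suc (Suc j))" "avoid p w1 = 0" "slant p w1 = u"
	 using insert_point_chain[OF p(2) S'(1,2) fi_sub_G u] S'(3) by auto
	have w1': "w1:kchains G (insert p S') (Suc (Suc j))" using w1(1) S'(3) by simp
	define y' where "y' = y - bd S w1"
	have y': "y':kchains G S (Suc j)" unfolding y'_def
	 using kchains_diff[OF fi_sub_G S y bd_chains[OF fi_sub_G S w1(1)]] .
	have y'_avoid: "y' L = y L - m (S - set L - {p}) (S - set L) id (r (S - set L) p (y L))" if L: "L:dlists S' (Suc j)" for L
	proof -
	 have d: "distinct L" "set L<=S'" using L by (auto simp: dlists_def)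
	 have s: "insert p (S' - set L) = S - set L" using memL(3,4)[OF L] by blast
	 have "bd S w1 L = m (S' - set L) (insert p (S' - set L)) id (u L)"
		using bd_insert_avoid[OF p(2) S'(1,2) w1' d] w1(2,3) D.bd_zero[OF S'(1,2)] S'(3) by simp
	 then show ?thesis unfolding y'_def s memL(4)[OF L] u_def using L by simp
	qed
	have y'_slant: "y' (p # L):N (S - set (p # L))" if L: "L:dlists S' j" for L
	proof -
	 have d: "distinct L" "set L<=S'" "p~:set L" using L S'(4) by (auto simp: dlists_def)
	 define T where "T = S - set L"
	 have T: "finite T" "T<=Om" "p:T" "S' - set L = T - {p}" "S - set (p # L) = T - {p}" using S p d by (auto simp: T_def S'_def)
	 have Tp: "finite (T - {p})" "T - {p}<=Om" using T by auto
	 have sub: "S' - insert q (set L) = T - {q} - {p}" "S - insert q (set L) = T - {q}" for q by (auto simp: T_def S'_def)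
	 have yq: "y (q # L):G (T - {q})" for q
		using kchains_in[OF fi_sub_G S y, of "q # L"] sub by simp
	 have up: "u (q # L) = r (T - {q}) p (y (q # L))" if q: "q:T - {p}" for q
		using q L S'(4) sub(2)[of q] by (auto simp: u_def dlists_def T_def S'_def)
	 have emq: "emb id (T - {q}) T" "finite (T - {q})" "T - {q}<=Om" for q using T by (auto simp: emb_def)
	 have inT: "m (T - {q}) T id (y (q # L)):G T" for q
		by (rule m_in[OF emq(2,3) T(1,2) emq(1) yq])
	 have "bd S w1 (p # L) = - bd S' u L"
		using bd_insert_slant[OF p(2) S'(1,2) w1' d(1,2)] w1(3) S'(3) by simp
	 also have "bd S' u L = (\<Sum>q\<in>T - {p}. m (T - {q} - {p}) (T - {p}) id (r (T - {q}) p (y (q # L))))"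
		unfolding bd_def using d(1,2) T(4) sub up by (auto intro!: sum.cong)
	 finally have e1: "bd S w1 (p # L) = - (\<Sum>q\<in>T - {p}. m (T - {q} - {p}) (T - {p}) id (r (T - {q}) p (y (q # L))))" .
	 have e2: "r T p (bd S y L) = (\<Sum>q\<in>T. r T p (m (T - {q}) T id (y (q # L))))"
	 proof -
		have "bd S y L = (\<Sum>q\<in>T. m (T - {q}) T id (y (q # L)))"
		 unfolding bd_def using d(1,2) sub S'(3) by (auto simp: T_def)
		then show ?thesis using r_sum[OF T(1-3)] inT by simp
	 qed
	 \<comment> \<open>Apply the retraction to the cycle condition for \<open>y\<close> and separate
	   the summand of p: what remains are the defects of \<open>r\<close> as a retraction and as a
	   natural map, all in N.\<close>
	 have "y' (p # L) = y (p # L) + (\<Sum>q\<in>T - {p}. m (T - {q} - {p}) (T - {p}) id (r (T - {q}) p (y (q # L))))"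
		unfolding y'_def minus_apply e1 by simp
	 also have "... = r T p (bd S y L) - (r T p (m (T - {p}) T id (y (p # L))) - y (p # L))
		 - (\<Sum>q\<in>T - {p}. r T p (m (T - {q}) T id (y (q # L))) - m (T - {q} - {p}) (T - {p}) id (r (T - {q}) p (y (q # L))))"
		unfolding e2 sum.remove[OF T(1,3)] sum_subtractf by simp
	 also have "...:N (T - {p})"
	 proof (rule fi_sub_diff[OF N Tp], rule fi_sub_diff[OF N Tp])
		have "bd S y L:N T" using kchains_in[OF N S dy, of L] by (simp add: T_def)
		then show "r T p (bd S y L):N (T - {p})" by (rule r_N[OF T(1-3)])
		show "r T p (m (T - {p}) T id (y (p # L))) - y (p # L):N (T - {p})"
		 by (rule r_ret[OF T(1-3) yq])
		show "(\<Sum>q\<in>T - {p}. r T p (m (T - {q}) T id (y (q # L))) - m (T - {q} - {p}) (T - {p}) id (r (T - {q}) p (y (q # L)))):N (T - {p})"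
		proof (rule fi_sub_sum[OF N Tp])
		 fix q assume "q:T - {p}"
		 then have "q:T" "p~=q" by auto
		 then show "r T p (m (T - {q}) T id (y (q # L))) - m (T - {q} - {p}) (T - {p}) id (r (T - {q}) p (y (q # L))):N (T - {p})"
			by (rule r_nat[OF T(1-3) _ _ yq])
		qed
	 qed
	 finally show ?thesis unfolding T(5) .
	qed
	have "y' L:N (S - set L)" if L: "L:dlists S (Suc j)" "set L\<inter>insert p X~={}" for L
	proof -
	 have f: "finite (S - set L)" "S - set L<=Om" using S by auto
	 show ?thesis
	 proof (cases "p:set L")
		case True
		obtain M where M: "distinct (p # M)" "set (p # M) = set L" "y' L = y' (p # M)\<or>y' L = - y' (p # M)"
		 using alternating_head[OF kchains_alternating[OF y'] L(1) True] by blast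
		have "length (p # M) = length L" using M(1,2) L(1) distinct_card unfolding dlists_def by (metis mem_Collect_eq)
		then have "M:dlists S' j" using M L(1) by (auto simp: dlists_def S'_def)
		then have "y' (p # M):N (S - set L)" using y'_slant M(2) by metis
		then show ?thesis using M(3) fi_sub_uminus[OF N f] by auto
	 next
		case False
		then have L': "L:dlists S' (Suc j)" "set L\<inter>X~={}" using L by (auto simp: dlists_def S'_def)
		\<comment> \<open>Points treated earlier stay good, because the retraction preserves N and so does
		  the correction term.\<close>
		have yN: "y L:N (S - set L)" using w(2)[OF L(1) L'(2)] by (simp add: y_def)
		have "m (S - set L - {p}) (S - set L) id (r (S - set L) p (y L)):N (S - set L)"
		 using r_N[OF memL(1-3)[OF L'(1)] yN] f by (intro fi_sub_m[OF N]) (auto simp: emb_def)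
		then show ?thesis unfolding y'_avoid[OF L'(1)] using fi_sub_diff[OF N f yN] by blast
	 qed
	qed
	moreover have "y' = z - bd S (w + w1)"
	 unfolding y'_def y_def bd_add[OF S w(1) w1(1)] by (simp only: diff_diff_eq)
	ultimately show ?case using kchains_add[OF fi_sub_G S w(1) w1(1)] by metis
 qed
 from this[OF S(1) subset_refl] obtain w where w: "w:kchains G S (Suc (Suc j))"
	"!!L. L:dlists S (Suc j)==>set L\<inter>S~={}==>(z - bd S w) L:N (S - set L)" by blast
 have "(z - bd S w) L:N (S - set L)" if "L:dlists S (Suc j)" for L
 proof (rule w(2)[OF that])
	show "set L\<inter>S~={}" using that by (cases L) (auto simp: dlists_def)
 qed
 moreover have "alternating S (Suc j) (z - bd S w)"
	using kchains_diff[OF fi_sub_G S z bd_chains[OF fi_sub_G S w(1)]] kchains_alternating by blast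
 ultimately have "z - bd S w:kchains N S (Suc j)" by (simp add: kchains_def)
 then show "\<exists>w\<in>kchains G S (Suc (Suc j)). z - bd S w:kchains N S (Suc j)" using w(1) by blast
qed

end

subsection \<open>Transfer along isomorphisms of subquotients\<close>

text \<open>The conditions say that \<open>g\<close> induces an isomorphism B/A -> B'/A'. Naturality
  is asked for inclusions only, the only structure maps occurring in the boundary.\<close>

lemma hvan_transfer:
 assumes V: "fi_group Om G m" and V': "fi_group Om G' m'"
	and sub: "fi_group.fi_sub Om G m A" "fi_group.fi_sub Om G m B" "fi_group.fi_sub Om G' m' A'" "fi_group.fi_sub Om G' m' B'"
	and S: "finite S" "S<=Om"
	and g_in: "!!T x. T<=S==>x:B T==>g T x:B' T"
	and g_diff: "!!T x y. T<=S==>x:B T==>y:B T==>g T (x - y) = g T x - g T y"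
	and g_nat: "!!T U x. T<=U==>U<=S==>x:B T==>g U (m T U id x) = m' T U id (g T x)"
	and g_ker: "!!T x. T<=S==>x:B T==>g T x:A' T<->x:A T"
	and g_surj: "!!T y. T<=S==>y:B' T==>\<exists>x\<in>B T. g T x - y:A' T"
 shows "fi_group.hvan m A B S i<->fi_group.hvan m' A' B' S i"
proof -
 interpret V: fi_group Om G m by fact
 interpret V': fi_group Om G' m' by fact
 define push where "push z L = g (S - set L) (z L)" for z L
 have TO: "finite T" "T<=Om" if "T<=S" for T using that S finite_subset by auto
 have g0: "g T 0 = 0" if "T<=S" for T
	using g_diff[OF that, of 0 0] V.fi_sub_zero[OF sub(2) TO[OF that]] by simp
 have gneg: "g T (- x) = - g T x" if "T<=S" "x:B T" for T x
	using g_diff[OF that(1), of 0 x] V.fi_sub_zero[OF sub(2) TO[OF that(1)]] that g0 by simp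
 have gsum: "g T (sum f I) = (\<Sum>i\<in>I. g T (f i))" if "T<=S" "!!i. i:I==>f i:B T" for T f and I :: "nat set"
	using that(2)
 proof (induction I rule: infinite_finite_induct)
	case (insert a I)
	have s: "sum f I:B T" by (rule V.fi_sub_sum[OF sub(2) TO[OF that(1)]]) (use insert in auto)
	have "g T (f a + sum f I) = g T (f a - (- sum f I))" by simp
	also have "... = g T (f a) + g T (sum f I)"
	 using g_diff[OF that(1) _ V.fi_sub_uminus[OF sub(2) TO[OF that(1)] s]] gneg[OF that(1) s] insert.prems by simp
	finally show ?case using insert by simp
 qed (use g0 that in auto)
 have push_alt: "alternating S i (push z)" if z: "z:kchains B S i" for z i
	unfolding alternating_def
 proof (intro conjI allI impI)
	show "push z L = 0" if "L~:dlists S i" for L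
	 using alternatingD0[OF kchains_alternating[OF z] that] g0 by (simp add: push_def)
	fix L a b assume ab: "a:set L" "b:set L" "(a::nat)~=b"
	show "push z (map (swp a b) L) = - push z L"
	 unfolding push_def set_map_swp[OF ab(1,2)] alternatingD[OF kchains_alternating[OF z] ab]
	 by (rule gneg) (use V.kchains_in[OF sub(2) S z] in auto)
 qed
 have push_in: "push z:kchains B' S i" if z: "z:kchains B S i" for z i
	using push_alt[OF z] g_in kchainsD[OF z] by (auto simp: kchains_def push_def)
 have push_A: "push z:kchains A' S i<->z:kchains A S i" if z: "z:kchains B S i" for z i
	using push_alt[OF z] kchains_alternating[OF z] g_ker kchainsD[OF z] by (auto simp: kchains_def push_def)
 have push_diff: "push (z - w) = push z - push w" if "z:kchains B S i" "w:kchains B S i" for z w i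
	using g_diff V.kchains_in[OF sub(2) S that(1)] V.kchains_in[OF sub(2) S that(2)] by (auto simp: push_def fun_eq_iff)
 have push_bd: "push (V.bd S z) = V'.bd S (push z)" if z: "z:kchains B S i" for z i
 proof
	fix L
	show "push (V.bd S z) L = V'.bd S (push z) L"
	proof (cases "distinct L&set L<=S")
	 case True
	 have "push (V.bd S z) L = g (S - set L) (\<Sum>x\<in>S - set L. m (S - insert x (set L)) (S - set L) id (z (x # L)))"
		using True by (simp add: push_def V.bd_def)
	 also have "... = (\<Sum>x\<in>S - set L. g (S - set L) (m (S - insert x (set L)) (S - set L) id (z (x # L))))"
		by (rule gsum) (use V.bd_term[OF sub(2) S z] in auto)
	 also have "... = (\<Sum>x\<in>S - set L. m' (S - insert x (set L)) (S - set L) id (g (S - insert x (set L)) (z (x # L))))"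
		by (rule sum.cong[OF refl], rule g_nat) (use V.bd_term[OF sub(2) S z] in auto)
	 finally show ?thesis using True by (simp add: push_def V'.bd_def)
	qed (auto simp: push_def V.bd_def V'.bd_def g0)
 qed
 \<comment> \<open>Preimages need not depend additively on the element, so they are chosen on sorted
   lists and extended by signs.\<close>
 have lift: "\<exists>z\<in>kchains B S i. push z - y:kchains A' S i" if y: "y:kchains B' S i" for y i
 proof -
	let ?E = "sorted_list_of_set :: nat set=>nat list"
	define v where "v M = (SOME x. x:B (S - M)&g (S - M) x - y (?E M):A' (S - M))" for M
	have v: "v M:B (S - M)&g (S - M) (v M) - y (?E M):A' (S - M)" if M: "M<=S" "card M = i" for M
	proof -
	 have fM: "finite M" using M S finite_subset by blast
	 then have "?E M:dlists S i" using M by (auto simp: dlists_def)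
	 then have "y (?E M):B' (S - M)" using kchainsD[OF y] fM by fastforce
	 then have "EX x. x:B (S - M)&g (S - M) x - y (?E M):A' (S - M)" using g_surj[of "S - M"] by blast
	 then show ?thesis unfolding v_def by (rule someI_ex)
	qed
	obtain z where z: "alternating S i z" "!!M. M<=S==>card M = i==>z (?E M) = v M"
	 using alternating_extension[OF enumeration_sorted S(1), of i v] by blast
	have zB: "z:kchains B S i"
	 by (rule V.kchainsI[OF sub(2) S z(1) enumeration_sorted]) (use z v in auto)
	have "push z - y:kchains A' S i"
	proof (rule V'.kchainsI[OF sub(3) S alternating_diff[OF push_alt[OF zB] kchains_alternating[OF y]] enumeration_sorted])
	 fix M assume M: "M<=S" "card M = i"
	 then have "finite M" using S finite_subset by blast
	 then show "(push z - y) (?E M):A' (S - M)" using v[OF M] z(2)[OF M] by (simp add: push_def)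
	qed
	then show ?thesis using zB by blast
 qed
 have bdB: "V.bd S z:kchains B S (i - 1)" if z: "z:kchains B S i" for z i
 proof (cases i)
	case 0
	then show ?thesis using V.bd_zero_chain[OF S] V.kchains_sub[OF sub(2) S z] V.kchains_zero[OF sub(2) S, of 0] by simp
 next
	case (Suc j) then show ?thesis using V.bd_chains[OF sub(2) S] z by simp
 qed
 show ?thesis
 proof
	assume h: "V.hvan A B S i"
	show "V'.hvan A' B' S i"
	 unfolding V'.hvan_def
	proof (intro ballI impI)
	 fix y assume y: "y:kchains B' S i" and dy: "V'.bd S y:kchains A' S (i - 1)"
	 obtain z where z: "z:kchains B S i" "push z - y:kchains A' S i" using lift[OF y] by blast
	 note yG = V'.kchains_sub[OF sub(4) S y]
	 note zG = V'.kchains_sub[OF sub(4) S push_in[OF z(1)]]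
	 have "V'.bd S (push z - y):kchains A' S (i - 1)"
	 proof (cases i)
		case 0
		then show ?thesis using V'.bd_zero_chain[OF S] V'.kchains_sub[OF sub(3) S z(2)] V'.kchains_zero[OF sub(3) S, of 0] by simp
	 next
		case (Suc j) then show ?thesis using V'.bd_chains[OF sub(3) S] z(2) by simp
	 qed
	 then have "V'.bd S (push z - y) + V'.bd S y:kchains A' S (i - 1)"
		using V'.kchains_add[OF sub(3) S _ dy] by blast
	 then have "push (V.bd S z):kchains A' S (i - 1)"
		using V'.bd_diff[OF S zG yG] push_bd[OF z(1)] by simp
	 then have "V.bd S z:kchains A S (i - 1)" using push_A[OF bdB[OF z(1)]] by simp
	 then obtain w where w: "w:kchains B S (Suc i)" "z - V.bd S w:kchains A S i"
		using h z(1) unfolding V.hvan_def by blast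
	 have bw: "V.bd S w:kchains B S i" using bdB[OF w(1)] by simp
	 have zw: "z - V.bd S w:kchains B S i" using V.kchains_diff[OF sub(2) S z(1) bw] .
	 have "push (z - V.bd S w):kchains A' S i" using push_A[OF zw] w(2) by simp
	 then have "push z - V'.bd S (push w):kchains A' S i"
		using push_diff[OF z(1) bw] push_bd[OF w(1)] by simp
	 then have "push z - V'.bd S (push w) - (push z - y):kchains A' S i"
		using V'.kchains_diff[OF sub(3) S _ z(2)] by blast
	 then show "\<exists>w\<in>kchains B' S (Suc i). y - V'.bd S w:kchains A' S i"
		using push_in[OF w(1)] by (intro bexI[of _ "push w"]) (auto simp: algebra_simps)
	qed
 next
	assume h: "V'.hvan A' B' S i"
	show "V.hvan A B S i"
	 unfolding V.hvan_def
	proof (intro ballI impI)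
	 fix z assume z: "z:kchains B S i" and dz: "V.bd S z:kchains A S (i - 1)"
	 have "V'.bd S (push z):kchains A' S (i - 1)"
		using push_A[OF bdB[OF z]] dz push_bd[OF z] by simp
	 then obtain w' where w': "w':kchains B' S (Suc i)" "push z - V'.bd S w':kchains A' S i"
		using h push_in[OF z] unfolding V'.hvan_def by blast
	 obtain w where w: "w:kchains B S (Suc i)" "push w - w':kchains A' S (Suc i)" using lift[OF w'(1)] by blast
	 have bw: "V.bd S w:kchains B S i" using bdB[OF w(1)] by simp
	 note G1 = V'.kchains_sub[OF sub(4) S push_in[OF w(1)]]
	 note G2 = V'.kchains_sub[OF sub(4) S w'(1)]
	 have "V'.bd S (push w - w'):kchains A' S i" using V'.bd_chains[OF sub(3) S w(2)] .
	 then have "push z - V'.bd S w' - (V'.bd S (push w) - V'.bd S w'):kchains A' S i"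
		using V'.kchains_diff[OF sub(3) S w'(2)] V'.bd_diff[OF S G1 G2] by (simp only:)
	 moreover have "push z - V'.bd S w' - (V'.bd S (push w) - V'.bd S w') = push z - V'.bd S (push w)"
		by (simp only: diff_diff_eq2 diff_add_cancel)
	 ultimately have "push (z - V.bd S w):kchains A' S i"
		using push_diff[OF z bw] push_bd[OF w(1)] by simp
	 then show "\<exists>w\<in>kchains B S (Suc i). z - V.bd S w:kchains A S i"
		using push_A[OF V.kchains_diff[OF sub(2) S z bw]] w(1) by blast
	qed
 qed
qed

section \<open>Modules and FI-modules\<close>

abbreviation full :: "('k, 'a) fi_mod=>nat set=>'a set" where
 "full V \<equiv> %S. carrier (obj V S)"

abbreviation zer :: "('k, 'a) fi_mod=>nat set=>'a" where
 "zer V S \<equiv> ring.zero (obj V S)"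

abbreviation null :: "('k, 'a) fi_mod=>nat set=>'a set" where
 "null V \<equiv> %S. {zer V S}"

lemma module_abelian_group: "Module.module R M==>abelian_group M"
 by (simp add: Module.module_def)

lemma (in abelian_group) minus_eq_zero_iff: "x:carrier G==>y:carrier G==>x\<ominus>y = \<zero><->x = y"
 by (metis add.inv_closed add.inv_equality minus_minus r_neg minus_eq)

lemma (in abelian_group) minus_add_cancel_right: "x:carrier G==>y:carrier G==>(x\<ominus>y)\<oplus>y = x"
 by (simp add: minus_eq a_assoc l_neg)

lemma mod_hom_closed: "f:mod_hom R M N==>x:carrier M==>f x:carrier N"
 by (auto simp: mod_hom_def)

lemma mod_hom_add: "f:mod_hom R M N==>x:carrier M==>y:carrier M==>f (x \<oplus>\<^bsub>M\<^esub> y) = f x \<oplus>\<^bsub>N\<^esub> f y"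
 by (simp add: mod_hom_def)

lemma mod_hom_smult: "f:mod_hom R M N==>c:carrier R==>x:carrier M==>f (c \<odot>\<^bsub>M\<^esub> x) = c \<odot>\<^bsub>N\<^esub> f x"
 by (simp add: mod_hom_def)

lemma
 assumes "abelian_group M" "abelian_group N" "f:mod_hom R M N"
 shows mod_hom_zero: "f \<zero>\<^bsub>M\<^esub> = \<zero>\<^bsub>N\<^esub>"
	and mod_hom_uminus: "x:carrier M==>f (\<ominus>\<^bsub>M\<^esub> x) = \<ominus>\<^bsub>N\<^esub> f x"
	and mod_hom_minus: "x:carrier M==>y:carrier M==>f (x \<ominus>\<^bsub>M\<^esub> y) = f x \<ominus>\<^bsub>N\<^esub> f y"
proof -
 interpret M: abelian_group M by fact
 interpret N: abelian_group N by fact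
 have c: "!!x. x:carrier M==>f x:carrier N" by (rule mod_hom_closed[OF assms(3)])
 have "f \<zero>\<^bsub>M\<^esub> \<oplus>\<^bsub>N\<^esub> f \<zero>\<^bsub>M\<^esub> = f \<zero>\<^bsub>M\<^esub>" using mod_hom_add[OF assms(3), of "\<zero>\<^bsub>M\<^esub>" "\<zero>\<^bsub>M\<^esub>"] by simp
 then show z: "f \<zero>\<^bsub>M\<^esub> = \<zero>\<^bsub>N\<^esub>" using c by (metis M.zero_closed N.add.r_cancel_one)
 show u: "f (\<ominus>\<^bsub>M\<^esub> x) = \<ominus>\<^bsub>N\<^esub> f x" if "x:carrier M" for x
 proof -
	have "f (\<ominus>\<^bsub>M\<^esub> x) \<oplus>\<^bsub>N\<^esub> f x = \<zero>\<^bsub>N\<^esub>"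
	 using mod_hom_add[OF assms(3), of "\<ominus>\<^bsub>M\<^esub> x" x] that z by (simp add: M.l_neg)
	then show ?thesis using c that by (metis M.a_inv_closed N.minus_equality)
 qed
 show "f (x \<ominus>\<^bsub>M\<^esub> y) = f x \<ominus>\<^bsub>N\<^esub> f y" if "x:carrier M" "y:carrier M"
	using mod_hom_add[OF assms(3) that(1), of "\<ominus>\<^bsub>M\<^esub> y"] u[OF that(2)] that by (simp add: a_minus_def)
qed

lemma mod_hom_comp: "f:mod_hom R M N==>g:mod_hom R N P==>(%x. g (f x)):mod_hom R M P"
 unfolding mod_hom_def by (auto simp: Pi_iff)

lemma mod_hom_id: "(%x. x):mod_hom R M M"
 by (auto simp: mod_hom_def)

lemma FI_homI: "emb f S T==>restrict f S:FI_hom S T"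
 by (auto simp: FI_hom_def emb_def inj_on_def)

lemma FI_hom_compose: "f:FI_hom S T==>g:FI_hom T U==>compose S g f:FI_hom S U"
 unfolding FI_hom_def by (auto simp: compose_def inj_on_def PiE_iff extensional_def)

lemma FI_incl_hom: "A<=S==>FI_incl A:FI_hom A S"
 by (auto simp: FI_hom_def FI_incl_def inj_on_def)

lemma compose_FI_incl: "f:FI_hom S T==>compose S (FI_incl T) f = f" "f:FI_hom S T==>compose S f (FI_incl S) = f"
 by (auto simp: FI_hom_def FI_incl_def compose_def fun_eq_iff PiE_iff extensional_def)

lemma compose_FI_incl_incl: "A<=B==>compose A (FI_incl B) (FI_incl A) = FI_incl A"
 by (auto simp: FI_incl_def compose_def fun_eq_iff)

context FI_module
begin

lemma obj_ab: "finite S==>abelian_group (obj V S)"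
 using obj_module module_abelian_group by blast

lemma mor_closed: "finite S==>finite T==>f:FI_hom S T==>x:full V S==>mor V S T f x:full V T"
 by (rule mod_hom_closed[OF mor_hom]; assumption)

lemma mor_add: "finite S==>finite T==>f:FI_hom S T==>x:full V S==>y:full V S ==>
	mor V S T f (x \<oplus>\<^bsub>obj V S\<^esub> y) = mor V S T f x \<oplus>\<^bsub>obj V T\<^esub> mor V S T f y"
 by (rule mod_hom_add[OF mor_hom]; assumption)

lemma mor_smult: "finite S==>finite T==>f:FI_hom S T==>c:carrier R==>x:full V S ==>
	mor V S T f (c \<odot>\<^bsub>obj V S\<^esub> x) = c \<odot>\<^bsub>obj V T\<^esub> mor V S T f x"
 by (rule mod_hom_smult[OF mor_hom]; assumption)

lemma mor_zero: "finite S==>finite T==>f:FI_hom S T==>mor V S T f (zer V S) = zer V T"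
 by (rule mod_hom_zero[OF obj_ab obj_ab mor_hom]; assumption)

lemma mor_minus: "finite S==>finite T==>f:FI_hom S T==>x:full V S==>y:full V S ==>
	mor V S T f (x \<ominus>\<^bsub>obj V S\<^esub> y) = mor V S T f x \<ominus>\<^bsub>obj V T\<^esub> mor V S T f y"
 by (rule mod_hom_minus[OF obj_ab obj_ab mor_hom]; assumption)

end

lemma FI_map_hom: "FI_map R V W ph==>finite S==>ph S:mod_hom R (obj V S) (obj W S)"
 by (simp add: FI_map_def)

lemma FI_map_closed: "FI_map R V W ph==>finite S==>x:full V S==>ph S x:full W S"
 by (rule mod_hom_closed[OF FI_map_hom]; assumption)

lemma FI_map_nat: "FI_map R V W ph==>finite S==>finite T==>f:FI_hom S T==>x:full V S ==>
	ph T (mor V S T f x) = mor W S T f (ph S x)"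
 by (simp add: FI_map_def)

lemma FI_map_add: "FI_map R V W ph==>finite S==>x:full V S==>y:full V S ==>
	ph S (x \<oplus>\<^bsub>obj V S\<^esub> y) = ph S x \<oplus>\<^bsub>obj W S\<^esub> ph S y"
 by (rule mod_hom_add[OF FI_map_hom]; assumption)

lemma FI_map_smult: "FI_map R V W ph==>finite S==>c:carrier R==>x:full V S ==>
	ph S (c \<odot>\<^bsub>obj V S\<^esub> x) = c \<odot>\<^bsub>obj W S\<^esub> ph S x"
 by (rule mod_hom_smult[OF FI_map_hom]; assumption)

lemma
 assumes "FI_module R V" "FI_module R W" "FI_map R V W ph" "finite S"
 shows FI_map_zero: "ph S (zer V S) = zer W S"
	and FI_map_minus: "x:full V S==>y:full V S==>ph S (x \<ominus>\<^bsub>obj V S\<^esub> y) = ph S x \<ominus>\<^bsub>obj W S\<^esub> ph S y"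
 using mod_hom_zero[OF FI_module.obj_ab[OF assms(1,4)] FI_module.obj_ab[OF assms(2,4)] FI_map_hom[OF assms(3,4)]]
	mod_hom_minus[OF FI_module.obj_ab[OF assms(1,4)] FI_module.obj_ab[OF assms(2,4)] FI_map_hom[OF assms(3,4)]] by auto

lemma FI_map_comp:
 assumes "FI_map R U V ph" "FI_map R V W ps"
 shows "FI_map R U W (%S x. ps S (ph S x))"
 unfolding FI_map_def
proof (intro conjI allI impI)
 fix S T f x assume S: "finite (S :: nat set)"
 show "(%x. ps S (ph S x)):mod_hom R (obj U S) (obj W S)"
	by (rule mod_hom_comp[OF FI_map_hom[OF assms(1) S] FI_map_hom[OF assms(2) S]])
 assume T: "finite (T :: nat set)" "f:FI_hom S T" "x:full U S"
 show "ps T (ph T (mor U S T f x)) = mor W S T f (ps S (ph S x))"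
	using FI_map_nat[OF assms(1) S T] FI_map_nat[OF assms(2) S T(1,2)] FI_map_closed[OF assms(1) S T(3)] by simp
qed

lemma FI_map_id: "FI_map R V V (%S x. x)"
 by (auto simp: FI_map_def mod_hom_id)

section \<open>Submodules and their images, preimages and sums\<close>

lemma
 assumes "FI_submodule R V N" "FI_module R V" "finite S"
 shows FI_subD: "x:N S==>x:full V S"
	and FI_sub_zero: "zer V S:N S"
	and FI_sub_add: "x:N S==>y:N S==>x \<oplus>\<^bsub>obj V S\<^esub> y:N S"
	and FI_sub_uminus: "x:N S==>\<ominus>\<^bsub>obj V S\<^esub> x:N S"
	and FI_sub_minus: "x:N S==>y:N S==>x \<ominus>\<^bsub>obj V S\<^esub> y:N S"
	and FI_sub_smult: "c:carrier R==>x:N S==>c \<odot>\<^bsub>obj V S\<^esub> x:N S"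
proof -
 interpret M: Module.module R "obj V S" using assms FI_module.obj_module by blast
 have s: "submodule (N S) R (obj V S)" using assms by (simp add: FI_submodule_def)
 note E = M.submoduleE[OF s]
 show "x:N S==>x:full V S" using E by blast
 show "zer V S:N S" using E by (metis M.add.r_inv ex_in_conv subsetD a_inv_def)
 show "x:N S==>y:N S==>x \<oplus>\<^bsub>obj V S\<^esub> y:N S" using E by blast
 show "x:N S==>\<ominus>\<^bsub>obj V S\<^esub> x:N S" using E by blast
 show "x:N S==>y:N S==>x \<ominus>\<^bsub>obj V S\<^esub> y:N S" unfolding a_minus_def using E by blast
 show "c:carrier R==>x:N S==>c \<odot>\<^bsub>obj V S\<^esub> x:N S" using E by blast
qed

lemma FI_sub_mor: "FI_submodule R V N==>finite S==>finite T==>f:FI_hom S T==>x:N S==>mor V S T f x:N T"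
 unfolding FI_submodule_def by (simp add: image_subset_iff)

lemma FI_submoduleI:
 assumes "FI_module R V"
	and "!!S x. finite S==>x:N S==>x:full V S"
	and "!!S. finite S==>zer V S:N S"
	and "!!S x y. finite S==>x:N S==>y:N S==>x \<oplus>\<^bsub>obj V S\<^esub> y:N S"
	and "!!S c x. finite S==>c:carrier R==>x:N S==>c \<odot>\<^bsub>obj V S\<^esub> x:N S"
	and "!!S T f x. finite S==>finite T==>f:FI_hom S T==>x:N S==>mor V S T f x:N T"
 shows "FI_submodule R V N"
 unfolding FI_submodule_def
proof (intro conjI allI impI)
 fix S :: "nat set" assume S: "finite S"
 interpret M: Module.module R "obj V S" using assms(1) S FI_module.obj_module by blast
 show "submodule (N S) R (obj V S)"
 proof (rule M.submoduleI)
	fix x assume x: "x:N S"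
	\<comment> \<open>Negation is multiplication by -1, so closure under negation need not be asked
	  separately.\<close>
	then have "\<ominus>\<^bsub>R\<^esub> \<one>\<^bsub>R\<^esub> \<odot>\<^bsub>obj V S\<^esub> x = \<ominus>\<^bsub>obj V S\<^esub> x"
	 using M.smult_l_minus[of "\<one>\<^bsub>R\<^esub>" x] assms(2)[OF S x] by simp
	then show "\<ominus>\<^bsub>obj V S\<^esub> x:N S" using assms(5)[OF S _ x, of "\<ominus>\<^bsub>R\<^esub> \<one>\<^bsub>R\<^esub>"] by simp
 qed (use assms S in auto)
qed (use assms(6) in auto)

lemma FI_submodule_full:
 assumes V: "FI_module R V"
 shows "FI_submodule R V (full V)"
proof (rule FI_submoduleI[OF V])
 interpret FI_module R V by fact
 fix S :: "nat set" assume S: "finite S"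
 interpret M: Module.module R "obj V S" using S obj_module by blast
 show "zer V S:full V S" by simp
 show "x \<oplus>\<^bsub>obj V S\<^esub> y:full V S" if "x:full V S" "y:full V S" for x y using that by simp
 show "c \<odot>\<^bsub>obj V S\<^esub> x:full V S" if "c:carrier R" "x:full V S" for c x using that by simp
qed (auto simp: FI_module.mor_closed[OF V])

lemma FI_submodule_null:
 assumes V: "FI_module R V"
 shows "FI_submodule R V (null V)"
proof (rule FI_submoduleI[OF V])
 interpret FI_module R V by fact
 fix S :: "nat set" assume S: "finite S"
 interpret M: Module.module R "obj V S" using S obj_module by blast
 show "x:full V S" if "x:null V S" for x using that by simp
 show "x \<oplus>\<^bsub>obj V S\<^esub> y:null V S" if "x:null V S" "y:null V S" for x y using that by simp
 show "c \<odot>\<^bsub>obj V S\<^esub> x:null V S" if "c:carrier R" "x:null V S" for c x using that by simp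
qed (auto simp: FI_module.mor_zero[OF V])

lemma FI_module_sub:
 assumes "FI_module R V" "FI_submodule R V N"
 shows "FI_module R (FI_sub V N)"
proof (rule FI_module.intro)
 interpret FI_module R V by fact
 show "cring R" by (rule cring)
 fix S :: "nat set" assume S: "finite S"
 show "Module.module R (obj (FI_sub V N) S)"
	using submodule.submodule_is_module[of "N S" R "obj V S"] assms(2) S obj_module[OF S]
	by (simp add: FI_sub_def FI_submodule_def)
 show "mor (FI_sub V N) S S (FI_incl S) x = x" if "x:full (FI_sub V N) S" for x
	using that mor_id[OF S] FI_subD[OF assms(2,1) S] by (simp add: FI_sub_def)
 fix T f assume T: "finite T" and f: "f:FI_hom S T"
 show "mor (FI_sub V N) S T f:mod_hom R (obj (FI_sub V N) S) (obj (FI_sub V N) T)"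
	using mor_add[OF S T f] mor_smult[OF S T f] FI_subD[OF assms(2,1) S] FI_sub_mor[OF assms(2) S T f]
	by (auto simp: mod_hom_def FI_sub_def)
 fix U g assume U: "finite U" and g: "g:FI_hom T U"
 show "mor (FI_sub V N) S U (compose S g f) x = mor (FI_sub V N) T U g (mor (FI_sub V N) S T f x)"
	if "x:full (FI_sub V N) S" for x
	using that mor_comp[OF S T U f g] FI_subD[OF assms(2,1) S] by (simp add: FI_sub_def)
qed

lemma FI_sub_sel [simp]: "full (FI_sub V N) S = N S" "mor (FI_sub V N) = mor V"
 "zer (FI_sub V N) S = zer V S" "x \<oplus>\<^bsub>obj (FI_sub V N) S\<^esub> y = x \<oplus>\<^bsub>obj V S\<^esub> y"
 "c \<odot>\<^bsub>obj (FI_sub V N) S\<^esub> x = c \<odot>\<^bsub>obj V S\<^esub> x"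
 by (auto simp: FI_sub_def)

lemma FI_map_incl: "FI_module R V==>FI_submodule R V N==>FI_map R (FI_sub V N) V (%S x. x)"
 unfolding FI_map_def mod_hom_def using FI_subD by fastforce

lemma FI_map_sub_dom: "FI_module R V==>FI_submodule R V N==>FI_map R V W ph==>FI_map R (FI_sub V N) W ph"
 by (rule FI_map_comp[OF FI_map_incl]; assumption)

lemma FI_map_sub_cod: "FI_map R V W ph==>(!!S x. finite S==>x:full V S==>ph S x:N S)==>FI_map R V (FI_sub W N) ph"
 unfolding FI_map_def mod_hom_def by auto

lemma FI_submodule_ker:
 assumes "FI_module R V" "FI_module R W" "FI_map R V W ph"
 shows "FI_submodule R V (FI_ker V W ph)"
proof (rule FI_submoduleI[OF assms(1)])
 interpret V: FI_module R V by fact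
 interpret W: FI_module R W by fact
 fix S :: "nat set" assume S: "finite S"
 interpret M: Module.module R "obj V S" using S V.obj_module by blast
 interpret N: Module.module R "obj W S" using S W.obj_module by blast
 show "zer V S:FI_ker V W ph S" using FI_map_zero[OF assms S] by (simp add: FI_ker_def)
 show "x \<oplus>\<^bsub>obj V S\<^esub> y:FI_ker V W ph S" if "x:FI_ker V W ph S" "y:FI_ker V W ph S" for x y
	using that FI_map_add[OF assms(3) S] by (simp add: FI_ker_def)
 show "c \<odot>\<^bsub>obj V S\<^esub> x:FI_ker V W ph S" if "c:carrier R" "x:FI_ker V W ph S" for c x
	using that FI_map_smult[OF assms(3) S] by (simp add: FI_ker_def)
 fix T f x assume "finite T" "f:FI_hom S T" "x:FI_ker V W ph S"
 then show "mor V S T f x:FI_ker V W ph T"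
	using FI_map_nat[OF assms(3) S] V.mor_closed[OF S] W.mor_zero[OF S] by (simp add: FI_ker_def)
qed (simp add: FI_ker_def)

lemma FI_submodule_image:
 assumes "FI_module R V" "FI_module R W" "FI_map R V W ph" "FI_submodule R V N"
 shows "FI_submodule R W (%S. ph S ` N S)"
proof (rule FI_submoduleI[OF assms(2)])
 fix S :: "nat set" assume S: "finite S"
 note N = FI_subD[OF assms(4,1) S]
 show "x:full W S" if "x:ph S ` N S" for x using that N FI_map_closed[OF assms(3) S] by auto
 show "zer W S:ph S ` N S" using FI_map_zero[OF assms(1-3) S] FI_sub_zero[OF assms(4,1) S] by (metis imageI)
 show "x \<oplus>\<^bsub>obj W S\<^esub> y:ph S ` N S" if "x:ph S ` N S" "y:ph S ` N S" for x y
	using that FI_map_add[OF assms(3) S] N FI_sub_add[OF assms(4,1) S] by (auto simp: image_iff) metis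
 show "c \<odot>\<^bsub>obj W S\<^esub> x:ph S ` N S" if "c:carrier R" "x:ph S ` N S" for c x
	using that FI_map_smult[OF assms(3) S] N FI_sub_smult[OF assms(4,1) S] by (auto simp: image_iff) metis
 fix T f x assume T: "finite T" "f:FI_hom S T" "x:ph S ` N S"
 then show "mor W S T f x:ph T ` N T"
	using FI_map_nat[OF assms(3) S T(1,2)] N FI_sub_mor[OF assms(4) S T(1,2)] by (auto simp: image_iff) metis
qed

lemma FI_submodule_preimage:
 assumes "FI_module R V" "FI_module R W" "FI_map R V W ph" "FI_submodule R W N"
 shows "FI_submodule R V (%S. {x\<in>full V S. ph S x:N S})"
proof (rule FI_submoduleI[OF assms(1)])
 fix S :: "nat set" assume S: "finite S"
 interpret M: Module.module R "obj V S" using S FI_module.obj_module[OF assms(1)] by blast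
 let ?P = "%S. {x\<in>full V S. ph S x:N S}"
 show "x:full V S" if "x:?P S" for x using that by simp
 show "zer V S:?P S" using FI_map_zero[OF assms(1-3) S] FI_sub_zero[OF assms(4,2) S] by simp
 show "x \<oplus>\<^bsub>obj V S\<^esub> y:?P S" if "x:?P S" "y:?P S" for x y
	using that FI_map_add[OF assms(3) S] FI_sub_add[OF assms(4,2) S] by simp
 show "c \<odot>\<^bsub>obj V S\<^esub> x:?P S" if "c:carrier R" "x:?P S" for c x
	using that FI_map_smult[OF assms(3) S] FI_sub_smult[OF assms(4,2) S] by simp
 fix T f x assume T: "finite T" "f:FI_hom S T" "x:?P S"
 then show "mor V S T f x:?P T"
	using FI_map_nat[OF assms(3) S T(1,2)] FI_module.mor_closed[OF assms(1) S T(1,2)] FI_sub_mor[OF assms(4) S T(1,2)] by simp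
qed

lemma FI_submodule_sum:
 assumes V: "FI_module R V" and A: "FI_submodule R V A" and B: "FI_submodule R V B"
 shows "FI_submodule R V (%S. {a \<oplus>\<^bsub>obj V S\<^esub> b | a b. a:A S&b:B S})"
proof (rule FI_submoduleI[OF V])
 fix S :: "nat set" assume S: "finite S"
 interpret M: Module.module R "obj V S" using S FI_module.obj_module[OF V] by blast
 note a = FI_subD[OF A V S] and b = FI_subD[OF B V S]
 let ?P = "%S. {a \<oplus>\<^bsub>obj V S\<^esub> b | a b. a:A S&b:B S}"
 show "x:full V S" if "x:?P S" for x using that a b by auto
 show "zer V S:?P S" using FI_sub_zero[OF A V S] FI_sub_zero[OF B V S]
	by (intro CollectI exI[of _ "zer V S"]) simp
 show "x \<oplus>\<^bsub>obj V S\<^esub> y:?P S" if xy: "x:?P S" "y:?P S" for x y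
 proof -
	obtain p q p' q' where *: "x = p \<oplus>\<^bsub>obj V S\<^esub> q" "y = p' \<oplus>\<^bsub>obj V S\<^esub> q'" "p:A S" "p':A S" "q:B S" "q':B S"
	 using xy by auto
	then have "x \<oplus>\<^bsub>obj V S\<^esub> y = (p \<oplus>\<^bsub>obj V S\<^esub> p') \<oplus>\<^bsub>obj V S\<^esub> (q \<oplus>\<^bsub>obj V S\<^esub> q')"
	 using a b by (simp add: M.M.a_ac)
	then show ?thesis using FI_sub_add[OF A V S *(3,4)] FI_sub_add[OF B V S *(5,6)]
	 by (intro CollectI exI[of _ "p \<oplus>\<^bsub>obj V S\<^esub> p'"] exI[of _ "q \<oplus>\<^bsub>obj V S\<^esub> q'"]) simp
 qed
 show "c \<odot>\<^bsub>obj V S\<^esub> x:?P S" if c: "c:carrier R" and x: "x:?P S" for c x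
 proof -
	obtain p q where *: "x = p \<oplus>\<^bsub>obj V S\<^esub> q" "p:A S" "q:B S" using x by auto
	then show ?thesis using FI_sub_smult[OF A V S c *(2)] FI_sub_smult[OF B V S c *(3)] M.smult_r_distr[OF c a[OF *(2)] b[OF *(3)]]
	 by (intro CollectI exI[of _ "c \<odot>\<^bsub>obj V S\<^esub> p"] exI[of _ "c \<odot>\<^bsub>obj V S\<^esub> q"]) simp
 qed
 fix T f x assume T: "finite T" "f:FI_hom S T" "x:?P S"
 then obtain p q where *: "x = p \<oplus>\<^bsub>obj V S\<^esub> q" "p:A S" "q:B S" by auto
 then show "mor V S T f x:?P T"
	using FI_sub_mor[OF A S T(1,2) *(2)] FI_sub_mor[OF B S T(1,2) *(3)]
	 FI_module.mor_add[OF V S T(1,2) a[OF *(2)] b[OF *(3)]]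
	by (intro CollectI exI[of _ "mor V S T f p"] exI[of _ "mor V S T f q"]) simp
qed

subsection \<open>The Koszul complex of a subquotient\<close>

text \<open>\<open>V\<close> is replaced by the free abelian groups on its values, so that the Koszul
 complex can be formed in a type class group; \<open>ev\<close> is the augmentation.\<close>

definition ev :: "('k, 'a) module=>('a \<Rightarrow>\<^sub>0 int)=>'a" where
 "ev M = (SOME h. h:hom (free_Abelian_group (carrier M)) (add_monoid M)&(\<forall>x\<in>carrier M. h (frag_of x) = x))"

context
 fixes M :: "('k, 'a) module"
 assumes M: "abelian_group M"
begin

interpretation abelian_group M by (rule M)

lemma ev_spec: "ev M:hom (free_Abelian_group (carrier M)) (add_monoid M)&(\<forall>x\<in>carrier M. ev M (frag_of x) = x)"
proof -
 have ex: "EX h. h:hom (free_Abelian_group (carrier M)) (add_monoid M)&(\<forall>x\<in>carrier M. h (frag_of x) = x)"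
	by (rule comm_group.free_Abelian_group_universal[OF a_comm_group, of "%x. x" "carrier M"]) auto
 show ?thesis using someI_ex[OF ex] unfolding ev_def .
qed

lemma ev_of: "x:carrier M==>ev M (frag_of x) = x"
 using ev_spec by blast

lemma ev_closed: "Poly_Mapping.keys p<=carrier M==>ev M p:carrier M"
 using ev_spec hom_in_carrier[of "ev M" "free_Abelian_group (carrier M)" "add_monoid M" p] by simp

lemma ev_add: "Poly_Mapping.keys p<=carrier M==>Poly_Mapping.keys q<=carrier M==>ev M (p + q) = ev M p \<oplus>\<^bsub>M\<^esub> ev M q"
 using ev_spec hom_mult[of "ev M" "free_Abelian_group (carrier M)" "add_monoid M" p q] by simp

lemma ev_diff:
 assumes "Poly_Mapping.keys p<=carrier M" "Poly_Mapping.keys q<=carrier M"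
 shows "ev M (p - q) = ev M p \<ominus>\<^bsub>M\<^esub> ev M q"
proof -
 have k: "Poly_Mapping.keys (p - q)<=carrier M" using assms keys_diff[of p q] by auto
 have "ev M p = ev M (p - q) \<oplus>\<^bsub>M\<^esub> ev M q" using ev_add[OF k assms(2)] by simp
 then show ?thesis using ev_closed[OF k] ev_closed[OF assms(1)] ev_closed[OF assms(2)]
	by (simp add: a_minus_def a_assoc r_neg)
qed

lemma ev_zero: "ev M 0 = \<zero>\<^bsub>M\<^esub>"
 using ev_diff[of 0 0] ev_closed[of 0] by (simp add: a_minus_def r_neg)

end

lemma ev_hom:
 assumes M: "abelian_group M" and M': "abelian_group M'" and f: "!!x. x:carrier M==>f x:carrier M'"
	"!!x y. x:carrier M==>y:carrier M==>f (x \<ominus>\<^bsub>M\<^esub> y) = f x \<ominus>\<^bsub>M'\<^esub> f y"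
	and p: "Poly_Mapping.keys p<=carrier M"
 shows "Poly_Mapping.keys (frag_extend (frag_of\<circ>f) p)<=carrier M'"
	"ev M' (frag_extend (frag_of\<circ>f) p) = f (ev M p)"
proof -
 interpret M: abelian_group M by fact
 interpret M': abelian_group M' by fact
 have k: "Poly_Mapping.keys (frag_extend (frag_of\<circ>f) p)<=carrier M'" if "Poly_Mapping.keys p<=carrier M" for p
 proof
	fix y assume "y:Poly_Mapping.keys (frag_extend (frag_of\<circ>f) p)"
	then have "y:(\<Union>x\<in>Poly_Mapping.keys p. Poly_Mapping.keys ((frag_of\<circ>f) x))"
	 by (rule subsetD[OF keys_frag_extend])
	then obtain x where x: "x:Poly_Mapping.keys p" "y:Poly_Mapping.keys ((frag_of\<circ>f) x)"
	 by (rule UN_E)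
	then have "y = f x" by simp
	then show "y:carrier M'" using f(1) x(1) that by blast
 qed
 show "Poly_Mapping.keys (frag_extend (frag_of\<circ>f) p)<=carrier M'" by (rule k[OF p])
 have z: "f \<zero>\<^bsub>M\<^esub> = \<zero>\<^bsub>M'\<^esub>"
 proof -
	have "f \<zero>\<^bsub>M\<^esub>:carrier M'" by (rule f(1)) simp
	moreover have "\<zero>\<^bsub>M\<^esub> \<ominus>\<^bsub>M\<^esub> \<zero>\<^bsub>M\<^esub> = \<zero>\<^bsub>M\<^esub>" by (simp add: a_minus_def M.r_neg)
	ultimately show ?thesis using f(2)[OF M.zero_closed M.zero_closed] M'.r_neg[of "f \<zero>\<^bsub>M\<^esub>"]
	 unfolding a_minus_def by (simp only:)
 qed
 have "Poly_Mapping.keys p<=carrier M&ev M' (frag_extend (frag_of\<circ>f) p) = f (ev M p)"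
	using p
 proof (induction p rule: frag_induction)
	case zero
	then show ?case using ev_zero[OF M] ev_zero[OF M'] z by simp
 next
	case (one x)
	then show ?case using ev_of[OF M] ev_of[OF M'] f(1) by simp
 next
	case (diff a b)
	have "Poly_Mapping.keys (a - b)<=carrier M" using diff keys_diff[of a b] by auto
	moreover have "ev M' (frag_extend (frag_of\<circ>f) (a - b)) = f (ev M (a - b))"
	 unfolding frag_extend_diff ev_diff[OF M' k[OF conjunct1[OF diff(1)]] k[OF conjunct1[OF diff(2)]]]
		ev_diff[OF M conjunct1[OF diff(1)] conjunct1[OF diff(2)]]
		f(2)[OF ev_closed[OF M conjunct1[OF diff(1)]] ev_closed[OF M conjunct1[OF diff(2)]]]
		conjunct2[OF diff(1)] conjunct2[OF diff(2)] ..
	ultimately show ?case ..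
 qed
 then show "ev M' (frag_extend (frag_of\<circ>f) p) = f (ev M p)" by blast
qed

text \<open>The preimage of B under the augmentation. In particular \<open>frags V (null V)\<close>
  is the kernel of the augmentation and not 0, so that \<open>frags V B / frags V A\<close> is
  B/A.\<close>

definition frags :: "('k, 'a) fi_mod=>(nat set=>'a set)=>nat set=>('a \<Rightarrow>\<^sub>0 int) set" where
 "frags V B S = {p. Poly_Mapping.keys p<=full V S&ev (obj V S) p:B S}"

definition fmor :: "('k, 'a) fi_mod=>nat set=>nat set=>(nat=>nat)=>('a \<Rightarrow>\<^sub>0 int)=>('a \<Rightarrow>\<^sub>0 int)" where
 "fmor V S T f = frag_extend (frag_of\<circ>mor V S T (restrict f S))"

lemma frag_extend_id_on: "(!!x. x:Poly_Mapping.keys p==>f x = x)==>frag_extend (frag_of\<circ>f) p = p"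
 using frag_extend_eq[of p "frag_of\<circ>f" frag_of] frag_expansion[of p] by simp

lemma frags_full: "FI_module R V==>finite S==>p:frags V (full V) S<->Poly_Mapping.keys p<=full V S"
 unfolding frags_def using ev_closed[OF FI_module.obj_ab] by blast

lemma (in FI_module) fmor_keys_ev:
 assumes "finite S" "finite T" "emb f S T" "Poly_Mapping.keys p<=full V S"
 shows "Poly_Mapping.keys (fmor V S T f p)<=full V T"
	"ev (obj V T) (fmor V S T f p) = mor V S T (restrict f S) (ev (obj V S) p)"
 unfolding fmor_def
 by (rule ev_hom[OF obj_ab[OF assms(1)] obj_ab[OF assms(2)] mor_closed[OF assms(1,2) FI_homI[OF assms(3)]] mor_minus[OF assms(1,2) FI_homI[OF assms(3)]] assms(4)]; assumption)+

lemma fi_group_frags: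
 assumes V: "FI_module R V"
 shows "fi_group UNIV (frags V (full V)) (fmor V)"
proof
 interpret FI_module R V by fact
 show "infinite (UNIV :: nat set)" by simp
 fix S :: "nat set" assume S: "finite S"
 note fS = frags_full[OF V S]
 show "0:frags V (full V) S" using fS by simp
 show "x - y:frags V (full V) S" if "x:frags V (full V) S" "y:frags V (full V) S" for x y
	using that fS keys_diff[of x y] by auto
 show "fmor V S S id x = x" if "x:frags V (full V) S" for x
 proof -
	have "restrict id S = FI_incl S" by (auto simp: FI_incl_def)
	then show ?thesis unfolding fmor_def using frag_extend_id_on[of x "mor V S S (FI_incl S)"] mor_id[OF S] that fS by auto
 qed
 fix T f assume T: "finite T" and f: "emb f S T"
 note fT = frags_full[OF V T]
 show "fmor V S T f x:frags V (full V) T" if "x:frags V (full V) S" for x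
	using fmor_keys_ev(1)[OF S T f] that fS fT by blast
 show "fmor V S T f (x - y) = fmor V S T f x - fmor V S T f y" for x y
	by (simp add: fmor_def frag_extend_diff)
 show "fmor V S T f x = fmor V S T g x" if "!!s. s:S==>f s = g s" for x g
 proof -
	have "restrict f S = restrict g S" using that by auto
	then show ?thesis by (simp add: fmor_def)
 qed
 fix U g assume U: "finite U" and g: "emb g T U"
 show "fmor V T U g (fmor V S T f x) = fmor V S U (g\<circ>f) x" if x: "x:frags V (full V) S" for x
 proof -
	have r: "restrict (g\<circ>f) S = compose S (restrict g T) (restrict f S)"
	 using f by (auto simp: compose_def emb_def fun_eq_iff)
	have "fmor V T U g (fmor V S T f x) = frag_extend (frag_of\<circ>mor V T U (restrict g T)\<circ>mor V S T (restrict f S)) x"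
	 unfolding fmor_def frag_extend_compose ..
	also have "... = fmor V S U (g\<circ>f) x"
	 unfolding fmor_def
	proof (rule frag_extend_eq)
	 fix y assume "y:Poly_Mapping.keys x"
	 then have "y:full V S" using x fS by blast
	 then show "(frag_of\<circ>mor V T U (restrict g T)\<circ>mor V S T (restrict f S)) y = (frag_of\<circ>mor V S U (restrict (g\<circ>f) S)) y"
		using mor_comp[OF S T U FI_homI[OF f] FI_homI[OF g]] r by simp
	qed
	finally show ?thesis .
 qed
qed

lemma fi_sub_frags:
 assumes V: "FI_module R V" and B: "FI_submodule R V B"
 shows "fi_group.fi_sub UNIV (frags V (full V)) (fmor V) (frags V B)"
proof -
 interpret FI_module R V by fact
 interpret F: fi_group UNIV "frags V (full V)" "fmor V" by (rule fi_group_frags[OF V])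
 have "frags V B S<=frags V (full V) S&0:frags V B S&(\<forall>x\<in>frags V B S. \<forall>y\<in>frags V B S. x - y:frags V B S)"
	if S: "finite S" for S
 proof -
	have "x - y:frags V B S" if xy: "x:frags V B S" "y:frags V B S" for x y
	 using xy keys_diff[of x y] FI_sub_minus[OF B V S] ev_diff[OF obj_ab[OF S], of x y] by (auto simp: frags_def)
	moreover have "frags V B S<=frags V (full V) S" using FI_subD[OF B V S] by (auto simp: frags_def)
	moreover have "0:frags V B S" using ev_zero[OF obj_ab[OF S]] FI_sub_zero[OF B V S] by (simp add: frags_def)
	ultimately show ?thesis by blast
 qed
 moreover have "fmor V S T f x:frags V B T" if "finite S" "finite T" "emb f S T" "x:frags V B S" for S T f x
 proof -
	have k: "Poly_Mapping.keys x<=full V S" "ev (obj V S) x:B S" using that by (auto simp: frags_def)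
	show ?thesis unfolding frags_def
	 using fmor_keys_ev[OF that(1-3) k(1)] FI_sub_mor[OF B that(1,2) FI_homI[OF that(3)] k(2)] by simp
 qed
 ultimately show ?thesis unfolding F.fi_sub_def by simp
qed

text \<open>Vanishing at S of the i-th Koszul homology of the subquotient B/A of V, computed on the
  free abelian groups over the values of V.\<close>

definition kvan :: "('k, 'a) fi_mod=>(nat set=>'a set)=>(nat set=>'a set)=>nat=>nat set=>bool" where
 "kvan V A B i S<->fi_group.hvan (fmor V) (frags V A) (frags V B) S i"

lemma kvan_beyond_card: "FI_module R V==>FI_submodule R V A==>finite S==>card S < i==>kvan V A B i S"
 unfolding kvan_def by (rule fi_group.hvan_beyond_card[OF fi_group_frags fi_sub_frags]) auto

lemma kvan_zero: "FI_module R V==>FI_submodule R V A==>FI_submodule R V B==>finite S ==>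
	(!!T. T<=S==>card T + i = card S==>B T<=A T)==>kvan V A B i S"
 unfolding kvan_def
 by (rule fi_group.hvan_zero[OF fi_group_frags fi_sub_frags fi_sub_frags]) (auto simp: frags_def)

lemma kvan_middle: "FI_module R V==>FI_submodule R V N==>FI_submodule R V B==>FI_submodule R V C ==>
	(!!S. finite S==>N S<=B S)==>(!!S. finite S==>B S<=C S)==>finite S==>kvan V N B i S==>kvan V B C i S==>kvan V N C i S"
 unfolding kvan_def
 by (rule fi_group.hvan_middle[OF fi_group_frags fi_sub_frags fi_sub_frags fi_sub_frags]) (auto simp: frags_def subset_iff)

lemma kvan_quotient: "FI_module R V==>FI_submodule R V N==>FI_submodule R V B==>FI_submodule R V C ==>
	(!!S. finite S==>N S<=B S)==>(!!S. finite S==>B S<=C S)==>finite S==>kvan V N C (Suc i) S==>kvan V N B i S==>kvan V B C (Suc i) S"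
 unfolding kvan_def
 by (rule fi_group.hvan_quotient[OF fi_group_frags fi_sub_frags fi_sub_frags fi_sub_frags]) (auto simp: frags_def subset_iff)

lemma kvan_kernel: "FI_module R V==>FI_submodule R V N==>FI_submodule R V B==>FI_submodule R V C ==>
	(!!S. finite S==>N S<=B S)==>(!!S. finite S==>B S<=C S)==>finite S==>kvan V B C (Suc i) S==>kvan V N C i S==>kvan V N B i S"
 unfolding kvan_def
 by (rule fi_group.hvan_kernel[OF fi_group_frags fi_sub_frags fi_sub_frags fi_sub_frags]) (auto simp: frags_def subset_iff)

lemma kvan_transfer:
 assumes V: "FI_module R V" and W: "FI_module R W" and ph: "FI_map R V W ph"
	and sub: "FI_submodule R V A" "FI_submodule R V B" "FI_submodule R W A'" "FI_submodule R W B'"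
	and S: "finite S"
	and inB: "!!T x. finite T==>x:B T==>ph T x:B' T"
	and ker: "!!T x. finite T==>x:B T==>ph T x:A' T<->x:A T"
	and surj: "!!T y. finite T==>y:B' T==>\<exists>x\<in>B T. ph T x \<ominus>\<^bsub>obj W T\<^esub> y:A' T"
 shows "kvan V A B i S<->kvan W A' B' i S"
proof -
 interpret V: FI_module R V by fact
 interpret W: FI_module R W by fact
 have ft: "finite T" if "T<=S" for T using that S finite_subset by blast
 have g: "Poly_Mapping.keys (frag_extend (frag_of\<circ>ph T) p)<=full W T"
	 "ev (obj W T) (frag_extend (frag_of\<circ>ph T) p) = ph T (ev (obj V T) p)"
	if "T<=S" "Poly_Mapping.keys p<=full V T" for T p
	using ev_hom[OF V.obj_ab[OF ft] W.obj_ab[OF ft] FI_map_closed[OF ph ft] FI_map_minus[OF V W ph ft]] that by blast+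
 show ?thesis
	unfolding kvan_def
 proof (rule hvan_transfer[OF fi_group_frags[OF V] fi_group_frags[OF W] fi_sub_frags[OF V sub(1)]
		fi_sub_frags[OF V sub(2)] fi_sub_frags[OF W sub(3)] fi_sub_frags[OF W sub(4)] S subset_UNIV,
		where g = "%T. frag_extend (frag_of\<circ>ph T)"])
	fix T assume T: "T<=S"
	show "frag_extend (frag_of\<circ>ph T) x:frags W B' T" if "x:frags V B T" for x
	 using that g[OF T, of x] inB[OF ft[OF T]] by (auto simp: frags_def)
	show "frag_extend (frag_of\<circ>ph T) (x - y) = frag_extend (frag_of\<circ>ph T) x - frag_extend (frag_of\<circ>ph T) y" for x y
	 by (rule frag_extend_diff)
	show "frag_extend (frag_of\<circ>ph T) x:frags W A' T<->x:frags V A T" if "x:frags V B T" for x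
	 using that g[OF T, of x] ker[OF ft[OF T]] by (auto simp: frags_def)
	show "\<exists>x\<in>frags V B T. frag_extend (frag_of\<circ>ph T) x - y:frags W A' T" if y: "y:frags W B' T" for y
	proof -
	 have y': "Poly_Mapping.keys y<=full W T" "ev (obj W T) y:B' T" using y by (auto simp: frags_def)
	 obtain x where x: "x:B T" "ph T x \<ominus>\<^bsub>obj W T\<^esub> ev (obj W T) y:A' T" using surj[OF ft[OF T] y'(2)] by blast
	 have xc: "x:full V T" using FI_subD[OF sub(2) V ft[OF T] x(1)] .
	 have "frag_of x:frags V B T" using x xc ev_of[OF V.obj_ab[OF ft[OF T]] xc] by (simp add: frags_def)
	 moreover have "frag_extend (frag_of\<circ>ph T) (frag_of x) - y:frags W A' T"
		using ev_diff[OF W.obj_ab[OF ft[OF T]] _ y'(1), of "frag_of (ph T x)"] x(2) y'(1) keys_diff[of "frag_of (ph T x)" y]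
		 ev_of[OF W.obj_ab[OF ft[OF T]]] FI_map_closed[OF ph ft[OF T] xc] by (auto simp: frags_def)
	 ultimately show ?thesis by blast
	qed
 next
	fix T U x assume U: "T<=U" "U<=S" and x: "x:frags V B T"
	then have T: "T<=S" by blast
	have "frag_extend (frag_of\<circ>ph U\<circ>mor V T U (restrict id T)) x = frag_extend (frag_of\<circ>mor W T U (restrict id T)\<circ>ph T) x"
	proof (rule frag_extend_eq)
	 fix y assume "y:Poly_Mapping.keys x"
	 then have "y:full V T" using x by (auto simp: frags_def)
	 then show "(frag_of\<circ>ph U\<circ>mor V T U (restrict id T)) y = (frag_of\<circ>mor W T U (restrict id T)\<circ>ph T) y"
		using FI_map_nat[OF ph ft[OF T] ft[OF U(2)] FI_homI[OF emb_id[OF U(1)]]] by simp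
	qed
	then show "frag_extend (frag_of\<circ>ph U) (fmor V T U id x) = fmor W T U id (frag_extend (frag_of\<circ>ph T) x)"
	 unfolding fmor_def frag_extend_compose .
 qed
qed

text \<open>Lets \<open>nonvanishing\<close>, which concerns quotients of the whole functor, be
  applied to a subquotient B/A.\<close>

lemma (in fi_group) fi_group_sub:
 assumes B: "fi_sub B"
 shows "fi_group Om B m"
proof (rule fi_group.intro, goal_cases)
 case 1 show ?case by (rule infinite_Om)
next
 case 2 then show ?case by (rule fi_sub_zero[OF B])
next
 case 3 then show ?case by (rule fi_sub_diff[OF B])
next
 case 4 then show ?case by (rule fi_sub_m[OF B])
next
 case (5 S T f x y) then show ?case using fi_subD[OF B] by (intro m_diff)
next
 case (6 S x) then show ?case using fi_subD[OF B] by (intro m_id)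
next
 case (7 S T U f g x) then show ?case using fi_subD[OF B 7(1,2)] by (intro m_comp)
next
 case (8 S T f x g) show ?case by (rule m_cong[OF 8(1-5) fi_subD[OF B 8(1,2,6)] 8(7)])
qed

lemma (in fi_group) fi_sub_sub:
 assumes "fi_sub B" "fi_sub A" "!!S. finite S==>A S<=B S"
 shows "fi_group.fi_sub Om B m A"
 using assms(2,3) unfolding fi_group.fi_sub_def[OF fi_group_sub[OF assms(1)]] fi_sub_def by simp

lemma restrict_id_incl: "restrict id A = FI_incl A"
 by (auto simp: FI_incl_def)

lemma kvan_nonvanishing:
 assumes V: "FI_module R V" and sub: "FI_submodule R V A" "FI_submodule R V B" and AB: "!!S. finite S==>A S<=B S"
	and C: "finite C" and x: "x:B C" "x~:A C"
	and kill: "!!q. q~:C==>mor V C (insert q C) (FI_incl C) x:A (insert q C)"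
	and S: "finite S" "C<=S" "card S = card C + i" "card C\<le>i"
 shows "\<not> kvan V A B i S"
proof -
 interpret V: FI_module R V by fact
 interpret F: fi_group UNIV "frags V (full V)" "fmor V" by (rule fi_group_frags[OF V])
 interpret B: fi_group UNIV "frags V B" "fmor V" by (rule F.fi_group_sub[OF fi_sub_frags[OF V sub(2)]])
 have xc: "x:full V C" by (rule FI_subD[OF sub(2) V C x(1)])
 have fx: "frag_of x:frags V B C" "frag_of x~:frags V A C"
	using xc x ev_of[OF V.obj_ab[OF C] xc] by (auto simp: frags_def)
 show ?thesis
	unfolding kvan_def
 proof (rule B.nonvanishing[OF F.fi_sub_sub[OF fi_sub_frags[OF V sub(2)] fi_sub_frags[OF V sub(1)]] C subset_UNIV fx _ S(1) subset_UNIV S(2-4)])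
	show "frags V A S<=frags V B S" if "finite S" for S using AB[OF that] by (auto simp: frags_def)
	fix q assume "q:UNIV - C"
	then show "fmor V C (insert q C) id (frag_of x):frags V A (insert q C)"
	 using kill[of q] C V.mor_closed[OF C _ FI_incl_hom[of C "insert q C"] xc] ev_of[OF V.obj_ab[of "insert q C"]]
	 by (auto simp: frags_def fmor_def restrict_id_incl subset_insertI)
 qed
qed

lemma kvan_regularity:
 assumes V: "FI_module R V"
	and "!!S. finite S==>k\<le>card S==>kvan V (null V) (full V) 0 S"
	and "!!S. finite S==>d\<le>card S==>kvan V (null V) (full V) (Suc 0) S"
	and "finite S" "2 * k + d + Suc j\<le>card S"
 shows "kvan V (null V) (full V) (Suc j) S"
 unfolding kvan_def
 by (rule fi_group_regularity[OF fi_group_frags[OF V] fi_sub_frags[OF V FI_submodule_null[OF V]]])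
	(use assms in \<open>auto simp: kvan_def\<close>)

lemma kvan_retraction:
 assumes V: "FI_module R V" and S: "finite S"
	and r_hom: "!!S p. finite S==>p:S==>r S p:mod_hom R (obj V S) (obj V (S - {p}))"
	and r_ret: "!!S p x. finite S==>p:S==>x:full V (S - {p})==>r S p (mor V (S - {p}) S (FI_incl (S - {p})) x) = x"
	and r_nat: "!!S p q x. finite S==>p:S==>q:S==>p~=q==>x:full V (S - {q}) ==>
	 r S p (mor V (S - {q}) S (FI_incl (S - {q})) x) = mor V (S - {q} - {p}) (S - {p}) (FI_incl (S - {q} - {p})) (r (S - {q}) p x)"
 shows "kvan V (null V) (full V) (Suc j) S"
proof -
 interpret V: FI_module R V by fact
 interpret F: fi_group UNIV "frags V (full V)" "fmor V" by (rule fi_group_frags[OF V])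
 define rf where "rf S p = frag_extend (frag_of\<circ>r S p)" for S p
 note r_cl = mod_hom_closed[OF r_hom]
 have rf: "Poly_Mapping.keys (rf S p x)<=full V (S - {p})" "ev (obj V (S - {p})) (rf S p x) = r S p (ev (obj V S) x)"
	if "finite S" "p:S" "Poly_Mapping.keys x<=full V S" for S :: "nat set" and p x
 proof -
	have f: "finite (S - {p})" using that by simp
	show "Poly_Mapping.keys (rf S p x)<=full V (S - {p})" "ev (obj V (S - {p})) (rf S p x) = r S p (ev (obj V S) x)"
	 unfolding rf_def
	 using ev_hom[OF V.obj_ab[OF that(1)] V.obj_ab[OF f] r_cl[OF that(1,2)] mod_hom_minus[OF V.obj_ab[OF that(1)] V.obj_ab[OF f] r_hom[OF that(1,2)]] that(3)]
	 by auto
 qed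
 have N: "F.fi_sub (frags V (null V))" by (rule fi_sub_frags[OF V FI_submodule_null[OF V]])
 have N0: "0:frags V (null V) S" if "finite S" for S :: "nat set"
	using F.fi_sub_zero[OF N that] by simp
 show ?thesis
	unfolding kvan_def
 proof (rule F.hvan_retraction[OF N S subset_UNIV, where r = rf])
	fix S :: "nat set" and p assume S: "finite S" "p:S"
	then have f: "finite (S - {p})" by simp
	show "rf S p x:frags V (full V) (S - {p})" if "x:frags V (full V) S" for x
	 using that rf(1)[OF S] frags_full[OF V S(1)] frags_full[OF V f] by blast
	show "rf S p (x - y) = rf S p x - rf S p y" for x y by (simp add: rf_def frag_extend_diff)
	show "rf S p x:frags V (null V) (S - {p})" if "x:frags V (null V) S" for x
	 using that rf[OF S, of x] mod_hom_zero[OF V.obj_ab[OF S(1)] V.obj_ab[OF f] r_hom[OF S]] by (auto simp: frags_def)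
	show "rf S p (fmor V (S - {p}) S id x) - x:frags V (null V) (S - {p})" if x: "x:frags V (full V) (S - {p})" for x
	proof -
	 have k: "Poly_Mapping.keys x<=full V (S - {p})" using x frags_full[OF V f] by blast
	 have "rf S p (fmor V (S - {p}) S id x) = frag_extend (frag_of\<circ>r S p\<circ>mor V (S - {p}) S (FI_incl (S - {p}))) x"
		unfolding rf_def fmor_def frag_extend_compose restrict_id_incl ..
	 also have "... = frag_extend (frag_of\<circ>(%y. y)) x"
		by (rule frag_extend_eq) (use r_ret[OF S] k in auto)
	 also have "... = x" by (rule frag_extend_id_on) simp
	 finally show ?thesis using N0[OF f] by simp
	qed
	fix q x assume q: "q:S" "p~=q" and x: "x:frags V (full V) (S - {q})"
	have k: "Poly_Mapping.keys x<=full V (S - {q})" using x frags_full[OF V] S(1) by blast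
	have "rf S p (fmor V (S - {q}) S id x) = frag_extend (frag_of\<circ>r S p\<circ>mor V (S - {q}) S (FI_incl (S - {q}))) x"
	 unfolding rf_def fmor_def frag_extend_compose restrict_id_incl ..
	also have "... = frag_extend (frag_of\<circ>mor V (S - {q} - {p}) (S - {p}) (FI_incl (S - {q} - {p}))\<circ>r (S - {q}) p) x"
	 by (rule frag_extend_eq) (use r_nat[OF S q] k in auto)
	also have "... = fmor V (S - {q} - {p}) (S - {p}) id (rf (S - {q}) p x)"
	 unfolding rf_def fmor_def frag_extend_compose restrict_id_incl ..
	finally show "rf S p (fmor V (S - {q}) S id x) - fmor V (S - {q} - {p}) (S - {p}) id (rf (S - {q}) p x):frags V (null V) (S - {p})"
	 using N0[OF f] by simp
 qed
qed

section \<open>FI-homology as Koszul homology\<close>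

subsection \<open>Decomposable elements\<close>

text \<open>The subgroup of V(S) generated by the images of the B(A) for proper subsets A. The
  inductive form avoids sums indexed by all subsets; for B = V it agrees with
  \<open>FI_decomp\<close>.\<close>

inductive_set gen :: "('k, 'a) fi_mod=>(nat set=>'a set)=>nat set=>'a set"
 for V B S where
 gen_zero: "zer V S:gen V B S"
| gen_step: "y:gen V B S==>A \<subset> S==>b:B A==>y \<oplus>\<^bsub>obj V S\<^esub> mor V A S (FI_incl A) b:gen V B S"

context
 fixes R :: "('k, 'r) ring_scheme" and V :: "('k, 'a) fi_mod" and B :: "nat set=>'a set" and S :: "nat set"
 assumes V: "FI_module R V" and B: "FI_submodule R V B" and S: "finite S"
begin

interpretation FI_module R V by (rule V)
interpretation M: Module.module R "obj V S" by (rule obj_module[OF S])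

lemma gen_incl_in: "A \<subset> S==>b:B A==>mor V A S (FI_incl A) b:B S"
 using FI_sub_mor[OF B _ S FI_incl_hom] S finite_subset by auto

lemma gen_in: "y:gen V B S==>y:B S"
 by (induction rule: gen.induct) (auto simp: FI_sub_zero[OF B V S] intro: FI_sub_add[OF B V S] gen_incl_in)

lemma gen_carrier: "y:gen V B S==>y:full V S"
 using gen_in FI_subD[OF B V S] by blast

lemma gen_incl_carrier: "A \<subset> S==>b:B A==>mor V A S (FI_incl A) b:full V S"
 using gen_incl_in FI_subD[OF B V S] by blast

lemma gen_incl: "A \<subset> S==>b:B A==>mor V A S (FI_incl A) b:gen V B S"
 using gen_step[OF gen_zero, of A S b B V] gen_incl_carrier[of A b] by simp

lemma gen_add:
 assumes x: "x:gen V B S" and y: "y:gen V B S"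
 shows "x \<oplus>\<^bsub>obj V S\<^esub> y:gen V B S"
 using y
proof (induction y rule: gen.induct)
 case gen_zero
 then show ?case using gen_carrier x by simp
next
 case (gen_step y A b)
 have c: "x:full V S" "y:full V S" "mor V A S (FI_incl A) b:full V S"
	using gen_step x gen_carrier gen_incl_carrier by auto
 show ?case unfolding M.a_assoc[OF c, symmetric]
	by (rule gen.gen_step) (use gen_step in auto)
qed

lemma gen_uminus: "y:gen V B S==>\<ominus>\<^bsub>obj V S\<^esub> y:gen V B S"
proof (induction rule: gen.induct)
 case gen_zero
 have "\<ominus>\<^bsub>obj V S\<^esub> zer V S = zer V S" by simp
 then show ?case using gen.gen_zero by metis
next
 case (gen_step y A b)
 have fA: "finite A" using gen_step S finite_subset by auto
 have c: "y:full V S" "mor V A S (FI_incl A) b:full V S"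
	using gen_step gen_carrier gen_incl_carrier by auto
 have bc: "b:full V A" using FI_subD[OF B V fA] gen_step by blast
 have "\<ominus>\<^bsub>obj V S\<^esub> mor V A S (FI_incl A) b = mor V A S (FI_incl A) (\<ominus>\<^bsub>obj V A\<^esub> b)"
	using mod_hom_uminus[OF obj_ab[OF fA] obj_ab[OF S] mor_hom[OF fA S FI_incl_hom] bc] gen_step by auto
 then have "\<ominus>\<^bsub>obj V S\<^esub> (y \<oplus>\<^bsub>obj V S\<^esub> mor V A S (FI_incl A) b) =
	 \<ominus>\<^bsub>obj V S\<^esub> y \<oplus>\<^bsub>obj V S\<^esub> mor V A S (FI_incl A) (\<ominus>\<^bsub>obj V A\<^esub> b)"
	using c by (simp add: M.minus_add)
 then show ?case using gen.gen_step[OF gen_step.IH gen_step.hyps(2) FI_sub_uminus[OF B V fA gen_step.hyps(3)]] by simp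
qed

lemma gen_minus: "x:gen V B S==>y:gen V B S==>x \<ominus>\<^bsub>obj V S\<^esub> y:gen V B S"
 unfolding a_minus_def using gen_add gen_uminus by blast

lemma gen_subgroup: "subgroup (gen V B S) (add_monoid (obj V S))"
proof (rule group.subgroupI[OF M.a_group])
 show "gen V B S<=carrier (add_monoid (obj V S))" using gen_carrier by auto
 show "gen V B S~={}" using gen_zero by auto
 show "inv\<^bsub>add_monoid (obj V S)\<^esub> a:gen V B S" if "a:gen V B S" for a
	using gen_uminus[OF that] by (simp add: a_inv_def)
 show "a \<otimes>\<^bsub>add_monoid (obj V S)\<^esub> b:gen V B S" if "a:gen V B S" "b:gen V B S" for a b
	using gen_add[OF that] by simp
qed

interpretation F: fi_group UNIV "frags V (full V)" "fmor V" by (rule fi_group_frags[OF V])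

text \<open>Every proper subset of S lies in some S - {x}, so the codimension one subsets seen by
  Koszul 1-chains already give all decomposable elements.\<close>

lemma gen_iff_boundary:
 "y:gen V B S<->(\<exists>w\<in>kchains (frags V B) S (Suc 0). ev (obj V S) (F.bd S w []) = y)"
proof
 assume "y:gen V B S"
 then show "\<exists>w\<in>kchains (frags V B) S (Suc 0). ev (obj V S) (F.bd S w []) = y"
 proof (induction rule: gen.induct)
	case gen_zero
	have "F.bd S 0 [] = 0" by (simp only: F.bd_zero[OF S subset_UNIV] zero_fun_apply)
	then have "ev (obj V S) (F.bd S 0 []) = zer V S" by (simp only: ev_zero[OF obj_ab[OF S]])
	then show ?case using F.kchains_zero[OF fi_sub_frags[OF V B] S subset_UNIV] by blast
 next
	case (gen_step y A b)
	obtain w where w: "w:kchains (frags V B) S (Suc 0)" "ev (obj V S) (F.bd S w []) = y" using gen_step by blast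
	obtain x where x: "x:S" "x~:A" using gen_step by blast
	have fA: "finite A" "finite (S - {x})" "A<=S - {x}" using gen_step S finite_subset x by auto
	have bA: "b:full V A" using FI_subD[OF B V fA(1)] gen_step by blast
	define b' where "b' = mor V A (S - {x}) (FI_incl A) b"
	have b': "b':B (S - {x})" unfolding b'_def using FI_sub_mor[OF B fA(1,2) FI_incl_hom[OF fA(3)]] gen_step by blast
	have b'c: "b':full V (S - {x})" using FI_subD[OF B V fA(2) b'] .
	have incl: "mor V (S - {x}) S (FI_incl (S - {x})) b' = mor V A S (FI_incl A) b"
	 unfolding b'_def using mor_comp[OF fA(1,2) S FI_incl_hom[OF fA(3)] FI_incl_hom bA] compose_FI_incl_incl[OF fA(3)] by auto
	define w' where "w' L = (if L = [x] then frag_of b' else 0)" for L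
	have w': "w':kchains (frags V B) S (Suc 0)"
	 unfolding kchains_def alternating_def
	proof (intro CollectI conjI allI impI ballI)
	 show "w' L = 0" if "L~:dlists S (Suc 0)" for L using that x by (auto simp: w'_def dlists_def)
	 show "w' (map (swp a c) L) = - w' L" if "a:set L" "c:set L" "a~=c" for L a c
	 proof -
		have "L~=[x]" "map (swp a c) L~=[x]" using that by (auto simp: map_eq_Cons_conv)
		then show ?thesis by (simp add: w'_def)
	 qed
	 show "w' L:frags V B (S - set L)" if L: "L:dlists S (Suc 0)" for L
	 proof (cases "L = [x]")
		case True
		then show ?thesis using b' b'c ev_of[OF obj_ab[OF fA(2)] b'c] by (simp add: w'_def frags_def)
	 next
		case False
		then show ?thesis using F.fi_sub_zero[OF fi_sub_frags[OF V B], of "S - set L"] S by (simp add: w'_def)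
	 qed
	qed
	note wG = F.kchains_sub[OF fi_sub_frags[OF V B] S subset_UNIV w(1)] F.kchains_sub[OF fi_sub_frags[OF V B] S subset_UNIV w']
	have bw': "F.bd S w' [] = fmor V (S - {x}) S id (frag_of b')"
	proof -
	 have z: "fmor V (S - {y}) S id (w' [y]) = 0" if "y:S - {x}" for y
		using that by (simp add: w'_def fmor_def)
	 have "F.bd S w' [] = (\<Sum>y\<in>S. fmor V (S - {y}) S id (w' [y]))" by (simp add: F.bd_def)
	 also have "... = fmor V (S - {x}) S id (w' [x])"
		unfolding sum.remove[OF S x(1)] using z by simp
	 finally show ?thesis by (simp add: w'_def)
	qed
	have k: "Poly_Mapping.keys (F.bd S u [])<=full V S" if "u:kchains (frags V (full V)) S (Suc 0)" for u
	 using F.bd_in[OF F.fi_sub_G S subset_UNIV that, of "[]"] frags_full[OF V S] by simp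
	have kb: "Poly_Mapping.keys (frag_of b')<=full V (S - {x})" using b'c by simp
	have "ev (obj V S) (F.bd S w' []) = mor V A S (FI_incl A) b"
	 unfolding bw' fmor_keys_ev(2)[OF fA(2) S emb_id[OF Diff_subset] kb] restrict_id_incl ev_of[OF obj_ab[OF fA(2)] b'c] incl ..
	then have "ev (obj V S) (F.bd S (w + w') []) = y \<oplus>\<^bsub>obj V S\<^esub> mor V A S (FI_incl A) b"
	 unfolding F.bd_add[OF S subset_UNIV wG] plus_fun_apply
	 using ev_add[OF obj_ab[OF S] k[OF wG(1)] k[OF wG(2)]] w(2) by simp
	then show ?case using F.kchains_add[OF fi_sub_frags[OF V B] S subset_UNIV w(1) w'] by blast
 qed
next
 assume "\<exists>w\<in>kchains (frags V B) S (Suc 0). ev (obj V S) (F.bd S w []) = y"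
 then obtain w where w: "w:kchains (frags V B) S (Suc 0)" "y = ev (obj V S) (F.bd S w [])" by auto
 have t: "Poly_Mapping.keys (fmor V (S - {x}) S id (w [x]))<=full V S
	 & ev (obj V S) (fmor V (S - {x}) S id (w [x])):gen V B S" if x: "x:S" for x
 proof -
	have f: "finite (S - {x})" using S by simp
	have wx: "w [x]:frags V B (S - {x})" using kchainsD[OF w(1), of "[x]"] x by (simp add: dlists_def)
	then have k: "Poly_Mapping.keys (w [x])<=full V (S - {x})" "ev (obj V (S - {x})) (w [x]):B (S - {x})"
	 by (auto simp: frags_def)
	show ?thesis
	 using fmor_keys_ev[OF f S emb_id[OF Diff_subset] k(1)] gen_incl[of "S - {x}", OF _ k(2)] x restrict_id_incl by auto
 qed
 have "Poly_Mapping.keys (\<Sum>x\<in>F. fmor V (S - {x}) S id (w [x]))<=full V S \<and>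
	 ev (obj V S) (\<Sum>x\<in>F. fmor V (S - {x}) S id (w [x])):gen V B S" if "finite F" "F<=S" for F
	using that
 proof (induction F rule: finite_induct)
	case empty
	then show ?case using ev_zero[OF obj_ab[OF S]] gen_zero by simp
 next
	case (insert x F)
	let ?a = "fmor V (S - {x}) S id (w [x])" and ?b = "\<Sum>x\<in>F. fmor V (S - {x}) S id (w [x])"
	have b: "Poly_Mapping.keys ?b<=full V S" "ev (obj V S) ?b:gen V B S"
	 using insert.IH insert.prems by (simp_all only: insert_subset)
	have a: "Poly_Mapping.keys ?a<=full V S" "ev (obj V S) ?a:gen V B S"
	 using t[of x] insert.prems by (simp_all only: insert_subset)
	have "Poly_Mapping.keys (?a + ?b)<=full V S" using a(1) b(1) Poly_Mapping.keys_add[of ?a ?b] by blast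
	moreover have "ev (obj V S) (?a + ?b):gen V B S"
	 using ev_add[OF obj_ab[OF S] a(1) b(1)] gen_add[OF a(2) b(2)] by simp
	ultimately show ?case by (simp only: sum.insert[OF insert.hyps])
 qed
 from this[OF S subset_refl] show "y:gen V B S" unfolding w(2) F.bd_def by simp
qed

end

lemma gen_image:
 assumes V: "FI_module R V" and W: "FI_module R W" and ph: "FI_map R V W ph" and B: "FI_submodule R V B"
	and im: "!!S. finite S==>ph S ` B S = B' S" and S: "finite S"
 shows "ph S ` gen V B S = gen W B' S"
proof
 interpret V: FI_module R V by fact
 show "ph S ` gen V B S<=gen W B' S"
 proof (rule image_subsetI)
	fix y assume "y:gen V B S"
	then show "ph S y:gen W B' S"
	proof (induction rule: gen.induct)
	 case gen_zero
	 then show ?case using FI_map_zero[OF V W ph S] gen.gen_zero by metis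
	next
	 case (gen_step y A b)
	 have fA: "finite A" using gen_step S finite_subset by auto
	 have c: "y:full V S" "mor V A S (FI_incl A) b:full V S"
		using gen_carrier[OF V B S] gen_incl_carrier[OF V B S] gen_step by auto
	 have bc: "b:full V A" using FI_subD[OF B V fA] gen_step by blast
	 have "ph S (y \<oplus>\<^bsub>obj V S\<^esub> mor V A S (FI_incl A) b) = ph S y \<oplus>\<^bsub>obj W S\<^esub> mor W A S (FI_incl A) (ph A b)"
		using FI_map_add[OF ph S c] FI_map_nat[OF ph fA S FI_incl_hom bc] gen_step by auto
	 moreover have "ph A b:B' A" using im[OF fA] gen_step by blast
	 ultimately show ?case using gen.gen_step[OF gen_step.IH gen_step.hyps(2)] by simp
	qed
 qed
 show "gen W B' S<=ph S ` gen V B S"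
 proof
	fix y assume "y:gen W B' S"
	then show "y:ph S ` gen V B S"
	proof (induction rule: gen.induct)
	 case gen_zero
	 then show ?case using FI_map_zero[OF V W ph S] gen.gen_zero by (metis imageI)
	next
	 case (gen_step y A b)
	 have fA: "finite A" using gen_step S finite_subset by auto
	 obtain y' where y': "y':gen V B S" "y = ph S y'" using gen_step by blast
	 obtain b' where b': "b':B A" "b = ph A b'" using im[OF fA] gen_step by blast
	 have c: "y':full V S" "mor V A S (FI_incl A) b':full V S"
		using gen_carrier[OF V B S] gen_incl_carrier[OF V B S] gen_step y' b' by auto
	 have bc: "b':full V A" using FI_subD[OF B V fA] b' by blast
	 have "ph S (y' \<oplus>\<^bsub>obj V S\<^esub> mor V A S (FI_incl A) b') = y \<oplus>\<^bsub>obj W S\<^esub> mor W A S (FI_incl A) b"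
		using FI_map_add[OF ph S c] FI_map_nat[OF ph fA S FI_incl_hom bc] gen_step y' b' by auto
	 then show ?case using gen.gen_step[OF y'(1) gen_step.hyps(2) b'(1)] by (metis imageI)
	qed
 qed
qed

lemma FI_decomp_eq_gen:
 assumes V: "FI_module R V" and S: "finite S"
 shows "FI_decomp V S = gen V (full V) S"
proof
 interpret FI_module R V by fact
 interpret M: Module.module R "obj V S" by (rule obj_module[OF S])
 let ?I = "{A. A \<subset> S}"
 have fI: "finite ?I" by (rule finite_subset[of _ "Pow S"]) (use S in auto)
 have fA: "finite A" if "A:?I" for A using that S finite_subset by auto
 have cl: "mor V A S (FI_incl A) x:full V S" if "A:?I" "x:full V A" for A x
	by (rule mor_closed[OF fA[OF that(1)] S FI_incl_hom that(2)]) (use that in auto)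
 show "FI_decomp V S<=gen V (full V) S"
	unfolding FI_decomp_def
 proof (rule image_subsetI)
	fix v assume v: "v:(\<Pi>\<^sub>E A\<in>?I. full V A)"
	have "finsum (obj V S) (%A. mor V A S (FI_incl A) (v A)) F:gen V (full V) S" if "finite F" "F<=?I" for F
	 using that
	proof (induction F rule: finite_induct)
	 case empty
	 then show ?case using gen_zero by simp
	next
	 case (insert A F)
	 have vA: "v A':full V A'" if "A':?I" for A' using v that by (rule PiE_mem)
	 have "finsum (obj V S) (%A. mor V A S (FI_incl A) (v A)) (insert A F) =
		 mor V A S (FI_incl A) (v A) \<oplus>\<^bsub>obj V S\<^esub> finsum (obj V S) (%A. mor V A S (FI_incl A) (v A)) F"
	 proof (rule M.finsum_insert[OF insert.hyps])
		have c: "mor V A' S (FI_incl A') (v A'):full V S" if "A':?I" for A'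
		 by (rule cl[OF that vA[OF that]])
		show "(%A. mor V A S (FI_incl A) (v A)):F \<rightarrow> full V S"
		 by (rule Pi_I, rule c) (use insert.prems in blast)
		show "mor V A S (FI_incl A) (v A):full V S" by (rule c) (use insert.prems in blast)
	 qed
	 moreover have "mor V A S (FI_incl A) (v A):gen V (full V) S"
		by (rule gen_incl[OF V FI_submodule_full[OF V] S]) (use insert vA in auto)
	 ultimately show ?case using gen_add[OF V FI_submodule_full[OF V] S] insert by simp
	qed
	from this[OF fI subset_refl] show "finsum (obj V S) (%A. mor V A S (FI_incl A) (v A)) ?I:gen V (full V) S" .
 qed
 show "gen V (full V) S<=FI_decomp V S"
 proof
	fix y assume "y:gen V (full V) S"
	then show "y:FI_decomp V S"
	proof (induction rule: gen.induct)
	 case gen_zero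
	 define v where "v = (\<lambda>A\<in>?I. zer V A)"
	 have z: "mor V A S (FI_incl A) (v A) = zer V S" if "A:?I" for A
		using that mor_zero[OF fA[OF that] S FI_incl_hom] by (auto simp: v_def)
	 have "finsum (obj V S) (%A. mor V A S (FI_incl A) (v A)) ?I = finsum (obj V S) (%A. zer V S) ?I"
		by (rule M.finsum_cong') (use z in auto)
	 then have "finsum (obj V S) (%A. mor V A S (FI_incl A) (v A)) ?I = zer V S" by simp
	 moreover have "v:(\<Pi>\<^sub>E A\<in>?I. full V A)"
		unfolding v_def using FI_sub_zero[OF FI_submodule_full[OF V] V] fA by (intro restrict_PiE_iff[THEN iffD2]) auto
	 ultimately show ?case unfolding FI_decomp_def by (metis (no_types, lifting) image_eqI)
	next
	 case (gen_step y A b)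
	 obtain v where v: "v:(\<Pi>\<^sub>E A\<in>?I. full V A)" "y = finsum (obj V S) (%A. mor V A S (FI_incl A) (v A)) ?I"
		using gen_step.IH unfolding FI_decomp_def by blast
	 have vA: "v A':full V A'" if "A':?I" for A' using v(1) that by (rule PiE_mem)
	 define u where "u = (\<lambda>A'\<in>?I. if A = A' then v A' \<oplus>\<^bsub>obj V A'\<^esub> b else v A')"
	 have A: "A:?I" using gen_step by simp
	 interpret MA: Module.module R "obj V A" by (rule obj_module[OF fA[OF A]])
	 have u: "u:(\<Pi>\<^sub>E A\<in>?I. full V A)"
		unfolding u_def using vA gen_step(3) by (intro restrict_PiE_iff[THEN iffD2]) auto
	 let ?h = "%A'. if A = A' then mor V A' S (FI_incl A') b else zer V S"
	 have eq: "mor V A' S (FI_incl A') (u A') = mor V A' S (FI_incl A') (v A') \<oplus>\<^bsub>obj V S\<^esub> ?h A'" if "A':?I" for A'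
	 proof (cases "A = A'")
		case True
		then show ?thesis using mor_add[OF fA[OF A] S FI_incl_hom vA[OF A] gen_step(3)] A by (auto simp: u_def)
	 next
		case False
		then show ?thesis using that cl[OF that vA[OF that]] by (auto simp: u_def)
	 qed
	 have h: "?h:?I \<rightarrow> full V S"
	 proof (rule Pi_I)
		fix A' show "?h A':full V S"
		 using cl[OF A gen_step(3)] by (cases "A = A'") simp_all
	 qed
	 have m: "(%A. mor V A S (FI_incl A) (v A)):?I \<rightarrow> full V S"
		by (rule Pi_I, rule cl, assumption, rule vA, assumption)
	 have "finsum (obj V S) (%A. mor V A S (FI_incl A) (u A)) ?I =
		 finsum (obj V S) (%A'. mor V A' S (FI_incl A') (v A') \<oplus>\<^bsub>obj V S\<^esub> ?h A') ?I"
		by (rule M.finsum_cong'[OF refl _ eq], rule Pi_I, rule M.a_closed, rule funcset_mem[OF m], assumption,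
			rule funcset_mem[OF h], assumption)
	 also have "... = finsum (obj V S) (%A. mor V A S (FI_incl A) (v A)) ?I \<oplus>\<^bsub>obj V S\<^esub> finsum (obj V S) ?h ?I"
		by (rule M.finsum_addf[OF m h])
	 also have "finsum (obj V S) ?h ?I = mor V A S (FI_incl A) b"
	 proof (rule M.finsum_singleton[OF A fI, of "%A'. mor V A S (FI_incl A) b", THEN trans[rotated]])
		show "finsum (obj V S) ?h ?I = (\<Oplus>\<^bsub>obj V S\<^esub>j\<in>?I. if A = j then mor V A S (FI_incl A) b else zer V S)"
		 by (rule M.finsum_cong'[OF refl]) (use cl[OF A gen_step(3)] in \<open>simp_all add: Pi_def\<close>)
		show "(%A'. mor V A S (FI_incl A) b):?I \<rightarrow> full V S" using cl[OF A gen_step(3)] by auto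
	 qed
	 finally have "finsum (obj V S) (%A. mor V A S (FI_incl A) (u A)) ?I = y \<oplus>\<^bsub>obj V S\<^esub> mor V A S (FI_incl A) b"
		using v(2) by simp
	 then show ?case unfolding FI_decomp_def using u by (metis (no_types, lifting) image_eqI)
	qed
 qed
qed

lemma kvan_0_iff:
 assumes V: "FI_module R V" and S: "finite S"
 shows "kvan V (null V) (full V) 0 S<->full V S<=gen V (full V) S"
proof -
 interpret FI_module R V by fact
 interpret M: Module.module R "obj V S" by (rule obj_module[OF S])
 interpret F: fi_group UNIV "frags V (full V)" "fmor V" by (rule fi_group_frags[OF V])
 note U = subset_UNIV
 note nul = fi_sub_frags[OF V FI_submodule_null[OF V]]
 have k: "Poly_Mapping.keys (F.bd S u [])<=full V S" if "u:kchains (frags V (full V)) S (Suc 0)" for u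
	using F.bd_in[OF F.fi_sub_G S U that, of "[]"] frags_full[OF V S] by simp
 show ?thesis
 proof
	assume h: "kvan V (null V) (full V) 0 S"
	show "full V S<=gen V (full V) S"
	proof
	 fix x assume x: "x:full V S"
	 let ?z = "%L::nat list. if L = [] then frag_of x else 0"
	 have z: "?z:kchains (frags V (full V)) S 0"
		by (rule F.zero_chain[OF _ S U]) (use x frags_full[OF V S] in auto)
	 have "F.bd S ?z:kchains (frags V (null V)) S (0 - 1)"
		using F.bd_zero_chain[OF S U z] F.kchains_zero[OF nul S U, of 0] by simp
	 then obtain w where w: "w:kchains (frags V (full V)) S (Suc 0)" "?z - F.bd S w:kchains (frags V (null V)) S 0"
		using h z unfolding kvan_def F.hvan_def by blast
	 have "(?z - F.bd S w) []:frags V (null V) (S - set [])"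
		by (rule kchainsD[OF w(2)]) (simp add: dlists_def)
	 then have "ev (obj V S) (frag_of x - F.bd S w []) = zer V S" by (simp add: frags_def)
	 then have "x = ev (obj V S) (F.bd S w [])"
		using ev_diff[OF obj_ab[OF S] _ k[OF w(1)], of "frag_of x"] ev_of[OF obj_ab[OF S] x] x ev_closed[OF obj_ab[OF S] k[OF w(1)]]
		by (simp add: M.minus_eq_zero_iff)
	 then show "x:gen V (full V) S" using gen_iff_boundary[OF V FI_submodule_full[OF V] S] w(1) by blast
	qed
 next
	assume h: "full V S<=gen V (full V) S"
	show "kvan V (null V) (full V) 0 S"
	 unfolding kvan_def F.hvan_def
	proof (intro ballI impI)
	 fix z assume z: "z:kchains (frags V (full V)) S 0"
	 have nil: "[]:dlists S 0" by (simp add: dlists_def)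
	 have kz: "Poly_Mapping.keys (z [])<=full V S" using kchainsD[OF z nil] frags_full[OF V S] by simp
	 then have "ev (obj V S) (z []):gen V (full V) S" using h ev_closed[OF obj_ab[OF S]] by blast
	 then obtain w where w: "w:kchains (frags V (full V)) S (Suc 0)" "ev (obj V S) (F.bd S w []) = ev (obj V S) (z [])"
		using gen_iff_boundary[OF V FI_submodule_full[OF V] S] by blast
	 have "z - F.bd S w:kchains (frags V (null V)) S 0"
	 proof (rule F.chain_0_eqI[OF S U nul])
		show "alternating S 0 (z - F.bd S w)"
		 by (rule kchains_alternating[OF F.kchains_diff[OF F.fi_sub_G S U z F.bd_chains[OF F.fi_sub_G S U w(1)]]])
		have "Poly_Mapping.keys (z [] - F.bd S w [])<=full V S" using kz k[OF w(1)] keys_diff[of "z []" "F.bd S w []"] by blast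
		then show "(z - F.bd S w) []:frags V (null V) S"
		 using ev_diff[OF obj_ab[OF S] kz k[OF w(1)]] w(2) ev_closed[OF obj_ab[OF S] kz] by (simp add: frags_def M.minus_eq_zero_iff)
	 qed
	 then show "\<exists>w\<in>kchains (frags V (full V)) S (Suc 0). z - F.bd S w:kchains (frags V (null V)) S 0" using w(1) by blast
	qed
 qed
qed

text \<open>H_1(V/Z) is the kernel of H_0(Z) -> H_0(V) as soon as H_1(V) vanishes at S. The
  inclusion on the right says that elements of Z decomposable in V are decomposable in Z.\<close>

lemma kvan_1_iff:
 assumes V: "FI_module R V" and Z: "FI_submodule R V Z" and S: "finite S" and h: "kvan V (null V) (full V) (Suc 0) S"
 shows "kvan V Z (full V) (Suc 0) S<->Z S\<inter>gen V (full V) S<=gen V Z S"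
proof -
 interpret FI_module R V by fact
 interpret M: Module.module R "obj V S" by (rule obj_module[OF S])
 interpret F: fi_group UNIV "frags V (full V)" "fmor V" by (rule fi_group_frags[OF V])
 note U = subset_UNIV
 note nul = fi_sub_frags[OF V FI_submodule_null[OF V]] and fZ = fi_sub_frags[OF V Z]
 have nil: "[]:dlists S 0" by (simp add: dlists_def)
 have k: "Poly_Mapping.keys (F.bd S u [])<=full V S" if "u:kchains (frags V (full V)) S (Suc 0)" for u
	using F.bd_in[OF F.fi_sub_G S U that, of "[]"] frags_full[OF V S] by simp
 have cyc: "F.bd S w:kchains (frags V B) S 0<->ev (obj V S) (F.bd S w []):B S"
	if w: "w:kchains (frags V (full V)) S (Suc 0)" and B: "FI_submodule R V B" for w B
 proof
	assume "F.bd S w:kchains (frags V B) S 0"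
	then show "ev (obj V S) (F.bd S w []):B S" using kchainsD[OF _ nil] by (fastforce simp: frags_def)
 next
	assume "ev (obj V S) (F.bd S w []):B S"
	then show "F.bd S w:kchains (frags V B) S 0"
	 using k[OF w] by (intro F.chain_0_eqI[OF S U fi_sub_frags[OF V B] kchains_alternating[OF F.bd_chains[OF F.fi_sub_G S U w]]])
		(simp add: frags_def)
 qed
 have diff: "F.bd S w - F.bd S v:kchains (frags V (null V)) S 0<->ev (obj V S) (F.bd S w []) = ev (obj V S) (F.bd S v [])"
	if w: "w:kchains (frags V (full V)) S (Suc 0)" and v: "v:kchains (frags V (full V)) S (Suc 0)" for w v
	using cyc[OF F.kchains_diff[OF F.fi_sub_G S U w v] FI_submodule_null[OF V]] F.bd_diff[OF S U w v]
	 ev_diff[OF obj_ab[OF S] k[OF w] k[OF v]] ev_closed[OF obj_ab[OF S] k[OF w]] ev_closed[OF obj_ab[OF S] k[OF v]]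
	by (simp add: M.minus_eq_zero_iff)
 have full: "v:kchains (frags V (full V)) S (Suc 0)" if "v:kchains (frags V Z) S (Suc 0)" for v
	by (rule F.kchains_sub[OF fZ S U that])
 have "kvan V Z (full V) (Suc 0) S<->(\<forall>w\<in>kchains (frags V (full V)) S (Suc 0). F.bd S w:kchains (frags V Z) S 0 -->
	 (\<exists>v\<in>kchains (frags V Z) S (Suc 0). F.bd S w - F.bd S v:kchains (frags V (null V)) S 0))"
	unfolding kvan_def
 proof (rule F.hvan_one_quotient_iff[OF nul fZ F.fi_sub_G _ _ S U h[unfolded kvan_def]])
	show "frags V (null V) T<=frags V Z T" if "finite T" for T using FI_sub_zero[OF Z V that] by (auto simp: frags_def)
	show "frags V Z T<=frags V (full V) T" if "finite T" for T using FI_subD[OF Z V that] by (auto simp: frags_def)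
 qed
 also have "...<->Z S\<inter>gen V (full V) S<=gen V Z S"
 proof
	assume r: "\<forall>w\<in>kchains (frags V (full V)) S (Suc 0). F.bd S w:kchains (frags V Z) S 0 -->
	 (\<exists>v\<in>kchains (frags V Z) S (Suc 0). F.bd S w - F.bd S v:kchains (frags V (null V)) S 0)"
	show "Z S\<inter>gen V (full V) S<=gen V Z S"
	proof
	 fix y assume y: "y:Z S\<inter>gen V (full V) S"
	 then obtain w where w: "w:kchains (frags V (full V)) S (Suc 0)" "ev (obj V S) (F.bd S w []) = y"
		using gen_iff_boundary[OF V FI_submodule_full[OF V] S] by blast
	 then obtain v where v: "v:kchains (frags V Z) S (Suc 0)" "F.bd S w - F.bd S v:kchains (frags V (null V)) S 0"
		using r cyc[OF w(1) Z] y by blast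
	 then show "y:gen V Z S" using gen_iff_boundary[OF V Z S] diff[OF w(1) full[OF v(1)]] w(2) by metis
	qed
 next
	assume l: "Z S\<inter>gen V (full V) S<=gen V Z S"
	show "\<forall>w\<in>kchains (frags V (full V)) S (Suc 0). F.bd S w:kchains (frags V Z) S 0 -->
	 (\<exists>v\<in>kchains (frags V Z) S (Suc 0). F.bd S w - F.bd S v:kchains (frags V (null V)) S 0)"
	proof (intro ballI impI)
	 fix w assume w: "w:kchains (frags V (full V)) S (Suc 0)" "F.bd S w:kchains (frags V Z) S 0"
	 have "ev (obj V S) (F.bd S w []):gen V Z S"
		using l cyc[OF w(1) Z] w gen_iff_boundary[OF V FI_submodule_full[OF V] S] by blast
	 then obtain v where "v:kchains (frags V Z) S (Suc 0)" "ev (obj V S) (F.bd S v []) = ev (obj V S) (F.bd S w [])"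
		using gen_iff_boundary[OF V Z S] by blast
	 then show "\<exists>v\<in>kchains (frags V Z) S (Suc 0). F.bd S w - F.bd S v:kchains (frags V (null V)) S 0"
		using diff[OF w(1) full] by metis
	qed
 qed
 finally show ?thesis .
qed

subsection \<open>Cosets\<close>

lemma coset_mem_iff: "z:D +>\<^bsub>M\<^esub> x<->(\<exists>g\<in>D. z = g \<oplus>\<^bsub>M\<^esub> x)"
 by (simp add: a_r_coset_def')

context
 fixes M :: "('k, 'a) module" and D :: "'a set"
 assumes M: "abelian_group M" and D: "subgroup D (add_monoid M)"
begin

interpretation M: abelian_group M by (rule M)
interpretation D: abelian_subgroup D M
 by (rule abelian_subgroupI2[OF M.a_comm_group D])

lemma coset_eq_iff:
 assumes "x:carrier M" "y:carrier M"
 shows "D +>\<^bsub>M\<^esub> x = D +>\<^bsub>M\<^esub> y<->x \<ominus>\<^bsub>M\<^esub> y:D"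
proof
 assume "D +>\<^bsub>M\<^esub> x = D +>\<^bsub>M\<^esub> y"
 then have "x:D +>\<^bsub>M\<^esub> y" using D.a_rcos_self[OF assms(1)] by simp
 then show "x \<ominus>\<^bsub>M\<^esub> y:D" unfolding a_minus_def by (rule D.a_rcos_module_imp[OF assms(2)])
next
 assume "x \<ominus>\<^bsub>M\<^esub> y:D"
 then have "x:D +>\<^bsub>M\<^esub> y" unfolding a_minus_def by (rule D.a_rcos_module_rev[OF assms(2,1)])
 then show "D +>\<^bsub>M\<^esub> x = D +>\<^bsub>M\<^esub> y" using D.a_repr_independence'[OF _ assms(2)] by simp
qed

lemma subgroup_zero: "\<zero>\<^bsub>M\<^esub>:D"
 using D.a_subgroup subgroup.one_closed by fastforce

lemma subgroup_carrier: "x:D==>x:carrier M"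
 using subgroup.subset[OF D] by auto

lemma coset_self_iff: "x:carrier M==>D +>\<^bsub>M\<^esub> x = D<->x:D"
proof -
 assume x: "x:carrier M"
 have "D +>\<^bsub>M\<^esub> \<zero>\<^bsub>M\<^esub> = D"
 proof -
	have "g \<oplus>\<^bsub>M\<^esub> \<zero>\<^bsub>M\<^esub> = g" if "g:D" for g using subgroup_carrier[OF that] by simp
	then show ?thesis unfolding a_r_coset_def' by auto
 qed
 moreover have "x \<ominus>\<^bsub>M\<^esub> \<zero>\<^bsub>M\<^esub> = x" using M.minus_add_cancel_right[OF x M.zero_closed] x by simp
 ultimately show ?thesis using coset_eq_iff[OF x M.zero_closed] by simp
qed

lemma coset_add: "x:carrier M==>y:carrier M==>set_add M (D +>\<^bsub>M\<^esub> x) (D +>\<^bsub>M\<^esub> y) = D +>\<^bsub>M\<^esub> (x \<oplus>\<^bsub>M\<^esub> y)"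
 by (rule D.a_rcos_sum)

lemma rcosets_trivial_iff: "A_RCOSETS M D = {D}<->carrier M<=D"
proof -
 have "A_RCOSETS M D = {D}<->(\<forall>x\<in>carrier M. D +>\<^bsub>M\<^esub> x = D)"
	unfolding A_RCOSETS_def' using M.zero_closed by blast
 then show ?thesis by (auto simp: coset_self_iff)
qed

end

lemma FI_quot_sel [simp]: "full (FI_quot V N) S = A_RCOSETS (obj V S) (N S)"
 "zer (FI_quot V N) S = N S" "add (obj (FI_quot V N) S) = set_add (obj V S)"
 by (auto simp: FI_quot_def mod_quot_def)

lemma FI_H0_zero_iff:
 assumes V: "FI_module R V" and S: "finite S"
 shows "full (FI_H0 V) S = {zer (FI_H0 V) S}<->kvan V (null V) (full V) 0 S"
 unfolding FI_H0_def FI_quot_sel FI_decomp_eq_gen[OF V S] kvan_0_iff[OF V S]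
 by (rule rcosets_trivial_iff[OF FI_module.obj_ab[OF V S] gen_subgroup[OF V FI_submodule_full[OF V] S]])

lemma FI_H0_map_coset:
 assumes V: "FI_module R V" and W: "FI_module R W" and ph: "FI_map R V W ph" and S: "finite S"
	and q: "q:full V S"
 shows "FI_H0_map W ph S (gen V (full V) S +>\<^bsub>obj V S\<^esub> q) = gen W (full W) S +>\<^bsub>obj W S\<^esub> ph S q"
proof -
 interpret V: FI_module R V by fact
 interpret W: FI_module R W by fact
 interpret M: Module.module R "obj V S" by (rule V.obj_module[OF S])
 interpret N: Module.module R "obj W S" by (rule W.obj_module[OF S])
 let ?D = "gen V (full V) S" and ?E = "gen W (full W) S"
 note gV = FI_submodule_full[OF V] and gW = FI_submodule_full[OF W]
 have E: "subgroup ?E (add_monoid (obj W S))" by (rule gen_subgroup[OF W gW S])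
 have "?E +>\<^bsub>obj W S\<^esub> ph S x = ?E +>\<^bsub>obj W S\<^esub> ph S q" if xq: "x:?D +>\<^bsub>obj V S\<^esub> q" for x
 proof -
	obtain g where g: "g:?D" "x = g \<oplus>\<^bsub>obj V S\<^esub> q"
	 using xq unfolding coset_mem_iff by blast
	have gc: "g:full V S" by (rule gen_carrier[OF V gV S g(1)])
	have x: "x:full V S" using g(2) gc q by simp
	have im: "ph T ` full V T<=full W T" if "finite T" for T using FI_map_closed[OF ph that] by blast
	have "ph S g:?E"
	 using g(1)
	proof (induction rule: gen.induct)
	 case gen_zero
	 then show ?case using FI_map_zero[OF V W ph S] gen.gen_zero by metis
	next
	 case (gen_step y A b)
	 have fA: "finite A" using gen_step S finite_subset by auto
	 have c: "y:full V S" "mor V A S (FI_incl A) b:full V S"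
		using gen_carrier[OF V gV S] gen_incl_carrier[OF V gV S] gen_step by auto
	 have "ph S (y \<oplus>\<^bsub>obj V S\<^esub> mor V A S (FI_incl A) b) = ph S y \<oplus>\<^bsub>obj W S\<^esub> mor W A S (FI_incl A) (ph A b)"
		using FI_map_add[OF ph S c] FI_map_nat[OF ph fA S FI_incl_hom gen_step.hyps(3)] gen_step by auto
	 moreover have "ph A b:full W A" using FI_map_closed[OF ph fA gen_step.hyps(3)] .
	 ultimately show ?case using gen.gen_step[OF gen_step.IH gen_step.hyps(2)] by simp
	qed
	moreover have "ph S x \<ominus>\<^bsub>obj W S\<^esub> ph S q = ph S g"
	 using FI_map_add[OF ph S gc q] g(2) FI_map_closed[OF ph S gc] FI_map_closed[OF ph S q]
	 by (simp add: a_minus_def N.M.a_assoc N.M.r_neg)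
	ultimately show ?thesis
	 using coset_eq_iff[OF W.obj_ab[OF S] E FI_map_closed[OF ph S x] FI_map_closed[OF ph S q]] by simp
 qed
 moreover have "q:?D +>\<^bsub>obj V S\<^esub> q" unfolding coset_mem_iff
	using gen_zero[of V S] q by (intro bexI[of _ "zer V S"]) auto
 ultimately show ?thesis unfolding FI_H0_map_def FI_decomp_eq_gen[OF W S] by blast
qed

text \<open>Removes two layers of cosets, those defining H_0 of the terms and those defining the
  homology of the resulting complex, and leaves a condition on elements of the middle term.\<close>

lemma FI_H0_homology_zero_iff:
 assumes P: "FI_module R P0" "FI_module R P1" "FI_module R P2"
	and d: "FI_map R P1 P0 d1" "FI_map R P2 P1 d2" and S: "finite S"
	and dd: "!!b. b:full P2 S==>d1 S (d2 S b) = zer P0 S"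
 defines "W \<equiv> FI_subquot (FI_H0 P1) (FI_ker (FI_H0 P1) (FI_H0 P0) (FI_H0_map P0 d1)) (FI_im (FI_H0 P2) (FI_H0_map P1 d2))"
 shows "full W S = {zer W S} <->
	(\<forall>q\<in>full P1 S. d1 S q:gen P0 (full P0) S -->
	 (\<exists>b\<in>full P2 S. q \<ominus>\<^bsub>obj P1 S\<^esub> d2 S b:gen P1 (full P1) S))"
proof -
 interpret P1: FI_module R P1 by fact
 interpret P2: FI_module R P2 by fact
 interpret M: Module.module R "obj P1 S" by (rule P1.obj_module[OF S])
 interpret M2: Module.module R "obj P2 S" by (rule P2.obj_module[OF S])
 let ?M = "obj P1 S"
 define D where "D = gen P1 (full P1) S"
 note ab = P1.obj_ab[OF S]
 note Dg = gen_subgroup[OF P(2) FI_submodule_full[OF P(2)] S, folded D_def]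
 define K where "K = FI_ker (FI_H0 P1) (FI_H0 P0) (FI_H0_map P0 d1) S"
 define I where "I = FI_im (FI_H0 P2) (FI_H0_map P1 d2) S"
 have car: "full (FI_H0 Q) S = (%q. gen Q (full Q) S +>\<^bsub>obj Q S\<^esub> q) ` full Q S" if "FI_module R Q" for Q
	unfolding FI_H0_def FI_quot_sel FI_decomp_eq_gen[OF that S] A_RCOSETS_def' by auto
 have d2c: "d2 S b:carrier ?M" if "b:full P2 S" for b by (rule FI_map_closed[OF d(2) S that])
 have I: "I = (%b. D +>\<^bsub>?M\<^esub> d2 S b) ` full P2 S"
	unfolding I_def FI_im_def car[OF P(3)] image_image D_def using FI_H0_map_coset[OF P(3,2) d(2) S] by auto
 have z0: "zer (FI_H0 P0) S = gen P0 (full P0) S"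
	unfolding FI_H0_def FI_quot_sel FI_decomp_eq_gen[OF P(1) S] ..
 have K: "K = {D +>\<^bsub>?M\<^esub> q | q. q:carrier ?M&d1 S q:gen P0 (full P0) S}"
 proof -
	have "FI_H0_map P0 d1 S (D +>\<^bsub>?M\<^esub> q) = zer (FI_H0 P0) S<->d1 S q:gen P0 (full P0) S" if q: "q:carrier ?M" for q
	 unfolding z0 D_def FI_H0_map_coset[OF P(2,1) d(1) S q]
	 by (rule coset_self_iff[OF FI_module.obj_ab[OF P(1) S] gen_subgroup[OF P(1) FI_submodule_full[OF P(1)] S] FI_map_closed[OF d(1) S q]])
	then show ?thesis unfolding K_def FI_ker_def car[OF P(2)] D_def[symmetric] by auto
 qed
 \<comment> \<open>The outer coset of the class X: a set of inner cosets.\<close>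
 define J where "J X = {set_add ?M Y X | Y. Y:I}" for X
 have cW: "full W S = J ` K" and zW: "zer W S = I"
	unfolding W_def FI_subquot_def FI_quot_sel A_RCOSETS_def' I_def K_def J_def
	by (auto simp: FI_sub_def a_r_coset_def' FI_H0_def)
 have DI: "D:I"
 proof -
	have "D +>\<^bsub>?M\<^esub> d2 S (zer P2 S) = D"
	 using FI_map_zero[OF P(3,2) d(2) S] coset_self_iff[OF ab Dg, of "\<zero>\<^bsub>?M\<^esub>"] subgroup_zero[OF ab Dg] by simp
	then show ?thesis unfolding I using M2.M.zero_closed by (metis imageI)
 qed
 have D0: "D +>\<^bsub>?M\<^esub> \<zero>\<^bsub>?M\<^esub> = D" using coset_self_iff[OF ab Dg] subgroup_zero[OF ab Dg] by simp
 have IK: "I<=K"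
 proof
	fix X assume "X:I"
	then obtain b where b: "b:full P2 S" "X = D +>\<^bsub>?M\<^esub> d2 S b" unfolding I by auto
	then show "X:K" unfolding K using d2c[OF b(1)] dd[OF b(1)] gen_zero[of P0 S "full P0"] by auto
 qed
 have "full W S = {zer W S}<->K<=I"
 proof
	assume e: "full W S = {zer W S}"
	show "K<=I"
	proof
	 fix X assume X: "X:K"
	 then have "J X:{I}" using e[unfolded cW zW] by (metis imageI)
	 then have eq: "J X = I" by simp
	 obtain q where q: "q:carrier ?M" "X = D +>\<^bsub>?M\<^esub> q" using X unfolding K by auto
	 have "set_add ?M D X = X"
		using coset_add[OF ab Dg M.M.zero_closed q(1)] D0 q by simp
	 then have "X:J X" unfolding J_def using DI by (metis (mono_tags, lifting) mem_Collect_eq)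
	 then show "X:I" using eq by simp
	qed
 next
	assume KI: "K<=I"
	have "J X = I" if X: "X:K" for X
	proof -
	 obtain b where b: "b:full P2 S" "X = D +>\<^bsub>?M\<^esub> d2 S b" using KI X unfolding I by auto
	 have add: "set_add ?M (D +>\<^bsub>?M\<^esub> d2 S c) X = D +>\<^bsub>?M\<^esub> d2 S (c \<oplus>\<^bsub>obj P2 S\<^esub> b)" if c: "c:full P2 S" for c
		unfolding b(2) coset_add[OF ab Dg d2c[OF c] d2c[OF b(1)]] FI_map_add[OF d(2) S c b(1)] ..
	 show ?thesis
	 proof
		show "J X<=I"
		proof
		 fix Y assume "Y:J X"
		 then obtain c where c: "c:full P2 S" "Y = set_add ?M (D +>\<^bsub>?M\<^esub> d2 S c) X"
			unfolding J_def I by auto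
		 then show "Y:I" unfolding I c(2) add[OF c(1)] using M2.M.a_closed[OF c(1) b(1)] by (rule_tac imageI)
		qed
		show "I<=J X"
		proof
		 fix Y assume "Y:I"
		 then obtain c where c: "c:full P2 S" "Y = D +>\<^bsub>?M\<^esub> d2 S c" unfolding I by auto
		 let ?c = "c \<ominus>\<^bsub>obj P2 S\<^esub> b"
		 have cc: "?c:full P2 S" using c b by simp
		 have "Y = set_add ?M (D +>\<^bsub>?M\<^esub> d2 S ?c) X"
			unfolding add[OF cc] c(2) M2.M.minus_add_cancel_right[OF c(1) b(1)] ..
		 moreover have "D +>\<^bsub>?M\<^esub> d2 S ?c:I" unfolding I using cc by (rule imageI)
		 ultimately show "Y:J X" unfolding J_def by blast
		qed
	 qed
	qed
	moreover have "K~={}" using IK DI by auto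
	ultimately show "full W S = {zer W S}" unfolding cW zW by (simp add: image_constant_conv cong: image_cong)
 qed
 also have "...<->(\<forall>q\<in>carrier ?M. d1 S q:gen P0 (full P0) S-->(\<exists>b\<in>full P2 S. D +>\<^bsub>?M\<^esub> q = D +>\<^bsub>?M\<^esub> d2 S b))"
	unfolding K I by blast
 also have "...<->(\<forall>q\<in>carrier ?M. d1 S q:gen P0 (full P0) S-->(\<exists>b\<in>full P2 S. q \<ominus>\<^bsub>?M\<^esub> d2 S b:D))"
	by (rule ball_cong[OF refl], rule imp_cong[OF refl], rule bex_cong[OF refl], rule coset_eq_iff[OF ab Dg], assumption, rule d2c)
 finally show ?thesis unfolding D_def .
qed

subsection \<open>Resolutions by Koszul-acyclic modules\<close>

text \<open>Dimension shifting along the syzygies reduces Koszul H_{i+1} of V to H_1 of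
  \<open>P i\<close> modulo a syzygy. There it is the kernel of a map on H_0, which is also the
  homology of the complex H_0(P) since that syzygy is covered by the next term.\<close>

lemma FI_homology_kvan:
 fixes V :: "('k, 'a) fi_mod" and P :: "nat=>('k, 'u) fi_mod"
 assumes V: "FI_module R V" and res: "proj_resolution R V P d e"
	and acyc: "!!n j T. finite T==>kvan (P n) (null (P n)) (full (P n)) (Suc j) T" and S: "finite S"
 shows "carrier (obj (FI_subquot (FI_H0 (P (Suc i))) (FI_ker (FI_H0 (P (Suc i))) (FI_H0 (P i)) (FI_H0_map (P i) (d i)))
	 (FI_im (FI_H0 (P (Suc (Suc i)))) (FI_H0_map (P (Suc i)) (d (Suc i))))) S) =
	{\<zero>\<^bsub>obj (FI_subquot (FI_H0 (P (Suc i))) (FI_ker (FI_H0 (P (Suc i))) (FI_H0 (P i)) (FI_H0_map (P i) (d i)))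
	 (FI_im (FI_H0 (P (Suc (Suc i)))) (FI_H0_map (P (Suc i)) (d (Suc i))))) S\<^esub>}<->kvan V (null V) (full V) (Suc i) S"
proof -
 have P: "FI_module R (P n)" for n using res by (auto simp: proj_resolution_def FI_projective_def)
 have d: "FI_map R (P (Suc n)) (P n) (d n)" for n using res by (auto simp: proj_resolution_def)
 have e: "FI_map R (P 0) V e" using res by (auto simp: proj_resolution_def)
 have ex: "e T ` full (P 0) T = full V T" "d 0 T ` full (P 1) T = FI_ker (P 0) V e T"
	"d (Suc n) T ` full (P (Suc (Suc n))) T = FI_ker (P (Suc n)) (P n) (d n) T" if "finite T" for T n
	using res that unfolding proj_resolution_def FI_im_def by simp_all
 \<comment> \<open>\<open>Z n\<close> is the n-th syzygy inside \<open>P n\<close>, both a kernel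
   and the image of \<open>d n\<close>.\<close>
 define Z where "Z n = (case n of 0=>FI_ker (P 0) V e | Suc k=>FI_ker (P (Suc k)) (P k) (d k))" for n
 have Z: "FI_submodule R (P n) (Z n)" for n
	unfolding Z_def using FI_submodule_ker[OF P V e] FI_submodule_ker[OF P P d] by (cases n) auto
 have imZ: "d n T ` full (P (Suc n)) T = Z n T" if "finite T" for n T
	unfolding Z_def using ex(2,3)[OF that] by (cases n) auto
 have imZE: "EX x. x:full (P (Suc n)) T&d n T x = y" if "finite T" "y:Z n T" for n T y
 proof -
	have "y:d n T ` full (P (Suc n)) T" unfolding imZ[OF that(1)] by (rule that(2))
	then show ?thesis by (rule imageE) (rule exI, rule conjI, assumption, rule sym)
 qed
 have exE: "EX x. x:full (P 0) T&e T x = y" if "finite T" "y:full V T" for T y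
 proof -
	have "y:e T ` full (P 0) T" unfolding ex(1)[OF that(1)] by (rule that(2))
	then show ?thesis by (rule imageE) (rule exI, rule conjI, assumption, rule sym)
 qed
 have kerd: "x:Z (Suc n) T<->d n T x = zer (P n) T" if "x:full (P (Suc n)) T" for x n T
	using that by (simp add: Z_def FI_ker_def)
 have trans: "kvan (P (Suc n)) (Z (Suc n)) (full (P (Suc n))) k S<->kvan (P n) (null (P n)) (Z n) k S" for n k
 proof (rule kvan_transfer[OF P P d Z FI_submodule_full[OF P] FI_submodule_null[OF P] Z S])
	fix T :: "nat set" assume T: "finite T"
	show "d n T x:Z n T" if "x:full (P (Suc n)) T" for x unfolding imZ[OF T, symmetric] using that by (rule imageI)
	show "d n T x:null (P n) T<->x:Z (Suc n) T" if "x:full (P (Suc n)) T" for x using kerd[OF that] by simp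
	show "\<exists>x\<in>full (P (Suc n)) T. d n T x \<ominus>\<^bsub>obj (P n) T\<^esub> y:null (P n) T" if y: "y:Z n T" for y
	proof -
	 interpret M: abelian_group "obj (P n) T" by (rule FI_module.obj_ab[OF P T])
	 obtain x where x: "x:full (P (Suc n)) T" "d n T x = y" using imZE[OF T y] by blast
	 show ?thesis using FI_subD[OF Z P T y] x(2) by (intro bexI[OF _ x(1)]) (simp add: M.minus_eq_zero_iff)
	qed
 qed
 have transV: "kvan (P 0) (Z 0) (full (P 0)) k S<->kvan V (null V) (full V) k S" for k
 proof (rule kvan_transfer[OF P V e Z FI_submodule_full[OF P] FI_submodule_null[OF V] FI_submodule_full[OF V] S])
	fix T :: "nat set" assume T: "finite T"
	show "e T x:full V T" if "x:full (P 0) T" for x by (rule FI_map_closed[OF e T that])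
	show "e T x:null V T<->x:Z 0 T" if "x:full (P 0) T" for x using that by (simp add: Z_def FI_ker_def)
	show "\<exists>x\<in>full (P 0) T. e T x \<ominus>\<^bsub>obj V T\<^esub> y:null V T" if y: "y:full V T" for y
	proof -
	 interpret M: abelian_group "obj V T" by (rule FI_module.obj_ab[OF V T])
	 obtain x where x: "x:full (P 0) T" "e T x = y" using exE[OF T y] by blast
	 show ?thesis using y x(2) by (intro bexI[OF _ x(1)]) (simp add: M.minus_eq_zero_iff)
	qed
 qed
 have nZ: "null (P n) T<=Z n T" and Zf: "Z n T<=full (P n) T" if "finite T" for n T
	using FI_sub_zero[OF Z P that] FI_subD[OF Z P that] by auto
 \<comment> \<open>The index starts at k + 1 on the smaller side because a projective term is
   acyclic only in positive degrees.\<close>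
 have shift: "kvan (P n) (Z n) (full (P n)) (Suc (Suc k)) S<->kvan (P n) (null (P n)) (Z n) (Suc k) S" for n k
 proof
	assume "kvan (P n) (Z n) (full (P n)) (Suc (Suc k)) S"
	then show "kvan (P n) (null (P n)) (Z n) (Suc k) S"
	 using kvan_kernel[OF P FI_submodule_null[OF P] Z FI_submodule_full[OF P] nZ Zf S _ acyc[OF S]] by blast
 next
	assume "kvan (P n) (null (P n)) (Z n) (Suc k) S"
	then show "kvan (P n) (Z n) (full (P n)) (Suc (Suc k)) S"
	 using kvan_quotient[OF P FI_submodule_null[OF P] Z FI_submodule_full[OF P] nZ Zf S acyc[OF S]] by blast
 qed
 have "kvan (P n) (Z n) (full (P n)) (Suc k) S<->kvan V (null V) (full V) (Suc (n + k)) S" for n k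
 proof (induction n arbitrary: k)
	case 0 then show ?case using transV by simp
 next
	case (Suc n)
	then show ?case using trans[of n "Suc k"] shift[of n k] Suc[of "Suc k"] by simp
 qed
 then have "kvan V (null V) (full V) (Suc i) S<->kvan (P i) (Z i) (full (P i)) (Suc 0) S" by (metis add_0_right)
 also have "...<->Z i S\<inter>gen (P i) (full (P i)) S<=gen (P i) (Z i) S"
	by (rule kvan_1_iff[OF P Z S acyc[OF S]])
 also have "...<->(\<forall>q\<in>full (P (Suc i)) S. d i S q:gen (P i) (full (P i)) S -->
	 (\<exists>b\<in>full (P (Suc (Suc i))) S. q \<ominus>\<^bsub>obj (P (Suc i)) S\<^esub> d (Suc i) S b:gen (P (Suc i)) (full (P (Suc i))) S))"
 proof -
	interpret M: abelian_group "obj (P (Suc i)) S" by (rule FI_module.obj_ab[OF P S])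
	interpret N: abelian_group "obj (P i) S" by (rule FI_module.obj_ab[OF P S])
	have gi: "d i S ` gen (P (Suc i)) (full (P (Suc i))) S = gen (P i) (Z i) S"
	 by (rule gen_image[OF P P d FI_submodule_full[OF P] _ S]) (rule imZ)
	note gc = gen_carrier[OF P FI_submodule_full[OF P] S, of _ "Suc i"]
	note dc = FI_map_closed[OF d S, of _ i]
	note dm = FI_map_minus[OF P P d S, of _ i]
	show ?thesis
	proof
	 assume l: "Z i S\<inter>gen (P i) (full (P i)) S<=gen (P i) (Z i) S"
	 show "\<forall>q\<in>full (P (Suc i)) S. d i S q:gen (P i) (full (P i)) S -->
	 (\<exists>b\<in>full (P (Suc (Suc i))) S. q \<ominus>\<^bsub>obj (P (Suc i)) S\<^esub> d (Suc i) S b:gen (P (Suc i)) (full (P (Suc i))) S)"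
	 proof (intro ballI impI)
		fix q assume q: "q:full (P (Suc i)) S" "d i S q:gen (P i) (full (P i)) S"
		then have "d i S q:Z i S" unfolding imZ[OF S, symmetric] by (intro imageI)
		then have "d i S q:gen (P i) (Z i) S" using l q(2) by blast
		then have "d i S q:d i S ` gen (P (Suc i)) (full (P (Suc i))) S" unfolding gi .
		then obtain g where g: "g:gen (P (Suc i)) (full (P (Suc i))) S" "d i S g = d i S q" by (metis imageE)
		have "d i S (q \<ominus>\<^bsub>obj (P (Suc i)) S\<^esub> g) = zer (P i) S"
		 using dm[OF q(1) gc[OF g(1)]] g(2) dc[OF q(1)] by (simp add: N.minus_eq_zero_iff)
		then have "q \<ominus>\<^bsub>obj (P (Suc i)) S\<^esub> g:Z (Suc i) S" using kerd q(1) gc[OF g(1)] by simp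
		then obtain b where b: "b:full (P (Suc (Suc i))) S" "d (Suc i) S b = q \<ominus>\<^bsub>obj (P (Suc i)) S\<^esub> g"
		 using imZE[OF S, of _ "Suc i"] by blast
		have "q \<ominus>\<^bsub>obj (P (Suc i)) S\<^esub> d (Suc i) S b = g"
		 unfolding b(2) using q(1) gc[OF g(1)]
		 by (simp add: a_minus_def M.minus_add M.a_assoc[symmetric] M.r_neg)
		then show "\<exists>b\<in>full (P (Suc (Suc i))) S. q \<ominus>\<^bsub>obj (P (Suc i)) S\<^esub> d (Suc i) S b:gen (P (Suc i)) (full (P (Suc i))) S"
		 using b(1) g(1) by (intro bexI[of _ b]) simp_all
	 qed
	next
	 assume r: "\<forall>q\<in>full (P (Suc i)) S. d i S q:gen (P i) (full (P i)) S -->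
	 (\<exists>b\<in>full (P (Suc (Suc i))) S. q \<ominus>\<^bsub>obj (P (Suc i)) S\<^esub> d (Suc i) S b:gen (P (Suc i)) (full (P (Suc i))) S)"
	 show "Z i S\<inter>gen (P i) (full (P i)) S<=gen (P i) (Z i) S"
	 proof
		fix y assume y: "y:Z i S\<inter>gen (P i) (full (P i)) S"
		then obtain q where q: "q:full (P (Suc i)) S" "d i S q = y" using imZE[OF S, of y i] by blast
		then obtain b where b: "b:full (P (Suc (Suc i))) S"
		 "q \<ominus>\<^bsub>obj (P (Suc i)) S\<^esub> d (Suc i) S b:gen (P (Suc i)) (full (P (Suc i))) S" using r y by blast
		have bz: "d (Suc i) S b:Z (Suc i) S" unfolding imZ[OF S, symmetric] using b(1) by (rule imageI)
		have bc: "d (Suc i) S b:full (P (Suc i)) S" by (rule FI_map_closed[OF d S b(1)])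
		have "d i S (q \<ominus>\<^bsub>obj (P (Suc i)) S\<^esub> d (Suc i) S b) = y"
		 using dm[OF q(1) bc] kerd[OF bc] bz q dc[OF q(1)] by (simp add: a_minus_def)
		then show "y:gen (P i) (Z i) S" using gi b(2) by (metis imageI)
	 qed
	qed
 qed
 finally have fin: "kvan V (null V) (full V) (Suc i) S<->(\<forall>q\<in>full (P (Suc i)) S. d i S q:gen (P i) (full (P i)) S -->
	 (\<exists>b\<in>full (P (Suc (Suc i))) S. q \<ominus>\<^bsub>obj (P (Suc i)) S\<^esub> d (Suc i) S b:gen (P (Suc i)) (full (P (Suc i))) S))" .
 show ?thesis
	unfolding fin
 proof (rule FI_H0_homology_zero_iff[OF P P P d d S])
	fix b assume "b:full (P (Suc (Suc i))) S"
	then have "d (Suc i) S b:Z (Suc i) S" "d (Suc i) S b:full (P (Suc i)) S"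
	 using FI_map_closed[OF d S] unfolding imZ[OF S, symmetric] by (simp_all only: imageI)
	then show "d i S (d (Suc i) S b) = zer (P i) S" using kerd by simp
 qed
qed

subsection \<open>Degrees\<close>

lemma FI_deg_le_iff:
 assumes "- 1\<le>d"
 shows "FI_deg W\<le>ereal (of_int d)<->(ALL S. finite S-->d < int (card S)-->full W S = {zer W S})"
proof
 assume "FI_deg W\<le>ereal (of_int d)"
 then have "FI_deg W < ereal (of_int (d + 1))" by (rule order_le_less_trans) simp
 then obtain x where "x < ereal (of_int (d + 1))" "x:{ereal (of_int d) | d::int. - 1\<le>d \<and>
	 (ALL S. finite S-->d < int (card S)-->full W S = {zer W S})}"
	unfolding FI_deg_def Inf_less_iff by blast
 then obtain d' :: int where d': "ereal (of_int d') < ereal (of_int (d + 1))"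
	"ALL S. finite S-->d' < int (card S)-->full W S = {zer W S}" by blast
 have "d'\<le>d" using d'(1) by (metis less_ereal.simps(1) of_int_less_iff zle_add1_eq_le)
 then show "ALL S. finite S-->d < int (card S)-->full W S = {zer W S}" using d'(2) by auto
next
 assume "ALL S. finite S-->d < int (card S)-->full W S = {zer W S}"
 then show "FI_deg W\<le>ereal (of_int d)" unfolding FI_deg_def using assms by (intro Inf_lower) auto
qed

lemma FI_deg_ge: "ereal (- 1)\<le>FI_deg W"
 unfolding FI_deg_def
proof (rule Inf_greatest)
 fix x assume "x:{ereal (of_int d) | d::int. - 1\<le>d \<and>
	 (ALL S. finite S-->d < int (card S)-->full W S = {zer W S})}"
 then obtain d :: int where "x = ereal (of_int d)" "- 1\<le>d" by blast
 then show "ereal (- 1)\<le>x" by simp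
qed

lemma FI_deg_finiteE:
 assumes "FI_deg W < \<infinity>"
 obtains d :: int where "- 1\<le>d" "FI_deg W = ereal (of_int d)"
proof -
 define D where "D d<->- 1\<le>d&(ALL S. finite S-->d < int (card S)-->full W S = {zer W S})" for d
 obtain x where "x:{ereal (of_int d) | d. D d}"
	using assms unfolding FI_deg_def Inf_less_iff D_def by blast
 then obtain d0 where d0: "D d0" by blast
 \<comment> \<open>Degrees start at -1; shifting by one makes them natural numbers, so the infimum
   is attained.\<close>
 define n where "n = (LEAST n. D (int n - 1))"
 have ex: "D (int (nat (d0 + 1)) - 1)" using d0 unfolding D_def by simp
 have n: "D (int n - 1)" unfolding n_def using ex by (rule LeastI)
 have le: "int n - 1\<le>d" if "D d" for d
 proof -
	have "D (int (nat (d + 1)) - 1)" using that unfolding D_def by simp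
	then have "n\<le>nat (d + 1)" unfolding n_def by (rule Least_le)
	then show ?thesis using that unfolding D_def by linarith
 qed
 have "FI_deg W = ereal (of_int (int n - 1))"
 proof (rule antisym)
	show "FI_deg W\<le>ereal (of_int (int n - 1))" using n FI_deg_le_iff[of "int n - 1" W] unfolding D_def by blast
	show "ereal (of_int (int n - 1))\<le>FI_deg W"
	 unfolding FI_deg_def
	proof (rule Inf_greatest)
	 fix x assume "x:{ereal (of_int d) | d::int. - 1\<le>d \<and>
		(ALL S. finite S-->d < int (card S)-->full W S = {zer W S})}"
	 then obtain d where "x = ereal (of_int d)" "D d" unfolding D_def by blast
	 then show "ereal (of_int (int n - 1))\<le>x" using le[of d] by simp
	qed
 qed
 then show ?thesis using that[of "int n - 1"] by simp
qed

section \<open>Transport of structure and quotients\<close>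

definition preim :: "('k, 'a) fi_mod=>(nat set=>'a=>'b)=>nat set=>'b=>'a" where
 "preim V q S = inv_into (full V S) (q S)"

text \<open>The structure of V carried to the image of \<open>q\<close>. For injective
  \<open>q\<close> it is a copy of V in another type; when \<open>q\<close> identifies exactly the
  elements congruent modulo a submodule, it is the quotient.\<close>

definition push :: "('k, 'a) fi_mod=>(nat set=>'a=>'b)=>('k, 'b) fi_mod" where
 "push V q = \<lparr>obj = (%S. \<lparr>carrier = q S ` full V S, monoid.mult = undefined, one = undefined,
	 ring.zero = q S (zer V S), add = (%a b. q S (preim V q S a \<oplus>\<^bsub>obj V S\<^esub> preim V q S b)),
	 smult = (%c a. q S (c \<odot>\<^bsub>obj V S\<^esub> preim V q S a))\<rparr>),
	mor = (%S T f a. q T (mor V S T f (preim V q S a)))\<rparr>"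

lemma push_sel: "full (push V q) S = q S ` full V S" "zer (push V q) S = q S (zer V S)"
 by (auto simp: push_def)

locale pushforward =
 fixes R :: "('k, 'r) ring_scheme" and V :: "('k, 'a) fi_mod" and N :: "nat set=>'a set"
	and q :: "nat set=>'a=>'b"
 assumes V: "FI_module R V" and N: "FI_submodule R V N"
	and q_eq: "!!S x y. finite S==>x:full V S==>y:full V S==>q S x = q S y<->x \<ominus>\<^bsub>obj V S\<^esub> y:N S"
begin

lemma pre_q:
 assumes "finite S" "x:full V S"
 shows "preim V q S (q S x):full V S" "q S (preim V q S (q S x)) = q S x"
 unfolding preim_def using assms(2) by (auto intro: inv_into_into f_inv_into_f)

lemma push_add:
 assumes S: "finite S" and x: "x:full V S" and y: "y:full V S"
 shows "q S x \<oplus>\<^bsub>obj (push V q) S\<^esub> q S y = q S (x \<oplus>\<^bsub>obj V S\<^esub> y)"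
proof -
 interpret M: abelian_group "obj V S" by (rule FI_module.obj_ab[OF V S])
 let ?x = "preim V q S (q S x)" and ?y = "preim V q S (q S y)"
 note px = pre_q[OF S x] and py = pre_q[OF S y]
 have "?x \<ominus>\<^bsub>obj V S\<^esub> x:N S" "?y \<ominus>\<^bsub>obj V S\<^esub> y:N S"
	using px py q_eq[OF S px(1) x] q_eq[OF S py(1) y] by simp_all
 then have "(?x \<ominus>\<^bsub>obj V S\<^esub> x) \<oplus>\<^bsub>obj V S\<^esub> (?y \<ominus>\<^bsub>obj V S\<^esub> y):N S" by (rule FI_sub_add[OF N V S])
 also have "(?x \<ominus>\<^bsub>obj V S\<^esub> x) \<oplus>\<^bsub>obj V S\<^esub> (?y \<ominus>\<^bsub>obj V S\<^esub> y) = (?x \<oplus>\<^bsub>obj V S\<^esub> ?y) \<ominus>\<^bsub>obj V S\<^esub> (x \<oplus>\<^bsub>obj V S\<^esub> y)"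
	using px(1) py(1) x y by (simp add: a_minus_def M.minus_add M.a_ac)
 finally have "q S (?x \<oplus>\<^bsub>obj V S\<^esub> ?y) = q S (x \<oplus>\<^bsub>obj V S\<^esub> y)"
	using q_eq[OF S, of "?x \<oplus>\<^bsub>obj V S\<^esub> ?y" "x \<oplus>\<^bsub>obj V S\<^esub> y"] px(1) py(1) x y by simp
 then show ?thesis by (simp add: push_def)
qed

lemma push_smult:
 assumes S: "finite S" and c: "c:carrier R" and x: "x:full V S"
 shows "c \<odot>\<^bsub>obj (push V q) S\<^esub> q S x = q S (c \<odot>\<^bsub>obj V S\<^esub> x)"
proof -
 interpret M: Module.module R "obj V S" by (rule FI_module.obj_module[OF V S])
 let ?x = "preim V q S (q S x)"
 note px = pre_q[OF S x]
 have "?x \<ominus>\<^bsub>obj V S\<^esub> x:N S" using px q_eq[OF S px(1) x] by simp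
 then have "c \<odot>\<^bsub>obj V S\<^esub> (?x \<ominus>\<^bsub>obj V S\<^esub> x):N S" by (rule FI_sub_smult[OF N V S c])
 also have "c \<odot>\<^bsub>obj V S\<^esub> (?x \<ominus>\<^bsub>obj V S\<^esub> x) = (c \<odot>\<^bsub>obj V S\<^esub> ?x) \<ominus>\<^bsub>obj V S\<^esub> (c \<odot>\<^bsub>obj V S\<^esub> x)"
	using px(1) x c M.smult_r_distr[OF c px(1), of "\<ominus>\<^bsub>obj V S\<^esub> x"] M.smult_r_minus[OF c x] by (simp add: a_minus_def)
 finally have "q S (c \<odot>\<^bsub>obj V S\<^esub> ?x) = q S (c \<odot>\<^bsub>obj V S\<^esub> x)"
	using q_eq[OF S, of "c \<odot>\<^bsub>obj V S\<^esub> ?x" "c \<odot>\<^bsub>obj V S\<^esub> x"] px(1) x c by simp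
 then show ?thesis by (simp add: push_def)
qed

lemma push_mor:
 assumes S: "finite S" and T: "finite T" and f: "f:FI_hom S T" and x: "x:full V S"
 shows "mor (push V q) S T f (q S x) = q T (mor V S T f x)"
proof -
 let ?x = "preim V q S (q S x)"
 note px = pre_q[OF S x]
 have "?x \<ominus>\<^bsub>obj V S\<^esub> x:N S" using px q_eq[OF S px(1) x] by simp
 then have "mor V S T f (?x \<ominus>\<^bsub>obj V S\<^esub> x):N T" by (rule FI_sub_mor[OF N S T f])
 then have "q T (mor V S T f ?x) = q T (mor V S T f x)"
	using q_eq[OF T FI_module.mor_closed[OF V S T f px(1)] FI_module.mor_closed[OF V S T f x]]
	 FI_module.mor_minus[OF V S T f px(1) x] by simp
 then show ?thesis by (simp add: push_def)
qed

lemma FI_module_push: "FI_module R (push V q)"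
proof (rule FI_module.intro)
 interpret FI_module R V by (rule V)
 show "cring R" by (rule cring)
 fix S :: "nat set" assume S: "finite S"
 interpret M: Module.module R "obj V S" by (rule obj_module[OF S])
 note A = push_add[OF S] and SM = push_smult[OF S]
 show "Module.module R (obj (push V q) S)"
 proof (rule moduleI[OF cring], rule abelian_groupI)
	show "zer (push V q) S:full (push V q) S" unfolding push_sel by simp
	fix x assume "x:full (push V q) S"
	then obtain x' where x: "x':full V S" "x = q S x'" unfolding push_sel by blast
	show "zer (push V q) S \<oplus>\<^bsub>obj (push V q) S\<^esub> x = x" unfolding x(2) push_sel A[OF M.M.zero_closed x(1)] using x(1) by simp
	have "q S (\<ominus>\<^bsub>obj V S\<^esub> x') \<oplus>\<^bsub>obj (push V q) S\<^esub> x = zer (push V q) S"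
	 unfolding x(2) push_sel A[OF M.M.a_inv_closed[OF x(1)] x(1)] using M.M.l_neg[OF x(1)] by simp
	then show "\<exists>y\<in>full (push V q) S. y \<oplus>\<^bsub>obj (push V q) S\<^esub> x = zer (push V q) S"
	 unfolding push_sel(1) using M.M.a_inv_closed[OF x(1)] by blast
	show "\<one>\<^bsub>R\<^esub> \<odot>\<^bsub>obj (push V q) S\<^esub> x = x" unfolding x(2) SM[OF M.R.one_closed x(1)] using x(1) by simp
	fix y assume "y:full (push V q) S"
	then obtain y' where y: "y':full V S" "y = q S y'" unfolding push_sel by blast
	note xy = M.M.a_closed[OF x(1) y(1)]
	show "x \<oplus>\<^bsub>obj (push V q) S\<^esub> y:full (push V q) S"
	 unfolding x(2) y(2) A[OF x(1) y(1)] push_sel using xy by blast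
	show "x \<oplus>\<^bsub>obj (push V q) S\<^esub> y = y \<oplus>\<^bsub>obj (push V q) S\<^esub> x"
	 unfolding x(2) y(2) A[OF x(1) y(1)] A[OF y(1) x(1)] M.M.a_comm[OF x(1) y(1)] ..
	show "x \<oplus>\<^bsub>obj (push V q) S\<^esub> y \<oplus>\<^bsub>obj (push V q) S\<^esub> z = x \<oplus>\<^bsub>obj (push V q) S\<^esub> (y \<oplus>\<^bsub>obj (push V q) S\<^esub> z)"
	 if "z:full (push V q) S" for z
	proof -
	 obtain z' where z: "z':full V S" "z = q S z'" using \<open>z:_\<close> unfolding push_sel by blast
	 show ?thesis unfolding x(2) y(2) z(2) A[OF x(1) y(1)] A[OF y(1) z(1)] A[OF xy z(1)] A[OF x(1) M.M.a_closed[OF y(1) z(1)]]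
		 M.M.a_assoc[OF x(1) y(1) z(1)] ..
	qed
 next
	fix a x assume a: "a:carrier R" and "x:full (push V q) S"
	then obtain x' where x: "x':full V S" "x = q S x'" unfolding push_sel by blast
	show "a \<odot>\<^bsub>obj (push V q) S\<^esub> x:full (push V q) S"
	 unfolding x(2) SM[OF a x(1)] push_sel using M.smult_closed[OF a x(1)] by blast
 next
	fix a b x assume a: "a:carrier R" and b: "b:carrier R" and "x:full (push V q) S"
	then obtain x' where x: "x':full V S" "x = q S x'" unfolding push_sel by blast
	show "(a \<oplus>\<^bsub>R\<^esub> b) \<odot>\<^bsub>obj (push V q) S\<^esub> x = a \<odot>\<^bsub>obj (push V q) S\<^esub> x \<oplus>\<^bsub>obj (push V q) S\<^esub> b \<odot>\<^bsub>obj (push V q) S\<^esub> x"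
	 unfolding x(2) SM[OF a x(1)] SM[OF b x(1)] SM[OF M.R.a_closed[OF a b] x(1)]
		A[OF M.smult_closed[OF a x(1)] M.smult_closed[OF b x(1)]] M.smult_l_distr[OF a b x(1)] ..
	show "a \<otimes>\<^bsub>R\<^esub> b \<odot>\<^bsub>obj (push V q) S\<^esub> x = a \<odot>\<^bsub>obj (push V q) S\<^esub> (b \<odot>\<^bsub>obj (push V q) S\<^esub> x)"
	 unfolding x(2) SM[OF b x(1)] SM[OF M.R.m_closed[OF a b] x(1)] SM[OF a M.smult_closed[OF b x(1)]] M.smult_assoc1[OF a b x(1)] ..
 next
	fix a x y assume a: "a:carrier R" and "x:full (push V q) S" "y:full (push V q) S"
	then obtain x' y' where x: "x':full V S" "x = q S x'" and y: "y':full V S" "y = q S y'" unfolding push_sel by blast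
	show "a \<odot>\<^bsub>obj (push V q) S\<^esub> (x \<oplus>\<^bsub>obj (push V q) S\<^esub> y) = a \<odot>\<^bsub>obj (push V q) S\<^esub> x \<oplus>\<^bsub>obj (push V q) S\<^esub> a \<odot>\<^bsub>obj (push V q) S\<^esub> y"
	 unfolding x(2) y(2) A[OF x(1) y(1)] SM[OF a M.M.a_closed[OF x(1) y(1)]] SM[OF a x(1)] SM[OF a y(1)]
		A[OF M.smult_closed[OF a x(1)] M.smult_closed[OF a y(1)]] M.smult_r_distr[OF a x(1) y(1)] ..
 qed
 show "mor (push V q) S S (FI_incl S) x = x" if "x:full (push V q) S" for x
 proof -
	obtain x' where x: "x':full V S" "x = q S x'" using \<open>x:_\<close> unfolding push_sel by blast
	show ?thesis unfolding x(2) push_mor[OF S S FI_incl_hom[OF subset_refl] x(1)] mor_id[OF S x(1)] ..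
 qed
 fix T f assume T: "finite T" and f: "f:FI_hom S T"
 note PM = push_mor[OF S T f]
 show "mor (push V q) S T f:mod_hom R (obj (push V q) S) (obj (push V q) T)"
	unfolding mod_hom_def
 proof (intro CollectI conjI ballI Pi_I)
	fix x assume "x:full (push V q) S"
	then obtain x' where x: "x':full V S" "x = q S x'" unfolding push_sel by blast
	note mx = mor_closed[OF S T f x(1)]
	show "mor (push V q) S T f x:full (push V q) T" unfolding x(2) PM[OF x(1)] push_sel using mx by blast
	show "mor (push V q) S T f (c \<odot>\<^bsub>obj (push V q) S\<^esub> x) = c \<odot>\<^bsub>obj (push V q) T\<^esub> mor (push V q) S T f x" if c: "c:carrier R" for c
	 unfolding x(2) PM[OF x(1)] SM[OF c x(1)] PM[OF M.smult_closed[OF c x(1)]] push_smult[OF T c mx] mor_smult[OF S T f c x(1)] ..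
	fix y assume "y:full (push V q) S"
	then obtain y' where y: "y':full V S" "y = q S y'" unfolding push_sel by blast
	show "mor (push V q) S T f (x \<oplus>\<^bsub>obj (push V q) S\<^esub> y) = mor (push V q) S T f x \<oplus>\<^bsub>obj (push V q) T\<^esub> mor (push V q) S T f y"
	 unfolding x(2) y(2) PM[OF x(1)] PM[OF y(1)] A[OF x(1) y(1)] PM[OF M.M.a_closed[OF x(1) y(1)]]
		push_add[OF T mx mor_closed[OF S T f y(1)]] mor_add[OF S T f x(1) y(1)] ..
 qed
 fix U g assume U: "finite U" and g: "g:FI_hom T U"
 show "mor (push V q) S U (compose S g f) x = mor (push V q) T U g (mor (push V q) S T f x)"
	if "x:full (push V q) S" for x
 proof -
	obtain x' where x: "x':full V S" "x = q S x'" using \<open>x:_\<close> unfolding push_sel by blast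
	show ?thesis unfolding x(2) PM[OF x(1)] push_mor[OF S U FI_hom_compose[OF f g] x(1)]
		push_mor[OF T U g mor_closed[OF S T f x(1)]] mor_comp[OF S T U f g x(1)] ..
 qed
qed

lemma FI_map_push: "FI_map R V (push V q) q"
 unfolding FI_map_def mod_hom_def push_sel
 by (auto simp: push_add push_smult push_mor)

lemma push_surj: "q S ` full V S = full (push V q) S"
 by (simp add: push_sel)

lemma push_zero_iff: "finite S==>x:full V S==>q S x = zer (push V q) S<->x:N S"
proof -
 assume S: "finite S" and x: "x:full V S"
 interpret M: abelian_group "obj V S" by (rule FI_module.obj_ab[OF V S])
 have "x \<ominus>\<^bsub>obj V S\<^esub> zer V S = x" using M.minus_add_cancel_right[OF x M.zero_closed] x by simp
 then show ?thesis unfolding push_sel using q_eq[OF S x M.zero_closed] by simp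
qed

end

lemma pushforward_inj:
 assumes V: "FI_module R V" and inj: "!!S. finite S==>inj_on (q S) (full V S)"
 shows "pushforward R V (null V) q"
proof (rule pushforward.intro[OF V FI_submodule_null[OF V]])
 fix S x y assume S: "finite (S :: nat set)" and xy: "x:full V S" "y:full V S"
 interpret M: abelian_group "obj V S" by (rule FI_module.obj_ab[OF V S])
 show "q S x = q S y<->x \<ominus>\<^bsub>obj V S\<^esub> y:null V S"
	using M.minus_eq_zero_iff[OF xy] inj_on_eq_iff[OF inj[OF S] xy] by simp
qed

lemma FI_map_pre:
 assumes V: "FI_module R V" and inj: "!!S. finite S==>inj_on (q S) (full V S)"
 shows "FI_map R (push V q) V (preim V q)"
	and "finite S==>x:full V S==>preim V q S (q S x) = x"
proof -
 interpret pushforward R V "null V" q by (rule pushforward_inj[OF assms])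
 have p: "preim V q S (q S x) = x" if "finite S" "x:full V S" for S x
	unfolding preim_def using inv_into_f_f[OF inj[OF that(1)] that(2)] .
 then show "finite S==>x:full V S==>preim V q S (q S x) = x" by blast
 show "FI_map R (push V q) V (preim V q)"
	unfolding FI_map_def mod_hom_def
 proof (intro allI impI conjI CollectI ballI Pi_I)
	fix S :: "nat set" assume S: "finite S"
	interpret M: Module.module R "obj V S" by (rule FI_module.obj_module[OF V S])
	fix x assume "x:full (push V q) S"
	then obtain x' where x: "x':full V S" "x = q S x'" unfolding push_sel by blast
	show "preim V q S x:full V S" unfolding x(2) p[OF S x(1)] by (rule x(1))
	show "preim V q S (c \<odot>\<^bsub>obj (push V q) S\<^esub> x) = c \<odot>\<^bsub>obj V S\<^esub> preim V q S x" if c: "c:carrier R" for c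
	 unfolding x(2) p[OF S x(1)] push_smult[OF S c x(1)] p[OF S M.smult_closed[OF c x(1)]] ..
	show "preim V q S (x \<oplus>\<^bsub>obj (push V q) S\<^esub> y) = preim V q S x \<oplus>\<^bsub>obj V S\<^esub> preim V q S y" if y0: "y:full (push V q) S" for y
	proof -
	 obtain y' where y: "y':full V S" "y = q S y'" using y0 unfolding push_sel by blast
	 show ?thesis unfolding x(2) y(2) p[OF S x(1)] p[OF S y(1)] push_add[OF S x(1) y(1)] p[OF S M.M.a_closed[OF x(1) y(1)]] ..
	qed
	fix T f assume T: "finite T" and f: "f:FI_hom S T"
	show "preim V q T (mor (push V q) S T f x) = mor V S T f (preim V q S x)"
	 unfolding x(2) p[OF S x(1)] push_mor[OF S T f x(1)] p[OF T FI_module.mor_closed[OF V S T f x(1)]] ..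
 qed
qed

text \<open>Cosets would live in \<open>'a set\<close>. Representing each coset by one of its
  elements keeps the quotient in the type of V, so that the cosyzygies never leave
  \<open>univ\<close>.\<close>

lemma quotient_exists:
 fixes V :: "('k, 'a) fi_mod"
 assumes V: "FI_module R V" and N: "FI_submodule R V N"
 shows "EX (Q :: ('k, 'a) fi_mod) q. FI_module R Q&FI_map R V Q q&(ALL S. q S ` full V S = full Q S) \<and>
	(ALL S x. finite S-->x:full V S-->(q S x = zer Q S<->x:N S))"
proof -
 define q where "q S x = (SOME y. y:N S +>\<^bsub>obj V S\<^esub> x)" for S x
 have "q S x = q S y<->x \<ominus>\<^bsub>obj V S\<^esub> y:N S" if S: "finite S" and xy: "x:full V S" "y:full V S" for S x y
 proof -
	have ab: "abelian_group (obj V S)" by (rule FI_module.obj_ab[OF V S])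
	interpret M: abelian_group "obj V S" by (rule ab)
	have sg: "subgroup (N S) (add_monoid (obj V S))"
	 using N S unfolding FI_submodule_def submodule_def by blast
	have mem: "q S z:N S +>\<^bsub>obj V S\<^esub> z" if z: "z:full V S" for z
	proof -
	 have "z:N S +>\<^bsub>obj V S\<^esub> z" unfolding coset_mem_iff
		using FI_sub_zero[OF N V S] z by (intro bexI[of _ "zer V S"]) simp_all
	 then show ?thesis unfolding q_def by (rule someI)
	qed
	have cl: "N S +>\<^bsub>obj V S\<^esub> (q S z) = N S +>\<^bsub>obj V S\<^esub> z" if z: "z:full V S" for z
	 using M.a_repr_independence[OF mem[OF z] z sg] by simp
	have "q S x = q S y<->N S +>\<^bsub>obj V S\<^esub> x = N S +>\<^bsub>obj V S\<^esub> y"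
	proof
	 assume "q S x = q S y"
	 then show "N S +>\<^bsub>obj V S\<^esub> x = N S +>\<^bsub>obj V S\<^esub> y" using cl[OF xy(1)] cl[OF xy(2)] by simp
	next
	 assume "N S +>\<^bsub>obj V S\<^esub> x = N S +>\<^bsub>obj V S\<^esub> y"
	 then show "q S x = q S y" unfolding q_def by simp
	qed
	then show ?thesis using coset_eq_iff[OF ab sg xy] by simp
 qed
 then interpret pushforward R V N q by (intro pushforward.intro V N)
 show ?thesis using FI_module_push FI_map_push push_surj push_zero_iff by blast
qed

section \<open>Coding into the universe of resolutions\<close>

text \<open>The index type \<open>nat + 'k\<close> is infinite, hence in bijection with its square,
  and a function into \<open>univ\<close> can be uncurried.\<close>

lemma univ_fun_inj: "EX c :: (nat + 'k=>('k, 'a) univ)=>('k, 'a) univ. inj c"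
proof -
 have "infinite (UNIV :: (nat + 'k) set)" by (simp add: finite_Plus_UNIV_iff)
 then have "|UNIV\<times>UNIV :: ((nat + 'k)\<times>(nat + 'k)) set| =o |UNIV :: (nat + 'k) set|"
	by (rule card_of_Times_same_infinite)
 then obtain b :: "(nat + 'k)\<times>(nat + 'k)=>nat + 'k" where "bij_betw b (UNIV\<times>UNIV) UNIV"
	unfolding card_of_ordIso[symmetric] by blast
 then have b: "inj b" by (simp add: bij_betw_def)
 define c :: "(nat + 'k=>('k, 'a) univ)=>('k, 'a) univ" where "c ph x = ph (fst (inv_into UNIV b x)) (snd (inv_into UNIV b x))" for ph x
 have "ph s t = c ph (b (s, t))" for ph s t unfolding c_def using b by simp
 then have "inj c" by (metis ext injI)
 then show ?thesis by blast
qed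

lemma univ_base_inj: "EX c :: 'a=>('k, 'a) univ. inj c"
 by (rule exI[of _ "%a _. Some a"]) (auto intro!: injI dest: fun_cong)

lemma univ_index_inj: "EX c :: nat + 'k=>('k, 'a) univ. inj c"
proof (rule exI, rule injI)
 fix x y :: "nat + 'k"
 assume "(%x z. if z = x then Some (undefined :: 'a) else None) x = (%x z. if z = x then Some undefined else None) y"
 then show "x = y" by (metis option.distinct(1))
qed

lemma univ_pair_inj: "EX c :: ('k, 'a) univ\<times>('k, 'a) univ=>('k, 'a) univ. inj c"
proof -
 obtain c :: "(nat + 'k=>('k, 'a) univ)=>('k, 'a) univ" where c: "inj c" using univ_fun_inj by blast
 have "inj (%(u, v). c (%x. if x = Inl 0 then u else v))"
 proof (rule injI, clarify)
	fix u v u' v' assume "c (%x. if x = Inl 0 then u else v) = c (%x. if x = Inl 0 then u' else v')"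
	then have e: "(%x :: nat + 'k. if x = Inl 0 then u else v) = (%x. if x = Inl 0 then u' else v')" using c by (simp add: inj_eq)
	show "u = u'&v = v'" using fun_cong[OF e, of "Inl 0"] fun_cong[OF e, of "Inl 1"] by simp
 qed
 then show ?thesis by blast
qed

lemma univ_list_inj: "EX c :: ('k, 'a) univ list=>('k, 'a) univ. inj c"
proof -
 obtain c :: "(nat + 'k=>('k, 'a) univ)=>('k, 'a) univ" where c: "inj c" using univ_fun_inj by blast
 obtain i :: "nat + 'k=>('k, 'a) univ" where i: "inj i" using univ_index_inj by blast
 \<comment> \<open>Position 0 records the length, position k + 1 the k-th entry, so that unspecified
   entries beyond the end do no harm.\<close>
 define F where "F l x = (case x of Inl n=>(case n of 0=>i (Inl (length l)) | Suc k=>l ! k) | Inr _=>undefined)"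
	for l :: "('k, 'a) univ list" and x :: "nat + 'k"
 have "inj (%l. c (F l))"
 proof (rule injI)
	fix l l' assume "c (F l) = c (F l')"
	then have e: "F l = F l'" using c by (simp add: inj_eq)
	have "i (Inl (length l)) = i (Inl (length l'))" using fun_cong[OF e, of "Inl 0"] by (simp add: F_def)
	then have "length l = length l'" using i by (simp add: inj_eq)
	moreover have "l ! k = l' ! k" for k using fun_cong[OF e, of "Inl (Suc k)"] by (simp add: F_def)
	ultimately show "l = l'" by (intro nth_equalityI) auto
 qed
 then show ?thesis by blast
qed

text \<open>A finitely supported function is coded by a list of its pairs of argument and value. The
  order in the list is arbitrary, since the set of pairs determines the function. The arguments need
  a code on A only.\<close>

lemma univ_finite_support_inj:
 fixes ci :: "'i=>('k, 'a) univ" and cv :: "'v=>('k, 'a) univ" and z :: 'v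
 assumes ci: "inj_on ci A" and cv: "inj cv"
 shows "EX c :: ('i=>'v)=>('k, 'a) univ. inj_on c {ph. finite {t. ph t~=z}&{t. ph t~=z}<=A}"
proof -
 obtain cp :: "('k, 'a) univ\<times>('k, 'a) univ=>('k, 'a) univ" where cp: "inj cp" using univ_pair_inj by blast
 obtain cl :: "('k, 'a) univ list=>('k, 'a) univ" where cl: "inj cl" using univ_list_inj by blast
 define l where "l ph = (SOME l. set l = {t. ph t~=z})" for ph :: "'i=>'v"
 have l: "set (l ph) = {t. ph t~=z}" if "finite {t. ph t~=z}" for ph
	unfolding l_def using finite_list[OF that] by (rule someI_ex)
 define c where "c ph = cl (map (%t. cp (ci t, cv (ph t))) (l ph))" for ph
 have "ph = ps" if p: "finite {t. ph t~=z}" "{t. ph t~=z}<=A" "finite {t. ps t~=z}" "{t. ps t~=z}<=A" and e: "c ph = c ps" for ph ps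
 proof -
	have "map (%t. cp (ci t, cv (ph t))) (l ph) = map (%t. cp (ci t, cv (ps t))) (l ps)"
	 using e cl unfolding c_def by (simp add: inj_eq)
	then have "set (map (%t. cp (ci t, cv (ph t))) (l ph)) = set (map (%t. cp (ci t, cv (ps t))) (l ps))" by (rule arg_cong)
	then have im: "(%t. cp (ci t, cv (ph t))) ` {t. ph t~=z} = (%t. cp (ci t, cv (ps t))) ` {t. ps t~=z}"
	 unfolding set_map l[OF p(1)] l[OF p(3)] .
	have key: "ps' t = ph' t" if "(%t. cp (ci t, cv (ph' t))) ` {t. ph' t~=z}<=(%t. cp (ci t, cv (ps' t))) ` {t. ps' t~=z}"
	 "{t. ph' t~=z}<=A" "{t. ps' t~=z}<=A" "ph' t~=z" for ph' ps' t
	proof -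
	 have "cp (ci t, cv (ph' t)):(%t. cp (ci t, cv (ps' t))) ` {t. ps' t~=z}" using that(1,4) by blast
	 then obtain s where s: "ps' s~=z" "cp (ci t, cv (ph' t)) = cp (ci s, cv (ps' s))" by blast
	 then have "ci t = ci s" "cv (ph' t) = cv (ps' s)" using cp by (simp_all add: inj_eq)
	 moreover have "t:A" "s:A" using that s by auto
	 ultimately show ?thesis using ci cv by (metis inj_onD injD)
	qed
	show ?thesis
	proof
	 fix t
	 have "ph t~=z==>ps t = ph t" by (rule key[OF equalityD1[OF im] p(2,4)])
	 moreover have "ps t~=z==>ph t = ps t" by (rule key[OF equalityD2[OF im] p(4,2)])
	 ultimately show "ph t = ps t" by metis
	qed
 qed
 then have "inj_on c {ph. finite {t. ph t~=z}&{t. ph t~=z}<=A}" by (intro inj_onI) blast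
 then show ?thesis by blast
qed

section \<open>Free FI-modules and projective resolutions\<close>

subsection \<open>Free modules\<close>

definition free_mod :: "('k, 'r) ring_scheme=>'i set=>('k, 'i=>'k) module" where
 "free_mod R A = \<lparr>carrier = {ph. (ALL t. ph t:carrier R)&(ALL t. t~:A-->ph t = \<zero>\<^bsub>R\<^esub>)&finite {t. ph t~=\<zero>\<^bsub>R\<^esub>}},
	 monoid.mult = undefined, one = undefined, ring.zero = (%t. \<zero>\<^bsub>R\<^esub>), add = (%ph ps t. ph t \<oplus>\<^bsub>R\<^esub> ps t),
	 smult = (%c ph t. c \<otimes>\<^bsub>R\<^esub> ph t)\<rparr>"

definition delta :: "('k, 'r) ring_scheme=>'i=>'i=>'k" where
 "delta R a t = (if t = a then \<one>\<^bsub>R\<^esub> else \<zero>\<^bsub>R\<^esub>)"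

definition lin :: "('k, 'r) ring_scheme=>('k, 'm) module=>('i=>'m)=>('i=>'k)=>'m" where
 "lin R M b ph = finsum M (%a. ph a \<odot>\<^bsub>M\<^esub> b a) {a. ph a~=\<zero>\<^bsub>R\<^esub>}"

context
 fixes R :: "('k, 'r) ring_scheme" (structure) and A :: "'i set"
 assumes R: "cring R"
begin

interpretation cring R by (rule R)

lemma free_mod_sel: "carrier (free_mod R A) = {ph. (ALL t. ph t:carrier R)&(ALL t. t~:A-->ph t = \<zero>)&finite {t. ph t~=\<zero>}}"
 "ph \<oplus>\<^bsub>free_mod R A\<^esub> ps = (%t. ph t\<oplus>ps t)" "c \<odot>\<^bsub>free_mod R A\<^esub> ph = (%t. c\<otimes>ph t)" "\<zero>\<^bsub>free_mod R A\<^esub> = (%t. \<zero>)"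
 by (auto simp: free_mod_def)

lemma free_modD:
 assumes "ph:carrier (free_mod R A)"
 shows "ph t:carrier R" "t~:A==>ph t = \<zero>" "finite {t. ph t~=\<zero>}"
 using assms by (simp_all add: free_mod_sel)

lemma free_mod_module: "Module.module R (free_mod R A)"
proof (rule moduleI[OF R], rule abelian_groupI)
 fix ph assume p: "ph:carrier (free_mod R A)"
 note p' = free_modD[OF p]
 show "\<zero>\<^bsub>free_mod R A\<^esub> \<oplus>\<^bsub>free_mod R A\<^esub> ph = ph" unfolding free_mod_sel using p'(1) by simp
 show "\<one> \<odot>\<^bsub>free_mod R A\<^esub> ph = ph" unfolding free_mod_sel using p'(1) by simp
 have "(%t.\<ominus>ph t):carrier (free_mod R A)"
	unfolding free_mod_sel
 proof (intro CollectI conjI allI impI)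
	show "finite {t.\<ominus>ph t~=\<zero>}" by (rule finite_subset[OF _ p'(3)]) auto
 qed (use p' in auto)
 moreover have "(%t.\<ominus>ph t) \<oplus>\<^bsub>free_mod R A\<^esub> ph = \<zero>\<^bsub>free_mod R A\<^esub>" unfolding free_mod_sel using p'(1) by (simp add: l_neg)
 ultimately show "\<exists>ps\<in>carrier (free_mod R A). ps \<oplus>\<^bsub>free_mod R A\<^esub> ph = \<zero>\<^bsub>free_mod R A\<^esub>" by blast
 show "c \<odot>\<^bsub>free_mod R A\<^esub> ph:carrier (free_mod R A)" if "c:carrier R" for c
	unfolding free_mod_sel
 proof (intro CollectI conjI allI impI)
	show "finite {t. c\<otimes>ph t~=\<zero>}" by (rule finite_subset[OF _ p'(3)]) (use that in auto)
 qed (use p' that in auto)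
 show "(a\<oplus>b) \<odot>\<^bsub>free_mod R A\<^esub> ph = a \<odot>\<^bsub>free_mod R A\<^esub> ph \<oplus>\<^bsub>free_mod R A\<^esub> b \<odot>\<^bsub>free_mod R A\<^esub> ph"
	"a\<otimes>b \<odot>\<^bsub>free_mod R A\<^esub> ph = a \<odot>\<^bsub>free_mod R A\<^esub> (b \<odot>\<^bsub>free_mod R A\<^esub> ph)"
	if "a:carrier R" "b:carrier R" for a b
	unfolding free_mod_sel using p'(1) that by (simp_all add: l_distr m_assoc)
 fix ps assume q: "ps:carrier (free_mod R A)"
 note q' = free_modD[OF q]
 show "ph \<oplus>\<^bsub>free_mod R A\<^esub> ps:carrier (free_mod R A)"
	unfolding free_mod_sel
 proof (intro CollectI conjI allI impI)
	show "finite {t. ph t\<oplus>ps t~=\<zero>}" by (rule finite_subset[OF _ finite_UnI[OF p'(3) q'(3)]]) auto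
 qed (use p' q' in auto)
 show "ph \<oplus>\<^bsub>free_mod R A\<^esub> ps = ps \<oplus>\<^bsub>free_mod R A\<^esub> ph" unfolding free_mod_sel using p'(1) q'(1) by (simp add: a_comm)
 show "a \<odot>\<^bsub>free_mod R A\<^esub> (ph \<oplus>\<^bsub>free_mod R A\<^esub> ps) = a \<odot>\<^bsub>free_mod R A\<^esub> ph \<oplus>\<^bsub>free_mod R A\<^esub> a \<odot>\<^bsub>free_mod R A\<^esub> ps"
	if "a:carrier R" for a unfolding free_mod_sel using p'(1) q'(1) that by (simp add: r_distr)
 show "ph \<oplus>\<^bsub>free_mod R A\<^esub> ps \<oplus>\<^bsub>free_mod R A\<^esub> \<xi> = ph \<oplus>\<^bsub>free_mod R A\<^esub> (ps \<oplus>\<^bsub>free_mod R A\<^esub> \<xi>)"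
	if "\<xi>:carrier (free_mod R A)" for \<xi> unfolding free_mod_sel using p'(1) q'(1) free_modD(1)[OF that] by (simp add: a_assoc)
next
 show "\<zero>\<^bsub>free_mod R A\<^esub>:carrier (free_mod R A)" unfolding free_mod_sel by simp
qed

lemma delta_in: "a:A==>delta R a:carrier (free_mod R A)"
 unfolding free_mod_sel delta_def by (auto intro: finite_subset[of _ "{a}"])

context
 fixes M :: "('k, 'm) module" and b :: "'i=>'m"
 assumes M: "Module.module R M" and b: "!!a. a:A==>b a:carrier M"
begin

interpretation M: Module.module R M by (rule M)

lemma lin_superset:
 assumes p: "ph:carrier (free_mod R A)" and F: "finite F" "{a. ph a~=\<zero>}<=F" "F<=A"
 shows "lin R M b ph = finsum M (%a. ph a \<odot>\<^bsub>M\<^esub> b a) F"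
 unfolding lin_def
proof (rule M.M.add.finprod_mono_neutral_cong_left[OF F(1,2)])
 show "ph a \<odot>\<^bsub>M\<^esub> b a = \<zero>\<^bsub>M\<^esub>" if "a:F - {a. ph a~=\<zero>}" for a
 proof -
	have "b a:carrier M" using that F(3) b by blast
	moreover have "ph a = \<zero>" using that by blast
	ultimately show ?thesis by simp
 qed
 show "(%a. ph a \<odot>\<^bsub>M\<^esub> b a):F \<rightarrow> carrier M" using F(3) b free_modD(1)[OF p] by (intro Pi_I M.smult_closed) auto
qed simp

lemma free_mod_supp: "ph:carrier (free_mod R A)==>{a. ph a~=\<zero>}<=A"
 using free_modD(2) by blast

lemma lin_hom: "lin R M b:mod_hom R (free_mod R A) M"
 unfolding mod_hom_def
proof (intro CollectI conjI ballI Pi_I)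
 fix ph assume p: "ph:carrier (free_mod R A)"
 note p' = free_modD[OF p]
 show "lin R M b ph:carrier M" unfolding lin_def
	by (rule M.M.finsum_closed, rule Pi_I, rule M.smult_closed, rule p'(1), rule b) (use free_mod_supp[OF p] in blast)
 show "lin R M b (c \<odot>\<^bsub>free_mod R A\<^esub> ph) = c \<odot>\<^bsub>M\<^esub> lin R M b ph" if c: "c:carrier R" for c
 proof -
	have cp: "c \<odot>\<^bsub>free_mod R A\<^esub> ph:carrier (free_mod R A)" by (rule Module.module.smult_closed[OF free_mod_module c p])
	have "lin R M b (c \<odot>\<^bsub>free_mod R A\<^esub> ph) = finsum M (%a. (c \<odot>\<^bsub>free_mod R A\<^esub> ph) a \<odot>\<^bsub>M\<^esub> b a) {a. ph a~=\<zero>}"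
	 by (rule lin_superset[OF cp p'(3) _ free_mod_supp[OF p]]) (use c in \<open>auto simp: free_mod_sel\<close>)
	also have "... = finsum M (%a. c \<odot>\<^bsub>M\<^esub> (ph a \<odot>\<^bsub>M\<^esub> b a)) {a. ph a~=\<zero>}"
	proof (rule M.M.finsum_cong'[OF refl])
	 fix a assume "a:{a. ph a~=\<zero>}"
	 then have "b a:carrier M" using free_mod_supp[OF p] b by blast
	 then show "(c \<odot>\<^bsub>free_mod R A\<^esub> ph) a \<odot>\<^bsub>M\<^esub> b a = c \<odot>\<^bsub>M\<^esub> (ph a \<odot>\<^bsub>M\<^esub> b a)"
		using M.smult_assoc1[OF c p'(1)] by (simp add: free_mod_sel)
	next
	 show "(%a. c \<odot>\<^bsub>M\<^esub> (ph a \<odot>\<^bsub>M\<^esub> b a)):{a. ph a~=\<zero>} \<rightarrow> carrier M"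
		by (rule Pi_I, rule M.smult_closed[OF c], rule M.smult_closed[OF p'(1)], rule b) (use free_mod_supp[OF p] in blast)
	qed
	also have "... = c \<odot>\<^bsub>M\<^esub> lin R M b ph"
	 unfolding lin_def
	 by (rule M.finsum_smult_ldistr[OF p'(3) c, symmetric], rule Pi_I, rule M.smult_closed[OF p'(1)], rule b) (use free_mod_supp[OF p] in blast)
	finally show ?thesis .
 qed
 fix ps assume q: "ps:carrier (free_mod R A)"
 note q' = free_modD[OF q]
 let ?F = "{a. ph a~=\<zero>}\<union>{a. ps a~=\<zero>}"
 have F: "finite ?F" "?F<=A" using p'(3) q'(3) free_mod_supp[OF p] free_mod_supp[OF q] by auto
 have pq: "ph \<oplus>\<^bsub>free_mod R A\<^esub> ps:carrier (free_mod R A)"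
	using free_mod_module p q by (metis abelian_group.axioms(1) abelian_monoid.a_closed module_abelian_group)
 have cl: "(%a. \<xi> a \<odot>\<^bsub>M\<^esub> b a):?F \<rightarrow> carrier M" if "!!a. \<xi> a:carrier R" for \<xi>
	by (rule Pi_I, rule M.smult_closed[OF that], rule b) (use F(2) in blast)
 have "lin R M b (ph \<oplus>\<^bsub>free_mod R A\<^esub> ps) = finsum M (%a. (ph \<oplus>\<^bsub>free_mod R A\<^esub> ps) a \<odot>\<^bsub>M\<^esub> b a) ?F"
	by (rule lin_superset[OF pq F(1) _ F(2)]) (auto simp: free_mod_sel)
 also have "... = finsum M (%a. ph a \<odot>\<^bsub>M\<^esub> b a \<oplus>\<^bsub>M\<^esub> ps a \<odot>\<^bsub>M\<^esub> b a) ?F"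
 proof (rule M.M.finsum_cong'[OF refl])
	fix a assume "a:?F"
	then have "b a:carrier M" using F(2) b by blast
	then show "(ph \<oplus>\<^bsub>free_mod R A\<^esub> ps) a \<odot>\<^bsub>M\<^esub> b a = ph a \<odot>\<^bsub>M\<^esub> b a \<oplus>\<^bsub>M\<^esub> ps a \<odot>\<^bsub>M\<^esub> b a"
	 using M.smult_l_distr[OF p'(1) q'(1)] by (simp add: free_mod_sel)
 next
	show "(%a. ph a \<odot>\<^bsub>M\<^esub> b a \<oplus>\<^bsub>M\<^esub> ps a \<odot>\<^bsub>M\<^esub> b a):?F \<rightarrow> carrier M"
	 by (rule Pi_I, rule M.M.a_closed, rule funcset_mem[OF cl[of ph, OF p'(1)]], assumption,
		 rule funcset_mem[OF cl[of ps, OF q'(1)]], assumption)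
 qed
 also have "... = finsum M (%a. ph a \<odot>\<^bsub>M\<^esub> b a) ?F \<oplus>\<^bsub>M\<^esub> finsum M (%a. ps a \<odot>\<^bsub>M\<^esub> b a) ?F"
	by (rule M.M.finsum_addf[OF cl[OF p'(1)] cl[OF q'(1)]])
 also have "finsum M (%a. ph a \<odot>\<^bsub>M\<^esub> b a) ?F = lin R M b ph" by (rule lin_superset[OF p F(1) _ F(2), symmetric]) auto
 also have "finsum M (%a. ps a \<odot>\<^bsub>M\<^esub> b a) ?F = lin R M b ps" by (rule lin_superset[OF q F(1) _ F(2), symmetric]) auto
 finally show "lin R M b (ph \<oplus>\<^bsub>free_mod R A\<^esub> ps) = lin R M b ph \<oplus>\<^bsub>M\<^esub> lin R M b ps" .
qed

lemma lin_delta: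
 assumes a: "a:A"
 shows "lin R M b (delta R a) = b a"
proof -
 have "lin R M b (delta R a) = finsum M (%t. delta R a t \<odot>\<^bsub>M\<^esub> b t) {a}"
	by (rule lin_superset[OF delta_in[OF a]]) (use a in \<open>auto simp: delta_def\<close>)
 also have "... = b a" using b[OF a] by (simp add: delta_def)
 finally show ?thesis .
qed

end

lemma free_mod_hom_eq:
 assumes M: "Module.module R M" and f: "f:mod_hom R (free_mod R A) M" and g: "g:mod_hom R (free_mod R A) M"
	and eq: "!!a. a:A==>f (delta R a) = g (delta R a)" and p: "ph:carrier (free_mod R A)"
 shows "f ph = g ph"
proof -
 have "f ph = g ph" if "finite F" "ph:carrier (free_mod R A)" "{a. ph a~=\<zero>}<=F" for F ph
	using that
 proof (induction F arbitrary: ph rule: finite_induct)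
	case empty
	then have "ph = \<zero>\<^bsub>free_mod R A\<^esub>" by (auto simp: free_mod_sel)
	then show ?case using mod_hom_zero[OF module_abelian_group[OF free_mod_module] module_abelian_group[OF M] f]
	 mod_hom_zero[OF module_abelian_group[OF free_mod_module] module_abelian_group[OF M] g] by simp
 next
	case (insert a F)
	note p' = free_modD[OF insert.prems(1)]
	show ?case
	proof (cases "a:A")
	 case False
	 then have "{a. ph a~=\<zero>}<=F" using insert.prems(2) p'(2)[of a] by auto
	 then show ?thesis using insert.IH insert.prems(1) by blast
	next
	 case True
	 define ps where "ps = ph(a := \<zero>)"
	 have psi: "ps:carrier (free_mod R A)"
		unfolding free_mod_sel ps_def
	 proof (intro CollectI conjI allI impI)
		show "finite {t. (ph(a := \<zero>)) t~=\<zero>}" by (rule finite_subset[OF _ p'(3)]) auto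
	 qed (use p' in auto)
	 have d: "ph a \<odot>\<^bsub>free_mod R A\<^esub> delta R a:carrier (free_mod R A)"
		by (rule Module.module.smult_closed[OF free_mod_module p'(1) delta_in[OF True]])
	 have e: "ph = ps \<oplus>\<^bsub>free_mod R A\<^esub> (ph a \<odot>\<^bsub>free_mod R A\<^esub> delta R a)"
		unfolding free_mod_sel ps_def delta_def using p'(1) by (auto simp: fun_eq_iff)
	 have "{t. ps t~=\<zero>}<=F" using insert.prems(2) by (auto simp: ps_def)
	 then have IH: "f ps = g ps" using insert.IH psi by blast
	 have "f (ps \<oplus>\<^bsub>free_mod R A\<^esub> (ph a \<odot>\<^bsub>free_mod R A\<^esub> delta R a)) = g (ps \<oplus>\<^bsub>free_mod R A\<^esub> (ph a \<odot>\<^bsub>free_mod R A\<^esub> delta R a))"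
		unfolding mod_hom_add[OF f psi d] mod_hom_add[OF g psi d] mod_hom_smult[OF f p'(1) delta_in[OF True]]
		 mod_hom_smult[OF g p'(1) delta_in[OF True]] IH eq[OF True] ..
	 then show ?thesis using e by simp
	qed
 qed
 from this[OF free_modD(3)[OF p] p subset_refl] show ?thesis .
qed

end

subsection \<open>Free covers\<close>

text \<open>Natural splittings of V(S - p) -> V(S), compatible with the inclusions of S - q into S:
  precisely the input of the homotopy argument for acyclicity.\<close>

definition retractions :: "('k, 'r) ring_scheme=>('k, 'a) fi_mod=>(nat set=>nat=>'a=>'a)=>bool" where
 "retractions R V r <->
	 (ALL S p. finite S-->p:S-->r S p:mod_hom R (obj V S) (obj V (S - {p}))) \<and>
	 (ALL S p x. finite S-->p:S-->x:full V (S - {p}) -->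
		r S p (mor V (S - {p}) S (FI_incl (S - {p})) x) = x) \<and>
	 (ALL S p q x. finite S-->p:S-->q:S-->p~=q-->x:full V (S - {q}) -->
		r S p (mor V (S - {q}) S (FI_incl (S - {q})) x) =
		mor V (S - {q} - {p}) (S - {p}) (FI_incl (S - {q} - {p})) (r (S - {q}) p x))"

lemma
 assumes "retractions R V r"
 shows retractions_hom: "finite S==>p:S==>r S p:mod_hom R (obj V S) (obj V (S - {p}))"
	and retractions_ret: "finite S==>p:S==>x:full V (S - {p})==>r S p (mor V (S - {p}) S (FI_incl (S - {p})) x) = x"
	and retractions_nat: "finite S==>p:S==>q:S==>p~=q==>x:full V (S - {q}) ==>
		r S p (mor V (S - {q}) S (FI_incl (S - {q})) x) =
		mor V (S - {q} - {p}) (S - {p}) (FI_incl (S - {q} - {p})) (r (S - {q}) p x)"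
 using assms unfolding retractions_def by simp_all

lemma retractions_kvan:
 assumes "FI_module R V" "retractions R V r" "finite S"
 shows "kvan V (null V) (full V) (Suc j) S"
 by (rule kvan_retraction[OF assms(1,3) retractions_hom[OF assms(2)] retractions_ret[OF assms(2)] retractions_nat[OF assms(2)]])

lemma retractions_retract:
 assumes W: "FI_module R W" "retractions R W r" and g: "FI_map R V W g" and e: "FI_map R W V e"
	and eg: "!!S x. finite S==>x:full V S==>e S (g S x) = x"
 shows "EX r'. retractions R V r'"
proof -
 note r = retractions_hom[OF W(2)] retractions_ret[OF W(2)] retractions_nat[OF W(2)]
 define r' where "r' S p x = e (S - {p}) (r S p (g S x))" for S p x
 show ?thesis
	unfolding retractions_def
 proof (intro exI[of _ r'] conjI allI impI)
	fix S :: "nat set" and p assume S: "finite S" "p:S"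
	have f: "finite (S - {p})" using S by simp
	show "r' S p:mod_hom R (obj V S) (obj V (S - {p}))"
	 unfolding r'_def[abs_def] by (rule mod_hom_comp[OF mod_hom_comp[OF FI_map_hom[OF g S(1)] r(1)[OF S]] FI_map_hom[OF e f]])
	show "r' S p (mor V (S - {p}) S (FI_incl (S - {p})) x) = x" if x: "x:full V (S - {p})" for x
	 unfolding r'_def FI_map_nat[OF g f S(1) FI_incl_hom[OF Diff_subset] x] r(2)[OF S FI_map_closed[OF g f x]] eg[OF f x] ..
	fix q x assume q: "q:S" "p~=q" and x: "x:full V (S - {q})"
	have fq: "finite (S - {q})" "p:S - {q}" "finite (S - {q} - {p})" using S q by auto
	have sub: "S - {q} - {p}<=S - {p}" by auto
	show "r' S p (mor V (S - {q}) S (FI_incl (S - {q})) x) =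
		mor V (S - {q} - {p}) (S - {p}) (FI_incl (S - {q} - {p})) (r' (S - {q}) p x)"
	 unfolding r'_def FI_map_nat[OF g fq(1) S(1) FI_incl_hom[OF Diff_subset] x] r(3)[OF S q FI_map_closed[OF g fq(1) x]]
		FI_map_nat[OF e fq(3) f FI_incl_hom[OF sub] mod_hom_closed[OF r(1)[OF fq(1,2)] FI_map_closed[OF g fq(1) x]]] ..
 qed
qed

text \<open>Basis at S of the canonical free cover, the sum over T and x in V(T) of copies of the
  representable module of T: the generator x pushed along the injection f from T to S.\<close>

definition fidx :: "('k, 'a) fi_mod=>nat set=>(nat set\<times>(nat=>nat)\<times>'a) set" where
 "fidx V S = {(T, f, x). finite T&f:FI_hom T S&x:full V T}"

definition along :: "(nat=>nat)=>nat set\<times>(nat=>nat)\<times>'a=>nat set\<times>(nat=>nat)\<times>'a" where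
 "along g t = (case t of (T, f, x)=>(T, compose T g f, x))"

definition free_fi :: "('k, 'r) ring_scheme=>('k, 'a) fi_mod=>('k, nat set\<times>(nat=>nat)\<times>'a=>'k) fi_mod" where
 "free_fi R V = \<lparr>obj = (%S. free_mod R (fidx V S)),
	 mor = (%S S' g. lin R (free_mod R (fidx V S')) (%t. delta R (along g t)))\<rparr>"

context
 fixes R :: "('k, 'r) ring_scheme" and V :: "('k, 'a) fi_mod"
 assumes V: "FI_module R V"
begin

interpretation FI_module R V by (rule V)

lemma along_in: "g:FI_hom S S'==>t:fidx V S==>along g t:fidx V S'"
 by (auto simp: fidx_def along_def FI_hom_compose)

lemma along_comp: "g:FI_hom S S'==>h:FI_hom S' S''==>t:fidx V S==>along (compose S h g) t = along h (along g t)"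
 by (auto simp: fidx_def along_def compose_def FI_hom_def fun_eq_iff)

lemma along_incl: "t:fidx V S==>along (FI_incl S) t = t"
 by (auto simp: fidx_def along_def compose_FI_incl)

lemma fr_mod: "Module.module R (free_mod R (fidx V S))"
 by (rule free_mod_module[OF cring])

lemma free_fi_sel: "obj (free_fi R V) S = free_mod R (fidx V S)"
 "mor (free_fi R V) S S' g = lin R (free_mod R (fidx V S')) (%t. delta R (along g t))"
 by (simp_all add: free_fi_def)

lemma free_fi_mor_hom: "g:FI_hom S S'==>mor (free_fi R V) S S' g:mod_hom R (obj (free_fi R V) S) (obj (free_fi R V) S')"
 unfolding free_fi_sel by (rule lin_hom[OF cring fr_mod delta_in[OF cring along_in]])

lemma free_fi_mor_delta: "g:FI_hom S S'==>t:fidx V S==>mor (free_fi R V) S S' g (delta R t) = delta R (along g t)"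
 unfolding free_fi_sel by (rule lin_delta[OF cring fr_mod delta_in[OF cring along_in]])

lemma FI_module_free: "FI_module R (free_fi R V)"
proof (rule FI_module.intro[OF cring])
 fix S :: "nat set" assume S: "finite S"
 show "Module.module R (obj (free_fi R V) S)" unfolding free_fi_sel by (rule fr_mod)
 show "mor (free_fi R V) S S (FI_incl S) x = x" if x: "x:full (free_fi R V) S" for x
	by (rule free_mod_hom_eq[OF cring fr_mod[of S] free_fi_mor_hom[OF FI_incl_hom[OF subset_refl], unfolded free_fi_sel(1)] mod_hom_id])
	 (use x in \<open>simp_all add: free_fi_mor_delta[OF FI_incl_hom[OF subset_refl]] along_incl free_fi_sel(1)\<close>)
 fix T f assume T: "finite T" and f: "f:FI_hom S T"
 show "mor (free_fi R V) S T f:mod_hom R (obj (free_fi R V) S) (obj (free_fi R V) T)" by (rule free_fi_mor_hom[OF f])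
 fix U g assume U: "finite U" and g: "g:FI_hom T U"
 show "mor (free_fi R V) S U (compose S g f) x = mor (free_fi R V) T U g (mor (free_fi R V) S T f x)"
	if x: "x:full (free_fi R V) S" for x
 proof (rule free_mod_hom_eq[OF cring fr_mod[of U] free_fi_mor_hom[OF FI_hom_compose[OF f g], unfolded free_fi_sel(1)]
		mod_hom_comp[OF free_fi_mor_hom[OF f, unfolded free_fi_sel(1)] free_fi_mor_hom[OF g, unfolded free_fi_sel(1)]]])
	show "mor (free_fi R V) S U (compose S g f) (delta R a) = mor (free_fi R V) T U g (mor (free_fi R V) S T f (delta R a))"
	 if a: "a:fidx V S" for a
	 unfolding free_fi_mor_delta[OF FI_hom_compose[OF f g] a] free_fi_mor_delta[OF f a] free_fi_mor_delta[OF g along_in[OF f a]]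
		along_comp[OF f g a] ..
	show "x:carrier (free_mod R (fidx V S))" using x unfolding free_fi_sel(1) .
 qed
qed

text \<open>The retraction keeps the basis elements whose injection avoids p and kills the
  others.\<close>

lemma retractions_free: "EX r. retractions R (free_fi R V) r"
proof -
 define r where "r S p = lin R (free_mod R (fidx V (S - {p})))
	 (%t. if t:fidx V (S - {p}) then delta R t else \<zero>\<^bsub>free_mod R (fidx V (S - {p}))\<^esub>)" for S p
 have zc: "\<zero>\<^bsub>free_mod R (fidx V T)\<^esub>:carrier (free_mod R (fidx V T))" for T
	using abelian_monoid.zero_closed[OF abelian_group.axioms(1)[OF module_abelian_group[OF fr_mod]]] .
 have b: "(if t:fidx V T then delta R t else \<zero>\<^bsub>free_mod R (fidx V T)\<^esub>):carrier (free_mod R (fidx V T))" for t T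
	using delta_in[OF cring, of t "fidx V T"] zc by simp
 have rh: "r S p:mod_hom R (free_mod R (fidx V S)) (free_mod R (fidx V (S - {p})))" for S p
	unfolding r_def by (rule lin_hom[OF cring fr_mod b])
 have rd: "r S p (delta R t) = (if t:fidx V (S - {p}) then delta R t else \<zero>\<^bsub>free_mod R (fidx V (S - {p}))\<^esub>)" if "t:fidx V S" for S p t
	unfolding r_def by (rule lin_delta[OF cring fr_mod b that])
 have sub: "along (FI_incl A) t = t" if "t:fidx V A" for A t by (rule along_incl[OF that])
 have mono: "t:fidx V B" if "t:fidx V A" "A<=B" for A B t
	using along_in[OF FI_incl_hom[OF that(2)] that(1)] sub[OF that(1)] by simp
 show ?thesis
	unfolding retractions_def
 proof (intro exI[of _ r] conjI allI impI)
	fix S :: "nat set" and p assume S: "finite S" "p:S"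
	show "r S p:mod_hom R (obj (free_fi R V) S) (obj (free_fi R V) (S - {p}))" unfolding free_fi_sel(1) by (rule rh)
	note i = FI_incl_hom[OF Diff_subset, of S "{p}"]
	show "r S p (mor (free_fi R V) (S - {p}) S (FI_incl (S - {p})) x) = x" if x: "x:full (free_fi R V) (S - {p})" for x
	proof (rule free_mod_hom_eq[OF cring fr_mod[of "S - {p}"] mod_hom_comp[OF free_fi_mor_hom[OF i, unfolded free_fi_sel(1)] rh] mod_hom_id])
	 show "r S p (mor (free_fi R V) (S - {p}) S (FI_incl (S - {p})) (delta R a)) = delta R a" if a: "a:fidx V (S - {p})" for a
		unfolding free_fi_mor_delta[OF i a] sub[OF a] rd[OF mono[OF a Diff_subset]] using a by simp
	 show "x:carrier (free_mod R (fidx V (S - {p})))" using x unfolding free_fi_sel(1) .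
	qed
	fix q x assume q: "q:S" "p~=q" and x: "x:full (free_fi R V) (S - {q})"
	note iq = FI_incl_hom[OF Diff_subset, of S "{q}"]
	have sb: "S - {q} - {p}<=S - {p}" by auto
	note iqp = FI_incl_hom[OF sb]
	show "r S p (mor (free_fi R V) (S - {q}) S (FI_incl (S - {q})) x) =
		mor (free_fi R V) (S - {q} - {p}) (S - {p}) (FI_incl (S - {q} - {p})) (r (S - {q}) p x)"
	proof (rule free_mod_hom_eq[OF cring fr_mod[of "S - {p}"] mod_hom_comp[OF free_fi_mor_hom[OF iq, unfolded free_fi_sel(1)] rh]
		 mod_hom_comp[OF rh free_fi_mor_hom[OF iqp, unfolded free_fi_sel(1)]]])
	 show "x:carrier (free_mod R (fidx V (S - {q})))" using x unfolding free_fi_sel(1) .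
	 fix a assume a: "a:fidx V (S - {q})"
	 have iff: "a:fidx V (S - {q} - {p})<->a:fidx V (S - {p})"
		using a by (auto simp: fidx_def FI_hom_def PiE_iff)
	 show "r S p (mor (free_fi R V) (S - {q}) S (FI_incl (S - {q})) (delta R a)) =
		mor (free_fi R V) (S - {q} - {p}) (S - {p}) (FI_incl (S - {q} - {p})) (r (S - {q}) p (delta R a))"
	 proof (cases "a:fidx V (S - {p})")
		case True
		then have a': "a:fidx V (S - {q} - {p})" using iff by simp
		show ?thesis
		 unfolding free_fi_mor_delta[OF iq a] sub[OF a] rd[OF mono[OF a Diff_subset]] rd[OF a] if_P[OF True] if_P[OF a']
			free_fi_mor_delta[OF iqp a'] sub[OF a'] ..
	 next
		case False
		then have a': "a~:fidx V (S - {q} - {p})" using iff by simp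
		have "mor (free_fi R V) (S - {q} - {p}) (S - {p}) (FI_incl (S - {q} - {p})) \<zero>\<^bsub>free_mod R (fidx V (S - {q} - {p}))\<^esub> =
		 \<zero>\<^bsub>free_mod R (fidx V (S - {p}))\<^esub>"
		 using mod_hom_zero[OF module_abelian_group[OF fr_mod] module_abelian_group[OF fr_mod] free_fi_mor_hom[OF iqp, unfolded free_fi_sel(1)]] .
		then show ?thesis
		 unfolding free_fi_mor_delta[OF iq a] sub[OF a] rd[OF mono[OF a Diff_subset]] rd[OF a] if_not_P[OF False] if_not_P[OF a'] by simp
	 qed
	qed
 qed
qed

lemma free_fi_extend:
 assumes M: "FI_module R M" and c: "!!T x. finite T==>x:full V T==>c T x:full M T"
 shows "EX g. FI_map R (free_fi R V) M g&(ALL S T f x. finite S-->finite T-->f:FI_hom T S-->x:full V T -->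
	g S (delta R (T, f, x)) = mor M T S f (c T x))"
proof -
 interpret M: FI_module R M by (rule M)
 define b where "b S t = (case t of (T, f, x)=>mor M T S f (c T x))" for S t
 have bc: "b S t:full M S" if S: "finite S" and t: "t:fidx V S" for S t
 proof -
	obtain T f x where e: "t = (T, f, x)" "finite T" "f:FI_hom T S" "x:full V T" using t unfolding fidx_def by blast
	show ?thesis unfolding b_def e(1) prod.case by (rule M.mor_closed[OF e(2) S e(3) c[OF e(2,4)]])
 qed
 define g where "g S = lin R (obj M S) (b S)" for S
 have gh: "g S:mod_hom R (free_mod R (fidx V S)) (obj M S)" if S: "finite S" for S
	unfolding g_def by (rule lin_hom[OF cring M.obj_module[OF S] bc[OF S]])
 have gd: "g S (delta R t) = b S t" if S: "finite S" and t: "t:fidx V S" for S t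
	unfolding g_def by (rule lin_delta[OF cring M.obj_module[OF S] bc[OF S] t])
 have "FI_map R (free_fi R V) M g"
	unfolding FI_map_def
 proof (intro conjI allI impI)
	fix S :: "nat set" assume S: "finite S"
	show "g S:mod_hom R (obj (free_fi R V) S) (obj M S)" unfolding free_fi_sel(1) by (rule gh[OF S])
 next
	fix S S' h x assume S: "finite (S :: nat set)" and S': "finite (S' :: nat set)" and h: "h:FI_hom S S'" and x: "x:full (free_fi R V) S"
	show "g S' (mor (free_fi R V) S S' h x) = mor M S S' h (g S x)"
	proof (rule free_mod_hom_eq[OF cring M.obj_module[OF S'] mod_hom_comp[OF free_fi_mor_hom[OF h, unfolded free_fi_sel(1)] gh[OF S']]
		 mod_hom_comp[OF gh[OF S] M.mor_hom[OF S S' h]]])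
	 show "x:carrier (free_mod R (fidx V S))" using x unfolding free_fi_sel(1) .
	 fix t assume t: "t:fidx V S"
	 obtain T f x where e: "t = (T, f, x)" "finite T" "f:FI_hom T S" "x:full V T" using t unfolding fidx_def by blast
	 show "g S' (mor (free_fi R V) S S' h (delta R t)) = mor M S S' h (g S (delta R t))"
		unfolding free_fi_mor_delta[OF h t] gd[OF S' along_in[OF h t]] gd[OF S t]
		unfolding e(1) along_def b_def prod.case by (rule M.mor_comp[OF e(2) S S' e(3) h c[OF e(2,4)]])
	qed
 qed
 moreover have "g S (delta R (T, f, x)) = mor M T S f (c T x)"
	if "finite S" "finite T" "f:FI_hom T S" "x:full V T" for S T f x
	using gd[OF that(1), of "(T, f, x)"] that by (simp add: fidx_def b_def)
 ultimately show ?thesis by blast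
qed

lemma free_fi_map_eq:
 assumes M: "FI_module R M" and g: "FI_map R (free_fi R V) M g" "FI_map R (free_fi R V) M g'"
	and eq: "!!T x. finite T==>x:full V T==>g T (delta R (T, FI_incl T, x)) = g' T (delta R (T, FI_incl T, x))"
	and S: "finite S" and p: "ph:full (free_fi R V) S"
 shows "g S ph = g' S ph"
proof (rule free_mod_hom_eq[OF cring FI_module.obj_module[OF M S] FI_map_hom[OF g(1) S, unfolded free_fi_sel(1)]
	 FI_map_hom[OF g(2) S, unfolded free_fi_sel(1)]])
 show "ph:carrier (free_mod R (fidx V S))" using p unfolding free_fi_sel(1) .
 fix t assume "t:fidx V S"
 then obtain T f x where e: "t = (T, f, x)" "finite T" "f:FI_hom T S" "x:full V T" unfolding fidx_def by blast
 have t0: "(T, FI_incl T, x):fidx V T" using e FI_incl_hom[OF subset_refl] by (simp add: fidx_def)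
 have d: "delta R t = mor (free_fi R V) T S f (delta R (T, FI_incl T, x))"
	unfolding free_fi_mor_delta[OF e(3) t0] by (simp add: e(1) along_def compose_FI_incl(2)[OF e(3)])
 have dc: "delta R (T, FI_incl T, x):full (free_fi R V) T" unfolding free_fi_sel(1) by (rule delta_in[OF cring t0])
 show "g S (delta R t) = g' S (delta R t)"
	unfolding d FI_map_nat[OF g(1) e(2) S e(3) dc] FI_map_nat[OF g(2) e(2) S e(3) dc] eq[OF e(2,4)] ..
qed

text \<open>A lift is chosen for each generator, and the map it determines agrees with
  \<open>f\<close> on generators, hence everywhere.\<close>

lemma free_fi_lift:
 assumes M: "FI_module R M" and N: "FI_module R N" and p: "FI_map R M N p"
	and surj: "!!S. finite S==>p S ` full M S = full N S" and f: "FI_map R (free_fi R V) N f"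
 shows "EX g. FI_map R (free_fi R V) M g&(ALL S. finite S-->(\<forall>x\<in>full (free_fi R V) S. p S (g S x) = f S x))"
proof -
 have t0: "(T, FI_incl T, x):fidx V T" if "finite T" "x:full V T" for T x
	using that FI_incl_hom[OF subset_refl] by (simp add: fidx_def)
 have dc: "delta R (T, FI_incl T, x):full (free_fi R V) T" if "finite T" "x:full V T" for T x
	unfolding free_fi_sel(1) by (rule delta_in[OF cring t0[OF that]])
 define c where "c T x = (SOME m. m:full M T&p T m = f T (delta R (T, FI_incl T, x)))" for T x
 have c: "c T x:full M T&p T (c T x) = f T (delta R (T, FI_incl T, x))" if T: "finite T" and x: "x:full V T" for T x
 proof -
	have "f T (delta R (T, FI_incl T, x)):p T ` full M T" unfolding surj[OF T] by (rule FI_map_closed[OF f T dc[OF T x]])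
	then have "EX m. m:full M T&p T m = f T (delta R (T, FI_incl T, x))" by (auto simp: image_iff)
	then show ?thesis unfolding c_def by (rule someI_ex)
 qed
 obtain g where g: "FI_map R (free_fi R V) M g" "!!S T h x. finite S==>finite T==>h:FI_hom T S==>x:full V T ==>
	g S (delta R (T, h, x)) = mor M T S h (c T x)"
	using free_fi_extend[OF M, of c] c by blast
 have "p S (g S x) = f S x" if S: "finite S" and x: "x:full (free_fi R V) S" for S x
 proof (rule free_fi_map_eq[OF N FI_map_comp[OF g(1) p] f _ S x])
	fix T y assume T: "finite T" and y: "y:full V T"
	show "p T (g T (delta R (T, FI_incl T, y))) = f T (delta R (T, FI_incl T, y))"
	 unfolding g(2)[OF T T FI_incl_hom[OF subset_refl] y] using c[OF T y] FI_module.mor_id[OF M T] by simp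
 qed
 then show ?thesis using g(1) by blast
qed

lemma free_fi_counit:
 "EX e. FI_map R (free_fi R V) V e&(ALL S. finite S-->e S ` full (free_fi R V) S = full V S)"
proof -
 obtain e where e: "FI_map R (free_fi R V) V e" "!!S T h x. finite S==>finite T==>h:FI_hom T S==>x:full V T ==>
	e S (delta R (T, h, x)) = mor V T S h x"
	using free_fi_extend[OF V, of "%T x. x"] by blast
 have "e S ` full (free_fi R V) S = full V S" if S: "finite S" for S
 proof
	show "e S ` full (free_fi R V) S<=full V S" using FI_map_closed[OF e(1) S] by (rule image_subsetI)
	show "full V S<=e S ` full (free_fi R V) S"
	proof
	 fix x assume x: "x:full V S"
	 have "(S, FI_incl S, x):fidx V S" using S x FI_incl_hom[OF subset_refl] by (simp add: fidx_def)
	 then have "delta R (S, FI_incl S, x):full (free_fi R V) S" unfolding free_fi_sel(1) by (rule delta_in[OF cring])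
	 moreover have "e S (delta R (S, FI_incl S, x)) = x"
		using e(2)[OF S S FI_incl_hom[OF subset_refl] x] mor_id[OF S x] by simp
	 ultimately show "x:e S ` full (free_fi R V) S" by (metis imageI)
	qed
 qed
 then show ?thesis using e(1) by blast
qed

end

section \<open>Projective resolutions inside \<open>univ\<close>\<close>

lemma countable_injections: "countable {(T, f :: nat=>nat). finite (T :: nat set)&f:extensional T}"
proof -
 have "inj_on (%(T, f). (sorted_list_of_set T, map f (sorted_list_of_set T))) {(T, f). finite (T :: nat set)&(f :: nat=>nat):extensional T}"
 proof (rule inj_onI, clarify)
	fix T f T' f' assume T: "finite (T :: nat set)" "finite (T' :: nat set)" and f: "f:extensional T" "(f' :: nat=>nat):extensional T'"
	 and e: "sorted_list_of_set T = sorted_list_of_set T'" "map f (sorted_list_of_set T) = map f' (sorted_list_of_set T')"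
	have TT: "T = T'" using e(1) T by (metis set_sorted_list_of_set)
	have "f = f'"
	proof (rule extensionalityI)
	 show "f:extensional T" by (rule f(1))
	 show "f':extensional T" using f(2) TT by simp
	 show "f x = f' x" if "x:T" for x using e(2) TT that T by simp
	qed
	then show "T = T'&f = f'" using TT by simp
 qed
 then show ?thesis by (rule countableI')
qed

lemma fidx_coding:
 fixes V :: "('k, 'v) fi_mod" and cv :: "'v=>('k, 'a) univ"
 assumes "inj cv"
 shows "EX ci :: nat set\<times>(nat=>nat)\<times>'v=>('k, 'a) univ. ALL S. inj_on ci (fidx V S)"
proof -
 obtain cp :: "('k, 'a) univ\<times>('k, 'a) univ=>('k, 'a) univ" where cp: "inj cp" using univ_pair_inj by blast
 obtain i :: "nat + 'k=>('k, 'a) univ" where i: "inj i" using univ_index_inj by blast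
 obtain n :: "nat set\<times>(nat=>nat)=>nat" where n: "inj_on n {(T, f). finite T&f:extensional T}"
	using countable_injections unfolding countable_def by blast
 have "inj_on (%(T, f, x). cp (i (Inl (n (T, f))), cv x)) (fidx V S)" for S :: "nat set"
 proof (rule inj_onI)
	fix t t' assume t: "t:fidx V S" "t':fidx V S" and "(case t of (T, f, x)=>cp (i (Inl (n (T, f))), cv x)) = (case t' of (T, f, x)=>cp (i (Inl (n (T, f))), cv x))"
	moreover obtain T f x T' f' x' where tt: "t = (T, f, x)" "t' = (T', f', x')" by (metis prod_cases3)
	ultimately have e: "cp (i (Inl (n (T, f))), cv x) = cp (i (Inl (n (T', f'))), cv x')" by simp
	have "n (T, f) = n (T', f')" "x = x'"
	 using e unfolding inj_eq[OF cp] prod.inject inj_eq[OF i] inj_eq[OF assms] sum.inject by simp_all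
	moreover have "(T, f):{(T, f). finite T&f:extensional T}" "(T', f'):{(T, f). finite T&f:extensional T}"
	 using t unfolding tt by (auto simp: fidx_def FI_hom_def PiE_iff)
	ultimately show "t = t'" unfolding tt using inj_onD[OF n] by blast
 qed
 then show ?thesis by (intro exI allI)
qed

text \<open>The canonical free module is too large a type for \<open>univ\<close> but its elements
  can be coded there; lifting property, retractions and covering map all pass to the isomorphic
  copy.\<close>

lemma free_cover:
 fixes V :: "('k, 'v) fi_mod" and cv :: "'v=>('k, 'a) univ"
 assumes V: "FI_module R V" and cv: "inj cv"
 shows "EX (P :: ('k, ('k, 'a) univ) fi_mod) e. FI_projective R P&(EX r. retractions R P r)&FI_map R P V e \<and>
	(ALL S. finite S-->e S ` full P S = full V S)"
proof -
 let ?F = "free_fi R V"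
 obtain ci :: "nat set\<times>(nat=>nat)\<times>'v=>('k, 'a) univ" where ci: "!!S. inj_on ci (fidx V S)"
	using fidx_coding[OF cv] by blast
 obtain ck0 :: "nat + 'k=>('k, 'a) univ" where ck0: "inj ck0" using univ_index_inj by blast
 have ck: "inj (%k. ck0 (Inr k))" using ck0 by (auto simp: inj_def)
 let ?D = "%S. {ph. finite {t. ph t~=\<zero>\<^bsub>R\<^esub>}&{t. ph t~=\<zero>\<^bsub>R\<^esub>}<=fidx V S}"
 define q :: "nat set=>(nat set\<times>(nat=>nat)\<times>'v=>'k)=>('k, 'a) univ" where "q S = (SOME c. inj_on c (?D S))" for S
 have q: "inj_on (q S) (?D S)" for S
	unfolding q_def by (rule someI_ex[OF univ_finite_support_inj[OF ci ck]])
 note cr = FI_module.cring[OF V]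
 have qi: "inj_on (q S) (full ?F S)" for S
 proof (rule inj_on_subset[OF q])
	show "full ?F S<=?D S"
	proof
	 fix ph assume "ph:full ?F S"
	 then have p: "ph:carrier (free_mod R (fidx V S))" unfolding free_fi_sel(1)[OF V] .
	 show "ph:?D S"
		by (intro CollectI conjI subsetI free_modD(3)[OF cr p]) (use free_modD(2)[OF cr p] in fastforce)
	qed
 qed
 note F = FI_module_free[OF V]
 interpret pushforward R ?F "null ?F" q by (rule pushforward_inj[OF F qi])
 let ?P = "push ?F q"
 note pr = FI_map_pre[OF F qi]
 have "FI_projective R ?P"
	unfolding FI_projective_def
 proof (intro conjI FI_module_push allI impI)
	fix M N :: "('k, ('k, 'a) univ) fi_mod" and p f
	assume M: "FI_module R M" and N: "FI_module R N" and p: "FI_map R M N p" and f: "FI_map R ?P N f"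
	 and surj: "ALL S. finite S-->p S ` full M S = full N S"
	have "EX g. FI_map R ?F M g&(ALL S. finite S-->(\<forall>x\<in>full ?F S. p S (g S x) = f S (q S x)))"
	 by (rule free_fi_lift[OF assms(1) M N p]) (simp add: surj, rule FI_map_comp[OF FI_map_push f])
	then obtain g where g: "FI_map R ?F M g" "!!S x. finite S==>x:full ?F S==>p S (g S x) = f S (q S x)"
	 by blast
	have "p S (g S (preim ?F q S y)) = f S y" if S: "finite S" and y: "y:full ?P S" for S y
	proof -
	 obtain x where x: "x:full ?F S" "y = q S x" using y unfolding push_sel by blast
	 show ?thesis unfolding x(2) pr(2)[OF S x(1)] by (rule g(2)[OF S x(1)])
	qed
	then show "EX g. FI_map R ?P M g&(ALL S. finite S-->(\<forall>x\<in>full ?P S. p S (g S x) = f S x))"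
	 using FI_map_comp[OF pr(1) g(1)] by blast
 qed
 moreover obtain r where r: "retractions R ?F r" using retractions_free[OF assms(1)] by blast
 have "EX r. retractions R ?P r"
 proof (rule retractions_retract[OF F r pr(1) FI_map_push])
	fix S x assume S: "finite (S :: nat set)" and "x:full ?P S"
	then obtain y where y: "y:full ?F S" "x = q S y" unfolding push_sel by blast
	show "q S (preim ?F q S x) = x" unfolding y(2) pr(2)[OF S y(1)] ..
 qed
 moreover obtain e where e: "FI_map R ?F V e" "!!S. finite S==>e S ` full ?F S = full V S"
	using free_fi_counit[OF assms(1)] by blast
 have "(%x. e S (preim ?F q S x)) ` full ?P S = full V S" if S: "finite S" for S
 proof -
	have "(%x. e S (preim ?F q S x)) ` full ?P S = e S ` full ?F S"
	 unfolding push_sel image_image by (rule image_cong[OF refl]) (simp add: pr(2)[OF S])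
	then show ?thesis using e(2)[OF S] by simp
 qed
 ultimately show ?thesis using FI_map_comp[OF pr(1) e(1)] by blast
qed

text \<open>A projective is a retract of its free cover, which lives in the same type and is
  therefore admissible in the lifting property.\<close>

lemma retractions_projective:
 fixes P :: "('k, ('k, 'a) univ) fi_mod"
 assumes P: "FI_projective R P"
 shows "EX r. retractions R P r"
proof -
 have PM: "FI_module R P" using P by (simp add: FI_projective_def)
 obtain Q :: "('k, ('k, 'a) univ) fi_mod" and e r where Q: "FI_projective R Q" "retractions R Q r" "FI_map R Q P e"
	"!!S. finite S==>e S ` full Q S = full P S"
	using free_cover[OF PM, of "%x. x"] by auto
 have QM: "FI_module R Q" using Q by (simp add: FI_projective_def)
 have lift: "!!(M :: ('k, ('k, 'a) univ) fi_mod) (N :: ('k, ('k, 'a) univ) fi_mod) p f.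
		FI_module R M==>FI_module R N==>FI_map R M N p==>FI_map R P N f ==>
		(!!S. finite S==>p S ` full M S = full N S) ==>
		(EX g. FI_map R P M g&(ALL S. finite S-->(\<forall>x\<in>full P S. p S (g S x) = f S x)))"
	using P unfolding FI_projective_def by simp
 obtain g where g: "FI_map R P Q g" "!!S x. finite S==>x:full P S==>e S (g S x) = x"
	using lift[OF QM PM Q(3) FI_map_id Q(4)] by blast
 show ?thesis by (rule retractions_retract[OF QM Q(2) g(1) Q(3)]) (rule g(2))
qed

lemma proj_resolution_exists:
 fixes V :: "('k, 'a) fi_mod"
 assumes V: "FI_module R V"
 shows "EX (P :: nat=>('k, ('k, 'a) univ) fi_mod) d e. proj_resolution R V P d e"
proof -
 obtain cv :: "'a=>('k, 'a) univ" where cv: "inj cv" using univ_base_inj by blast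
 obtain P0 :: "('k, ('k, 'a) univ) fi_mod" and e where P0: "FI_projective R P0" "FI_map R P0 V e"
	"!!S. finite S==>e S ` full P0 S = full V S"
	using free_cover[OF V cv] by blast
 have P0M: "FI_module R P0" using P0 by (simp add: FI_projective_def)
 \<comment> \<open>The state of the recursion: a projective term together with the submodule that
   the next term must cover.\<close>
 define St where "St s<->FI_projective R (fst s)&FI_submodule R (fst s) (snd s)"
	for s :: "('k, ('k, 'a) univ) fi_mod\<times>(nat set=>('k, 'a) univ set)"
 define Tr where "Tr s s'<->(EX d. FI_map R (fst s') (fst s) d&snd s' = FI_ker (fst s') (fst s) d \<and>
	 (ALL S. finite S-->d S ` full (fst s') S = snd s S))"
	for s s' :: "('k, ('k, 'a) univ) fi_mod\<times>(nat set=>('k, 'a) univ set)"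
 have step: "EX s'. St s'&Tr s s'" if s: "St s" for s
 proof -
	have M: "FI_module R (fst s)" and Z: "FI_submodule R (fst s) (snd s)" using s by (auto simp: St_def FI_projective_def)
	obtain Q :: "('k, ('k, 'a) univ) fi_mod" and e' where Q: "FI_projective R Q" "FI_map R Q (FI_sub (fst s) (snd s)) e'"
	 "!!S. finite S==>e' S ` full Q S = full (FI_sub (fst s) (snd s)) S"
	 using free_cover[OF FI_module_sub[OF M Z], of "%x. x"] by auto
	have e': "FI_map R Q (fst s) e'" using FI_map_comp[OF Q(2) FI_map_incl[OF M Z]] .
	have QM: "FI_module R Q" using Q by (simp add: FI_projective_def)
	have "St (Q, FI_ker Q (fst s) e')" unfolding St_def using Q(1) FI_submodule_ker[OF QM M e'] by simp
	moreover have "Tr s (Q, FI_ker Q (fst s) e')" unfolding Tr_def using e' Q(3) by auto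
	ultimately show ?thesis by blast
 qed
 define s0 where "s0 = (P0, FI_ker P0 V e)"
 have s0: "St s0" unfolding St_def s0_def using P0 FI_submodule_ker[OF P0M V P0(2)] by simp
 obtain s where s: "!!n. (n = 0-->s n = s0)&St (s n)" "!!n. Tr (s n) (s (Suc n))"
	using dependent_nat_choice[of "%n x. (n = 0-->x = s0)&St x" "%n x y. Tr x y"] s0 step by auto
 define d where "d n = (SOME d. FI_map R (fst (s (Suc n))) (fst (s n)) d&snd (s (Suc n)) = FI_ker (fst (s (Suc n))) (fst (s n)) d \<and>
	 (ALL S. finite S-->d S ` full (fst (s (Suc n))) S = snd (s n) S))" for n
 have d': "FI_map R (fst (s (Suc n))) (fst (s n)) (d n)&snd (s (Suc n)) = FI_ker (fst (s (Suc n))) (fst (s n)) (d n) \<and>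
	 (ALL S. finite S-->d n S ` full (fst (s (Suc n))) S = snd (s n) S)" for n
	unfolding d_def by (rule someI_ex[OF s(2)[of n, unfolded Tr_def]])
 note d = conjunct1[OF d'] conjunct1[OF conjunct2[OF d']] conjunct2[OF conjunct2[OF d'], rule_format]
 have z: "s 0 = s0" using s(1)[of 0] by simp
 have "proj_resolution R V (%n. fst (s n)) d e"
	unfolding proj_resolution_def FI_im_def
 proof (intro conjI allI impI)
	show "FI_projective R (fst (s n))" for n using s(1)[of n] by (simp add: St_def)
	show "FI_map R (fst (s (Suc n))) (fst (s n)) (d n)" for n by (rule d(1))
	show "FI_map R (fst (s 0)) V e" using P0 z by (simp add: s0_def)
	fix S :: "nat set" assume S: "finite S"
	show "e S ` full (fst (s 0)) S = full V S" using P0(3)[OF S] z by (simp add: s0_def)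
	show "d 0 S ` full (fst (s 1)) S = FI_ker (fst (s 0)) V e S" using d(3)[OF S, of 0] z by (simp add: s0_def)
	show "d (Suc n) S ` carrier (obj (fst (s (Suc (Suc n)))) S) = FI_ker (fst (s (Suc n))) (fst (s n)) (d n) S" for n
	 using d(3)[OF S, of "Suc n"] d(2)[of n] by simp
 qed
 then show ?thesis by (intro exI)
qed

text \<open>Whatever resolution \<open>SOME\<close> selects, its terms have retractions and so are
  Koszul-acyclic; the vanishing is thereby expressed through V alone.\<close>

theorem FI_homology_zero_iff:
 fixes V :: "('k, 'a) fi_mod"
 assumes V: "FI_module R V" and S: "finite S"
 shows "full (FI_homology R (Suc i) V) S = {zer (FI_homology R (Suc i) V) S}<->kvan V (null V) (full V) (Suc i) S"
proof -
 obtain P d where Pd: "some_proj_resolution R V = (P, d)" by (cases "some_proj_resolution R V") auto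
 have "EX x. case x of (P, d)=>EX e. proj_resolution R V (P :: nat=>('k, ('k, 'a) univ) fi_mod) d e"
	using proj_resolution_exists[OF V] by auto
 then have "case some_proj_resolution R V of (P, d)=>EX e. proj_resolution R V P d e"
	unfolding some_proj_resolution_def by (rule someI_ex)
 then obtain e where e: "proj_resolution R V P d e" using Pd by auto
 have P: "FI_projective R (P n)" for n using e by (auto simp: proj_resolution_def)
 have "kvan (P n) (null (P n)) (full (P n)) (Suc j) T" if T: "finite T" for n j T
 proof -
	obtain r where r: "retractions R (P n) r" using retractions_projective[OF P[of n]] by blast
	show ?thesis by (rule retractions_kvan[OF _ r T]) (use P[of n] in \<open>simp add: FI_projective_def\<close>)
 qed
 from FI_homology_kvan[OF V e this S] show ?thesis unfolding FI_homology_def Pd by simp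
qed

section \<open>Injective FI-modules and local cohomology\<close>

subsection \<open>Divisible groups\<close>

lemma chain_Union_pair:
 assumes "subset.chain \<A> \<C>" "x:\<Union>\<C>" "y:\<Union>\<C>"
 shows "\<exists>X\<in>\<C>. x:X&y:X"
 using assms unfolding subset_chain_def by blast

definition divisible :: "'g monoid=>bool" where
 "divisible D<->comm_group D&(\<forall>x\<in>carrier D. ALL n>0::nat. \<exists>y\<in>carrier D. y [^]\<^bsub>D\<^esub> n = x)"

text \<open>A homomorphism into D defined on a subgroup of G, encoded by its graph so that extension
  is inclusion and Zorn's lemma applies to sets.\<close>

definition graph_hom :: "('h, 'x) monoid_scheme=>'g monoid=>('h\<times>'g) set=>bool" where
 "graph_hom G D Gm<->subgroup Gm (G \<times>\<times>D)&(ALL y. (\<one>\<^bsub>G\<^esub>, y):Gm-->y = \<one>\<^bsub>D\<^esub>)"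

context
 fixes G :: "('h, 'x) monoid_scheme" and D :: "'g monoid"
 assumes G: "comm_group G" and D: "comm_group D"
begin

interpretation G: comm_group G by (rule G)
interpretation D: comm_group D by (rule D)
interpretation P: group "G \<times>\<times>D" by (rule DirProd_group[OF G.is_group D.is_group])

lemma graph_homD:
 assumes "graph_hom G D Gm"
 shows "(a, b):Gm==>a:carrier G" "(a, b):Gm==>b:carrier D" "(\<one>\<^bsub>G\<^esub>, \<one>\<^bsub>D\<^esub>):Gm"
	"(a, b):Gm==>(c, d):Gm==>(a \<otimes>\<^bsub>G\<^esub> c, b \<otimes>\<^bsub>D\<^esub> d):Gm" "(a, b):Gm==>(inv\<^bsub>G\<^esub> a, inv\<^bsub>D\<^esub> b):Gm"
	"(a, b):Gm==>(a [^]\<^bsub>G\<^esub> (k :: int), b [^]\<^bsub>D\<^esub> k):Gm" "(\<one>\<^bsub>G\<^esub>, b):Gm==>b = \<one>\<^bsub>D\<^esub>"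
	"(a, b):Gm==>(a, d):Gm==>b = d"
proof -
 have s: "subgroup Gm (G \<times>\<times>D)" and u: "!!y. (\<one>\<^bsub>G\<^esub>, y):Gm==>y = \<one>\<^bsub>D\<^esub>" using assms by (simp_all add: graph_hom_def)
 have cl: "a:carrier G&b:carrier D" if "(a, b):Gm" for a b
	using subgroup.mem_carrier[OF s that] by simp
 have one: "(\<one>\<^bsub>G\<^esub>, \<one>\<^bsub>D\<^esub>):Gm" using subgroup.one_closed[OF s] by simp
 have m: "(a \<otimes>\<^bsub>G\<^esub> c, b \<otimes>\<^bsub>D\<^esub> d):Gm" if "(a, b):Gm" "(c, d):Gm" for a b c d
	using subgroup.m_closed[OF s that] by simp
 have i: "(inv\<^bsub>G\<^esub> a, inv\<^bsub>D\<^esub> b):Gm" if "(a, b):Gm" for a b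
	using subgroup.m_inv_closed[OF s that] cl[OF that] inv_DirProd[OF G.is_group D.is_group, of a b] by simp
 have n: "(a [^]\<^bsub>G\<^esub> (n :: nat), b [^]\<^bsub>D\<^esub> n):Gm" if "(a, b):Gm" for a b n
	by (induction n) (simp_all add: one m that)
 show "(a, b):Gm==>(a [^]\<^bsub>G\<^esub> (k :: int), b [^]\<^bsub>D\<^esub> k):Gm"
	by (cases k rule: int_cases2) (simp_all add: int_pow_int G.int_pow_neg_int D.int_pow_neg_int cl n i)
 show "b = d" if ab: "(a, b):Gm" and ad: "(a, d):Gm"
 proof -
	have "(\<one>\<^bsub>G\<^esub>, b \<otimes>\<^bsub>D\<^esub> inv\<^bsub>D\<^esub> d):Gm" using m[OF ab i[OF ad]] cl[OF ab] by simp
	from u[OF this] show ?thesis using cl[OF ab] cl[OF ad] by (metis D.inv_closed D.inv_equality D.inv_inv)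
 qed
 show "(a, b):Gm==>a:carrier G" "(a, b):Gm==>b:carrier D" using cl by blast+
 show "(\<one>\<^bsub>G\<^esub>, \<one>\<^bsub>D\<^esub>):Gm" "(a, b):Gm==>(c, d):Gm==>(a \<otimes>\<^bsub>G\<^esub> c, b \<otimes>\<^bsub>D\<^esub> d):Gm"
	"(a, b):Gm==>(inv\<^bsub>G\<^esub> a, inv\<^bsub>D\<^esub> b):Gm" "(\<one>\<^bsub>G\<^esub>, b):Gm==>b = \<one>\<^bsub>D\<^esub>" by (fact one m i u)+
qed

text \<open>The exponents k for which the k-th power of x lies in the domain form an ideal of the
  integers with generator n. Divisibility supplies y whose n-th power is the value prescribed at the
  n-th power of x, and sending x to y is consistent.\<close>

lemma graph_hom_step:
 assumes div: "divisible D" and Gm: "graph_hom G D Gm" and x: "x:carrier G"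
 shows "EX Gm'. graph_hom G D Gm'&Gm<=Gm'&(EX y. (x, y):Gm')"
proof -
 note g = graph_homD[OF Gm]
 define K where "K = {k :: int. EX d. (x [^]\<^bsub>G\<^esub> k, d):Gm}"
 have "\<exists>y\<in>carrier D. \<forall>k\<in>K. (x [^]\<^bsub>G\<^esub> k, y [^]\<^bsub>D\<^esub> k):Gm"
 proof (cases "\<forall>k\<in>K. k = 0")
	case True
	then show ?thesis using g(3) by (intro bexI[of _ "\<one>\<^bsub>D\<^esub>"]) auto
 next
	case False
	then obtain k where k: "k:K" "k~=0" by blast
	then obtain d where d: "(x [^]\<^bsub>G\<^esub> k, d):Gm" by (auto simp: K_def)
	have "(x [^]\<^bsub>G\<^esub> - k, inv\<^bsub>D\<^esub> d):Gm" using g(5)[OF d] x by (simp add: G.int_pow_neg)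
	then have "- k:K" unfolding K_def by blast
	then have ex: "EX n>0. int n:K" using k by (intro exI[of _ "nat \<bar>k\<bar>"]) (auto simp: abs_if)
	define n where "n = (LEAST n. n > 0&int n:K)"
	have n: "n > 0" "int n:K" using LeastI_ex[OF ex] unfolding n_def by simp_all
	have least: "m = 0" if "int m:K" "m < n" for m
	 using not_less_Least[of m "%n. n > 0&int n:K"] that unfolding n_def by auto
	obtain d where d: "(x [^]\<^bsub>G\<^esub> int n, d):Gm" using n by (auto simp: K_def)
	obtain y where y: "y:carrier D" "y [^]\<^bsub>D\<^esub> n = d" using div g(2)[OF d] n(1) unfolding divisible_def by blast
	have yn: "y [^]\<^bsub>D\<^esub> int n = d" using y(2) by (simp add: int_pow_int)
	have "(x [^]\<^bsub>G\<^esub> k, y [^]\<^bsub>D\<^esub> k):Gm" if k: "k:K" for k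
	proof -
	 obtain e where e: "(x [^]\<^bsub>G\<^esub> k, e):Gm" using k by (auto simp: K_def)
	 have "(x [^]\<^bsub>G\<^esub> k \<otimes>\<^bsub>G\<^esub> (x [^]\<^bsub>G\<^esub> int n) [^]\<^bsub>G\<^esub> (- (k div int n)), e \<otimes>\<^bsub>D\<^esub> d [^]\<^bsub>D\<^esub> (- (k div int n))):Gm"
		by (rule g(4)[OF e g(6)[OF d]])
	 moreover have "x [^]\<^bsub>G\<^esub> k \<otimes>\<^bsub>G\<^esub> (x [^]\<^bsub>G\<^esub> int n) [^]\<^bsub>G\<^esub> (- (k div int n)) = x [^]\<^bsub>G\<^esub> (k mod int n)"
		using x by (simp add: G.int_pow_pow flip: G.int_pow_mult minus_mult_div_eq_mod)
	 ultimately have "k mod int n:K" by (auto simp: K_def)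
	 \<comment> \<open>The remainder is again an admissible exponent and is smaller than n.\<close>
	 then have "nat (k mod int n) = 0" using n(1) by (intro least) (auto simp: nat_less_iff)
	 then have "k mod int n = 0" using n(1) pos_mod_sign[of "int n" k] by linarith
	 then have kn: "k = int n * (k div int n)" using div_mult_mod_eq[of k "int n"] by (simp add: mult.commute)
	 show ?thesis using g(6)[OF d, of "k div int n"] x y(1) kn by (simp add: G.int_pow_pow D.int_pow_pow flip: yn)
	qed
	then show ?thesis using y(1) by blast
 qed
 then obtain y where y: "y:carrier D" "!!k. k:K==>(x [^]\<^bsub>G\<^esub> k, y [^]\<^bsub>D\<^esub> k):Gm" by blast
 define Gm' where "Gm' = {(a \<otimes>\<^bsub>G\<^esub> x [^]\<^bsub>G\<^esub> k, b \<otimes>\<^bsub>D\<^esub> y [^]\<^bsub>D\<^esub> k) | a b (k :: int). (a, b):Gm}"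
 have in': "(a \<otimes>\<^bsub>G\<^esub> x [^]\<^bsub>G\<^esub> k, b \<otimes>\<^bsub>D\<^esub> y [^]\<^bsub>D\<^esub> k):Gm'" if "(a, b):Gm" for a b and k :: int
	unfolding Gm'_def using that by blast
 have "subgroup Gm' (G \<times>\<times>D)"
 proof (rule P.subgroupI)
	show "Gm'<=carrier (G \<times>\<times>D)" unfolding Gm'_def using g(1,2) x y(1) by auto
	show "Gm'~={}" using in'[OF g(3)] by blast
 next
	fix p assume "p:Gm'"
	then obtain a b and k :: int where p: "p = (a \<otimes>\<^bsub>G\<^esub> x [^]\<^bsub>G\<^esub> k, b \<otimes>\<^bsub>D\<^esub> y [^]\<^bsub>D\<^esub> k)" and ab: "(a, b):Gm" unfolding Gm'_def by blast
	note c = g(1,2)[OF ab]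
	have "inv\<^bsub>G \<times>\<times>D\<^esub> p = (inv\<^bsub>G\<^esub> a \<otimes>\<^bsub>G\<^esub> x [^]\<^bsub>G\<^esub> (- k), inv\<^bsub>D\<^esub> b \<otimes>\<^bsub>D\<^esub> y [^]\<^bsub>D\<^esub> (- k))"
	 unfolding p using c x y(1) by (simp add: inv_DirProd[OF G.is_group D.is_group] G.inv_mult D.inv_mult G.int_pow_neg D.int_pow_neg)
	then show "inv\<^bsub>G \<times>\<times>D\<^esub> p:Gm'" using in'[OF g(5)[OF ab], of "- k"] by simp
	fix p' assume "p':Gm'"
	then obtain a' b' and k' :: int where p': "p' = (a' \<otimes>\<^bsub>G\<^esub> x [^]\<^bsub>G\<^esub> k', b' \<otimes>\<^bsub>D\<^esub> y [^]\<^bsub>D\<^esub> k')" and ab': "(a', b'):Gm" unfolding Gm'_def by blast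
	note c' = g(1,2)[OF ab']
	have "p \<otimes>\<^bsub>G \<times>\<times>D\<^esub> p' = ((a \<otimes>\<^bsub>G\<^esub> a') \<otimes>\<^bsub>G\<^esub> x [^]\<^bsub>G\<^esub> (k + k'), (b \<otimes>\<^bsub>D\<^esub> b') \<otimes>\<^bsub>D\<^esub> y [^]\<^bsub>D\<^esub> (k + k'))"
	 unfolding p p' using c c' x y(1) by (simp add: G.int_pow_mult D.int_pow_mult G.m_ac D.m_ac)
	then show "p \<otimes>\<^bsub>G \<times>\<times>D\<^esub> p':Gm'" using in'[OF g(4)[OF ab ab'], of "k + k'"] by simp
 qed
 moreover have "z = \<one>\<^bsub>D\<^esub>" if z: "(\<one>\<^bsub>G\<^esub>, z):Gm'" for z
 proof -
	obtain a b and k :: int where e: "\<one>\<^bsub>G\<^esub> = a \<otimes>\<^bsub>G\<^esub> x [^]\<^bsub>G\<^esub> k" "z = b \<otimes>\<^bsub>D\<^esub> y [^]\<^bsub>D\<^esub> k" and ab: "(a, b):Gm" using z unfolding Gm'_def by blast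
	have "x [^]\<^bsub>G\<^esub> k = inv\<^bsub>G\<^esub> a" using e(1) g(1)[OF ab] x by (metis G.int_pow_closed G.inv_equality G.m_comm)
	then have "k:K" using g(5)[OF ab] unfolding K_def by auto
	from g(4)[OF ab y(2)[OF this]] show ?thesis unfolding e(1)[symmetric] e(2)[symmetric] by (rule g(7))
 qed
 moreover have "Gm<=Gm'"
 proof (rule subrelI)
	fix a b assume ab: "(a, b):Gm"
	show "(a, b):Gm'" using in'[OF ab, of 0] g(1,2)[OF ab] by simp
 qed
 moreover have "(x, y):Gm'" using in'[OF g(3), of 1] x y(1) by simp
 ultimately show ?thesis unfolding graph_hom_def by blast
qed

text \<open>Baer's argument over the integers: a maximal extension of the graph is defined
  everywhere, as it could otherwise be extended by one more element.\<close>

lemma divisible_extension: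
 assumes div: "divisible D" and A: "comm_group A" and i: "i:hom A G" "inj_on i (carrier A)" and h: "h:hom A D"
 shows "\<exists>k\<in>hom G D. \<forall>a\<in>carrier A. k (i a) = h a"
proof -
 interpret A: comm_group A by (rule A)
 have ih: "group_hom A G i" "group_hom A D h"
	using i(1) h by (simp_all add: group_hom_def group_hom_axioms_def A.is_group G.is_group D.is_group)
 define Gm0 where "Gm0 = (%a. (i a, h a)) ` carrier A"
 have "(%a. (i a, h a)):hom A (G \<times>\<times>D)" using i(1) h by (auto simp: hom_def)
 then have "group_hom A (G \<times>\<times>D) (%a. (i a, h a))"
	by (simp add: group_hom_def group_hom_axioms_def A.is_group P.is_group)
 from group_hom.img_is_subgroup[OF this] have s0: "subgroup Gm0 (G \<times>\<times>D)" unfolding Gm0_def .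
 have g0: "graph_hom G D Gm0"
	unfolding graph_hom_def
 proof (intro conjI s0 allI impI)
	fix y assume "(\<one>\<^bsub>G\<^esub>, y):Gm0"
	then obtain a where a: "a:carrier A" "i a = \<one>\<^bsub>G\<^esub>" "y = h a" unfolding Gm0_def by auto
	have "a = \<one>\<^bsub>A\<^esub>" by (rule inj_onD[OF i(2) _ a(1) A.one_closed]) (simp add: a(2) group_hom.hom_one[OF ih(1)])
	then show "y = \<one>\<^bsub>D\<^esub>" unfolding a(3) by (simp add: group_hom.hom_one[OF ih(2)])
 qed
 define \<A> where "\<A> = {Gm. graph_hom G D Gm&Gm0<=Gm}"
 have "\<exists>M\<in>\<A>. \<forall>X\<in>\<A>. M<=X-->X = M"
 proof (rule subset_Zorn_nonempty)
	show "\<A>~={}" using g0 unfolding \<A>_def by blast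
	fix \<C> assume ne: "\<C>~={}" and ch: "subset.chain \<A> \<C>"
	have gC: "graph_hom G D X" "Gm0<=X" if "X:\<C>" for X using ch that unfolding subset_chain_def \<A>_def by auto
	obtain X0 where X0: "X0:\<C>" using ne by blast
	have "subgroup (\<Union>\<C>) (G \<times>\<times>D)"
	proof (rule P.subgroupI)
	 show "\<Union>\<C><=carrier (G \<times>\<times>D)" using gC(1) subgroup.subset unfolding graph_hom_def by blast
	 show "\<Union>\<C>~={}" using X0 graph_homD(3)[OF gC(1)[OF X0]] by blast
	 show "inv\<^bsub>G \<times>\<times>D\<^esub> p:\<Union>\<C>" if "p:\<Union>\<C>" for p
		using that gC(1) subgroup.m_inv_closed unfolding graph_hom_def by (metis Union_iff)
	 fix p q assume "p:\<Union>\<C>" "q:\<Union>\<C>"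
	 from chain_Union_pair[OF ch this] obtain X where X: "X:\<C>" "p:X" "q:X" by blast
	 show "p \<otimes>\<^bsub>G \<times>\<times>D\<^esub> q:\<Union>\<C>"
		using X(1) subgroup.m_closed[of X "G \<times>\<times>D", OF _ X(2,3)] gC(1)[OF X(1)] unfolding graph_hom_def by blast
	qed
	then show "\<Union>\<C>:\<A>" unfolding \<A>_def graph_hom_def using gC X0 graph_homD(7)[OF gC(1)] by blast
 qed
 then obtain Gm where M: "Gm:\<A>" "\<forall>X\<in>\<A>. Gm<=X-->X = Gm" by (rule bexE)
 then have Gm: "graph_hom G D Gm" "Gm0<=Gm" unfolding \<A>_def by simp_all
 note g = graph_homD[OF Gm(1)]
 have total: "EX y. (x, y):Gm" if x: "x:carrier G" for x
 proof -
	obtain X y where X: "graph_hom G D X" "Gm<=X" "(x, y):X" using graph_hom_step[OF div Gm(1) x] by (elim exE conjE)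
	have "X:\<A>" unfolding \<A>_def using X(1) subset_trans[OF Gm(2) X(2)] by simp
	with M(2) X(2) have "X = Gm" by simp
	then show ?thesis using X(3) by blast
 qed
 define k where "k x = (THE y. (x, y):Gm)" for x
 have keq: "k x = y" if "(x, y):Gm" for x y unfolding k_def using g(8) that by blast
 have kin: "(x, k x):Gm" if x: "x:carrier G" for x using total[OF x] keq by blast
 show ?thesis
 proof (intro bexI[of _ k] ballI homI)
	show "k x:carrier D" if "x:carrier G" for x by (rule g(2)[OF kin[OF that]])
	show "k (x \<otimes>\<^bsub>G\<^esub> y) = k x \<otimes>\<^bsub>D\<^esub> k y" if "x:carrier G" "y:carrier G" for x y
	 by (rule keq[OF g(4)[OF kin[OF that(1)] kin[OF that(2)]]])
	show "k (i a) = h a" if a: "a:carrier A" for a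
	 by (rule keq[OF subsetD[OF Gm(2)]]) (unfold Gm0_def, rule imageI[OF a])
 qed
qed

end

text \<open>M is the free abelian group on its elements modulo the kernel K of the augmentation.
  Allowing rational coefficients and dividing by the same K gives a divisible group containing
  M.\<close>

lemma divisible_embedding:
 fixes M :: "('k, 'v) module"
 assumes M: "abelian_group M"
 shows "EX (D :: ('v \<Rightarrow>\<^sub>0 rat) set monoid) j. divisible D&j:hom (add_monoid M) D&inj_on j (carrier M) \<and>
	inj_on (%X. SOME p. p:X) (carrier D)"
proof -
 interpret M: abelian_group M by (rule M)
 define G :: "('v \<Rightarrow>\<^sub>0 rat) monoid" where "G = \<lparr>carrier = UNIV, monoid.mult = (+), one = 0\<rparr>"
 have gsel: "carrier G = UNIV" "x \<otimes>\<^bsub>G\<^esub> y = x + y" "\<one>\<^bsub>G\<^esub> = 0" for x y by (simp_all add: G_def)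
 interpret G: comm_group G
	by (rule comm_groupI) (auto simp: gsel add.assoc add.commute intro: exI[of _ "- x" for x])
 have ginv: "inv\<^bsub>G\<^esub> x = - x" for x by (rule G.inv_equality) (simp_all add: gsel)
 define qt :: "('v \<Rightarrow>\<^sub>0 int)=>('v \<Rightarrow>\<^sub>0 rat)" where "qt p = Poly_Mapping.map rat_of_int p" for p
 have rl: "Poly_Mapping.lookup (qt p) x = rat_of_int (Poly_Mapping.lookup p x)" for p x unfolding qt_def by (simp add: Poly_Mapping.map.rep_eq when_def)
 have rinj: "p = q" if "qt p = qt q" for p q
	using that rl by (intro poly_mapping_eqI) (metis of_int_eq_iff)
 have rdiff: "qt p - qt q = qt (p - q)" for p q by (rule poly_mapping_eqI) (simp add: rl lookup_minus)
 \<comment> \<open>Only integral relations are divided out; this keeps M embedded.\<close>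
 define N where "N = {qt p | p. Poly_Mapping.keys p<=carrier M&ev M p = \<zero>\<^bsub>M\<^esub>}"
 have Nd: "x - y:N" if xy: "x:N" "y:N" for x y
 proof -
	obtain p q where "x = qt p" "y = qt q" "Poly_Mapping.keys p<=carrier M" "Poly_Mapping.keys q<=carrier M"
	 "ev M p = \<zero>\<^bsub>M\<^esub>" "ev M q = \<zero>\<^bsub>M\<^esub>" using xy unfolding N_def by blast
	then show ?thesis unfolding N_def rdiff using keys_diff[of p q] ev_diff[OF M, of p q]
	 M.minus_eq_zero_iff[OF M.zero_closed M.zero_closed]
	 by (auto simp: rdiff intro!: exI[of _ "p - q"])
 qed
 have N0: "0:N" unfolding N_def
	by (intro CollectI exI[of _ 0] conjI) (simp_all add: ev_zero[OF M] poly_mapping_eq_iff fun_eq_iff rl)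
 have N: "subgroup N G"
 proof (rule G.subgroupI)
	show "inv\<^bsub>G\<^esub> x:N" if "x:N" for x using Nd[OF N0 that] by (simp add: ginv)
	show "x \<otimes>\<^bsub>G\<^esub> y:N" if "x:N" "y:N" for x y using Nd[OF that(1) Nd[OF N0 that(2)]] by (simp add: gsel)
 qed (use N0 in \<open>auto simp: gsel\<close>)
 interpret N: normal N G by (rule G.subgroup_imp_normal[OF N])
 define D where "D = G Mod N"
 define c where "c x = N #>\<^bsub>G\<^esub> x" for x
 have D: "comm_group D" unfolding D_def by (rule G.abelian_FactGroup[OF N])
 then interpret D: comm_group D .
 have ch: "c:hom G D" unfolding D_def c_def[abs_def] by (rule N.r_coset_hom_Mod)
 have cadd: "c (x + y) = c x \<otimes>\<^bsub>D\<^esub> c y" for x y using hom_mult[OF ch, of x y] by (simp add: gsel)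
 have cD: "carrier D = range c" unfolding D_def carrier_FactGroup gsel(1) c_def ..
 have ceq: "c x = c y<->x - y:N" for x y
 proof
	assume "c x = c y"
	then have "x:N #>\<^bsub>G\<^esub> y" unfolding c_def using G.rcos_self[OF _ N, of x] by (simp add: gsel)
	then show "x - y:N" unfolding r_coset_def gsel by auto
 next
	assume "x - y:N"
	then have "x:N #>\<^bsub>G\<^esub> y" unfolding r_coset_def gsel by (auto intro!: bexI[of _ "x - y"])
	then show "c x = c y" unfolding c_def using G.repr_independence[OF _ _ N, of x y] by (simp add: gsel)
 qed
 have cpow: "c y [^]\<^bsub>D\<^esub> n = c (\<Sum>i<n. y)" for y and n :: nat
 proof (induction n)
	case 0
	show ?case using hom_one[OF ch G.is_group D.is_group] by (simp add: gsel)
 qed (simp add: cadd)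
 have "divisible D"
	unfolding divisible_def
 proof (intro conjI D ballI allI impI)
	fix x and n :: nat assume x: "x:carrier D" and n: "0 < n"
	obtain z where z: "x = c z" using x cD by blast
	define y where "y = Poly_Mapping.map (%r. r / of_nat n) z"
	have yl: "Poly_Mapping.lookup y t = Poly_Mapping.lookup z t / of_nat n" for t unfolding y_def by (simp add: Poly_Mapping.map.rep_eq when_def)
	have "(\<Sum>i<n. y) = z" using n by (intro poly_mapping_eqI) (simp add: lookup_sum yl)
	then show "\<exists>y\<in>carrier D. y [^]\<^bsub>D\<^esub> n = x" using cpow[of y n] cD z by auto
 qed
 moreover define j where "j x = c (qt (frag_of x))" for x
 have "j:hom (add_monoid M) D"
 proof (rule homI)
	show "j x:carrier D" for x unfolding j_def cD by blast
	fix x y assume "x:carrier (add_monoid M)" "y:carrier (add_monoid M)"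
	then have xy: "x:carrier M" "y:carrier M" by simp_all
	have "c (qt (frag_of (x \<oplus>\<^bsub>M\<^esub> y))) = c (qt (frag_of x) + qt (frag_of y))"
	 unfolding ceq
	proof -
	 let ?p = "frag_of (x \<oplus>\<^bsub>M\<^esub> y) - (frag_of x + frag_of y)"
	 have k: "Poly_Mapping.keys (frag_of x + frag_of y)<=carrier M"
		using keys_add[of "frag_of x" "frag_of y"] xy by auto
	 have "qt (frag_of (x \<oplus>\<^bsub>M\<^esub> y)) - (qt (frag_of x) + qt (frag_of y)) = qt ?p"
		by (rule poly_mapping_eqI) (simp add: rl lookup_minus lookup_add)
	 moreover have "Poly_Mapping.keys ?p<=carrier M"
		using keys_diff[of "frag_of (x \<oplus>\<^bsub>M\<^esub> y)" "frag_of x + frag_of y"] k xy by auto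
	 moreover have "ev M ?p = \<zero>\<^bsub>M\<^esub>"
		using k xy by (simp add: ev_diff[OF M] ev_add[OF M] ev_of[OF M] a_minus_def M.r_neg)
	 ultimately show "qt (frag_of (x \<oplus>\<^bsub>M\<^esub> y)) - (qt (frag_of x) + qt (frag_of y)):N" unfolding N_def by blast
	qed
	then show "j (x \<otimes>\<^bsub>add_monoid M\<^esub> y) = j x \<otimes>\<^bsub>D\<^esub> j y" unfolding j_def by (simp add: cadd)
 qed
 moreover have "inj_on j (carrier M)"
 proof (rule inj_onI)
	fix x y assume xy: "x:carrier M" "y:carrier M" and "j x = j y"
	then obtain p where p: "qt (frag_of x - frag_of y) = qt p" "ev M p = \<zero>\<^bsub>M\<^esub>" unfolding j_def ceq rdiff N_def by blast
	have "ev M (frag_of x - frag_of y) = \<zero>\<^bsub>M\<^esub>" unfolding rinj[OF p(1)] by (rule p(2))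
	then have "x \<ominus>\<^bsub>M\<^esub> y = \<zero>\<^bsub>M\<^esub>" using ev_diff[OF M, of "frag_of x" "frag_of y"] xy by (simp add: ev_of[OF M])
	then show "x = y" using M.minus_eq_zero_iff[OF xy] by simp
 qed
 \<comment> \<open>Distinct cosets have distinct representatives, so D can be coded through finitely
   supported rational functions.\<close>
 moreover have "inj_on (%X. SOME p. p:X) (carrier D)"
 proof (rule inj_on_inverseI)
	fix X assume "X:carrier D"
	then obtain z where z: "X = c z" using cD by blast
	have "(SOME p. p:X):X" by (rule someI[of _ z]) (simp add: z c_def G.rcos_self[OF _ N] gsel)
	then show "c (SOME p. p:X) = X" unfolding z ceq by (auto simp: c_def r_coset_def gsel)
 qed
 ultimately show ?thesis by (intro exI conjI)
qed

subsection \<open>Injective FI-modules\<close>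

definition cidx :: "('k, 'r) ring_scheme=>nat set=>(nat set\<times>(nat=>nat)\<times>'k) set" where
 "cidx R S = {(T, f, c). finite T&f:FI_hom S T&c:carrier R}"

text \<open>The right Kan extension of the family \<open>Hom\<^sub>\<int>(k, D T)\<close>: for every \<open>W\<close>, the maps \<open>W \<rightarrow> coind R D\<close> correspond to
 families of additive maps \<open>W T \<rightarrow> D T\<close>.\<close>

definition coind :: "('k, 'r) ring_scheme=>(nat set=>'d monoid)=>('k, nat set\<times>(nat=>nat)\<times>'k=>'d) fi_mod" where
 "coind R D = \<lparr>obj = (%S. \<lparr>carrier = {ph:extensional (cidx R S).
	 (ALL T f c. (T, f, c):cidx R S-->ph (T, f, c):carrier (D T)) \<and>
	 (ALL T f c c'. (T, f, c):cidx R S-->c':carrier R-->ph (T, f, c \<oplus>\<^bsub>R\<^esub> c') = ph (T, f, c) \<otimes>\<^bsub>D T\<^esub> ph (T, f, c'))},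
	 monoid.mult = undefined, one = undefined, ring.zero = (\<lambda>t\<in>cidx R S. \<one>\<^bsub>D (fst t)\<^esub>),
	 add = (%ph ps. \<lambda>t\<in>cidx R S. ph t \<otimes>\<^bsub>D (fst t)\<^esub> ps t),
	 smult = (%a ph. \<lambda>t\<in>cidx R S. ph (fst t, fst (snd t), a \<otimes>\<^bsub>R\<^esub> snd (snd t)))\<rparr>),
	mor = (%S S' g ph. \<lambda>t\<in>cidx R S'. ph (fst t, compose S (fst (snd t)) g, snd (snd t)))\<rparr>"

section \<open>Coinduced modules\<close>

context
 fixes R :: "('k, 'r) ring_scheme" and D :: "nat set=>'d monoid"
 assumes R: "cring R" and D: "!!T. finite T==>divisible (D T)"
begin

interpretation R: cring R by (rule R)

lemma Dc: "(T, f, c):cidx R S==>comm_group (D T)"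
 using D by (simp add: divisible_def cidx_def)

lemma coind_sel:
 "ph:full (coind R D) S<->ph:extensional (cidx R S) \<and>
	 (ALL T f c. (T, f, c):cidx R S-->ph (T, f, c):carrier (D T)) \<and>
	 (ALL T f c c'. (T, f, c):cidx R S-->c':carrier R-->ph (T, f, c \<oplus>\<^bsub>R\<^esub> c') = ph (T, f, c) \<otimes>\<^bsub>D T\<^esub> ph (T, f, c'))"
 "zer (coind R D) S = (\<lambda>t\<in>cidx R S. \<one>\<^bsub>D (fst t)\<^esub>)"
 "ph \<oplus>\<^bsub>obj (coind R D) S\<^esub> ps = (\<lambda>t\<in>cidx R S. ph t \<otimes>\<^bsub>D (fst t)\<^esub> ps t)"
 "a \<odot>\<^bsub>obj (coind R D) S\<^esub> ph = (\<lambda>t\<in>cidx R S. ph (fst t, fst (snd t), a \<otimes>\<^bsub>R\<^esub> snd (snd t)))"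
 "mor (coind R D) S S' g ph = (\<lambda>t\<in>cidx R S'. ph (fst t, compose S (fst (snd t)) g, snd (snd t)))"
 by (simp_all add: coind_def)

lemma coind_ext:
 assumes "ph:extensional (cidx R S)" "ps:extensional (cidx R S)" "!!T f c. (T, f, c):cidx R S==>ph (T, f, c) = ps (T, f, c)"
 shows "ph = ps"
 by (rule extensionalityI[OF assms(1,2)]) (use assms(3) in auto)

lemma cidx_simps: "(T, f, c):cidx R S==>c':carrier R==>(T, f, c'):cidx R S"
 "(T, f, c):cidx R S==>c:carrier R" "(T, f, c):cidx R S'==>g:FI_hom S S'==>(T, compose S f g, c):cidx R S"
 by (auto simp: cidx_def FI_hom_compose)

lemma coindD:
 assumes "ph:full (coind R D) S"
 shows "ph:extensional (cidx R S)" "(T, f, c):cidx R S==>ph (T, f, c):carrier (D T)"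
	"(T, f, c):cidx R S==>c':carrier R==>ph (T, f, c \<oplus>\<^bsub>R\<^esub> c') = ph (T, f, c) \<otimes>\<^bsub>D T\<^esub> ph (T, f, c')"
 using assms unfolding coind_sel by auto

lemma coindI:
 assumes "!!T f c. (T, f, c):cidx R S==>h (T, f, c):carrier (D T)"
	"!!T f c c'. (T, f, c):cidx R S==>c':carrier R==>h (T, f, c \<oplus>\<^bsub>R\<^esub> c') = h (T, f, c) \<otimes>\<^bsub>D T\<^esub> h (T, f, c')"
 shows "(\<lambda>t\<in>cidx R S. h t):full (coind R D) S"
 unfolding coind_sel(1)
proof (intro conjI allI impI restrict_extensional)
 fix T f c assume t: "(T, f, c):cidx R S"
 show "(\<lambda>t\<in>cidx R S. h t) (T, f, c):carrier (D T)" using assms(1)[OF t] t by simp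
 show "(\<lambda>t\<in>cidx R S. h t) (T, f, c \<oplus>\<^bsub>R\<^esub> c') = (\<lambda>t\<in>cidx R S. h t) (T, f, c) \<otimes>\<^bsub>D T\<^esub> (\<lambda>t\<in>cidx R S. h t) (T, f, c')"
	if c': "c':carrier R" for c'
	using assms(2)[OF t c'] t cidx_simps(1)[OF t c'] cidx_simps(1)[OF t R.add.m_closed[OF cidx_simps(2)[OF t] c']] by simp
qed

lemma coind_add_closed:
 assumes p: "ph:full (coind R D) S" and q: "ps:full (coind R D) S"
 shows "ph \<oplus>\<^bsub>obj (coind R D) S\<^esub> ps:full (coind R D) S"
 unfolding coind_sel(3)
proof (rule coindI)
 fix T f c assume t: "(T, f, c):cidx R S"
 interpret G: comm_group "D T" by (rule Dc[OF t])
 show "ph (T, f, c) \<otimes>\<^bsub>D (fst (T, f, c))\<^esub> ps (T, f, c):carrier (D T)" using coindD(2)[OF p t] coindD(2)[OF q t] by simp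
 fix c' assume c': "c':carrier R"
 note t' = cidx_simps(1)[OF t c']
 show "ph (T, f, c \<oplus>\<^bsub>R\<^esub> c') \<otimes>\<^bsub>D (fst (T, f, c \<oplus>\<^bsub>R\<^esub> c'))\<^esub> ps (T, f, c \<oplus>\<^bsub>R\<^esub> c') =
	(ph (T, f, c) \<otimes>\<^bsub>D (fst (T, f, c))\<^esub> ps (T, f, c)) \<otimes>\<^bsub>D T\<^esub> (ph (T, f, c') \<otimes>\<^bsub>D (fst (T, f, c'))\<^esub> ps (T, f, c'))"
	unfolding fst_conv coindD(3)[OF p t c'] coindD(3)[OF q t c'] using coindD(2)[OF p t] coindD(2)[OF q t] coindD(2)[OF p t'] coindD(2)[OF q t']
	by (simp add: G.m_ac)
qed

lemma coind_smult_closed: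
 assumes p: "ph:full (coind R D) S" and a: "a:carrier R"
 shows "a \<odot>\<^bsub>obj (coind R D) S\<^esub> ph:full (coind R D) S"
 unfolding coind_sel(4)
proof (rule coindI)
 fix T f c assume t: "(T, f, c):cidx R S"
 have ta: "(T, f, a \<otimes>\<^bsub>R\<^esub> c):cidx R S" using t a by (auto simp: cidx_def)
 show "ph (fst (T, f, c), fst (snd (T, f, c)), a \<otimes>\<^bsub>R\<^esub> snd (snd (T, f, c))):carrier (D T)" using coindD(2)[OF p ta] by simp
 show "ph (fst (T, f, c \<oplus>\<^bsub>R\<^esub> c'), fst (snd (T, f, c \<oplus>\<^bsub>R\<^esub> c')), a \<otimes>\<^bsub>R\<^esub> snd (snd (T, f, c \<oplus>\<^bsub>R\<^esub> c'))) =
	ph (fst (T, f, c), fst (snd (T, f, c)), a \<otimes>\<^bsub>R\<^esub> snd (snd (T, f, c))) \<otimes>\<^bsub>D T\<^esub> ph (fst (T, f, c'), fst (snd (T, f, c')), a \<otimes>\<^bsub>R\<^esub> snd (snd (T, f, c')))"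
	if c': "c':carrier R" for c'
	using coindD(3)[OF p ta, of "a \<otimes>\<^bsub>R\<^esub> c'"] a c' cidx_simps(2)[OF t] by (simp add: R.r_distr)
qed

lemma coind_mor_closed:
 assumes p: "ph:full (coind R D) S" and g: "g:FI_hom S S'"
 shows "mor (coind R D) S S' g ph:full (coind R D) S'"
 unfolding coind_sel(5)
 by (rule coindI) (simp_all add: coindD(2)[OF p cidx_simps(3)[OF _ g]] coindD(3)[OF p cidx_simps(3)[OF _ g]])

lemma coind_zero_closed: "zer (coind R D) S:full (coind R D) S"
 unfolding coind_sel(2)
proof (rule coindI)
 fix T f c assume t: "(T, f, c):cidx R S"
 interpret G: comm_group "D T" by (rule Dc[OF t])
 show "\<one>\<^bsub>D (fst (T, f, c))\<^esub>:carrier (D T)" by simp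
 show "\<one>\<^bsub>D (fst (T, f, c \<oplus>\<^bsub>R\<^esub> c'))\<^esub> = \<one>\<^bsub>D (fst (T, f, c))\<^esub> \<otimes>\<^bsub>D T\<^esub> \<one>\<^bsub>D (fst (T, f, c'))\<^esub>" for c' by simp
qed

lemma coind_abelian: "abelian_group (obj (coind R D) S)"
proof (rule abelian_groupI)
 note ad = coind_add_closed and z = coind_zero_closed
 let ?M = "obj (coind R D) S"
 show "\<zero>\<^bsub>?M\<^esub>:carrier ?M" by (rule z)
 fix ph assume p: "ph:carrier ?M"
 show "\<zero>\<^bsub>?M\<^esub> \<oplus>\<^bsub>?M\<^esub> ph = ph"
 proof (rule coind_ext[OF coindD(1)[OF ad[OF z p]] coindD(1)[OF p]])
	fix T f c assume t: "(T, f, c):cidx R S"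
	interpret G: comm_group "D T" by (rule Dc[OF t])
	show "(\<zero>\<^bsub>?M\<^esub> \<oplus>\<^bsub>?M\<^esub> ph) (T, f, c) = ph (T, f, c)" using t coindD(2)[OF p t] by (simp add: coind_sel)
 qed
 let ?i = "\<lambda>t\<in>cidx R S. inv\<^bsub>D (fst t)\<^esub> (ph t)"
 have i: "?i:carrier ?M"
 proof (rule coindI)
	fix T f c assume t: "(T, f, c):cidx R S"
	interpret G: comm_group "D T" by (rule Dc[OF t])
	show "inv\<^bsub>D (fst (T, f, c))\<^esub> ph (T, f, c):carrier (D T)" using coindD(2)[OF p t] by simp
	show "inv\<^bsub>D (fst (T, f, c \<oplus>\<^bsub>R\<^esub> c'))\<^esub> ph (T, f, c \<oplus>\<^bsub>R\<^esub> c') =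
	 inv\<^bsub>D (fst (T, f, c))\<^esub> ph (T, f, c) \<otimes>\<^bsub>D T\<^esub> inv\<^bsub>D (fst (T, f, c'))\<^esub> ph (T, f, c')" if c': "c':carrier R" for c'
	 using coindD(3)[OF p t c'] coindD(2)[OF p t] coindD(2)[OF p cidx_simps(1)[OF t c']] by (simp add: G.inv_mult)
 qed
 show "\<exists>ps\<in>carrier ?M. ps \<oplus>\<^bsub>?M\<^esub> ph = \<zero>\<^bsub>?M\<^esub>"
 proof (rule bexI[OF _ i], rule coind_ext[OF coindD(1)[OF ad[OF i p]] coindD(1)[OF z]])
	fix T f c assume t: "(T, f, c):cidx R S"
	interpret G: comm_group "D T" by (rule Dc[OF t])
	show "(?i \<oplus>\<^bsub>?M\<^esub> ph) (T, f, c) = \<zero>\<^bsub>?M\<^esub> (T, f, c)" using t coindD(2)[OF p t] by (simp add: coind_sel)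
 qed
 fix ps assume q: "ps:carrier ?M"
 show "ph \<oplus>\<^bsub>?M\<^esub> ps:carrier ?M" by (rule ad[OF p q])
 show "ph \<oplus>\<^bsub>?M\<^esub> ps = ps \<oplus>\<^bsub>?M\<^esub> ph"
 proof (rule coind_ext[OF coindD(1)[OF ad[OF p q]] coindD(1)[OF ad[OF q p]]])
	fix T f c assume t: "(T, f, c):cidx R S"
	interpret G: comm_group "D T" by (rule Dc[OF t])
	show "(ph \<oplus>\<^bsub>?M\<^esub> ps) (T, f, c) = (ps \<oplus>\<^bsub>?M\<^esub> ph) (T, f, c)"
	 using t coindD(2)[OF p t] coindD(2)[OF q t] by (simp add: coind_sel G.m_comm)
 qed
 fix ch assume r: "ch:carrier ?M"
 show "ph \<oplus>\<^bsub>?M\<^esub> ps \<oplus>\<^bsub>?M\<^esub> ch = ph \<oplus>\<^bsub>?M\<^esub> (ps \<oplus>\<^bsub>?M\<^esub> ch)"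
 proof (rule coind_ext[OF coindD(1)[OF ad[OF ad[OF p q] r]] coindD(1)[OF ad[OF p ad[OF q r]]]])
	fix T f c assume t: "(T, f, c):cidx R S"
	interpret G: comm_group "D T" by (rule Dc[OF t])
	show "(ph \<oplus>\<^bsub>?M\<^esub> ps \<oplus>\<^bsub>?M\<^esub> ch) (T, f, c) = (ph \<oplus>\<^bsub>?M\<^esub> (ps \<oplus>\<^bsub>?M\<^esub> ch)) (T, f, c)"
	 using t coindD(2)[OF p t] coindD(2)[OF q t] coindD(2)[OF r t] by (simp add: coind_sel G.m_assoc)
 qed
qed

lemma FI_module_coind: "FI_module R (coind R D)"
proof (rule FI_module.intro[OF R])
 fix S :: "nat set" assume S: "finite S"
 let ?M = "obj (coind R D) S"
 note cl = coind_smult_closed and ad = coind_add_closed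
 show "Module.module R ?M"
 proof (rule moduleI[OF R coind_abelian])
	show "\<one>\<^bsub>R\<^esub> \<odot>\<^bsub>?M\<^esub> ph = ph" if p: "ph:carrier ?M" for ph
	 by (rule coind_ext[OF coindD(1)[OF cl[OF p R.one_closed]] coindD(1)[OF p]])
		(simp add: coind_sel, simp add: cidx_def)
	fix a ph assume a: "a:carrier R" and p: "ph:carrier ?M"
	show "a \<odot>\<^bsub>?M\<^esub> ph:carrier ?M" by (rule cl[OF p a])
	show "a \<odot>\<^bsub>?M\<^esub> (ph \<oplus>\<^bsub>?M\<^esub> ps) = a \<odot>\<^bsub>?M\<^esub> ph \<oplus>\<^bsub>?M\<^esub> a \<odot>\<^bsub>?M\<^esub> ps" if q: "ps:carrier ?M" for ps
	 by (rule coind_ext[OF coindD(1)[OF cl[OF ad[OF p q] a]] coindD(1)[OF ad[OF cl[OF p a] cl[OF q a]]]])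
		(simp add: coind_sel, simp add: cidx_def a)
	fix b assume b: "b:carrier R"
	show "(a \<oplus>\<^bsub>R\<^esub> b) \<odot>\<^bsub>?M\<^esub> ph = a \<odot>\<^bsub>?M\<^esub> ph \<oplus>\<^bsub>?M\<^esub> b \<odot>\<^bsub>?M\<^esub> ph"
	proof (rule coind_ext[OF coindD(1)[OF cl[OF p R.add.m_closed[OF a b]]] coindD(1)[OF ad[OF cl[OF p a] cl[OF p b]]]])
	 fix T f c assume t: "(T, f, c):cidx R S"
	 note c = cidx_simps(2)[OF t]
	 show "((a \<oplus>\<^bsub>R\<^esub> b) \<odot>\<^bsub>?M\<^esub> ph) (T, f, c) = (a \<odot>\<^bsub>?M\<^esub> ph \<oplus>\<^bsub>?M\<^esub> b \<odot>\<^bsub>?M\<^esub> ph) (T, f, c)"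
		using coindD(3)[OF p cidx_simps(1)[OF t R.m_closed[OF a c]] R.m_closed[OF b c]] t a b c by (simp add: coind_sel R.l_distr)
	qed
	show "(a \<otimes>\<^bsub>R\<^esub> b) \<odot>\<^bsub>?M\<^esub> ph = a \<odot>\<^bsub>?M\<^esub> (b \<odot>\<^bsub>?M\<^esub> ph)"
	proof (rule coind_ext[OF coindD(1)[OF cl[OF p R.m_closed[OF a b]]] coindD(1)[OF cl[OF cl[OF p b] a]]])
	 fix T f c assume t: "(T, f, c):cidx R S"
	 note c = cidx_simps(2)[OF t]
	 have e: "a \<otimes>\<^bsub>R\<^esub> b \<otimes>\<^bsub>R\<^esub> c = b \<otimes>\<^bsub>R\<^esub> (a \<otimes>\<^bsub>R\<^esub> c)" using a b c by (simp add: R.m_ac)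
	 show "((a \<otimes>\<^bsub>R\<^esub> b) \<odot>\<^bsub>?M\<^esub> ph) (T, f, c) = (a \<odot>\<^bsub>?M\<^esub> (b \<odot>\<^bsub>?M\<^esub> ph)) (T, f, c)"
		using t cidx_simps(1)[OF t R.m_closed[OF a c]] by (simp add: coind_sel e)
	qed
 qed
 show "mor (coind R D) S S (FI_incl S) ph = ph" if p: "ph:carrier ?M" for ph
 proof (rule coind_ext[OF coindD(1)[OF coind_mor_closed[OF p FI_incl_hom[OF subset_refl]]] coindD(1)[OF p]])
	fix T f c assume t: "(T, f, c):cidx R S"
	then have "f:FI_hom S T" by (simp add: cidx_def)
	then show "mor (coind R D) S S (FI_incl S) ph (T, f, c) = ph (T, f, c)" using t by (simp add: coind_sel(5) compose_FI_incl(2))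
 qed
 fix S' g assume S': "finite S'" and g: "g:FI_hom S S'"
 note mc = coind_mor_closed[OF _ g]
 show "mor (coind R D) S S' g:mod_hom R ?M (obj (coind R D) S')"
	unfolding mod_hom_def
 proof (intro CollectI conjI ballI Pi_I mc)
	fix ph assume p: "ph:carrier ?M"
	show "mor (coind R D) S S' g (ph \<oplus>\<^bsub>?M\<^esub> ps) = mor (coind R D) S S' g ph \<oplus>\<^bsub>obj (coind R D) S'\<^esub> mor (coind R D) S S' g ps"
	 if q: "ps:carrier ?M" for ps
	 by (rule coind_ext[OF coindD(1)[OF mc[OF ad[OF p q]]] coindD(1)[OF ad[OF mc[OF p] mc[OF q]]]])
		(simp add: coind_sel cidx_simps(3)[OF _ g])
	show "mor (coind R D) S S' g (a \<odot>\<^bsub>?M\<^esub> ph) = a \<odot>\<^bsub>obj (coind R D) S'\<^esub> mor (coind R D) S S' g ph" if a: "a:carrier R" for a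
	proof (rule coind_ext[OF coindD(1)[OF mc[OF cl[OF p a]]] coindD(1)[OF cl[OF mc[OF p] a]]])
	 fix T f c assume t: "(T, f, c):cidx R S'"
	 show "mor (coind R D) S S' g (a \<odot>\<^bsub>?M\<^esub> ph) (T, f, c) = (a \<odot>\<^bsub>obj (coind R D) S'\<^esub> mor (coind R D) S S' g ph) (T, f, c)"
		using t cidx_simps(3)[OF t g] cidx_simps(1)[OF t R.m_closed[OF a cidx_simps(2)[OF t]]] by (simp add: coind_sel)
	qed
 qed
 fix U h assume U: "finite U" and h: "h:FI_hom S' U"
 note gh = FI_hom_compose[OF g h]
 show "mor (coind R D) S U (compose S h g) ph = mor (coind R D) S' U h (mor (coind R D) S S' g ph)" if p: "ph:carrier ?M" for ph
 proof (rule coind_ext[OF coindD(1)[OF coind_mor_closed[OF p gh]] coindD(1)[OF coind_mor_closed[OF mc[OF p] h]]])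
	fix T f c assume t: "(T, f, c):cidx R U"
	have "compose S f (compose S h g) = compose S (compose S' f h) g"
	 using g by (auto simp: compose_def FI_hom_def fun_eq_iff)
	then show "mor (coind R D) S U (compose S h g) ph (T, f, c) = mor (coind R D) S' U h (mor (coind R D) S S' g ph) (T, f, c)"
	 using t cidx_simps(3)[OF t h] by (simp add: coind_sel)
 qed
qed

lemma coind_map:
 assumes N: "FI_module R N" and h: "!!T. finite T==>h T:hom (add_monoid (obj N T)) (D T)"
 shows "FI_map R N (coind R D) (%S y. \<lambda>t\<in>cidx R S. h (fst t) (mor N S (fst t) (fst (snd t)) (snd (snd t) \<odot>\<^bsub>obj N S\<^esub> y)))"
	(is "FI_map R N _ ?g")
proof -
 interpret N: FI_module R N by (rule N)
 have hc: "h T x:carrier (D T)" if "finite T" "x:full N T" for T x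
	using hom_in_carrier[OF h[OF that(1)]] that(2) by simp
 have ha: "h T (x \<oplus>\<^bsub>obj N T\<^esub> y) = h T x \<otimes>\<^bsub>D T\<^esub> h T y" if "finite T" "x:full N T" "y:full N T" for T x y
	using hom_mult[OF h[OF that(1)]] that(2,3) by simp
 have gc: "?g S y:full (coind R D) S" if S: "finite S" and y: "y:full N S" for S y
 proof (rule coindI)
	interpret M: Module.module R "obj N S" by (rule N.obj_module[OF S])
	fix T f c assume "(T, f, c):cidx R S"
	then have T: "finite T" "f:FI_hom S T" "c:carrier R" by (auto simp: cidx_def)
	note m = N.mor_closed[OF S T(1,2) M.smult_closed[OF _ y]]
	show "h (fst (T, f, c)) (mor N S (fst (T, f, c)) (fst (snd (T, f, c))) (snd (snd (T, f, c)) \<odot>\<^bsub>obj N S\<^esub> y)):carrier (D T)"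
	 using hc[OF T(1) m[OF T(3)]] by simp
	fix c' assume c': "c':carrier R"
	have "h T (mor N S T f ((c \<oplus>\<^bsub>R\<^esub> c') \<odot>\<^bsub>obj N S\<^esub> y)) = h T (mor N S T f (c \<odot>\<^bsub>obj N S\<^esub> y)) \<otimes>\<^bsub>D T\<^esub> h T (mor N S T f (c' \<odot>\<^bsub>obj N S\<^esub> y))"
	 unfolding M.smult_l_distr[OF T(3) c' y] N.mor_add[OF S T(1,2) M.smult_closed[OF T(3) y] M.smult_closed[OF c' y]]
	 by (rule ha[OF T(1) m[OF T(3)] m[OF c']])
	then show "h (fst (T, f, c \<oplus>\<^bsub>R\<^esub> c')) (mor N S (fst (T, f, c \<oplus>\<^bsub>R\<^esub> c')) (fst (snd (T, f, c \<oplus>\<^bsub>R\<^esub> c'))) (snd (snd (T, f, c \<oplus>\<^bsub>R\<^esub> c')) \<odot>\<^bsub>obj N S\<^esub> y)) =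
	 h (fst (T, f, c)) (mor N S (fst (T, f, c)) (fst (snd (T, f, c))) (snd (snd (T, f, c)) \<odot>\<^bsub>obj N S\<^esub> y)) \<otimes>\<^bsub>D T\<^esub>
	 h (fst (T, f, c')) (mor N S (fst (T, f, c')) (fst (snd (T, f, c'))) (snd (snd (T, f, c')) \<odot>\<^bsub>obj N S\<^esub> y))"
	 by simp
 qed
 show ?thesis
	unfolding FI_map_def mod_hom_def
 proof (intro conjI allI impI CollectI ballI Pi_I gc)
	fix S :: "nat set" assume S: "finite S"
	interpret M: Module.module R "obj N S" by (rule N.obj_module[OF S])
	fix y assume y: "y:full N S"
	note rest = coind_ext[OF restrict_extensional restrict_extensional]
	show "?g S (y \<oplus>\<^bsub>obj N S\<^esub> z) = ?g S y \<oplus>\<^bsub>obj (coind R D) S\<^esub> ?g S z" if z: "z:full N S" for z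
	 unfolding coind_sel(3)
	proof (rule rest)
	 fix T f c assume t: "(T, f, c):cidx R S"
	 then have T: "finite T" "f:FI_hom S T" "c:carrier R" by (auto simp: cidx_def)
	 note cy = M.smult_closed[OF T(3) y] M.smult_closed[OF T(3) z]
	 have "h T (mor N S T f (c \<odot>\<^bsub>obj N S\<^esub> (y \<oplus>\<^bsub>obj N S\<^esub> z))) =
		h T (mor N S T f (c \<odot>\<^bsub>obj N S\<^esub> y)) \<otimes>\<^bsub>D T\<^esub> h T (mor N S T f (c \<odot>\<^bsub>obj N S\<^esub> z))"
		unfolding M.smult_r_distr[OF T(3) y z] N.mor_add[OF S T(1,2) cy]
		by (rule ha[OF T(1) N.mor_closed[OF S T(1,2) cy(1)] N.mor_closed[OF S T(1,2) cy(2)]])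
	 then show "?g S (y \<oplus>\<^bsub>obj N S\<^esub> z) (T, f, c) = (\<lambda>t\<in>cidx R S. ?g S y t \<otimes>\<^bsub>D (fst t)\<^esub> ?g S z t) (T, f, c)" using t by simp
	qed
	show "?g S (a \<odot>\<^bsub>obj N S\<^esub> y) = a \<odot>\<^bsub>obj (coind R D) S\<^esub> ?g S y" if a: "a:carrier R" for a
	 unfolding coind_sel(4)
	proof (rule rest)
	 fix T f c assume t: "(T, f, c):cidx R S"
	 then have c: "c:carrier R" by (auto simp: cidx_def)
	 have "c \<odot>\<^bsub>obj N S\<^esub> (a \<odot>\<^bsub>obj N S\<^esub> y) = (a \<otimes>\<^bsub>R\<^esub> c) \<odot>\<^bsub>obj N S\<^esub> y"
		unfolding M.smult_assoc1[OF c a y, symmetric] R.m_comm[OF c a] ..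
	 then show "?g S (a \<odot>\<^bsub>obj N S\<^esub> y) (T, f, c) = (\<lambda>t\<in>cidx R S. ?g S y (fst t, fst (snd t), a \<otimes>\<^bsub>R\<^esub> snd (snd t))) (T, f, c)"
		using t cidx_simps(1)[OF t R.m_closed[OF a c]] by simp
	qed
	fix S' k assume S': "finite S'" and k: "k:FI_hom S S'"
	show "?g S' (mor N S S' k y) = mor (coind R D) S S' k (?g S y)"
	 unfolding coind_sel(5)
	proof (rule rest)
	 fix T f c assume t: "(T, f, c):cidx R S'"
	 then have T: "finite T" "f:FI_hom S' T" "c:carrier R" by (auto simp: cidx_def)
	 have "mor N S' T f (c \<odot>\<^bsub>obj N S'\<^esub> mor N S S' k y) = mor N S T (compose S f k) (c \<odot>\<^bsub>obj N S\<^esub> y)"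
		unfolding N.mor_smult[OF S S' k T(3) y, symmetric] N.mor_comp[OF S S' T(1) k T(2) M.smult_closed[OF T(3) y]] ..
	 then show "?g S' (mor N S S' k y) (T, f, c) = (\<lambda>t\<in>cidx R S'. ?g S y (fst t, compose S (fst (snd t)) k, snd (snd t))) (T, f, c)"
		using t cidx_simps(3)[OF t k] by simp
	qed
 qed
qed

text \<open>The adjunction turns the extension problem into one for abelian groups at each T
  separately, where divisibility solves it.\<close>

lemma coind_extend:
 assumes M: "FI_module R M" and N: "FI_module R N" and i: "FI_map R M N i" and f: "FI_map R M (coind R D) F"
	and inj: "!!S. finite S==>inj_on (i S) (full M S)"
 shows "EX g. FI_map R N (coind R D) g&(ALL S. finite S-->(\<forall>x\<in>full M S. g S (i S x) = F S x))"
proof -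
 interpret M: FI_module R M by (rule M)
 interpret N: FI_module R N by (rule N)
 have u: "(T, FI_incl T, \<one>\<^bsub>R\<^esub>):cidx R T" if "finite T" for T
	using that FI_incl_hom[OF subset_refl] by (simp add: cidx_def)
 \<comment> \<open>Evaluation at the identity of T and the scalar 1 recovers the additive map that
   corresponds to \<open>F\<close>.\<close>
 have ex: "\<exists>k\<in>hom (add_monoid (obj N T)) (D T). \<forall>m\<in>carrier (add_monoid (obj M T)). k (i T m) = F T m (T, FI_incl T, \<one>\<^bsub>R\<^esub>)" if T: "finite T" for T
 proof (rule divisible_extension[OF _ _ D[OF T]])
	show "comm_group (add_monoid (obj N T))" "comm_group (add_monoid (obj M T))"
	 using M.obj_ab[OF T] N.obj_ab[OF T] by (simp_all add: abelian_group.a_comm_group)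
	show "comm_group (D T)" using D[OF T] by (simp add: divisible_def)
	show "i T:hom (add_monoid (obj M T)) (add_monoid (obj N T))"
	 by (rule homI) (simp_all add: FI_map_closed[OF i T] FI_map_add[OF i T])
	show "inj_on (i T) (carrier (add_monoid (obj M T)))" using inj[OF T] by simp
	show "(%m. F T m (T, FI_incl T, \<one>\<^bsub>R\<^esub>)):hom (add_monoid (obj M T)) (D T)"
	 by (rule homI) (simp_all add: coindD(2)[OF FI_map_closed[OF f T] u[OF T]] FI_map_add[OF f T] coind_sel(3) u[OF T])
 qed
 define h where "h T = (SOME k. k:hom (add_monoid (obj N T)) (D T)&(\<forall>m\<in>carrier (add_monoid (obj M T)). k (i T m) = F T m (T, FI_incl T, \<one>\<^bsub>R\<^esub>)))" for T
 have h0: "h T:hom (add_monoid (obj N T)) (D T)&(\<forall>m\<in>carrier (add_monoid (obj M T)). h T (i T m) = F T m (T, FI_incl T, \<one>\<^bsub>R\<^esub>))" if T: "finite T" for T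
	unfolding h_def by (rule someI_ex[OF ex[OF T, unfolded Bex_def]])
 have h': "h T:hom (add_monoid (obj N T)) (D T)&(\<forall>m\<in>full M T. h T (i T m) = F T m (T, FI_incl T, \<one>\<^bsub>R\<^esub>))" if T: "finite T" for T
	using h0[OF T] by simp
 let ?g = "%S y. \<lambda>t\<in>cidx R S. h (fst t) (mor N S (fst t) (fst (snd t)) (snd (snd t) \<odot>\<^bsub>obj N S\<^esub> y))"
 have "?g S (i S x) = F S x" if S: "finite S" and x: "x:full M S" for S x
 proof (rule coind_ext[OF restrict_extensional coindD(1)[OF FI_map_closed[OF f S x]]])
	interpret MS: Module.module R "obj M S" by (rule M.obj_module[OF S])
	fix T k c assume t: "(T, k, c):cidx R S"
	then have T: "finite T" "k:FI_hom S T" "c:carrier R" by (auto simp: cidx_def)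
	note cx = MS.smult_closed[OF T(3) x]
	have "mor N S T k (c \<odot>\<^bsub>obj N S\<^esub> i S x) = i T (mor M S T k (c \<odot>\<^bsub>obj M S\<^esub> x))"
	 unfolding FI_map_nat[OF i S T(1,2) cx] FI_map_smult[OF i S T(3) x] ..
	moreover have "h T (i T (mor M S T k (c \<odot>\<^bsub>obj M S\<^esub> x))) = F T (mor M S T k (c \<odot>\<^bsub>obj M S\<^esub> x)) (T, FI_incl T, \<one>\<^bsub>R\<^esub>)"
	 using h'[OF T(1)] M.mor_closed[OF S T(1,2) cx] by simp
	moreover have "F T (mor M S T k (c \<odot>\<^bsub>obj M S\<^esub> x)) (T, FI_incl T, \<one>\<^bsub>R\<^esub>) = F S x (T, k, c)"
	 unfolding FI_map_nat[OF f S T(1,2) cx] FI_map_smult[OF f S T(3) x] coind_sel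
	 using u[OF T(1)] T(3) cidx_simps(1)[OF t R.one_closed] by (simp add: compose_FI_incl(1)[OF T(2)])
	ultimately show "?g S (i S x) (T, k, c) = F S x (T, k, c)" using t by simp
 qed
 then show ?thesis using coind_map[OF N conjunct1[OF h']] by (intro exI[of _ ?g]) simp
qed

end

text \<open>For fixed S only countably many pairs (T, f) occur, so an element is a countable family
  of functions on \<open>'k\<close> and fits into two nested functions on the index type.\<close>

lemma coind_coding:
 fixes R :: "('k, 'r) ring_scheme" and cd :: "nat set=>'d=>('k, 'a) univ"
 assumes R: "cring R" and D: "!!T. finite T==>divisible (D T)" and cd: "!!T. finite T==>inj_on (cd T) (carrier (D T))"
 shows "EX q :: nat set=>(nat set\<times>(nat=>nat)\<times>'k=>'d)=>('k, 'a) univ. ALL S. finite S-->inj_on (q S) (full (coind R D) S)"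
proof -
 obtain cf :: "(nat + 'k=>('k, 'a) univ)=>('k, 'a) univ" where cf: "inj cf" using univ_fun_inj by blast
 define X :: "nat set=>(nat set\<times>(nat=>nat)) set" where "X S = {T. finite T}\<times>{f. f:extensional S}" for S
 have X: "countable (X S)" if S: "finite S" for S
 proof -
	have "countable (snd ` {(T, f :: nat=>nat). finite (T :: nat set)&f:extensional T})" by (intro countable_image countable_injections)
	moreover have "f:snd ` {(T, f :: nat=>nat). finite (T :: nat set)&f:extensional T}" if "f:extensional S" for f
	 by (rule image_eqI[of _ _ "(S, f)"]) (simp_all add: S that)
	ultimately have "countable {f :: nat=>nat. f:extensional S}" by (auto intro: countable_subset)
	then show ?thesis unfolding X_def by (intro countable_SIGMA countable_Collect_finite)
 qed
 define d where "d S = from_nat_into (X S)" for S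
 define q :: "nat set=>(nat set\<times>(nat=>nat)\<times>'k=>'d)=>('k, 'a) univ" where "q S ph = cf (case_sum (%i. cf (case_sum (%_. undefined) (%k. cd (fst (d S i)) (ph (fst (d S i), snd (d S i), k))))) (%_. undefined))" for S ph
 have "inj_on (q S) (full (coind R D) S)" if S: "finite S" for S
 proof (rule inj_onI)
	fix ph ps assume p: "ph:full (coind R D) S" and p': "ps:full (coind R D) S" and e: "q S ph = q S ps"
	note cD = coindD[OF R D] coind_ext[OF R D]
	show "ph = ps"
	proof (rule cD(4)[OF _ cD(1)[OF _ p] cD(1)[OF _ p']])
	 fix T f c assume t: "(T, f, c):cidx R S"
	 then have T: "finite T" "(T, f):X S" by (auto simp: cidx_def FI_hom_def PiE_iff X_def)
	 note dn = from_nat_into_to_nat_on[OF X[OF S] T(2), folded d_def]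
	 from fun_cong[OF injD[OF cf, OF e[unfolded q_def]], of "Inl (to_nat_on (X S) (T, f))"]
	 have "cf (case_sum (%_. undefined) (%k. cd T (ph (T, f, k)))) = cf (case_sum (%_. undefined) (%k. cd T (ps (T, f, k))))"
		by (simp add: dn)
	 from fun_cong[OF injD[OF cf, OF this], of "Inr c"] have "cd T (ph (T, f, c)) = cd T (ps (T, f, c))" by simp
	 then show "ph (T, f, c) = ps (T, f, c)" by (rule inj_onD[OF cd[OF T(1)] _ cD(2)[OF _ p t] cD(2)[OF _ p' t]])
	qed
 qed
 then show ?thesis by (intro exI[of _ q] allI impI)
qed

text \<open>Each V(T) embeds into a divisible group, and the component at the identity and the
  scalar 1 shows that V embeds into the module coinduced from this family.\<close>

lemma enough_injectives:
 fixes V :: "('k, 'v) fi_mod" and cv :: "'v=>('k, 'a) univ"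
 assumes V: "FI_module R V" and cv: "inj cv"
 shows "EX (I :: ('k, ('k, 'a) univ) fi_mod) e. FI_injective R I&FI_map R V I e&(ALL S. finite S-->inj_on (e S) (full V S))"
proof -
 interpret V: FI_module R V by (rule V)
 note R = V.cring
 interpret R: cring R by (rule R)
 have ab: "abelian_group (obj V T)" if "finite T" for T by (rule V.obj_ab[OF that])
 define P where "P T Dj<->divisible (fst Dj)&snd Dj:hom (add_monoid (obj V T)) (fst Dj)&inj_on (snd Dj) (full V T) \<and>
	inj_on (%X. SOME p. p:X) (carrier (fst Dj))" for T and Dj :: "('v \<Rightarrow>\<^sub>0 rat) set monoid\<times>('v=>('v \<Rightarrow>\<^sub>0 rat) set)"
 define Dj where "Dj T = (SOME x. P T x)" for T
 have Dj: "P T (Dj T)" if T: "finite T" for T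
 proof -
	have "EX x. P T x" unfolding P_def split_paired_Ex fst_conv snd_conv by (rule divisible_embedding[OF ab[OF T]])
	then show ?thesis unfolding Dj_def by (rule someI_ex)
 qed
 define D where "D T = fst (Dj T)" for T
 define j where "j T = snd (Dj T)" for T
 have D: "divisible (D T)" and j: "j T:hom (add_monoid (obj V T)) (D T)" "inj_on (j T) (full V T)"
	and sel: "inj_on (%X. SOME p. p:X) (carrier (D T))" if "finite T" for T
	using Dj[OF that] unfolding P_def D_def j_def by simp_all
 let ?J = "coind R D"
 obtain i :: "nat + 'k=>('k, 'a) univ" where i: "inj i" using univ_index_inj by blast
 have ck: "inj (%r :: rat. i (Inl (to_nat r)))" by (rule injI, drule injD[OF i]) simp
 obtain cr :: "('v=>rat)=>('k, 'a) univ" where cr: "inj_on cr {ph. finite {t. ph t~=0}&{t. ph t~=0}<=UNIV}"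
	using univ_finite_support_inj[OF cv[THEN inj_on_subset] ck, of UNIV 0] by auto
 define cd where "cd T X = cr (Poly_Mapping.lookup (SOME p. p:X))" for T :: "nat set" and X
 have cd: "inj_on (cd T) (carrier (D T))" if T: "finite T" for T
 proof (rule inj_onI)
	fix X Y assume X: "X:carrier (D T)" "Y:carrier (D T)" and e: "cd T X = cd T Y"
	have "Poly_Mapping.lookup (SOME p. p:X) = Poly_Mapping.lookup (SOME p. p:Y)"
	 by (rule inj_onD[OF cr, OF e[unfolded cd_def]]) simp_all
	then have "(SOME p. p:X) = (SOME p. p:Y)" by (intro poly_mapping_eqI) (rule fun_cong)
	then show "X = Y" by (rule inj_onD[OF sel[OF T] _ X(1,2)])
 qed
 obtain q :: "nat set=>(nat set\<times>(nat=>nat)\<times>'k=>('v \<Rightarrow>\<^sub>0 rat) set)=>('k, 'a) univ" where q: "ALL S. finite S-->inj_on (q S) (full ?J S)"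
	using coind_coding[OF R D cd] by (rule exE)
 have J: "FI_module R ?J" by (rule FI_module_coind[OF R D])
 have qi: "inj_on (q S) (full ?J S)" if "finite S" for S using q that by simp
 let ?I = "push ?J q"
 have pr1: "FI_map R ?I ?J (preim ?J q)" by (rule FI_map_pre(1)[OF J]) (rule qi)
 have pr2: "preim ?J q S (q S x) = x" if "finite S" "x:full ?J S" for S x by (rule FI_map_pre(2)[OF J _ that]) (rule qi)
 have pf: "pushforward R ?J (null ?J) q" by (rule pushforward_inj[OF J]) (rule qi)
 note I = pushforward.FI_module_push[OF pf] and qm = pushforward.FI_map_push[OF pf]
 have "FI_injective R ?I"
	unfolding FI_injective_def
 proof (intro conjI I allI impI)
	fix M N :: "('k, ('k, 'a) univ) fi_mod" and i f
	assume M: "FI_module R M" and N: "FI_module R N" and im: "FI_map R M N i" and f: "FI_map R M ?I f"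
	 and inj: "ALL S. finite S-->inj_on (i S) (full M S)"
	have "EX g. FI_map R N ?J g&(ALL S. finite S-->(\<forall>x\<in>full M S. g S (i S x) = preim ?J q S (f S x)))"
	 by (rule coind_extend[OF R D M N im FI_map_comp[OF f pr1]]) (simp_all add: inj)
	then obtain g where g: "FI_map R N ?J g" "!!S x. finite S==>x:full M S==>g S (i S x) = preim ?J q S (f S x)" by blast
	have "q S (g S (i S x)) = f S x" if S: "finite S" and x: "x:full M S" for S x
	proof -
	 obtain z where z: "z:full ?J S" "f S x = q S z" using FI_map_closed[OF f S x] unfolding push_sel by blast
	 show ?thesis using g(2)[OF S x] z(2) pr2[OF S z(1)] by simp
	qed
	then show "EX g. FI_map R N ?I g&(ALL S. finite S-->(\<forall>x\<in>full M S. g S (i S x) = f S x))"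
	 using FI_map_comp[OF g(1) qm] by (intro exI[of _ "%S x. q S (g S x)"]) simp
 qed
 moreover let ?e = "%S y. \<lambda>t\<in>cidx R S. j (fst t) (mor V S (fst t) (fst (snd t)) (snd (snd t) \<odot>\<^bsub>obj V S\<^esub> y))"
 have e: "FI_map R V ?J ?e" by (rule coind_map[OF R D V j(1)])
 have "inj_on (%x. q S (?e S x)) (full V S)" if S: "finite S" for S
 proof (rule inj_onI)
	interpret M: Module.module R "obj V S" by (rule V.obj_module[OF S])
	have t: "(S, FI_incl S, \<one>\<^bsub>R\<^esub>):cidx R S" using S FI_incl_hom[OF subset_refl] by (simp add: cidx_def)
	fix x y assume x: "x:full V S" and y: "y:full V S" and "q S (?e S x) = q S (?e S y)"
	then have "?e S x = ?e S y" using inj_onD[OF qi[OF S] _ FI_map_closed[OF e S x] FI_map_closed[OF e S y]] by simp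
	from fun_cong[OF this, of "(S, FI_incl S, \<one>\<^bsub>R\<^esub>)"] have "j S x = j S y" using t x y V.mor_id[OF S] by simp
	then show "x = y" by (rule inj_onD[OF j(2)[OF S] _ x y])
 qed
 ultimately show ?thesis using FI_map_comp[OF e qm] by (intro exI conjI) auto
qed

subsection \<open>Torsion\<close>

text \<open>Being killed by every injection into a sufficiently large set is a uniform condition,
  evidently closed under sums; that a single injection suffices is shown below.\<close>

definition tor :: "('k, 'a) fi_mod=>nat set=>'a set" where
 "tor V S = {x\<in>full V S. EX n. ALL U g. finite U-->n\<le>card U-->g:FI_hom S U-->mor V S U g x = zer V U}"

text \<open>If U is at least as large as T, its complement of the image of S has room for that of T.
  Hence an element killed by one injection into T is killed by every injection into a set of size at
  least that of T.\<close>

lemma FI_hom_factor: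
 assumes "finite S" "finite T" "finite U" and f: "f:FI_hom S T" and g: "g:FI_hom S U" and c: "card T\<le>card U"
 shows "\<exists>h\<in>FI_hom T U. compose S h f = g"
proof -
 have fi: "inj_on f S" "f ` S<=T" and gi: "inj_on g S" "g ` S<=U" and ge: "g:extensional S"
	using f g by (auto simp: FI_hom_def PiE_iff)
 have "card (T - f ` S)\<le>card (U - g ` S)"
	using c card_Diff_subset[of "f ` S" T] card_Diff_subset[of "g ` S" U] assms(1-3) fi gi by (simp add: card_image)
 then obtain k where k: "k ` (T - f ` S)<=U - g ` S" "inj_on k (T - f ` S)"
	using card_le_inj[of "T - f ` S" "U - g ` S"] assms(2,3) by auto
 define h where "h = (\<lambda>x\<in>T. if x:f ` S then g (inv_into S f x) else k x)"
 have hf: "h (f x) = g x" if "x:S" for x using that fi by (auto simp: h_def inv_into_f_f)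
 have hk: "h x = k x" if "x:T - f ` S" for x using that by (simp add: h_def)
 have "h x:U" if "x:T" for x using that hf hk k(1) gi(2) by (cases "x:f ` S") auto
 moreover have "inj_on h T"
 proof (rule inj_onI)
	fix x y assume xy: "x:T" "y:T" "h x = h y"
	have dis: False if "a:S" "b:T - f ` S" "h (f a) = h b" for a b
	 using that hf[OF that(1)] hk[OF that(2)] k(1) by auto
	consider (1) a b where "a:S" "b:S" "x = f a" "y = f b" | (2) a where "a:S" "x = f a" "y:T - f ` S"
	 | (3) a where "a:S" "y = f a" "x:T - f ` S" | (4) "x:T - f ` S" "y:T - f ` S" using xy by blast
	then show "x = y"
	proof cases
	 case 1
	 then have "g a = g b" using xy(3) hf by simp
	 then have "a = b" by (rule inj_onD[OF gi(1) _ 1(1,2)])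
	 then show ?thesis using 1 by simp
	next
	 case 4
	 then show ?thesis using xy(3) hk inj_onD[OF k(2)] by simp
	qed (use dis xy(3) in metis)+
 qed
 ultimately have "h:FI_hom T U" by (auto simp: FI_hom_def h_def)
 moreover have "compose S h f = g"
	by (rule extensionalityI[OF _ ge]) (simp_all add: compose_def hf)
 ultimately show ?thesis by blast
qed

lemma torI:
 assumes V: "FI_module R V" and S: "finite S" and T: "finite T" and f: "f:FI_hom S T" and x: "x:full V S"
	and z: "mor V S T f x = zer V T"
 shows "x:tor V S"
 unfolding tor_def
proof (intro CollectI conjI x exI[of _ "card T"] allI impI)
 fix U g assume U: "finite U" "card T\<le>card U" "g:FI_hom S U"
 obtain h where h: "h:FI_hom T U" "compose S h f = g" using FI_hom_factor[OF S T U(1) f U(3,2)] by blast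
 show "mor V S U g x = zer V U"
	unfolding h(2)[symmetric] FI_module.mor_comp[OF V S T U(1) f h(1) x] z by (rule FI_module.mor_zero[OF V T U(1) h(1)])
qed

lemma torE:
 assumes V: "FI_module R V" and S: "finite S" and x: "x:tor V S"
 obtains T where "finite T" "S<=T" "mor V S T (FI_incl S) x = zer V T"
proof -
 obtain n where n: "!!U g. finite U==>n\<le>card U==>g:FI_hom S U==>mor V S U g x = zer V U" using x unfolding tor_def by blast
 have "card {..<n}\<le>card (S\<union>{..<n})" using S by (intro card_mono) auto
 then have "mor V S (S\<union>{..<n}) (FI_incl S) x = zer V (S\<union>{..<n})" using S by (intro n FI_incl_hom) auto
 then show ?thesis using S by (intro that[of "S\<union>{..<n}"]) auto
qed

lemma tor_submodule:
 assumes V: "FI_module R V"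
 shows "FI_submodule R V (tor V)"
proof (rule FI_submoduleI[OF V])
 interpret FI_module R V by (rule V)
 fix S :: "nat set" assume S: "finite S"
 interpret M: Module.module R "obj V S" by (rule obj_module[OF S])
 show "x:full V S" if "x:tor V S" for x using that by (simp add: tor_def)
 show "zer V S:tor V S" using mor_zero[OF S] by (simp add: tor_def)
 show "x \<oplus>\<^bsub>obj V S\<^esub> y:tor V S" if x: "x:tor V S" and y: "y:tor V S" for x y
 proof -
	have c: "x:full V S" "y:full V S" using x y by (simp_all add: tor_def)
	obtain n m where n: "!!U g. finite U==>n\<le>card U==>g:FI_hom S U==>mor V S U g x = zer V U"
	 and m: "!!U g. finite U==>m\<le>card U==>g:FI_hom S U==>mor V S U g y = zer V U" using x y unfolding tor_def by blast
	show ?thesis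
	 unfolding tor_def
	proof (intro CollectI conjI M.a_closed c exI[of _ "max n m"] allI impI)
	 fix U g assume U: "finite U" "max n m\<le>card U" "g:FI_hom S U"
	 interpret U: abelian_group "obj V U" by (rule obj_ab[OF U(1)])
	 show "mor V S U g (x \<oplus>\<^bsub>obj V S\<^esub> y) = zer V U"
		using n[OF U(1) _ U(3)] m[OF U(1) _ U(3)] U(2) mor_add[OF S U(1,3) c] by simp
	qed
 qed
 show "c \<odot>\<^bsub>obj V S\<^esub> x:tor V S" if c: "c:carrier R" and x: "x:tor V S" for c x
 proof -
	have xc: "x:full V S" using x by (simp add: tor_def)
	obtain n where n: "!!U g. finite U==>n\<le>card U==>g:FI_hom S U==>mor V S U g x = zer V U" using x unfolding tor_def by blast
	show ?thesis
	 unfolding tor_def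
	proof (intro CollectI conjI M.smult_closed c xc exI[of _ n] allI impI)
	 fix U g assume U: "finite U" "n\<le>card U" "g:FI_hom S U"
	 interpret U: Module.module R "obj V U" by (rule obj_module[OF U(1)])
	 show "mor V S U g (c \<odot>\<^bsub>obj V S\<^esub> x) = zer V U"
		using n[OF U] mor_smult[OF S U(1,3) c xc] U.smult_r_null[OF c] by simp
	qed
 qed
 fix T f x assume T: "finite T" and f: "f:FI_hom S T" and x: "x:tor V S"
 have xc: "x:full V S" using x by (simp add: tor_def)
 obtain n where n: "!!U g. finite U==>n\<le>card U==>g:FI_hom S U==>mor V S U g x = zer V U" using x unfolding tor_def by blast
 show "mor V S T f x:tor V T"
	unfolding tor_def
	by (intro CollectI conjI mor_closed[OF S T f xc] exI[of _ n] allI impI)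
	 (simp add: n FI_hom_compose[OF f] flip: mor_comp[OF S T _ f _ xc])
qed

lemma tor_carrier: "x:tor V S==>x:full V S"
 by (simp add: tor_def)

lemma torsion_part_eq:
 assumes V: "FI_module R V" and S: "finite S"
 shows "torsion_part R V S = tor V S"
proof
 show "torsion_part R V S<=tor V S"
 proof
	fix x assume "x:torsion_part R V S"
	then obtain N where N: "FI_submodule R V N" "FI_torsion (FI_sub V N)" "x:N S" unfolding torsion_part_def by blast
	then obtain T f where "finite T" "f:FI_hom S T" "mor V S T f x = zer V T"
	 using N(2)[unfolded FI_torsion_def FI_sub_sel, rule_format, OF S N(3)] by blast
	then show "x:tor V S" by (rule torI[OF V S _ _ FI_subD[OF N(1) V S N(3)]])
 qed
 have "FI_torsion (FI_sub V (tor V))"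
	unfolding FI_torsion_def FI_sub_sel
 proof (intro allI impI)
	fix S x assume S: "finite (S :: nat set)" and x: "x:tor V S"
	obtain T where "finite T" "S<=T" "mor V S T (FI_incl S) x = zer V T" by (rule torE[OF V S x])
	then show "EX T f. finite T&f:FI_hom S T&mor V S T f x = zer V T" using FI_incl_hom by blast
 qed
 then show "tor V S<=torsion_part R V S" unfolding torsion_part_def using tor_submodule[OF V] by blast
qed

lemma tor_map:
 assumes V: "FI_module R V" and W: "FI_module R W" and p: "FI_map R V W ph" and S: "finite S" and x: "x:tor V S"
 shows "ph S x:tor W S"
proof -
 obtain T where T: "finite T" "S<=T" "mor V S T (FI_incl S) x = zer V T" by (rule torE[OF V S x])
 note i = FI_incl_hom[OF T(2)]
 show ?thesis
	by (rule torI[OF W S T(1) i FI_map_closed[OF p S tor_carrier[OF x]]])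
	 (simp add: T(3) FI_map_zero[OF V W p T(1)] flip: FI_map_nat[OF p S T(1) i tor_carrier[OF x]])
qed

lemma tor_inj:
 assumes V: "FI_module R V" and W: "FI_module R W" and p: "FI_map R V W ph" and inj: "!!S. finite S==>inj_on (ph S) (full V S)"
	and S: "finite S" and x: "x:full V S" "ph S x:tor W S"
 shows "x:tor V S"
proof -
 obtain T where T: "finite T" "S<=T" "mor W S T (FI_incl S) (ph S x) = zer W T" by (rule torE[OF W S x(2)])
 note i = FI_incl_hom[OF T(2)] and z = FI_sub_zero[OF FI_submodule_full[OF V] V T(1)]
 have "ph T (mor V S T (FI_incl S) x) = ph T (zer V T)"
	unfolding FI_map_nat[OF p S T(1) i x(1)] T(3) FI_map_zero[OF V W p T(1)] ..
 then have "mor V S T (FI_incl S) x = zer V T" by (rule inj_onD[OF inj[OF T(1)] _ FI_module.mor_closed[OF V S T(1) i x(1)] z])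
 then show ?thesis by (rule torI[OF V S T(1) i x(1)])
qed

subsection \<open>Comparison of injective resolutions\<close>

lemma FI_map_diff:
 assumes V: "FI_module R V" and W: "FI_module R W" and p: "FI_map R V W ph" and q: "FI_map R V W ps"
 shows "FI_map R V W (%S x. ph S x \<ominus>\<^bsub>obj W S\<^esub> ps S x)"
 unfolding FI_map_def mod_hom_def
proof (intro conjI allI impI CollectI ballI Pi_I)
 fix S :: "nat set" assume S: "finite S"
 interpret M: Module.module R "obj W S" by (rule FI_module.obj_module[OF W S])
 note c = FI_map_closed[OF p S] FI_map_closed[OF q S]
 fix x assume x: "x:full V S"
 show "ph S x \<ominus>\<^bsub>obj W S\<^esub> ps S x:full W S" using c[OF x] by simp
 show "ph S (x \<oplus>\<^bsub>obj V S\<^esub> y) \<ominus>\<^bsub>obj W S\<^esub> ps S (x \<oplus>\<^bsub>obj V S\<^esub> y) = ph S x \<ominus>\<^bsub>obj W S\<^esub> ps S x \<oplus>\<^bsub>obj W S\<^esub> (ph S y \<ominus>\<^bsub>obj W S\<^esub> ps S y)"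
	if y: "y:full V S" for y
	unfolding FI_map_add[OF p S x y] FI_map_add[OF q S x y] a_minus_def using c[OF x] c[OF y] by (simp add: M.minus_add M.a_ac)
 show "ph S (a \<odot>\<^bsub>obj V S\<^esub> x) \<ominus>\<^bsub>obj W S\<^esub> ps S (a \<odot>\<^bsub>obj V S\<^esub> x) = a \<odot>\<^bsub>obj W S\<^esub> (ph S x \<ominus>\<^bsub>obj W S\<^esub> ps S x)"
	if a: "a:carrier R" for a
	unfolding FI_map_smult[OF p S a x] FI_map_smult[OF q S a x] a_minus_def using c[OF x] a by (simp add: M.smult_r_distr M.smult_r_minus)
 fix T f assume T: "finite T" and f: "f:FI_hom S T"
 show "ph T (mor V S T f x) \<ominus>\<^bsub>obj W T\<^esub> ps T (mor V S T f x) = mor W S T f (ph S x \<ominus>\<^bsub>obj W S\<^esub> ps S x)"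
	unfolding FI_map_nat[OF p S T f x] FI_map_nat[OF q S T f x] FI_module.mor_minus[OF W S T f c(1)[OF x] c(2)[OF x]] ..
qed

text \<open>Since \<open>k\<close> vanishes on the kernel of \<open>h\<close>, it factors through
  the image of \<open>h\<close>. That image is a submodule of \<open>Y\<close>, which brings W, of
  an arbitrary type, into the type in which injectivity is tested.\<close>

lemma injective_extend:
 fixes I Y :: "('k, 'u) fi_mod" and W :: "('k, 'w) fi_mod"
 assumes I: "FI_injective R I" and W: "FI_module R W" and Y: "FI_module R Y" and h: "FI_map R W Y h" and k: "FI_map R W I k"
	and ker: "!!S x. finite S==>x:full W S==>h S x = zer Y S==>k S x = zer I S"
 shows "EX g. FI_map R Y I g&(ALL S x. finite S-->x:full W S-->g S (h S x) = k S x)"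
proof -
 have IM: "FI_module R I" using I by (simp add: FI_injective_def)
 interpret W: FI_module R W by (rule W)
 let ?N = "%S. h S ` full W S"
 let ?M = "FI_sub Y ?N"
 have N: "FI_submodule R Y ?N" by (rule FI_submodule_image[OF W Y h FI_submodule_full[OF W]])
 define f where "f S y = k S (SOME x. x:full W S&h S x = y)" for S y
 have f: "f S (h S x) = k S x" if S: "finite S" and x: "x:full W S" for S x
 proof -
	interpret MW: abelian_group "obj W S" by (rule W.obj_ab[OF S])
	interpret MI: abelian_group "obj I S" by (rule FI_module.obj_ab[OF IM S])
	interpret MY: abelian_group "obj Y S" by (rule FI_module.obj_ab[OF Y S])
	define x' where "x' = (SOME x'. x':full W S&h S x' = h S x)"
	have x': "x':full W S&h S x' = h S x" unfolding x'_def by (rule someI[of _ x]) (simp add: x)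
	have hz: "h S (x' \<ominus>\<^bsub>obj W S\<^esub> x) = zer Y S"
	 using FI_map_minus[OF W Y h S _ x, of x'] x' MY.minus_eq_zero_iff FI_map_closed[OF h S x] by simp
	have "k S (x' \<ominus>\<^bsub>obj W S\<^esub> x) = zer I S" by (rule ker[OF S MW.minus_closed[OF conjunct1[OF x'] x] hz])
	then show ?thesis
	 unfolding f_def x'_def[symmetric] using FI_map_minus[OF W IM k S _ x, of x'] x' MI.minus_eq_zero_iff FI_map_closed[OF k S] x by simp
 qed
 have "FI_map R ?M I f"
	unfolding FI_map_def mod_hom_def FI_sub_sel
 proof (intro conjI allI impI CollectI ballI Pi_I)
	fix S :: "nat set" assume S: "finite S"
	interpret MW: Module.module R "obj W S" by (rule W.obj_module[OF S])
	fix y assume "y:?N S"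
	then obtain x where x: "x:full W S" and y: "y = h S x" by blast
	show "f S y:full I S" unfolding y f[OF S x] by (rule FI_map_closed[OF k S x])
	show "f S (a \<odot>\<^bsub>obj Y S\<^esub> y) = a \<odot>\<^bsub>obj I S\<^esub> f S y" if a: "a:carrier R" for a
	 unfolding y f[OF S x] FI_map_smult[OF h S a x, symmetric] f[OF S MW.smult_closed[OF a x]] by (rule FI_map_smult[OF k S a x])
	show "f S (y \<oplus>\<^bsub>obj Y S\<^esub> z) = f S y \<oplus>\<^bsub>obj I S\<^esub> f S z" if zn: "z:?N S" for z
	proof -
	 obtain w where w: "w:full W S" and z: "z = h S w" using zn by blast
	 show ?thesis
		unfolding y z f[OF S x] f[OF S w] FI_map_add[OF h S x w, symmetric] f[OF S MW.a_closed[OF x w]] by (rule FI_map_add[OF k S x w])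
	qed
	fix T g assume T: "finite T" and g: "g:FI_hom S T"
	show "f T (mor Y S T g y) = mor I S T g (f S y)"
	 unfolding y f[OF S x] FI_map_nat[OF h S T g x, symmetric] f[OF T W.mor_closed[OF S T g x]] by (rule FI_map_nat[OF k S T g x])
 qed
 moreover have "ALL S. finite S-->inj_on (%x. x) (full ?M S)" by simp
 ultimately have "EX g. FI_map R Y I g&(ALL S. finite S-->(\<forall>x\<in>full ?M S. g S x = f S x))"
	using I FI_module_sub[OF Y N] Y FI_map_incl[OF Y N] unfolding FI_injective_def by blast
 then obtain g where "FI_map R Y I g" "!!S x. finite S==>x:?N S==>g S x = f S x" by auto
 then show ?thesis using f by (intro exI[of _ g]) simp
qed

lemma inj_resolutionD:
 assumes "inj_resolution R V I d e"
 shows "FI_injective R (I n)" "FI_module R (I n)" "FI_map R (I n) (I (Suc n)) (d n)" "FI_map R V (I 0) e"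
	"finite S==>inj_on (e S) (full V S)"
	"finite S==>x:full (I 0) S==>d 0 S x = zer (I 1) S<->x:e S ` full V S"
	"finite S==>y:full (I (Suc n)) S==>d (Suc n) S y = zer (I (Suc (Suc n))) S<->y:d n S ` full (I n) S"
 using assms by (auto simp: inj_resolution_def FI_im_def FI_ker_def FI_injective_def)

lemma inj_resolution_dd:
 assumes "inj_resolution R V I d e" "finite S"
 shows "x:full (I n) S==>d (Suc n) S (d n S x) = zer (I (Suc (Suc n))) S"
	"v:full V S==>d 0 S (e S v) = zer (I 1) S"
 using inj_resolutionD(7)[OF assms(1,2) FI_map_closed[OF inj_resolutionD(3)[OF assms(1)] assms(2)]]
	inj_resolutionD(6)[OF assms(1,2) FI_map_closed[OF inj_resolutionD(4)[OF assms(1)] assms(2)]] by blast+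

lemma chain_map_exists:
 fixes I J :: "nat=>('k, 'u) fi_mod"
 assumes V: "FI_module R V" and I: "inj_resolution R V I d e" and J: "inj_resolution R V J d' e'"
 obtains f where "!!n. FI_map R (I n) (J n) (f n)" "!!S x. finite S==>x:full V S==>f 0 S (e S x) = e' S x"
	"!!n S x. finite S==>x:full (I n) S==>f (Suc n) S (d n S x) = d' n S (f n S x)"
proof -
 note i = inj_resolutionD[OF I] and j = inj_resolutionD[OF J]
 \<comment> \<open>The invariant that the map built so far sends cycles to cycles is what permits
   the next extension.\<close>
 define P where "P n f<->FI_map R (I n) (J n) f&(n = 0-->(ALL S x. finite S-->x:full V S-->f S (e S x) = e' S x)) \<and>
	(ALL S x. finite S-->x:full (I n) S-->d n S x = zer (I (Suc n)) S-->d' n S (f S x) = zer (J (Suc n)) S)" for n f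
 define Q where "Q n f g<->(ALL S x. finite S-->x:full (I n) S-->g S (d n S x) = d' n S (f S x))"
	for n and f g :: "nat set=>'u=>'u"
 have "EX f. ALL n. P n (f n)&Q n (f n) (f (Suc n))"
 proof (rule dependent_nat_choice)
	have "e' S x = zer (J 0) S" if S: "finite S" and x: "x:full V S" and z: "e S x = zer (I 0) S" for S x
	proof -
	 have "x = zer V S"
		by (rule inj_onD[OF i(5)[OF S] _ x FI_sub_zero[OF FI_submodule_full[OF V] V S]]) (simp add: z FI_map_zero[OF V i(2) i(4) S])
	 then show ?thesis using FI_map_zero[OF V j(2) j(4) S] by simp
	qed
	from injective_extend[OF j(1) V i(2) i(4) j(4) this]
	obtain f where f: "FI_map R (I 0) (J 0) f" "!!S x. finite S==>x:full V S==>f S (e S x) = e' S x" by blast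
	have "d' 0 S (f S x) = zer (J (Suc 0)) S" if S: "finite S" and x: "x:full (I 0) S" and z: "d 0 S x = zer (I (Suc 0)) S" for S x
	proof -
	 obtain v where v: "v:full V S" "x = e S v" using i(6)[OF S x] z by auto
	 show ?thesis unfolding v(2) f(2)[OF S v(1)] using inj_resolution_dd(2)[OF J S v(1)] by simp
	qed
	then show "EX f. P 0 f" unfolding P_def using f by (intro exI[of _ f]) simp
 next
	fix f n assume P: "P n f"
	have fm: "FI_map R (I n) (J n) f" using P by (simp add: P_def)
	have "d' n S (f S x) = zer (J (Suc n)) S" if "finite S" "x:full (I n) S" "d n S x = zer (I (Suc n)) S" for S x
	 using P that by (simp add: P_def)
	from injective_extend[OF j(1) i(2) i(2) i(3) FI_map_comp[OF fm j(3)] this]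
	obtain g where g: "FI_map R (I (Suc n)) (J (Suc n)) g" "!!S x. finite S==>x:full (I n) S==>g S (d n S x) = d' n S (f S x)" by blast
	have "d' (Suc n) S (g S x) = zer (J (Suc (Suc n))) S"
	 if S: "finite S" and x: "x:full (I (Suc n)) S" and z: "d (Suc n) S x = zer (I (Suc (Suc n))) S" for S x
	proof -
	 obtain v where v: "v:full (I n) S" "x = d n S v" using i(7)[OF S x] z by auto
	 show ?thesis unfolding v(2) g(2)[OF S v(1)] by (rule inj_resolution_dd(1)[OF J S FI_map_closed[OF fm S v(1)]])
	qed
	then have "P (Suc n) g" unfolding P_def using g(1) by simp
	moreover have "Q n f g" unfolding Q_def using g(2) by simp
	ultimately show "EX g. P (Suc n) g&Q n f g" by (intro exI conjI)
 qed
 then obtain f where "ALL n. P n (f n)&Q n (f n) (f (Suc n))" by (rule exE)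
 then have f: "P n (f n)" "Q n (f n) (f (Suc n))" for n by simp_all
 show ?thesis by (rule that[of f]) (use f in \<open>simp_all add: P_def Q_def\<close>)
qed

lemma null_homotopy_exists:
 fixes I :: "nat=>('k, 'u) fi_mod"
 assumes I: "inj_resolution R V I d e" and u: "!!n. FI_map R (I n) (I n) (u n)"
	and ud: "!!n S x. finite S==>x:full (I n) S==>u (Suc n) S (d n S x) = d n S (u n S x)"
	and ue: "!!S x. finite S==>x:full V S==>u 0 S (e S x) = zer (I 0) S"
 obtains s where "!!n. FI_map R (I (Suc n)) (I n) (s n)" "!!S x. finite S==>x:full (I 0) S==>s 0 S (d 0 S x) = u 0 S x"
	"!!n S x. finite S==>x:full (I (Suc n)) S==>s (Suc n) S (d (Suc n) S x) = u (Suc n) S x \<ominus>\<^bsub>obj (I (Suc n)) S\<^esub> d n S (s n S x)"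
proof -
 note i = inj_resolutionD[OF I]
 have ab: "abelian_group (obj (I n) S)" if "finite S" for n S by (rule FI_module.obj_ab[OF i(2) that])
 have dz: "d n S (zer (I n) S) = zer (I (Suc n)) S" if "finite S" for n S by (rule FI_map_zero[OF i(2) i(2) i(3) that])
 \<comment> \<open>The invariant d(u - s d) = 0 makes \<open>u - d s\<close> vanish on cycles of the
   next degree, so that it factors through the differential.\<close>
 define P where "P n s<->FI_map R (I (Suc n)) (I n) s&(n = 0-->(ALL S x. finite S-->x:full (I 0) S-->s S (d 0 S x) = u 0 S x)) \<and>
	(ALL S x. finite S-->x:full (I n) S-->d n S (u n S x \<ominus>\<^bsub>obj (I n) S\<^esub> s S (d n S x)) = zer (I (Suc n)) S)" for n s
 define Q where "Q n s s'<->(ALL S x. finite S-->x:full (I (Suc n)) S -->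
	s' S (d (Suc n) S x) = u (Suc n) S x \<ominus>\<^bsub>obj (I (Suc n)) S\<^esub> d n S (s S x))" for n and s s' :: "nat set=>'u=>'u"
 have "EX s. ALL n. P n (s n)&Q n (s n) (s (Suc n))"
 proof (rule dependent_nat_choice)
	have "u 0 S x = zer (I 0) S" if S: "finite S" and x: "x:full (I 0) S" and z: "d 0 S x = zer (I (Suc 0)) S" for S x
	proof -
	 obtain v where v: "v:full V S" "x = e S v" using i(6)[OF S x] z by auto
	 show ?thesis unfolding v(2) by (rule ue[OF S v(1)])
	qed
	from injective_extend[OF i(1) i(2) i(2) i(3) u this]
	obtain s where s: "FI_map R (I (Suc 0)) (I 0) s" "!!S x. finite S==>x:full (I 0) S==>s S (d 0 S x) = u 0 S x" by blast
	have "d 0 S (u 0 S x \<ominus>\<^bsub>obj (I 0) S\<^esub> s S (d 0 S x)) = zer (I (Suc 0)) S" if S: "finite S" and x: "x:full (I 0) S" for S x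
	 using s(2)[OF S x] abelian_group.minus_eq_zero_iff[OF ab[OF S] FI_map_closed[OF u S x] FI_map_closed[OF u S x]] dz[OF S] by simp
	then show "EX s. P 0 s" unfolding P_def using s by (intro exI[of _ s]) simp
 next
	fix s n assume P: "P n s"
	have sm: "FI_map R (I (Suc n)) (I n) s" using P by (simp add: P_def)
	have sP: "d n S (u n S x \<ominus>\<^bsub>obj (I n) S\<^esub> s S (d n S x)) = zer (I (Suc n)) S" if "finite S" "x:full (I n) S" for S x
	 using P that by (simp add: P_def)
	have "u (Suc n) S x \<ominus>\<^bsub>obj (I (Suc n)) S\<^esub> d n S (s S x) = zer (I (Suc n)) S"
	 if S: "finite S" and x: "x:full (I (Suc n)) S" and z: "d (Suc n) S x = zer (I (Suc (Suc n))) S" for S x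
	proof -
	 obtain v where v: "v:full (I n) S" "x = d n S v" using i(7)[OF S x] z by auto
	 note c = FI_map_closed[OF u S v(1)] FI_map_closed[OF sm S FI_map_closed[OF i(3) S v(1)]]
	 show ?thesis unfolding v(2) ud[OF S v(1)] FI_map_minus[OF i(2) i(2) i(3) S c, symmetric] by (rule sP[OF S v(1)])
	qed
	from injective_extend[OF i(1) i(2) i(2) i(3) FI_map_diff[OF i(2) i(2) u FI_map_comp[OF sm i(3)]] this]
	obtain t where t: "FI_map R (I (Suc (Suc n))) (I (Suc n)) t" "!!S x. finite S==>x:full (I (Suc n)) S ==>
	 t S (d (Suc n) S x) = u (Suc n) S x \<ominus>\<^bsub>obj (I (Suc n)) S\<^esub> d n S (s S x)" by blast
	have "d (Suc n) S (u (Suc n) S x \<ominus>\<^bsub>obj (I (Suc n)) S\<^esub> t S (d (Suc n) S x)) = zer (I (Suc (Suc n))) S"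
	 if S: "finite S" and x: "x:full (I (Suc n)) S" for S x
	proof -
	 interpret A: abelian_group "obj (I (Suc n)) S" by (rule ab[OF S])
	 note c = FI_map_closed[OF u S x] FI_map_closed[OF i(3) S FI_map_closed[OF sm S x]]
	 have "u (Suc n) S x \<ominus>\<^bsub>obj (I (Suc n)) S\<^esub> (u (Suc n) S x \<ominus>\<^bsub>obj (I (Suc n)) S\<^esub> d n S (s S x)) = d n S (s S x)"
		unfolding a_minus_def using c by (simp add: A.minus_add A.a_assoc[symmetric] A.r_neg)
	 then show ?thesis unfolding t(2)[OF S x] using inj_resolution_dd(1)[OF I S FI_map_closed[OF sm S x]] by simp
	qed
	then have "P (Suc n) t" unfolding P_def using t(1) by simp
	moreover have "Q n s t" unfolding Q_def using t(2) by simp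
	ultimately show "EX t. P (Suc n) t&Q n s t" by (intro exI conjI)
 qed
 then obtain s where "ALL n. P n (s n)&Q n (s n) (s (Suc n))" by (rule exE)
 then have s: "P n (s n)" "Q n (s n) (s (Suc n))" for n by simp_all
 show ?thesis by (rule that[of s]) (use s in \<open>simp_all add: P_def Q_def\<close>)
qed

text \<open>Vanishing at S of the j-th cohomology of the torsion subcomplex of
  \<open>I\<close>.\<close>

definition tvan :: "(nat=>('k, 'u) fi_mod)=>(nat=>nat set=>'u=>'u)=>nat=>nat set=>bool" where
 "tvan I d j S<->(\<forall>x\<in>tor (I j) S. d j S x = zer (I (Suc j)) S -->
	x:(case j of 0=>{zer (I 0) S} | Suc i=>d i S ` tor (I i) S))"

text \<open>All maps of FI-modules preserve torsion, so the homotopy between the identity and the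
  composite of comparison maps restricts to the torsion subcomplex; a class trivial in
  \<open>J\<close> is trivial in \<open>I\<close>.\<close>

lemma tvan_compare:
 fixes I J :: "nat=>('k, 'u) fi_mod"
 assumes V: "FI_module R V" and I: "inj_resolution R V I d e" and J: "inj_resolution R V J d' e'" and S: "finite S"
	and van: "tvan J d' j S"
 shows "tvan I d j S"
proof -
 note i = inj_resolutionD[OF I] and ij = inj_resolutionD[OF J]
 obtain f where f: "!!n. FI_map R (I n) (J n) (f n)" "!!S x. finite S==>x:full V S==>f 0 S (e S x) = e' S x"
	"!!n S x. finite S==>x:full (I n) S==>f (Suc n) S (d n S x) = d' n S (f n S x)"
	by (rule chain_map_exists[OF V I J]) (erule that; simp)
 obtain g where g: "!!n. FI_map R (J n) (I n) (g n)" "!!S x. finite S==>x:full V S==>g 0 S (e' S x) = e S x"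
	"!!n S x. finite S==>x:full (J n) S==>g (Suc n) S (d' n S x) = d n S (g n S x)"
	by (rule chain_map_exists[OF V J I]) (erule that; simp)
 define u where "u n S x = x \<ominus>\<^bsub>obj (I n) S\<^esub> g n S (f n S x)" for n S x
 have um: "FI_map R (I n) (I n) (u n)" for n
	unfolding u_def[abs_def] by (rule FI_map_diff[OF i(2) i(2) FI_map_id FI_map_comp[OF f(1) g(1)]])
 have ud: "u (Suc n) S (d n S x) = d n S (u n S x)" if S: "finite S" and x: "x:full (I n) S" for n S x
	unfolding u_def f(3)[OF S x] g(3)[OF S FI_map_closed[OF f(1) S x]]
	 FI_map_minus[OF i(2) i(2) i(3) S x FI_map_closed[OF g(1) S FI_map_closed[OF f(1) S x]]] ..
 have ue: "u 0 S (e S x) = zer (I 0) S" if S: "finite S" and x: "x:full V S" for S x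
	unfolding u_def f(2)[OF S x] g(2)[OF S x]
	using abelian_group.minus_eq_zero_iff[OF FI_module.obj_ab[OF i(2) S] FI_map_closed[OF i(4) S x] FI_map_closed[OF i(4) S x]] by simp
 obtain s where s: "!!n. FI_map R (I (Suc n)) (I n) (s n)" "!!S x. finite S==>x:full (I 0) S==>s 0 S (d 0 S x) = u 0 S x"
	"!!n S x. finite S==>x:full (I (Suc n)) S==>s (Suc n) S (d (Suc n) S x) = u (Suc n) S x \<ominus>\<^bsub>obj (I (Suc n)) S\<^esub> d n S (s n S x)"
	by (rule null_homotopy_exists[OF I um ud ue]; (assumption | erule that; simp))
 show ?thesis
	unfolding tvan_def
 proof (intro ballI impI)
	fix x assume xt: "x:tor (I j) S" and dx: "d j S x = zer (I (Suc j)) S"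
	note x = tor_carrier[OF xt]
	interpret A: abelian_group "obj (I j) S" by (rule FI_module.obj_ab[OF i(2) S])
	have "d' j S (f j S x) = zer (J (Suc j)) S"
	 unfolding f(3)[OF S x, symmetric] dx by (rule FI_map_zero[OF i(2) ij(2) f(1) S])
	with van tor_map[OF i(2) ij(2) f(1) S xt]
	have fx: "f j S x:(case j of 0=>{zer (J 0) S} | Suc i=>d' i S ` tor (J i) S)" unfolding tvan_def by blast
	have gc: "g j S (f j S x):full (I j) S" by (rule FI_map_closed[OF g(1) S FI_map_closed[OF f(1) S x]])
	show "x:(case j of 0=>{zer (I 0) S} | Suc i=>d i S ` tor (I i) S)"
	proof (cases j)
	 case 0
	 have "g 0 S (f 0 S x) = zer (I 0) S" using fx FI_map_zero[OF ij(2) i(2) g(1) S] by (simp add: 0)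
	 moreover have "u 0 S x = zer (I 0) S" using s(2)[OF S, of x] x dx FI_map_zero[OF i(2) i(2) s(1) S] by (simp add: 0)
	 ultimately have "x = zer (I 0) S" using A.minus_eq_zero_iff[OF x gc] by (simp add: u_def 0)
	 then show ?thesis by (simp add: 0)
	next
	 case (Suc k)
	 then obtain z where z: "z:tor (J k) S" "f j S x = d' k S z" using fx by auto
	 note zc = tor_carrier[OF z(1)]
	 have gz: "g j S (f j S x) = d k S (g k S z)" unfolding z(2) unfolding Suc by (rule g(3)[OF S zc])
	 have xs: "x:full (I (Suc k)) S" using x Suc by simp
	 have sx: "s k S x:tor (I k) S" using tor_map[OF i(2) i(2) s(1) S] xt Suc by simp
	 have gt: "g k S z:tor (I k) S" by (rule tor_map[OF ij(2) i(2) g(1) S z(1)])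
	 have "s j S (d j S x) = zer (I j) S" unfolding dx by (rule FI_map_zero[OF i(2) i(2) s(1) S])
	 then have "u (Suc k) S x \<ominus>\<^bsub>obj (I (Suc k)) S\<^esub> d k S (s k S x) = zer (I (Suc k)) S"
		unfolding Suc s(3)[OF S xs] .
	 from iffD1[OF abelian_group.minus_eq_zero_iff[OF FI_module.obj_ab[OF i(2) S] FI_map_closed[OF um S xs] FI_map_closed[OF i(3) S tor_carrier[OF sx]]] this]
	 have "u j S x = d k S (s k S x)" by (simp add: Suc)
	 then have "x = d k S (s k S x) \<oplus>\<^bsub>obj (I j) S\<^esub> d k S (g k S z)"
		using A.minus_add_cancel_right[OF x gc] unfolding u_def gz by simp
	 also have "... = d k S (s k S x \<oplus>\<^bsub>obj (I k) S\<^esub> g k S z)"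
		using FI_map_add[OF i(3) S tor_carrier[OF sx] tor_carrier[OF gt]] by (simp add: Suc)
	 finally show ?thesis using FI_sub_add[OF tor_submodule[OF i(2)] i(2) S sx gt] by (auto simp: Suc)
	qed
 qed
qed

lemma torsion_part_submodule: "FI_module R V==>FI_submodule R V (torsion_part R V)"
 using tor_submodule[of R V] unfolding FI_submodule_def by (simp add: torsion_part_eq)

text \<open>Frees local cohomology from the resolution chosen by \<open>SOME\<close>: any injective
  resolution in \<open>univ\<close> may be used, in particular the one spliced from the
  tower.\<close>

lemma local_cohomology_zero_iff:
 fixes V :: "('k, 'a) fi_mod" and J :: "nat=>('k, ('k, 'a) univ) fi_mod"
 assumes V: "FI_module R V" and J: "inj_resolution R V J d' e'" and S: "finite S"
 shows "full (local_cohomology R j V) S = {zer (local_cohomology R j V) S}<->tvan J d' j S"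
proof -
 obtain I d where Id: "some_inj_resolution R V = (I, d)" by (cases "some_inj_resolution R V") auto
 have "EX x. case x of (I, d)=>EX e. inj_resolution R V (I :: nat=>('k, ('k, 'a) univ) fi_mod) d e" using J by auto
 then have "case some_inj_resolution R V of (I, d)=>EX e. inj_resolution R V I d e"
	unfolding some_inj_resolution_def by (rule someI_ex)
 then obtain e where I: "inj_resolution R V I d e" using Id by auto
 note i = inj_resolutionD[OF I]
 let ?T = "%n. FI_Hm0 R (I n)"
 have T: "FI_module R (?T n)" for n unfolding FI_Hm0_def by (rule FI_module_sub[OF i(2) torsion_part_submodule[OF i(2)]])
 have Tc: "full (?T n) S = tor (I n) S" if "finite S" for n S unfolding FI_Hm0_def by (simp add: torsion_part_eq[OF i(2) that])
 have Tz: "zer (?T n) S = zer (I n) S" for n S unfolding FI_Hm0_def by simp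
 have dT: "FI_map R (?T n) (?T (Suc n)) (d n)" for n
	unfolding FI_Hm0_def
	by (rule FI_map_sub_cod[OF FI_map_sub_dom[OF i(2) torsion_part_submodule[OF i(2)] i(3)]])
	 (simp add: torsion_part_eq[OF i(2)] tor_map[OF i(2) i(2) i(3)])
 let ?Z = "FI_ker (?T j) (?T (Suc j)) (d j)"
 let ?B = "case j of 0=>%S. {zer (I 0) S} | Suc i=>FI_im (?T i) (d i)"
 let ?M = "FI_sub (?T j) ?Z"
 have M: "FI_module R ?M" by (rule FI_module_sub[OF T FI_submodule_ker[OF T T dT]])
 have B: "FI_submodule R ?M ?B"
 proof (cases j)
	case 0
	have "FI_submodule R ?M (null ?M)" by (rule FI_submodule_null[OF M])
	then show ?thesis by (simp add: 0 Tz)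
 next
	case (Suc k)
	have "FI_map R (?T k) (FI_sub (?T (Suc k)) (FI_ker (?T (Suc k)) (?T (Suc (Suc k))) (d (Suc k)))) (d k)"
	proof (rule FI_map_sub_cod[OF dT])
	 fix S x assume S: "finite (S :: nat set)" and x: "x:full (?T k) S"
	 then have "x:full (I k) S" unfolding Tc[OF S] by (simp add: tor_def)
	 then show "d k S x:FI_ker (?T (Suc k)) (?T (Suc (Suc k))) (d (Suc k)) S"
		unfolding FI_ker_def Tz using FI_map_closed[OF dT S x] inj_resolution_dd(1)[OF I S] by simp
	qed
	from FI_submodule_image[OF T M[unfolded Suc] this FI_submodule_full[OF T]]
	show ?thesis unfolding FI_im_def Suc by simp
 qed
 have sg: "subgroup (?B S) (add_monoid (obj ?M S))"
	using B S unfolding FI_submodule_def submodule_def by blast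
 have "full (local_cohomology R j V) S = {zer (local_cohomology R j V) S}<->full ?M S<=?B S"
	unfolding local_cohomology_def Id prod.case FI_subquot_def FI_quot_sel
	by (rule rcosets_trivial_iff[OF FI_module.obj_ab[OF M S] sg])
 also have "...<->tvan I d j S"
	unfolding FI_sub_sel FI_ker_def tvan_def Tc[OF S] Tz
	by (cases j) (auto simp: FI_im_def Tc[OF S])
 also have "...<->tvan J d' j S" using tvan_compare[OF V I J S] tvan_compare[OF V J I S] by blast
 finally show ?thesis .
qed

subsection \<open>Retracts of injectives\<close>

definition max_complement :: "('k, 'r) ring_scheme=>('k, 'b) fi_mod=>(nat set=>'b set)=>(nat set=>'b set)=>(nat set=>'b set)=>bool" where
 "max_complement R V A B N<->FI_submodule R V N&(ALL S. finite S-->A S<=N S)&(ALL S. finite S-->N S\<inter>B S<={zer V S}) \<and>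
	(ALL N'. FI_submodule R V N'-->(ALL S. finite S-->N S<=N' S)-->(ALL S. finite S-->N' S\<inter>B S<={zer V S}) -->
	 (ALL S. finite S-->N' S<=N S))"

lemma max_complementD:
 assumes "max_complement R V A B N"
 shows "FI_submodule R V N" "finite S==>A S<=N S" "finite S==>N S\<inter>B S<={zer V S}"
	"FI_submodule R V N'==>(!!S. finite S==>N S<=N' S)==>(!!S. finite S==>N' S\<inter>B S<={zer V S})==>finite S==>N' S<=N S"
 using assms unfolding max_complement_def by simp_all

lemma max_complement_exists:
 assumes V: "FI_module R (V :: ('k, 'b) fi_mod)" and A: "FI_submodule R V A" and B: "FI_submodule R V B"
	and AB: "!!S. finite S==>A S\<inter>B S<={zer V S}"
 shows "EX N. max_complement R V A B N"
proof -
 \<comment> \<open>Families of subsets are turned into sets of pairs over finite S, so that Zorn's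
   lemma for inclusion applies and values at infinite sets are forgotten.\<close>
 define fib where "fib P S = {x. (S, x):P}" for P :: "(nat set\<times>'b) set" and S
 define pairs where "pairs N = {(S, x). finite S&x:N S}" for N :: "nat set=>'b set"
 have fib_pairs: "fib (pairs N) S = N S" if "finite S" for N S using that by (simp add: fib_def pairs_def)
 have sub_cong: "FI_submodule R V N'" if "FI_submodule R V N" "!!S. finite S==>N' S = N S" for N N'
	using that unfolding FI_submodule_def by simp
 define \<A> where "\<A> = {P. FI_submodule R V (fib P)&pairs A<=P&(ALL S x. (S, x):P-->finite S&(x:B S-->x = zer V S))}"
 have in_A: "pairs N:\<A>" if "FI_submodule R V N" "!!S. finite S==>A S<=N S" "!!S. finite S==>N S\<inter>B S<={zer V S}" for N
	unfolding \<A>_def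
 proof (intro CollectI conjI)
	show "FI_submodule R V (fib (pairs N))" by (rule sub_cong[OF that(1)]) (rule fib_pairs)
	show "pairs A<=pairs N" using that(2) by (auto simp: pairs_def)
	show "ALL S x. (S, x):pairs N-->finite S&(x:B S-->x = zer V S)" using that(3) by (auto simp: pairs_def)
 qed
 have "\<exists>M\<in>\<A>. \<forall>X\<in>\<A>. M<=X-->X = M"
 proof (rule subset_Zorn_nonempty)
	show "\<A>~={}" using in_A[OF A _ AB] by auto
	fix \<C> assume ne: "\<C>~={}" and ch: "subset.chain \<A> \<C>"
	have C: "FI_submodule R V (fib X)" "pairs A<=X" "(S, x):X==>finite S" "(S, x):X==>x:B S==>x = zer V S" if "X:\<C>" for X S x
	 using ch that unfolding subset_chain_def \<A>_def by auto
	obtain X0 where X0: "X0:\<C>" using ne by blast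
	have I: "x:fib (\<Union>\<C>) S" if "X:\<C>" "x:fib X S" for x X S using that by (auto simp: fib_def)
	have "FI_submodule R V (fib (\<Union>\<C>))"
	proof (rule FI_submoduleI[OF V])
	 fix S :: "nat set" assume S: "finite S"
	 show "zer V S:fib (\<Union>\<C>) S" by (rule I[OF X0 FI_sub_zero[OF C(1)[OF X0] V S]])
	 show "x \<oplus>\<^bsub>obj V S\<^esub> y:fib (\<Union>\<C>) S" if xy: "x:fib (\<Union>\<C>) S" "y:fib (\<Union>\<C>) S" for x y
	 proof -
		obtain X where X: "X:\<C>" "(S, x):X" "(S, y):X" using chain_Union_pair[OF ch, of "(S, x)" "(S, y)"] xy unfolding fib_def by blast
		show ?thesis by (rule I[OF X(1) FI_sub_add[OF C(1)[OF X(1)] V S]]) (use X in \<open>simp_all add: fib_def\<close>)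
	 qed
	 fix x assume "x:fib (\<Union>\<C>) S"
	 then obtain X where X: "X:\<C>" "x:fib X S" by (auto simp: fib_def)
	 show "x:full V S" by (rule FI_subD[OF C(1)[OF X(1)] V S X(2)])
	 show "c \<odot>\<^bsub>obj V S\<^esub> x:fib (\<Union>\<C>) S" if c: "c:carrier R" for c by (rule I[OF X(1) FI_sub_smult[OF C(1)[OF X(1)] V S c X(2)]])
	 show "mor V S T f x:fib (\<Union>\<C>) T" if T: "finite T" "f:FI_hom S T" for T f
		by (rule I[OF X(1) FI_sub_mor[OF C(1)[OF X(1)] S T X(2)]])
	qed
	then show "\<Union>\<C>:\<A>" unfolding \<A>_def using C X0 by blast
 qed
 then obtain M where M: "M:\<A>" "\<forall>X\<in>\<A>. M<=X-->X = M" by (rule bexE)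
 have M': "FI_submodule R V (fib M)" "pairs A<=M" "!!S x. (S, x):M==>finite S" "!!S x. (S, x):M==>x:B S==>x = zer V S"
	using M(1) unfolding \<A>_def by auto
 have AM: "A S<=fib M S" if "finite S" for S using M'(2) that by (auto simp: fib_def pairs_def)
 have "N' S<=fib M S" if N': "FI_submodule R V N'" and le: "!!S. finite S==>fib M S<=N' S"
	and d: "!!S. finite S==>N' S\<inter>B S<={zer V S}" and S: "finite S" for N' S
 proof -
	have "pairs N':\<A>" by (rule in_A[OF N' subset_trans[OF AM le] d])
	moreover have "M<=pairs N'" using le M'(3) by (force simp: fib_def pairs_def)
	ultimately have "pairs N' = M" using M(2) by simp
	then show ?thesis using fib_pairs[OF S, of N'] by simp
 qed
 moreover have "fib M S\<inter>B S<={zer V S}" if "finite S" for S using M'(4) by (auto simp: fib_def)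
 ultimately have "max_complement R V A B (fib M)" unfolding max_complement_def using M'(1) AM by simp
 then show ?thesis by (intro exI[of _ "fib M"])
qed

lemma injective_retract:
 assumes J: "FI_injective R J" and E: "FI_submodule R J E" and ph: "FI_map R J J ph"
	and into: "!!S x. finite S==>x:full J S==>ph S x:E S" and id: "!!S x. finite S==>x:E S==>ph S x = x"
 shows "FI_injective R (FI_sub J E)"
proof -
 have JM: "FI_module R J" using J by (simp add: FI_injective_def)
 show ?thesis
	unfolding FI_injective_def
 proof (intro conjI FI_module_sub[OF JM E] allI impI)
	fix M N :: "('a, 'c) fi_mod" and i f
	assume M: "FI_module R M" and N: "FI_module R N" and i: "FI_map R M N i" and f: "FI_map R M (FI_sub J E) f"
	 and inj: "ALL S. finite S-->inj_on (i S) (full M S)"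
	have f': "FI_map R M J f" using FI_map_comp[OF f FI_map_incl[OF JM E]] .
	have "EX g. FI_map R N J g&(ALL S. finite S-->(\<forall>x\<in>full M S. g S (i S x) = f S x))"
	 using J M N i f' inj unfolding FI_injective_def by simp
	then obtain g where g: "FI_map R N J g" "!!S x. finite S==>x:full M S==>g S (i S x) = f S x" by auto
	have "FI_map R N (FI_sub J E) (%S x. ph S (g S x))"
	 by (rule FI_map_sub_cod[OF FI_map_comp[OF g(1) ph]]) (rule into, assumption, rule FI_map_closed[OF g(1)])
	moreover have "ph S (g S (i S x)) = f S x" if "finite S" "x:full M S" for S x
	 using id[OF that(1)] FI_map_closed[OF f that] g(2)[OF that] by simp
	ultimately show "EX g. FI_map R N (FI_sub J E) g&(ALL S. finite S-->(\<forall>x\<in>full M S. g S (i S x) = f S x))"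
	 by (intro exI[of _ "%S x. ph S (g S x)"]) simp
 qed
qed

definition projection :: "('k, 'r) ring_scheme=>('k, 'u) fi_mod=>(nat set=>'u set)=>(nat set=>'u=>'u)=>bool" where
 "projection R J E ph<->FI_submodule R J E&FI_map R J J ph \<and>
	(ALL S x. finite S-->x:full J S-->ph S x:E S)&(ALL S x. finite S-->x:E S-->ph S x = x)"

lemma projectionD:
 assumes "projection R J E ph"
 shows "FI_submodule R J E" "FI_map R J J ph" "finite S==>x:full J S==>ph S x:E S" "finite S==>x:E S==>ph S x = x"
 using assms unfolding projection_def by simp_all

text \<open>If \<open>E\<close> is maximal with \<open>E \<inter> B = 0\<close> and \<open>C \<supseteq> B\<close> is maximal with \<open>C \<inter> E = 0\<close>, then extending the inverse of
 \<open>E \<rightarrow> J / C\<close> gives a projection of \<open>J\<close> onto \<open>E\<close> with kernel \<open>C\<close>.\<close>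

lemma complement_retract:
 fixes J :: "('k, 'u) fi_mod"
 assumes J: "FI_injective R J" and V: "FI_submodule R J V" and B: "FI_submodule R J B"
	and VB: "!!S. finite S==>V S\<inter>B S<={zer J S}"
 shows "EX E ph. max_complement R J V B E&projection R J E ph"
proof -
 have JM: "FI_module R J" using J by (simp add: FI_injective_def)
 obtain E where Em: "max_complement R J V B E" using max_complement_exists[OF JM V B VB] by blast
 note E = max_complementD(1-3)[OF Em] and Emax = max_complementD(4)[OF Em]
 have BE: "B S\<inter>E S<={zer J S}" if "finite S" for S using E(3)[OF that] by blast
 obtain C where Cm: "max_complement R J B E C" using max_complement_exists[OF JM B E(1) BE] by blast
 note C = max_complementD(1-3)[OF Cm] and Cmax = max_complementD(4)[OF Cm]
 obtain Q :: "('k, 'u) fi_mod" and q where Q: "FI_module R Q" "FI_map R J Q q"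
	"!!S x. finite S==>x:full J S==>q S x = zer Q S<->x:C S" using quotient_exists[OF JM C(1)] by blast
 note EM = FI_module_sub[OF JM E(1)] and Ei = FI_map_incl[OF JM E(1)]
 have "x = zer J S" if S: "finite S" and x: "x:full (FI_sub J E) S" and z: "q S x = zer Q S" for S x
	using Q(3)[OF S FI_subD[OF E(1) JM S]] x z C(3)[OF S] by auto
 from injective_extend[OF J EM Q(1) FI_map_sub_dom[OF JM E(1) Q(2)] Ei this]
 obtain g where g': "FI_map R Q J g&(ALL S x. finite S-->x:full (FI_sub J E) S-->g S (q S x) = x)" ..
 then have g: "FI_map R Q J g" "!!S x. finite S==>x:E S==>g S (q S x) = x" by simp_all
 define ph where "ph S x = g S (q S x)" for S x
 have ph: "FI_map R J J ph" unfolding ph_def[abs_def] by (rule FI_map_comp[OF Q(2) g(1)])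
 have phE: "ph S x = x" if "finite S" "x:E S" for S x unfolding ph_def by (rule g(2)[OF that])
 have phC: "ph S x = zer J S" if S: "finite S" and x: "x:C S" for S x
	using Q(3)[OF S FI_subD[OF C(1) JM S x]] x FI_map_zero[OF Q(1) JM g(1) S] unfolding ph_def by simp
 \<comment> \<open>The preimage of B contains C and meets E trivially, since \<open>ph\<close> is
   the identity on E; maximality of C gives equality.\<close>
 let ?P = "%S. {x\<in>full J S. ph S x:B S}"
 have PC: "?P S<=C S" if S: "finite S" for S
 proof (rule Cmax[OF FI_submodule_preimage[OF JM JM ph B] _ _ S])
	fix S :: "nat set" assume S: "finite S"
	show "C S<=?P S" using FI_subD[OF C(1) JM S] phC[OF S] FI_sub_zero[OF B JM S] by auto
	show "?P S\<inter>E S<={zer J S}" using phE[OF S] E(3)[OF S] by auto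
 qed
 \<comment> \<open>If \<open>ph x\<close> lies in B, then x lies in C and \<open>ph x\<close> is 0.
   So the image meets B trivially, and maximality of E bounds it.\<close>
 let ?I = "%S. ph S ` full J S"
 have IE: "?I S<=E S" if S: "finite S" for S
 proof (rule Emax[OF FI_submodule_image[OF JM JM ph FI_submodule_full[OF JM]] _ _ S])
	fix S :: "nat set" assume S: "finite S"
	show "E S<=?I S"
	proof
	 fix x assume x: "x:E S"
	 show "x:?I S" by (rule image_eqI[of _ "ph S" x]) (simp_all add: phE[OF S x] FI_subD[OF E(1) JM S x])
	qed
	show "?I S\<inter>B S<={zer J S}" using PC[OF S] phC[OF S] by auto
 qed
 have "projection R J E ph" unfolding projection_def using E(1) ph phE IE by blast
 then show ?thesis using Em by (intro exI[of _ E] exI[of _ ph] conjI)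
qed

subsection \<open>Torsion-free injectives\<close>

text \<open>A model within the naturals of S with a disjoint point added: 0 is the new
  point.\<close>

definition shift_set :: "nat set=>nat set" where
 "shift_set S = insert 0 (Suc ` S)"

definition shift_fun :: "nat set=>(nat=>nat)=>nat=>nat" where
 "shift_fun S f = (\<lambda>x\<in>shift_set S. case x of 0=>0 | Suc y=>Suc (f y))"

definition shift :: "('k, 'a) fi_mod=>('k, 'a) fi_mod" where
 "shift V = \<lparr>obj = (%S. obj V (shift_set S)), mor = (%S T f. mor V (shift_set S) (shift_set T) (shift_fun S f))\<rparr>"

text \<open>For p in S, the identification of S with S - {p} plus a point.\<close>

definition point_at :: "nat set=>nat=>nat=>nat" where
 "point_at S p = (\<lambda>x\<in>S. if x = p then 0 else Suc x)"

lemma shift_sel: "obj (shift V) S = obj V (shift_set S)" "mor (shift V) S T f = mor V (shift_set S) (shift_set T) (shift_fun S f)"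
 by (simp_all add: shift_def)

lemma shift_set_finite: "finite S==>finite (shift_set S)"
 by (simp add: shift_set_def)

lemma shift_fun_hom: "f:FI_hom S T==>shift_fun S f:FI_hom (shift_set S) (shift_set T)"
 by (auto simp: FI_hom_def shift_fun_def shift_set_def inj_on_def PiE_iff)

lemma shift_fun_incl: "shift_fun S (FI_incl S) = FI_incl (shift_set S)"
 by (auto simp: shift_fun_def FI_incl_def shift_set_def fun_eq_iff split: nat.split)

lemma shift_fun_compose: "f:FI_hom S T==>shift_fun S (compose S g f) = compose (shift_set S) (shift_fun T g) (shift_fun S f)"
 by (auto simp: shift_fun_def compose_def shift_set_def fun_eq_iff FI_hom_def split: nat.split)

lemma suc_hom: "(\<lambda>x\<in>S. Suc x):FI_hom S (shift_set S)"
 by (auto simp: FI_hom_def shift_set_def inj_on_def)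

lemma point_at_hom: "point_at S p:FI_hom S (shift_set (S - {p}))"
 by (auto simp: FI_hom_def shift_set_def inj_on_def point_at_def)

lemma FI_module_shift:
 assumes V: "FI_module R V"
 shows "FI_module R (shift V)"
proof (rule FI_module.intro)
 interpret FI_module R V by (rule V)
 show "cring R" by (rule cring)
 fix S :: "nat set" assume S: "finite S"
 note S' = shift_set_finite[OF S]
 show "Module.module R (obj (shift V) S)" unfolding shift_sel by (rule obj_module[OF S'])
 show "mor (shift V) S S (FI_incl S) x = x" if x: "x:full (shift V) S" for x
	using mor_id[OF S'] x unfolding shift_sel shift_fun_incl by simp
 fix T f assume T: "finite T" and f: "f:FI_hom S T"
 show "mor (shift V) S T f:mod_hom R (obj (shift V) S) (obj (shift V) T)"
	unfolding shift_sel by (rule mor_hom[OF S' shift_set_finite[OF T] shift_fun_hom[OF f]])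
 show "mor (shift V) S U (compose S g f) x = mor (shift V) T U g (mor (shift V) S T f x)"
	if "finite U" "g:FI_hom T U" "x:full (shift V) S" for U g x
	using that unfolding shift_sel shift_fun_compose[OF f]
	by (intro mor_comp[OF S' shift_set_finite[OF T] shift_set_finite shift_fun_hom[OF f] shift_fun_hom])
qed

text \<open>For torsion-free C the natural map from C to its shift is injective, and injectivity of
  C splits it. Identifying S with the shift of S - {p} turns this one splitting into retractions for
  all points.\<close>

lemma torsion_free_injective_retractions:
 fixes C :: "('k, 'u) fi_mod"
 assumes C: "FI_injective R C" and tf: "!!S. finite S==>tor C S<={zer C S}"
 shows "EX r. retractions R C r"
proof -
 have CM: "FI_module R C" using C by (simp add: FI_injective_def)
 interpret FI_module R C by (rule CM)
 define io where "io S = mor C S (shift_set S) (\<lambda>x\<in>S. Suc x)" for S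
 have io: "FI_map R C (shift C) io"
	unfolding FI_map_def shift_sel io_def
 proof (intro conjI allI impI)
	fix S :: "nat set" assume S: "finite S"
	show "mor C S (shift_set S) (\<lambda>x\<in>S. Suc x):mod_hom R (obj C S) (obj C (shift_set S))"
	 by (rule mor_hom[OF S shift_set_finite[OF S] suc_hom])
	fix T f x assume T: "finite T" and f: "f:FI_hom S T" and x: "x:full C S"
	have "compose S (\<lambda>x\<in>T. Suc x) f = compose S (shift_fun S f) (\<lambda>x\<in>S. Suc x)"
	 using f by (auto simp: compose_def shift_fun_def shift_set_def fun_eq_iff FI_hom_def)
	then show "mor C T (shift_set T) (\<lambda>x\<in>T. Suc x) (mor C S T f x) =
	 mor C (shift_set S) (shift_set T) (shift_fun S f) (mor C S (shift_set S) (\<lambda>x\<in>S. Suc x) x)"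
	 using mor_comp[OF S T shift_set_finite[OF T] f suc_hom x]
		mor_comp[OF S shift_set_finite[OF S] shift_set_finite[OF T] suc_hom shift_fun_hom[OF f] x] by simp
 qed
 have "inj_on (io S) (full C S)" if S: "finite S" for S
 proof (rule inj_onI)
	interpret M: abelian_group "obj C S" by (rule obj_ab[OF S])
	interpret M': abelian_group "obj C (shift_set S)" by (rule obj_ab[OF shift_set_finite[OF S]])
	fix x y assume x: "x:full C S" and y: "y:full C S" and e: "io S x = io S y"
	have "mor C S (shift_set S) (\<lambda>x\<in>S. Suc x) (x \<ominus>\<^bsub>obj C S\<^esub> y) = zer C (shift_set S)"
	 unfolding mor_minus[OF S shift_set_finite[OF S] suc_hom x y] e[unfolded io_def]
	 using M'.minus_eq_zero_iff mor_closed[OF S shift_set_finite[OF S] suc_hom y] by simp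
	then have "x \<ominus>\<^bsub>obj C S\<^esub> y:tor C S" by (rule torI[OF CM S shift_set_finite[OF S] suc_hom M.minus_closed[OF x y]])
	then show "x = y" using tf[OF S] M.minus_eq_zero_iff[OF x y] by auto
 qed
 then have "EX rh. FI_map R (shift C) C rh&(ALL S. finite S-->(\<forall>x\<in>full C S. rh S (io S x) = x))"
	using C CM FI_module_shift[OF CM] io FI_map_id unfolding FI_injective_def by blast
 then obtain rh where rh: "FI_map R (shift C) C rh" "!!S x. finite S==>x:full C S==>rh S (io S x) = x" by auto
 define r where "r S p x = rh (S - {p}) (mor C S (shift_set (S - {p})) (point_at S p) x)" for S p x
 show ?thesis
	unfolding retractions_def
 proof (intro exI[of _ r] conjI allI impI)
	fix S :: "nat set" and p assume S: "finite S" "p:S"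
	have f: "finite (S - {p})" using S by simp
	note f' = shift_set_finite[OF f]
	show "r S p:mod_hom R (obj C S) (obj C (S - {p}))"
	 unfolding r_def[abs_def] by (rule mod_hom_comp[OF mor_hom[OF S(1) f' point_at_hom] FI_map_hom[OF rh(1) f, unfolded shift_sel]])
	show "r S p (mor C (S - {p}) S (FI_incl (S - {p})) x) = x" if x: "x:full C (S - {p})" for x
	proof -
	 have "compose (S - {p}) (point_at S p) (FI_incl (S - {p})) = (\<lambda>x\<in>S - {p}. Suc x)"
		by (auto simp: compose_def point_at_def FI_incl_def fun_eq_iff)
	 then show ?thesis
		unfolding r_def mor_comp[OF f S(1) f' FI_incl_hom[OF Diff_subset] point_at_hom x, symmetric] using rh(2)[OF f x] by (simp add: io_def)
	qed
	fix q x assume q: "q:S" "p~=q" and x: "x:full C (S - {q})"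
	have fq: "finite (S - {q})" "finite (S - {q} - {p})" using S by simp_all
	note fq' = shift_set_finite[OF fq(2)]
	have sub: "S - {q} - {p}<=S - {p}" by auto
	let ?y = "mor C (S - {q}) (shift_set (S - {q} - {p})) (point_at (S - {q}) p) x"
	have y: "?y:full (shift C) (S - {q} - {p})" unfolding shift_sel by (rule mor_closed[OF fq(1) fq' point_at_hom x])
	have "compose (S - {q}) (point_at S p) (FI_incl (S - {q})) =
	 compose (S - {q}) (shift_fun (S - {q} - {p}) (FI_incl (S - {q} - {p}))) (point_at (S - {q}) p)"
	 by (auto simp: compose_def point_at_def FI_incl_def shift_fun_def shift_set_def fun_eq_iff)
	then show "r S p (mor C (S - {q}) S (FI_incl (S - {q})) x) =
	 mor C (S - {q} - {p}) (S - {p}) (FI_incl (S - {q} - {p})) (r (S - {q}) p x)"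
	 unfolding r_def FI_map_nat[OF rh(1) fq(2) f FI_incl_hom[OF sub] y, symmetric] shift_sel
		mor_comp[OF fq(1) S(1) f' FI_incl_hom[OF Diff_subset] point_at_hom x, symmetric]
		mor_comp[OF fq(1) fq' f' point_at_hom shift_fun_hom[OF FI_incl_hom[OF sub]] x, symmetric] by simp
 qed
qed

section \<open>Separating the torsion of an injective\<close>

lemma truncation_submodule:
 assumes V: "FI_module R V" and N: "FI_submodule R V N"
 shows "FI_submodule R V (%S. if c\<le>card S then N S else {zer V S})"
proof (rule FI_submoduleI[OF V])
 interpret FI_module R V by (rule V)
 fix S :: "nat set" assume S: "finite S"
 interpret M: Module.module R "obj V S" by (rule obj_module[OF S])
 note n = FI_subD[OF N V S] FI_sub_zero[OF N V S] FI_sub_add[OF N V S] FI_sub_smult[OF N V S]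
 fix x assume x: "x:(if c\<le>card S then N S else {zer V S})"
 show "x:full V S" using x n(1) by (auto split: if_splits)
 show "x \<oplus>\<^bsub>obj V S\<^esub> y:(if c\<le>card S then N S else {zer V S})" if "y:(if c\<le>card S then N S else {zer V S})" for y
	using x that n(3) by (auto split: if_splits)
 show "a \<odot>\<^bsub>obj V S\<^esub> x:(if c\<le>card S then N S else {zer V S})" if "a:carrier R" for a
	using x that n(4) M.smult_r_null by (auto split: if_splits)
 fix T f assume T: "finite T" and f: "f:FI_hom S T"
 have "card S\<le>card T" using f T by (intro card_inj_on_le[of f]) (auto simp: FI_hom_def)
 then show "mor V S T f x:(if c\<le>card T then N T else {zer V T})"
	using x FI_sub_mor[OF N S T f] mor_zero[OF S T f] FI_sub_zero[OF N V T] by (auto split: if_splits)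
qed (use FI_sub_zero[OF N V] in auto)

text \<open>When torsion is confined to sets with fewer than c points, it is a maximal complement of
  the part of X on sets with at least c points. It therefore splits off, and its complement is
  injective and torsion-free, hence acyclic.\<close>

lemma injective_torsion_splitting:
 fixes X :: "('k, 'u) fi_mod"
 assumes X: "FI_injective R X" and c: "!!S. finite S==>c\<le>card S==>tor X S<={zer X S}" and S: "finite S"
 shows "kvan X (tor X) (full X) (Suc j) S"
proof -
 have XM: "FI_module R X" using X by (simp add: FI_injective_def)
 interpret FI_module R X by (rule XM)
 note T = tor_submodule[OF XM]
 let ?B = "%S. if c\<le>card S then full X S else {zer X S}"
 have B: "FI_submodule R X ?B" by (rule truncation_submodule[OF XM FI_submodule_full[OF XM]])
 have TB: "tor X S\<inter>?B S<={zer X S}" if "finite S" for S using c[OF that] by auto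
 obtain E ph where Em: "max_complement R X (tor X) ?B E" and p: "projection R X E ph"
	using complement_retract[OF X T B TB] by blast
 note E = projectionD(1,2)[OF p] max_complementD(2,3)[OF Em] projectionD(3,4)[OF p]
 \<comment> \<open>E is zero on sets with at least c points, so any of its elements dies on
   enlarging S.\<close>
 have ET: "E S = tor X S" if S: "finite S" for S
 proof
	show "E S<=tor X S"
	proof
	 fix x assume x: "x:E S"
	 have f: "finite (S\<union>{..<c})" using S by simp
	 have "c\<le>card (S\<union>{..<c})" using card_mono[OF f, of "{..<c}"] by simp
	 then have z: "E (S\<union>{..<c})<={zer X (S\<union>{..<c})}" using E(4)[OF f] FI_subD[OF E(1) XM f] by auto
	 note i = FI_incl_hom[of S "S\<union>{..<c}", OF Un_upper1]
	 show "x:tor X S" by (rule torI[OF XM S f i FI_subD[OF E(1) XM S x]]) (use z FI_sub_mor[OF E(1) S f i x] in blast)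
	qed
 qed (rule E(3)[OF S])
 let ?ps = "%S x. x \<ominus>\<^bsub>obj X S\<^esub> ph S x"
 have ps: "FI_map R X X ?ps" by (rule FI_map_diff[OF XM XM FI_map_id E(2)])
 let ?C = "FI_ker X X ph"
 have C: "FI_submodule R X ?C" by (rule FI_submodule_ker[OF XM XM E(2)])
 have cl: "ph S x:full X S" if "finite S" "x:full X S" for S x by (rule FI_map_closed[OF E(2) that])
 have psC: "?ps S x:?C S" if S: "finite S" and x: "x:full X S" for S x
 proof -
	interpret M: abelian_group "obj X S" by (rule obj_ab[OF S])
	have "ph S (?ps S x) = zer X S"
	 unfolding FI_map_minus[OF XM XM E(2) S x cl[OF S x]] E(6)[OF S E(5)[OF S x]] using M.minus_eq_zero_iff[OF cl[OF S x] cl[OF S x]] by simp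
	then show ?thesis using FI_map_closed[OF ps S x] unfolding FI_ker_def by simp
 qed
 have psid: "?ps S x = x" if S: "finite S" and x: "x:?C S" for S x
 proof -
	interpret M: abelian_group "obj X S" by (rule obj_ab[OF S])
	have "x:full X S" "ph S x = zer X S" using x by (auto simp: FI_ker_def)
	then show ?thesis by (simp add: a_minus_def)
 qed
 have CI: "FI_injective R (FI_sub X ?C)" by (rule injective_retract[OF X C ps psC psid])
 note CM = FI_module_sub[OF XM C]
 have "tor (FI_sub X ?C) S<={zer (FI_sub X ?C) S}" if S: "finite S" for S
 proof
	fix x assume x: "x:tor (FI_sub X ?C) S"
	have "x:tor X S" using tor_map[OF CM XM FI_map_incl[OF XM C] S x] .
	then have "ph S x = x" using E(6)[OF S] ET[OF S] by simp
	moreover have "ph S x = zer X S" using tor_carrier[OF x] by (simp add: FI_ker_def)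
	ultimately show "x:{zer (FI_sub X ?C) S}" by simp
 qed
 from torsion_free_injective_retractions[OF CI this]
 obtain r where "retractions R (FI_sub X ?C) r" by blast
 then have k: "kvan (FI_sub X ?C) (null (FI_sub X ?C)) (full (FI_sub X ?C)) (Suc j) S" by (rule retractions_kvan[OF CM _ S])
 have "kvan X (tor X) (full X) (Suc j) S<->kvan (FI_sub X ?C) (null (FI_sub X ?C)) (full (FI_sub X ?C)) (Suc j) S"
 proof (rule kvan_transfer[OF XM CM FI_map_sub_cod[OF ps psC] T FI_submodule_full[OF XM] FI_submodule_null[OF CM] FI_submodule_full[OF CM] S])
	fix U :: "nat set" assume U: "finite U"
	interpret M: abelian_group "obj X U" by (rule obj_ab[OF U])
	interpret CU: abelian_group "obj (FI_sub X ?C) U" by (rule FI_module.obj_ab[OF CM U])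
	show "?ps U x:full (FI_sub X ?C) U" if "x:full X U" for x using psC[OF U that] by simp
	show "?ps U x:null (FI_sub X ?C) U<->x:tor X U" if x: "x:full X U" for x
	 using M.minus_eq_zero_iff[OF x cl[OF U x]] E(5)[OF U x] E(6)[OF U, of x] unfolding ET[OF U] by auto
	show "\<exists>x\<in>full X U. ?ps U x \<ominus>\<^bsub>obj (FI_sub X ?C) U\<^esub> y:null (FI_sub X ?C) U" if y: "y:full (FI_sub X ?C) U" for y
	proof (rule bexI[of _ y])
	 show "?ps U y \<ominus>\<^bsub>obj (FI_sub X ?C) U\<^esub> y:null (FI_sub X ?C) U"
		using psid[OF U, of y] y CU.minus_eq_zero_iff[OF y y] by simp
	 show "y:full X U" using y by (simp add: FI_ker_def)
	qed
 qed
 then show ?thesis using k by simp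
qed

text \<open>A direct embedding into an injective may create torsion in large degrees. Instead of an
  essential extension it suffices to take a submodule containing Z and maximal among those without
  torsion on sets of size at least c; it is a retract.\<close>

lemma injective_hull:
 fixes Z :: "('k, ('k, 'a) univ) fi_mod"
 assumes Z: "FI_module R Z" and c: "!!S. finite S==>c\<le>card S==>tor Z S<={zer Z S}"
 shows "EX (X :: ('k, ('k, 'a) univ) fi_mod) e. FI_injective R X&FI_map R Z X e&(ALL S. finite S-->inj_on (e S) (full Z S)) \<and>
	(ALL S. finite S-->c\<le>card S-->tor X S<={zer X S})"
proof -
 obtain J :: "('k, ('k, 'a) univ) fi_mod" and e where J: "FI_injective R J" "FI_map R Z J e" "!!S. finite S==>inj_on (e S) (full Z S)"
	using enough_injectives[OF Z, of "%x. x"] by auto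
 have JM: "FI_module R J" using J(1) by (simp add: FI_injective_def)
 note V = FI_submodule_image[OF Z JM J(2) FI_submodule_full[OF Z]]
 let ?B = "%S. if c\<le>card S then tor J S else {zer J S}"
 have B: "FI_submodule R J ?B" by (rule truncation_submodule[OF JM tor_submodule[OF JM]])
 have VB: "e S ` full Z S\<inter>?B S<={zer J S}" if S: "finite S" for S
 proof
	fix x assume x: "x:e S ` full Z S\<inter>?B S"
	then obtain z where z: "z:full Z S" "x = e S z" by blast
	show "x:{zer J S}"
	proof (cases "c\<le>card S")
	 case True
	 then have "z:tor Z S" using x z by (intro tor_inj[OF Z JM J(2,3) S]) auto
	 then have "z = zer Z S" using c[OF S True] by blast
	 then show ?thesis unfolding z(2) using FI_map_zero[OF Z JM J(2) S] by simp
	qed (use x in auto)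
 qed
 obtain E ph where Em: "max_complement R J (%S. e S ` full Z S) ?B E" and p: "projection R J E ph"
	using complement_retract[OF J(1) V B VB] by blast
 note E = projectionD(1,2)[OF p] max_complementD(2,3)[OF Em] projectionD(3,4)[OF p]
 let ?X = "FI_sub J E"
 have X: "FI_injective R ?X" by (rule injective_retract[OF J(1) E(1,2,5,6)])
 have "tor ?X S<={zer ?X S}" if S: "finite S" and cS: "c\<le>card S" for S
 proof
	fix x assume x: "x:tor ?X S"
	have "x:tor J S" using tor_map[OF FI_module_sub[OF JM E(1)] JM FI_map_incl[OF JM E(1)] S x] .
	then show "x:{zer ?X S}" using tor_carrier[OF x] E(4)[OF S] cS by auto
 qed
 moreover have "FI_map R Z ?X e" by (rule FI_map_sub_cod[OF J(2)]) (use E(3) in blast)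
 ultimately show ?thesis using X J(3) by (intro exI[of _ ?X] exI[of _ e]) simp
qed

subsection \<open>The cosyzygy tower\<close>

lemma superset_card:
 assumes "finite (T :: nat set)"
 shows "EX S. finite S&T<=S&card S = card T + i"
proof -
 obtain B where B: "finite B" "card B = i" "B<=UNIV - T" using infinite_arbitrarily_large[of "UNIV - T" i] assms by auto
 then have "card (T\<union>B) = card T + i" using assms by (subst card_Un_disjoint) auto
 then show ?thesis using B assms by (intro exI[of _ "T\<union>B"]) auto
qed

text \<open>Push a torsion element outside U forward to a largest set where it is still outside U.
  From there every larger set kills it modulo U, and it produces homology in a size excluded by
  \<open>bnd\<close>.\<close>

lemma torsion_bound:
 assumes Z: "FI_module R Z" and U: "FI_submodule R Z U"
	and bnd: "!!i S. finite S==>i0\<le>i==>b + i\<le>card S==>kvan Z U (full Z) i S"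
	and S: "finite S" and bS: "b\<le>card S"
 shows "tor Z S<=U S"
proof
 interpret FI_module R Z by (rule Z)
 fix x assume x: "x:tor Z S"
 note xc = tor_carrier[OF x]
 show "x:U S"
 proof (rule ccontr)
	assume xU: "x~:U S"
	\<comment> \<open>The sizes of sets at which the image of x still lies outside U; bounded because x
	  is torsion.\<close>
	define M where "M = {card T | T. finite T&S<=T&mor Z S T (FI_incl S) x~:U T}"
	obtain n where n: "!!T g. finite T==>n\<le>card T==>g:FI_hom S T==>mor Z S T g x = zer Z T" using x unfolding tor_def by blast
	have "m < n" if m: "m:M" for m
	proof (rule ccontr)
	 assume "\<not> m < n"
	 with m obtain T where T: "finite T" "S<=T" "mor Z S T (FI_incl S) x~:U T" "n\<le>card T" unfolding M_def by auto
	 then show False using n[OF T(1,4) FI_incl_hom[OF T(2)]] FI_sub_zero[OF U Z T(1)] by simp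
	qed
	then have fM: "finite M" by (meson finite_nat_set_iff_bounded)
	have "card S:M" unfolding M_def using S xU mor_id[OF S xc] by auto
	then have "Max M:M" using Max_in[OF fM] by blast
	define m where "m = Max M"
	have "m:M" unfolding m_def by fact
	then obtain T where T: "finite T" "S<=T" "mor Z S T (FI_incl S) x~:U T" "card T = m" unfolding M_def by blast
	let ?y = "mor Z S T (FI_incl S) x"
	note i = FI_incl_hom[OF T(2)]
	have yt: "?y:full Z T" by (rule mor_closed[OF S T(1) i xc])
	have kill: "mor Z T (insert q T) (FI_incl T) ?y:U (insert q T)" if q: "q~:T" for q
	proof (rule ccontr)
	 assume nU: "mor Z T (insert q T) (FI_incl T) ?y~:U (insert q T)"
	 have f: "finite (insert q T)" using T by simp
	 have "mor Z T (insert q T) (FI_incl T) ?y = mor Z S (insert q T) (FI_incl S) x"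
		using mor_comp[OF S T(1) f i FI_incl_hom[OF subset_insertI] xc] compose_FI_incl_incl[OF T(2)] by simp
	 then have "card (insert q T):M" unfolding M_def using nU f T(2) by (intro CollectI exI[of _ "insert q T"]) auto
	 moreover have "card (insert q T) = Suc m" using T(1,4) q by simp
	 ultimately have "Suc m:M" by simp
	 then show False using Max_ge[OF fM, of "Suc m"] by (simp add: m_def)
	qed
	\<comment> \<open>The index must be at least \<open>i0\<close> for the vanishing hypothesis and at
	  least \<open>card T\<close> for the nonvanishing result.\<close>
	obtain S' where S': "finite S'" "T<=S'" "card S' = card T + max i0 (card T)" using superset_card[OF T(1)] by blast
	have "card S\<le>card T" using T by (intro card_mono) auto
	then have "kvan Z U (full Z) (max i0 (card T)) S'" using S' bS by (intro bnd) auto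
	moreover have "\<not> kvan Z U (full Z) (max i0 (card T)) S'"
	 by (rule kvan_nonvanishing[OF Z U FI_submodule_full[OF Z] _ T(1) yt T(3) kill S']) (use FI_subD[OF U Z] in auto)
	ultimately show False by simp
 qed
qed

text \<open>The invariant of the tower at level n. The constant b is the same at all levels; the
  range of indices starts at n + 1 because every cosyzygy raises the index of homology by
  one.\<close>

definition stage :: "('k, 'r) ring_scheme=>nat=>nat=>('k, 'u) fi_mod=>(nat set=>'u set)=>bool" where
 "stage R b n Z U<->FI_module R Z&FI_submodule R Z U&(ALL S. finite S-->U S<=tor Z S) \<and>
	(ALL S. finite S-->b\<le>card S-->U S<={zer Z S}) \<and>
	(ALL i S. finite S-->Suc n\<le>i-->b + i\<le>card S-->kvan Z U (full Z) i S)"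

lemma stageD:
 assumes "stage R b n Z U"
 shows "FI_module R Z" "FI_submodule R Z U" "finite S==>U S<=tor Z S" "finite S==>b\<le>card S==>U S<={zer Z S}"
	"finite S==>Suc n\<le>i==>b + i\<le>card S==>kvan Z U (full Z) i S"
 using assms by (simp_all add: stage_def)

lemma stage_tor:
 assumes s: "stage R b n Z U" and S: "finite S" "b\<le>card S"
 shows "tor Z S<=U S"
 by (rule torsion_bound[OF stageD(1,2)[OF s] stageD(5)[OF s] S])

text \<open>One step 0 -> Z -> X -> Z' -> 0 with X injective and U' the image of the torsion of X.
  The last two clauses are the shift between H_i(Z / tor Z) and H_{i+1}(Z'/U'); only one direction
  is available for i = 0.\<close>

definition cosyzygy :: "('k, 'r) ring_scheme=>('k, 'u) fi_mod=>('k, 'u) fi_mod=>(nat set=>'u=>'u)=>(nat set=>'u=>'u) =>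
	('k, 'u) fi_mod=>(nat set=>'u set)=>bool" where
 "cosyzygy R Z X e p Z' U'<->FI_injective R X&FI_map R Z X e&(ALL S. finite S-->inj_on (e S) (full Z S)) \<and>
	FI_map R X Z' p&(ALL S. p S ` full X S = full Z' S) \<and>
	(ALL S x. finite S-->x:full X S-->(p S x = zer Z' S<->x:e S ` full Z S)) \<and>
	(ALL S. U' S = p S ` tor X S) \<and>
	(ALL i S. finite S-->kvan Z (tor Z) (full Z) i S-->kvan Z' U' (full Z') (Suc i) S) \<and>
	(ALL i S. finite S-->kvan Z' U' (full Z') (Suc (Suc i)) S-->kvan Z (tor Z) (full Z) (Suc i) S)"

lemma cosyzygyD:
 assumes "cosyzygy R Z X e p Z' U'"
 shows "FI_injective R X" "FI_map R Z X e" "finite S==>inj_on (e S) (full Z S)" "FI_map R X Z' p"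
	"p S ` full X S = full Z' S"
	"finite S==>x:full X S==>p S x = zer Z' S<->x:e S ` full Z S"
	"U' S = p S ` tor X S" "finite S==>kvan Z (tor Z) (full Z) i S==>kvan Z' U' (full Z') (Suc i) S"
	"finite S==>kvan Z' U' (full Z') (Suc (Suc i)) S==>kvan Z (tor Z) (full Z) (Suc i) S"
 using assms by (simp_all add: cosyzygy_def)

text \<open>Inside X, the quotient (Z + tor X) / tor X is Z / tor Z, because Z meets the torsion of
  X in its own torsion, and X / (Z + tor X) is Z'/U'. As X / tor X is acyclic in positive degrees,
  the connecting map is the shift.\<close>

lemma cosyzygyI:
 fixes Z X Z' :: "('k, 'u) fi_mod"
 assumes Z: "FI_module R Z" and X: "FI_injective R X" and e: "FI_map R Z X e" and einj: "!!S. finite S==>inj_on (e S) (full Z S)"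
	and ac: "!!j S. finite S==>kvan X (tor X) (full X) (Suc j) S"
	and Z': "FI_module R Z'" and p: "FI_map R X Z' p" and psurj: "!!S. p S ` full X S = full Z' S"
	and pker: "!!S x. finite S==>x:full X S==>p S x = zer Z' S<->x:e S ` full Z S"
 shows "cosyzygy R Z X e p Z' (%S. p S ` tor X S)"
proof -
 have XM: "FI_module R X" using X by (simp add: FI_injective_def)
 interpret FI_module R X by (rule XM)
 note T = tor_submodule[OF XM] and TZ = tor_submodule[OF Z] and F = FI_submodule_full[OF XM]
 let ?U = "%S. p S ` tor X S"
 have U: "FI_submodule R Z' ?U" by (rule FI_submodule_image[OF XM Z' p T])
 note E = FI_submodule_image[OF Z XM e FI_submodule_full[OF Z]]
 let ?W = "%S. {a \<oplus>\<^bsub>obj X S\<^esub> t | a t. a:e S ` full Z S&t:tor X S}"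
 have W: "FI_submodule R X ?W" by (rule FI_submodule_sum[OF XM E T])
 have WI: "a \<oplus>\<^bsub>obj X S\<^esub> t:?W S" if "a:e S ` full Z S" "t:tor X S" for a t S using that by blast
 have TW: "tor X S<=?W S" if S: "finite S" for S
 proof
	interpret M: abelian_group "obj X S" by (rule obj_ab[OF S])
	fix t assume t: "t:tor X S"
	show "t:?W S" using WI[OF FI_sub_zero[OF E XM S] t] tor_carrier[OF t] by simp
 qed
 have WF: "?W S<=full X S" if S: "finite S" for S using FI_subD[OF W XM S] by blast
 have K1: "kvan Z (tor Z) (full Z) i S<->kvan X (tor X) ?W i S" if S: "finite S" for i S
 proof (rule kvan_transfer[OF Z XM e TZ FI_submodule_full[OF Z] T W S])
	fix S :: "nat set" assume S: "finite S"
	interpret M: abelian_group "obj X S" by (rule obj_ab[OF S])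
	show "e S x:?W S" if x: "x:full Z S" for x
	 using WI[of "e S x" S, OF imageI[OF x] FI_sub_zero[OF T XM S]] FI_map_closed[OF e S x] by simp
	show "e S x:tor X S<->x:tor Z S" if x: "x:full Z S" for x
	 using tor_inj[OF Z XM e einj S x] tor_map[OF Z XM e S] by blast
	show "\<exists>x\<in>full Z S. e S x \<ominus>\<^bsub>obj X S\<^esub> y:tor X S" if yW: "y:?W S" for y
	proof -
	 obtain z t where y: "y = e S z \<oplus>\<^bsub>obj X S\<^esub> t" "z:full Z S" "t:tor X S" using yW by blast
	 have eq: "e S z \<ominus>\<^bsub>obj X S\<^esub> y = \<ominus>\<^bsub>obj X S\<^esub> t"
		unfolding y(1) a_minus_def using FI_map_closed[OF e S y(2)] tor_carrier[OF y(3)] by (simp add: M.minus_add M.a_assoc[symmetric] M.r_neg)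
	 show ?thesis by (rule bexI[OF _ y(2)]) (unfold eq, rule FI_sub_uminus[OF T XM S y(3)])
	qed
 qed
 have K2: "kvan X ?W (full X) i S<->kvan Z' ?U (full Z') i S" if S: "finite S" for i S
 proof (rule kvan_transfer[OF XM Z' p W F U FI_submodule_full[OF Z'] S])
	fix S :: "nat set" assume S: "finite S"
	interpret M: abelian_group "obj X S" by (rule obj_ab[OF S])
	interpret M': abelian_group "obj Z' S" by (rule FI_module.obj_ab[OF Z' S])
	note pc = FI_map_closed[OF p S]
	show "p S x:full Z' S" if "x:full X S" for x by (rule pc[OF that])
	show "p S x:?U S<->x:?W S" if x: "x:full X S" for x
	proof
	 assume "p S x:?U S"
	 then obtain t where t: "t:tor X S" "p S x = p S t" by blast
	 note tc = tor_carrier[OF t(1)]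
	 have "p S (x \<ominus>\<^bsub>obj X S\<^esub> t) = zer Z' S"
		unfolding FI_map_minus[OF XM Z' p S x tc] t(2) using M'.minus_eq_zero_iff[OF pc[OF tc] pc[OF tc]] by simp
	 then have "x \<ominus>\<^bsub>obj X S\<^esub> t:e S ` full Z S" using pker[OF S M.minus_closed[OF x tc]] by simp
	 from WI[OF this t(1)] show "x:?W S" unfolding M.minus_add_cancel_right[OF x tc] .
	next
	 assume "x:?W S"
	 then obtain z t where y: "x = e S z \<oplus>\<^bsub>obj X S\<^esub> t" "z:full Z S" "t:tor X S" by blast
	 note c = FI_map_closed[OF e S y(2)] tor_carrier[OF y(3)]
	 have "p S (e S z) = zer Z' S" using pker[OF S c(1)] y(2) by blast
	 then have "p S x = p S t" unfolding y(1) FI_map_add[OF p S c] using pc[OF c(2)] by simp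
	 then show "p S x:?U S" using y(3) by blast
	qed
	show "\<exists>x\<in>full X S. p S x \<ominus>\<^bsub>obj Z' S\<^esub> y:?U S" if y: "y:full Z' S" for y
	proof -
	 obtain x where x: "x:full X S" "y = p S x" using y unfolding psurj[symmetric] by blast
	 show ?thesis
		by (rule bexI[OF _ x(1)]) (use M'.minus_eq_zero_iff[OF y y] x(2) FI_sub_zero[OF U Z' S] in simp)
	qed
 qed
 show ?thesis
	unfolding cosyzygy_def
 proof (intro conjI allI impI X e einj p psurj pker refl)
	fix i and S :: "nat set" assume S: "finite S"
	show "kvan Z' ?U (full Z') (Suc i) S" if "kvan Z (tor Z) (full Z) i S"
	 using kvan_quotient[OF XM T W F TW WF S ac[OF S]] that unfolding K1[OF S] K2[OF S] by simp
	show "kvan Z (tor Z) (full Z) (Suc i) S" if "kvan Z' ?U (full Z') (Suc (Suc i)) S"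
	 using kvan_kernel[OF XM T W F TW WF S _ ac[OF S]] that unfolding K1[OF S] K2[OF S] by simp
 qed
qed

lemma stage_step:
 fixes Z :: "('k, ('k, 'a) univ) fi_mod"
 assumes s: "stage R b n Z U"
 shows "EX (X :: ('k, ('k, 'a) univ) fi_mod) e p Z' U'. cosyzygy R Z X e p Z' U'&stage R b (Suc n) Z' U'"
proof -
 note st = stageD[OF s]
 note Z = st(1)
 have tz: "tor Z S<={zer Z S}" if "finite S" "b\<le>card S" for S
	using stage_tor[OF s that] st(4)[OF that] by blast
 have "EX Xe :: ('k, ('k, 'a) univ) fi_mod\<times>_. FI_injective R (fst Xe)&FI_map R Z (fst Xe) (snd Xe)&(ALL S. finite S-->inj_on (snd Xe S) (full Z S)) \<and>
	(ALL S. finite S-->b\<le>card S-->tor (fst Xe) S<={zer (fst Xe) S})"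
	using injective_hull[OF Z tz] by (simp only: split_paired_Ex fst_conv snd_conv)
 then obtain Xe :: "('k, ('k, 'a) univ) fi_mod\<times>(nat set=>('k, 'a) univ=>('k, 'a) univ)"
	where Xe: "FI_injective R (fst Xe)&FI_map R Z (fst Xe) (snd Xe)&(ALL S. finite S-->inj_on (snd Xe S) (full Z S)) \<and>
	(ALL S. finite S-->b\<le>card S-->tor (fst Xe) S<={zer (fst Xe) S})" ..
 define X where "X = fst Xe"
 define e where "e = snd Xe"
 have X: "FI_injective R X" "FI_map R Z X e" "!!S. finite S==>inj_on (e S) (full Z S)"
	"!!S. finite S==>b\<le>card S==>tor X S<={zer X S}"
	using Xe unfolding X_def e_def by simp_all
 have XM: "FI_module R X" using X(1) by (simp add: FI_injective_def)
 note T = tor_submodule[OF XM] and E = FI_submodule_image[OF Z XM X(2) FI_submodule_full[OF Z]]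
 obtain Z' :: "('k, ('k, 'a) univ) fi_mod" where "EX p. FI_module R Z'&FI_map R X Z' p&(ALL S. p S ` full X S = full Z' S) \<and>
	(ALL S x. finite S-->x:full X S-->(p S x = zer Z' S<->x:e S ` full Z S))"
	using quotient_exists[OF XM E] ..
 then obtain p where "FI_module R Z'&FI_map R X Z' p&(ALL S. p S ` full X S = full Z' S) \<and>
	(ALL S x. finite S-->x:full X S-->(p S x = zer Z' S<->x:e S ` full Z S))" ..
 then have p: "FI_module R Z'" "FI_map R X Z' p" "!!S. p S ` full X S = full Z' S"
	"!!S x. finite S==>x:full X S==>p S x = zer Z' S<->x:e S ` full Z S" by simp_all
 let ?U = "%S. p S ` tor X S"
 have ac: "kvan X (tor X) (full X) (Suc j) S" if "finite S" for j S by (rule injective_torsion_splitting[OF X(1) X(4) that])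
 have cos: "cosyzygy R Z X e p Z' ?U" by (rule cosyzygyI[OF Z X(1,2,3) ac p])
 have "stage R b (Suc n) Z' ?U"
	unfolding stage_def
 proof (intro conjI p(1) FI_submodule_image[OF XM p(1,2) T] allI impI)
	fix S :: "nat set" assume S: "finite S"
	show "?U S<=tor Z' S" using tor_map[OF XM p(1,2) S] by blast
	show "?U S<={zer Z' S}" if "b\<le>card S" using X(4)[OF S that] FI_map_zero[OF XM p(1,2) S] by auto
	fix i assume i: "Suc (Suc n)\<le>i" and c: "b + i\<le>card S"
	then obtain k where k: "i = Suc (Suc k)" "n\<le>k" by (metis Suc_le_D Suc_le_mono)
	\<comment> \<open>The relevant sets have |S| - k points, hence at least b + 2, and in size at least
	  b all torsion of Z lies in U.\<close>
	have z: "kvan Z U (tor Z) k S"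
	proof (rule kvan_zero[OF Z st(2) tor_submodule[OF Z] S])
	 fix T assume T: "T<=S" "card T + k = card S"
	 show "tor Z T<=U T" by (rule stage_tor[OF s]) (use T c k S finite_subset in auto)
	qed
	have "kvan Z U (full Z) (Suc k) S" by (rule st(5)[OF S]) (use k c in auto)
	then have "kvan Z (tor Z) (full Z) (Suc k) S"
	 by (intro kvan_quotient[OF Z st(2) tor_submodule[OF Z] FI_submodule_full[OF Z] st(3) _ S _ z]) (auto simp: tor_carrier)
	then show "kvan Z' ?U (full Z') i S" unfolding k(1) by (rule cosyzygyD(8)[OF cos S])
 qed
 then show ?thesis using cos by (intro exI[of _ X] exI[of _ e] exI[of _ p] exI[of _ Z'] exI[of _ ?U] conjI)
qed

text \<open>What remains of the resolution once it is built: level 0 is V, consecutive levels are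
  linked by the index shift, and the j-th local cohomology is \<open>tor (Z j)\<close> modulo
  \<open>U j\<close>.\<close>

definition tower :: "('k, 'r) ring_scheme=>('k, 'a) fi_mod=>nat=>(nat=>('k, ('k, 'a) univ) fi_mod) =>
	(nat=>nat set=>('k, 'a) univ set)=>bool" where
 "tower R V b Z U<->(ALL n. stage R b n (Z n) (U n)) \<and>
	(ALL i S. finite S-->(kvan (Z 0) (U 0) (full (Z 0)) i S<->kvan V (null V) (full V) i S)) \<and>
	(ALL n i S. finite S-->kvan (Z n) (tor (Z n)) (full (Z n)) i S-->kvan (Z (Suc n)) (U (Suc n)) (full (Z (Suc n))) (Suc i) S) \<and>
	(ALL n i S. finite S-->kvan (Z (Suc n)) (U (Suc n)) (full (Z (Suc n))) (Suc (Suc i)) S-->kvan (Z n) (tor (Z n)) (full (Z n)) (Suc i) S) \<and>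
	(ALL j S. finite S-->(full (local_cohomology R j V) S = {zer (local_cohomology R j V) S}<->tor (Z j) S<=U j S))"

lemma tower_exists:
 fixes V :: "('k, 'a) fi_mod"
 assumes V: "FI_module R V" and bnd: "!!i S. finite S==>1\<le>i==>b + i\<le>card S==>kvan V (null V) (full V) i S"
 shows "EX Z U. tower R V b Z U"
proof -
 obtain cv :: "'a=>('k, 'a) univ" where cv: "inj cv" using univ_base_inj by blast
 define q where "q S = cv" for S :: "nat set"
 have qi: "inj_on (q S) (full V S)" for S unfolding q_def using cv by (rule inj_on_subset) simp
 let ?Z0 = "push V q"
 interpret pf: pushforward R V "null V" q by (rule pushforward_inj[OF V qi])
 note Z0 = pf.FI_module_push and q = pf.FI_map_push
 have k0: "kvan ?Z0 (null ?Z0) (full ?Z0) i S<->kvan V (null V) (full V) i S" if S: "finite S" for i S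
 proof (rule sym, rule kvan_transfer[OF V Z0 q FI_submodule_null[OF V] FI_submodule_full[OF V] FI_submodule_null[OF Z0] FI_submodule_full[OF Z0] S])
	fix S :: "nat set" assume S: "finite S"
	interpret M: abelian_group "obj ?Z0 S" by (rule FI_module.obj_ab[OF Z0 S])
	show "q S x:full ?Z0 S" if "x:full V S" for x by (rule FI_map_closed[OF q S that])
	show "q S x:null ?Z0 S<->x:null V S" if "x:full V S" for x using pf.push_zero_iff[OF S that] by simp
	show "\<exists>x\<in>full V S. q S x \<ominus>\<^bsub>obj ?Z0 S\<^esub> y:null ?Z0 S" if y: "y:full ?Z0 S" for y
	proof -
	 obtain x where x: "x:full V S" "y = q S x" using y unfolding push_sel by blast
	 show ?thesis by (rule bexI[OF _ x(1)]) (use M.minus_eq_zero_iff[OF y y] x(2) in simp)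
	qed
 qed
 have s0: "stage R b 0 ?Z0 (null ?Z0)"
	unfolding stage_def using Z0 FI_submodule_null[OF Z0] FI_sub_zero[OF tor_submodule[OF Z0] Z0] k0 bnd by simp
 define z0 where "z0 = (?Z0, null ?Z0)"
 have "EX f. ALL n. ((n = 0-->f n = z0)&stage R b n (fst (f n)) (snd (f n))) \<and>
	(EX x. cosyzygy R (fst (f n)) (fst x) (fst (snd x)) (snd (snd x)) (fst (f (Suc n))) (snd (f (Suc n))))"
 proof (rule dependent_nat_choice)
	show "EX s. ((0 :: nat) = 0-->s = z0)&stage R b 0 (fst s) (snd s)" using s0 by (intro exI[of _ z0]) (simp add: z0_def)
	fix s :: "('k, ('k, 'a) univ) fi_mod\<times>(nat set=>('k, 'a) univ set)" and n :: nat
	assume "(n = 0-->s = z0)&stage R b n (fst s) (snd s)"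
	then have "stage R b n (fst s) (snd s)" ..
	from stage_step[OF this] obtain X e p Z' U' where "cosyzygy R (fst s) X e p Z' U'" "stage R b (Suc n) Z' U'" by (elim exE conjE)
	then show "EX s'. ((Suc n = 0-->s' = z0)&stage R b (Suc n) (fst s') (snd s')) \<and>
	 (EX x. cosyzygy R (fst s) (fst x) (fst (snd x)) (snd (snd x)) (fst s') (snd s'))"
	 by (intro exI[of _ "(Z', U')"] conjI exI[of _ "(X, e, p)"]) simp_all
 qed
 then obtain f where f: "ALL n. ((n = 0-->f n = z0)&stage R b n (fst (f n)) (snd (f n))) \<and>
	(EX x. cosyzygy R (fst (f n)) (fst x) (fst (snd x)) (snd (snd x)) (fst (f (Suc n))) (snd (f (Suc n))))" ..
 define Z where "Z n = fst (f n)" for n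
 define U where "U n = snd (f n)" for n
 have ZU0: "Z 0 = ?Z0" "U 0 = null ?Z0" using f by (simp_all add: Z_def U_def z0_def)
 have st: "stage R b n (Z n) (U n)" for n using f by (simp add: Z_def U_def)
 define x where "x n = (SOME x. cosyzygy R (Z n) (fst x) (fst (snd x)) (snd (snd x)) (Z (Suc n)) (U (Suc n)))" for n
 define X where "X n = fst (x n)" for n
 define e where "e n = fst (snd (x n))" for n
 define p where "p n = snd (snd (x n))" for n
 have ex: "EX x. cosyzygy R (Z n) (fst x) (fst (snd x)) (snd (snd x)) (Z (Suc n)) (U (Suc n))" for n using f unfolding Z_def U_def by simp
 have cos: "cosyzygy R (Z n) (X n) (e n) (p n) (Z (Suc n)) (U (Suc n))" for n
	unfolding X_def e_def p_def x_def by (rule someI_ex[OF ex])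
 note c = cosyzygyD[OF cos]
 have ZM: "FI_module R (Z n)" for n by (rule stageD(1)[OF st])
 have XM: "FI_module R (X n)" for n using c(1)[of n] by (simp add: FI_injective_def)
 \<comment> \<open>The short exact sequences are spliced: project onto the next cosyzygy and embed
   it into the next injective.\<close>
 define d where "d n S y = e (Suc n) S (p n S y)" for n S y
 have dm: "FI_map R (X n) (X (Suc n)) (d n)" for n unfolding d_def[abs_def] by (rule FI_map_comp[OF c(4) c(2)])
 have dz: "d n S y = zer (X (Suc n)) S<->y:e n S ` full (Z n) S" if S: "finite S" and y: "y:full (X n) S" for n S y
 proof -
	have "d n S y = zer (X (Suc n)) S<->e (Suc n) S (p n S y) = e (Suc n) S (zer (Z (Suc n)) S)"
	 unfolding d_def FI_map_zero[OF ZM XM c(2) S] ..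
	also have "...<->p n S y = zer (Z (Suc n)) S"
	 by (rule inj_on_eq_iff[OF c(3)[OF S] FI_map_closed[OF c(4) S y] FI_sub_zero[OF FI_submodule_full[OF ZM] ZM S]])
	also have "...<->y:e n S ` full (Z n) S" by (rule c(6)[OF S y])
	finally show ?thesis .
 qed
 have res: "inj_resolution R V X d (%S v. e 0 S (q S v))"
	unfolding inj_resolution_def FI_im_def FI_ker_def
 proof (intro conjI allI impI c(1) dm)
	show "FI_map R V (X 0) (%S v. e 0 S (q S v))" using FI_map_comp[OF q c(2)[of 0, unfolded ZU0]] .
	fix S :: "nat set" assume S: "finite S"
	have im: "q S ` full V S = full (Z 0) S" unfolding ZU0 by (rule pf.push_surj)
	show "inj_on (%v. e 0 S (q S v)) (full V S)"
	 using comp_inj_on[OF qi[of S], of "e 0 S"] c(3)[OF S, of 0] unfolding im comp_def by simp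
	have "(%v. e 0 S (q S v)) ` full V S = e 0 S ` full (Z 0) S" unfolding im[symmetric] image_image ..
	then show "(%v. e 0 S (q S v)) ` full V S = {x\<in>full (X 0) S. d 0 S x = zer (X 1) S}"
	 using dz[OF S, of _ 0] FI_map_closed[OF c(2)[of 0] S] by auto
	show "d n S ` full (X n) S = {x\<in>full (X (Suc n)) S. d (Suc n) S x = zer (X (Suc (Suc n))) S}" for n
	proof -
	 have "d n S ` full (X n) S = e (Suc n) S ` full (Z (Suc n)) S" unfolding d_def c(5)[of n S, symmetric] image_image ..
	 then show ?thesis using dz[OF S, of _ "Suc n"] FI_map_closed[OF c(2)[of "Suc n"] S] by auto
	qed
 qed
 \<comment> \<open>Torsion cycles of \<open>X j\<close> are the image of \<open>tor (Z j)\<close>,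
   and boundaries of torsion elements are the image of \<open>U j\<close>; both are read inside
   \<open>Z j\<close>.\<close>
 have coh: "tvan X d j S<->tor (Z j) S<=U j S" if S: "finite S" for j S
 proof -
	have inj: "e j S z:e j S ` B<->z:B" if "z:full (Z j) S" "B<=full (Z j) S" for z B
	 by (rule inj_on_image_mem_iff[OF c(3)[OF S] that])
	have B: "(case j of 0=>{zer (X 0) S} | Suc i=>d i S ` tor (X i) S) = e j S ` U j S"
	proof (cases j)
	 case 0
	 then show ?thesis using FI_map_zero[OF ZM XM c(2) S, of 0] by (simp add: ZU0)
	next
	 case (Suc i)
	 then show ?thesis unfolding Suc by (simp add: c(7)[of i S] image_image d_def)
	qed
	have Uc: "U j S<=full (Z j) S" by (rule subsetI, rule tor_carrier[OF subsetD[OF stageD(3)[OF st S]]])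
	have ker: "y:tor (X j) S&d j S y = zer (X (Suc j)) S<->y:e j S ` tor (Z j) S" for y
	proof
	 assume y: "y:tor (X j) S&d j S y = zer (X (Suc j)) S"
	 have "y:e j S ` full (Z j) S" by (rule iffD1[OF dz[OF S tor_carrier[OF conjunct1[OF y]]] conjunct2[OF y]])
	 then obtain z where z: "y = e j S z" "z:full (Z j) S" by (rule imageE)
	 have "z:tor (Z j) S" by (rule tor_inj[OF ZM XM c(2) c(3) S z(2)]) (use y z(1) in simp_all)
	 then show "y:e j S ` tor (Z j) S" unfolding z(1) by (rule imageI)
	next
	 assume "y:e j S ` tor (Z j) S"
	 then obtain z where z: "y = e j S z" "z:tor (Z j) S" by (rule imageE)
	 have y: "y:tor (X j) S" unfolding z(1) by (rule tor_map[OF ZM XM c(2) S z(2)])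
	 have "y:e j S ` full (Z j) S" unfolding z(1) by (rule imageI[OF tor_carrier[OF z(2)]])
	 with y show "y:tor (X j) S&d j S y = zer (X (Suc j)) S" using dz[OF S tor_carrier[OF y]] by simp
	qed
	have "tvan X d j S<->(\<forall>y\<in>e j S ` tor (Z j) S. y:e j S ` U j S)"
	 unfolding tvan_def B using ker by (simp add: Ball_def flip: ker imp_conjL)
	also have "...<->tor (Z j) S<=U j S"
	proof -
	 have "(\<forall>y\<in>e j S ` tor (Z j) S. y:e j S ` U j S)<->(\<forall>z\<in>tor (Z j) S. e j S z:e j S ` U j S)" by simp
	 also have "...<->(\<forall>z\<in>tor (Z j) S. z:U j S)" by (rule ball_cong[OF refl]) (rule inj[OF tor_carrier Uc])
	 finally show ?thesis unfolding subset_eq .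
	qed
	finally show ?thesis .
 qed
 have "tower R V b Z U"
	unfolding tower_def
 proof (intro conjI allI impI st)
	fix S :: "nat set" assume S: "finite S"
	show "kvan (Z 0) (U 0) (full (Z 0)) i S<->kvan V (null V) (full V) i S" for i unfolding ZU0 by (rule k0[OF S])
	show "kvan (Z (Suc n)) (U (Suc n)) (full (Z (Suc n))) (Suc i) S" if "kvan (Z n) (tor (Z n)) (full (Z n)) i S" for n i
	 by (rule c(8)[OF S that])
	show "kvan (Z n) (tor (Z n)) (full (Z n)) (Suc i) S" if "kvan (Z (Suc n)) (U (Suc n)) (full (Z (Suc n))) (Suc (Suc i)) S" for n i
	 by (rule c(9)[OF S that])
	show "full (local_cohomology R j V) S = {zer (local_cohomology R j V) S}<->tor (Z j) S<=U j S" for j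
	 using local_cohomology_zero_iff[OF V res S] coh[OF S] by blast
 qed
 then show ?thesis by (intro exI[of _ Z] exI[of _ U])
qed

subsection \<open>Regularity and the critical index\<close>

lemma FI_deg_eqI:
 assumes S: "finite S" "card S = m" "full W S~={zer W S}"
	and up: "!!S. finite S==>m < card S==>full W S = {zer W S}"
 shows "FI_deg W = ereal (real m)"
proof -
 have le: "FI_deg W\<le>ereal (of_int (int m))" by (subst FI_deg_le_iff) (use up in auto)
 then have "FI_deg W < \<infinity>" by (rule order_le_less_trans) simp
 then obtain d :: int where d: "- 1\<le>d" "FI_deg W = ereal (of_int d)" by (rule FI_deg_finiteE)
 have "int m\<le>d" using FI_deg_le_iff[OF d(1), of W] d(2) S by (metis not_le order_refl)
 moreover have "d\<le>int m" using le d(2) by simp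
 ultimately show ?thesis using d(2) by simp
qed

lemma FI_deg_zero:
 assumes "!!S. finite S==>full W S = {zer W S}"
 shows "FI_deg W = ereal (- 1)"
proof (rule antisym[OF _ FI_deg_ge])
 show "FI_deg W\<le>ereal (- 1)" using FI_deg_le_iff[of "- 1" W] assms by simp
qed

text \<open>For a tower this says that the j-th local cohomology is nonzero at some set of size
  m.\<close>

definition tor_at :: "(nat=>('k, 'u) fi_mod)=>(nat=>nat set=>'u set)=>nat=>nat=>bool" where
 "tor_at Z U j m<->(EX S. finite S&card S = m&\<not> tor (Z j) S<=U j S)"

lemma towerD:
 assumes "tower R V b Z U"
 shows "stage R b n (Z n) (U n)"
	"finite S==>kvan (Z 0) (U 0) (full (Z 0)) i S<->kvan V (null V) (full V) i S"
	"finite S==>kvan (Z n) (tor (Z n)) (full (Z n)) i S==>kvan (Z (Suc n)) (U (Suc n)) (full (Z (Suc n))) (Suc i) S"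
	"finite S==>kvan (Z (Suc n)) (U (Suc n)) (full (Z (Suc n))) (Suc (Suc i)) S==>kvan (Z n) (tor (Z n)) (full (Z n)) (Suc i) S"
	"finite S==>full (local_cohomology R j V) S = {zer (local_cohomology R j V) S}<->tor (Z j) S<=U j S"
 using assms by (simp_all add: tower_def)

context
 fixes R :: "('k, 'r) ring_scheme" and V :: "('k, 'a) fi_mod" and b Z U
 assumes tow: "tower R V b Z U"
begin

lemma tower_module: "FI_module R (Z n)" "FI_submodule R (Z n) (U n)" "FI_submodule R (Z n) (tor (Z n))" "FI_submodule R (Z n) (full (Z n))"
	"finite S==>U n S<=tor (Z n) S" "tor (Z n) S<=full (Z n) S"
 using stageD[OF towerD(1)[OF tow]] by (auto simp: tor_submodule FI_submodule_full tor_carrier)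

lemma tower_tor_kvan:
 assumes "finite S" "!!T :: nat set. finite T==>card T + i = card S==>\<not> tor_at Z U n (card T)"
 shows "kvan (Z n) (U n) (tor (Z n)) i S"
proof (rule kvan_zero[OF tower_module(1,2,3) assms(1)])
 fix T assume T: "T<=S" "card T + i = card S"
 then have f: "finite T" using assms(1) finite_subset by blast
 show "tor (Z n) T<=U n T" using assms(2)[OF f T(2)] f unfolding tor_at_def by blast
qed

text \<open>Raising i and j together leaves the size condition intact, and the climb ends when i
  exceeds |S|, where no chains exist. On the way back \<open>tor (Z j)\<close> modulo
  \<open>U j\<close> contributes nothing, since its i-th homology at S involves sets of size |S| -
  i, above rh - j.\<close>

lemma tower_upper:
 assumes rho: "!!j m. tor_at Z U j m==>int m + int j\<le>rh" and S: "finite S" and i: "1\<le>i" and c: "rh - int j + int i < int (card S)"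
 shows "kvan (Z j) (U j) (full (Z j)) i S"
 using i c
proof (induction "Suc (card S) - i" arbitrary: i j rule: less_induct)
 case less
 show ?case
 proof (cases "card S < i")
	case True
	then show ?thesis by (rule kvan_beyond_card[OF tower_module(1,2) S])
 next
	case False
	obtain k where k: "i = Suc k" using less.prems(1) by (cases i) auto
	have "kvan (Z (Suc j)) (U (Suc j)) (full (Z (Suc j))) (Suc i) S" by (rule less.hyps) (use False less.prems in auto)
	then have t: "kvan (Z j) (tor (Z j)) (full (Z j)) i S" unfolding k by (rule towerD(4)[OF tow S])
	have "kvan (Z j) (U j) (tor (Z j)) i S"
	proof (rule tower_tor_kvan[OF S])
	 fix T assume "finite T" "card T + i = card S"
	 then show "\<not> tor_at Z U j (card T)" using rho[of j "card T"] less.prems(2) by auto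
	qed
	from kvan_middle[OF tower_module(1-6) S this t] show ?thesis .
 qed
qed

text \<open>At level j a torsion element of top degree h gives homology of index i + j on a set of
  size h + i + j; this is where h <= i + j is needed. Each step down lowers the index by one and
  keeps S, and the torsion of the lower levels cannot interfere because h + j dominates
  there.\<close>

lemma tower_lower:
 assumes h: "tor_at Z U j h" and dom: "!!j' m. j'\<le>j==>tor_at Z U j' m==>m + j'\<le>h + j" and i: "1\<le>i" "h\<le>i + j"
 shows "EX S. finite S&card S = h + j + i&\<not> kvan V (null V) (full V) i S"
proof -
 obtain C where C: "finite C" "card C = h" "\<not> tor (Z j) C<=U j C" using h unfolding tor_at_def by blast
 then obtain x where x: "x:tor (Z j) C" "x~:U j C" by blast
 obtain S where S: "finite S" "C<=S" "card S = card C + (i + j)" using superset_card[OF C(1)] by blast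
 have "\<not> kvan (Z (j - k)) (U (j - k)) (full (Z (j - k))) (i + j - k) S" if "k\<le>j" for k
	using that
 proof (induction k)
	case 0
	have kill: "mor (Z j) C (insert q C) (FI_incl C) x:U j (insert q C)" if q: "q~:C" for q
	proof -
	 have f: "finite (insert q C)" using C(1) by simp
	 have "\<not> tor_at Z U j (card (insert q C))" using dom[of j "card (insert q C)"] C(1,2) q by auto
	 then have "tor (Z j) (insert q C)<=U j (insert q C)" using f unfolding tor_at_def by blast
	 then show ?thesis using FI_sub_mor[OF tower_module(3) C(1) f FI_incl_hom[OF subset_insertI] x(1)] by blast
	qed
	have "\<not> kvan (Z j) (U j) (full (Z j)) (i + j) S"
	 by (rule kvan_nonvanishing[OF tower_module(1,2,4) subset_trans[OF tower_module(5,6)] C(1) tor_carrier[OF x(1)] x(2) kill S]) (use C(2) i in auto)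
	then show ?case by simp
 next
	case (Suc k)
	define n where "n = j - Suc k"
	have n: "j - k = Suc n" using Suc.prems by (simp add: n_def)
	define l where "l = i + j - Suc (Suc k)"
	have l: "i + j - k = Suc (Suc l)" "i + j - Suc k = Suc l" using Suc.prems i(1) by (simp_all add: l_def)
	show ?case
	proof
	 assume "kvan (Z (j - Suc k)) (U (j - Suc k)) (full (Z (j - Suc k))) (i + j - Suc k) S"
	 then have v: "kvan (Z n) (U n) (full (Z n)) (Suc l) S" unfolding n_def[symmetric] l .
	 \<comment> \<open>The sets that matter have size |S| - l with |S| - l + n = h + j + 1, just beyond
	   the degrees allowed by \<open>dom\<close>.\<close>
	 have "kvan (Z n) (U n) (tor (Z n)) l S"
	 proof (rule tower_tor_kvan[OF S(1)])
		fix T assume "finite T" "card T + l = card S"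
		then have "h + j < card T + n" using S(3) C(2) n l(1) Suc.prems by linarith
		then show "\<not> tor_at Z U n (card T)" using dom[of n "card T"] by (auto simp: n_def)
	 qed
	 from kvan_quotient[OF tower_module(1-6) S(1) v this] have "kvan (Z n) (tor (Z n)) (full (Z n)) (Suc l) S" .
	 then have "kvan (Z (Suc n)) (U (Suc n)) (full (Z (Suc n))) (Suc (Suc l)) S" by (rule towerD(3)[OF tow S(1)])
	 then show False using Suc.IH Suc.prems unfolding n l by simp
	qed
 qed
 from this[of j] have "\<not> kvan V (null V) (full V) i S" using towerD(2)[OF tow S(1)] by simp
 then show ?thesis using S C(2) by (intro exI[of _ S]) simp
qed

text \<open>The stage invariant places torsion outside U in sizes below b, so a largest degree
  exists and is the degree of local cohomology.\<close>

lemma tower_max: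
 assumes t: "tor_at Z U j m"
 shows "\<exists>h\<ge>m. tor_at Z U j h&(ALL m. tor_at Z U j m-->m\<le>h)&FI_h R j V = ereal (real h)"
proof -
 define H where "H = {m. tor_at Z U j m}"
 have "m < b" if "m:H" for m
 proof (rule ccontr)
	obtain S where S: "finite S" "card S = m" "\<not> tor (Z j) S<=U j S" using \<open>m:H\<close> unfolding H_def tor_at_def by blast
	assume "\<not> m < b"
	then show False using stage_tor[OF towerD(1)[OF tow] S(1), of j] S(2,3) by simp
 qed
 then have fH: "finite H" by (meson finite_nat_set_iff_bounded)
 have "m:H" using t by (simp add: H_def)
 define h where "h = Max H"
 have "h:H" unfolding h_def using Max_in[OF fH] \<open>m:H\<close> by blast
 then have h: "tor_at Z U j h" by (simp add: H_def)
 have max: "m\<le>h" if "tor_at Z U j m" for m unfolding h_def by (rule Max_ge[OF fH]) (simp add: H_def that)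
 obtain S where S: "finite S" "card S = h" "\<not> tor (Z j) S<=U j S" using h unfolding tor_at_def by blast
 have "FI_h R j V = ereal (real h)"
	unfolding FI_h_def
 proof (rule FI_deg_eqI[OF S(1,2)])
	show "full (local_cohomology R j V) S~={zer (local_cohomology R j V) S}" using towerD(5)[OF tow S(1), of j] S(3) by simp
	fix T :: "nat set" assume T: "finite T" "h < card T"
	then have "tor (Z j) T<=U j T" using max[of "card T"] unfolding tor_at_def by force
	then show "full (local_cohomology R j V) T = {zer (local_cohomology R j V) T}" using towerD(5)[OF tow T(1), of j] by simp
 qed
 then show ?thesis using h max t by blast
qed

lemma tower_nonneg:
 assumes "0\<le>FI_h R j V"
 shows "EX m. tor_at Z U j m"
proof (rule ccontr)
 assume n: "\<nexists>m. tor_at Z U j m"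
 have "FI_deg (local_cohomology R j V) = ereal (- 1)"
 proof (rule FI_deg_zero)
	fix S :: "nat set" assume S: "finite S"
	have "tor (Z j) S<=U j S" using n S unfolding tor_at_def by blast
	then show "full (local_cohomology R j V) S = {zer (local_cohomology R j V) S}" using towerD(5)[OF tow S, of j] by simp
 qed
 then show False using assms by (simp add: FI_h_def)
qed

text \<open>At the least level violating the bound, its top degree dominates all lower levels, so
  its homology descends to V and contradicts the linear bound. Consequently only finitely many sums
  of degree and level occur.\<close>

lemma tower_total_bound:
 assumes bnd: "!!i S. finite S==>1\<le>i==>b + i\<le>card S==>kvan V (null V) (full V) i S" and t: "tor_at Z U j m"
 shows "m + j < b"
proof (rule ccontr)
 assume "\<not> m + j < b"
 then have ex: "EX j m. tor_at Z U j m&b\<le>m + j" using t by (intro exI[of _ j] exI[of _ m]) simp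
 define j0 where "j0 = (LEAST j. EX m. tor_at Z U j m&b\<le>m + j)"
 obtain m0 where m0: "tor_at Z U j0 m0" "b\<le>m0 + j0" using LeastI_ex[OF ex] unfolding j0_def by blast
 obtain h where h: "m0\<le>h" "tor_at Z U j0 h" "!!m. tor_at Z U j0 m==>m\<le>h" using tower_max[OF m0(1)] by blast
 have "m + j'\<le>h + j0" if "j'\<le>j0" and tm: "tor_at Z U j' m" for j' m
 proof (cases "j' = j0")
	case True
	then show ?thesis using h(3) tm by simp
 next
	case False
	then have "j' < j0" using \<open>j' \<le> j0\<close> by simp
	then have "\<not> (EX m. tor_at Z U j' m&b\<le>m + j')" unfolding j0_def by (rule not_less_Least)
	then show ?thesis using tm m0(2) h(1) by fastforce
 qed
 then have "EX S. finite S&card S = h + j0 + max 1 h&\<not> kvan V (null V) (full V) (max 1 h) S"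
	by (intro tower_lower[OF h(2)]) simp_all
 then obtain S where "finite S" "card S = h + j0 + max 1 h" "\<not> kvan V (null V) (full V) (max 1 h) S" by (elim exE conjE)
 then show False using bnd[of S "max 1 h"] m0(2) h(1) by simp
qed

end

theorem theoremA:
 fixes R :: "('k, 'r) ring_scheme" and V :: "('k, 'a) fi_mod" and a :: int
 assumes "cring R"
	and "FI_module R V"
	and "presented_in_finite_degrees R V"
	and "\<not> H0_acyclic R V"
	and "ereal (of_int a) \<ge>
	 (if \<one>\<^bsub>R\<^esub> \<oplus>\<^bsub>R\<^esub> \<one>\<^bsub>R\<^esub> \<in> Units R
		then max 1 (FI_h R (FI_crit R V) V - ereal (real (FI_crit R V)))
		else max 1 (2 * FI_h R (FI_crit R V) V - ereal (real (FI_crit R V))))"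
 shows "FI_t R (nat a) V - ereal (of_int a) = FI_reg R V"
proof -
 note V = assms(2)
 have t: "FI_deg (FI_H0 V) < \<infinity>" "FI_deg (FI_homology R 1 V) < \<infinity>"
	using assms(3) by (simp_all add: presented_in_finite_degrees_def FI_t_def)
 obtain d0 d1 :: int where d: "- 1\<le>d0" "FI_deg (FI_H0 V) = ereal (of_int d0)" "- 1\<le>d1" "FI_deg (FI_homology R 1 V) = ereal (of_int d1)"
	using FI_deg_finiteE[OF t(1)] FI_deg_finiteE[OF t(2)] by metis
 have k0: "kvan V (null V) (full V) 0 S" if "finite S" "nat (d0 + 1)\<le>card S" for S
	using FI_deg_le_iff[OF d(1), of "FI_H0 V"] d(2) that FI_H0_zero_iff[OF V that(1)] by (auto simp: nat_le_iff)
 have k1: "kvan V (null V) (full V) (Suc 0) S" if "finite S" "nat (d1 + 1)\<le>card S" for S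
	using FI_deg_le_iff[OF d(3), of "FI_homology R 1 V"] d(4) that FI_homology_zero_iff[OF V that(1), of 0] by (auto simp: nat_le_iff)
 \<comment> \<open>Church's bound: H_0 and H_1 vanish on sets with at least d0 + 1 and d1 + 1
   points; the shift by one also makes degree -1 a natural number.\<close>
 define b where "b = 2 * nat (d0 + 1) + nat (d1 + 1)"
 have bnd: "kvan V (null V) (full V) i S" if S: "finite S" and i: "1\<le>i" and c: "b + i\<le>card S" for i S
 proof -
	obtain j where j: "i = Suc j" using i by (cases i) auto
	show ?thesis unfolding j by (rule kvan_regularity[OF V k0 k1 S]) (use c j in \<open>simp_all add: b_def\<close>)
 qed
 obtain Z U where tow: "tower R V b Z U" using tower_exists[OF V bnd] by blast
 note total = tower_total_bound[OF tow bnd]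
 have hom: "full (FI_homology R i V) S = {zer (FI_homology R i V) S}<->kvan V (null V) (full V) i S"
	if "finite S" "1\<le>i" for i S
	using FI_homology_zero_iff[OF V that(1), of "i - 1"] that(2) by simp
 have upper: "kvan V (null V) (full V) i S"
	if "!!j m. tor_at Z U j m==>int m + int j\<le>rh" "finite S" "1\<le>i" "rh + int i < int (card S)" for rh i S
	using tower_upper[OF tow that(1-3), of 0] that(4) towerD(2)[OF tow that(2)] by simp
 \<comment> \<open>The sums of degree and level at which local cohomology is nonzero; their maximum
   will be the regularity.\<close>
 define A where "A = {m + j | m j. tor_at Z U j m}"
 have fA: "finite A" using total unfolding A_def finite_nat_set_iff_bounded by auto
 have "A~={}"
 proof
	assume "A = {}"
	then have n: "\<not> tor_at Z U j m" for j m unfolding A_def by blast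
	\<comment> \<open>With no torsion classes any rh bounds them, so it may be taken small enough for
	  the given S and i.\<close>
	have "kvan V (null V) (full V) i S" if "finite S" "1\<le>i" for i S
	 by (rule upper[of "int (card S) - int i - 1"]) (use n that in auto)
	then have "H0_acyclic R V" unfolding H0_acyclic_def FI_zero_def using hom by simp
	then show False using assms(4) by simp
 qed
 define rh where "rh = Max A"
 have "rh:A" unfolding rh_def by (rule Max_in[OF fA \<open>A ~= {}\<close>])
 then obtain m0 j0 where mj: "tor_at Z U j0 m0" "rh = m0 + j0" unfolding A_def by blast
 have le: "m + j\<le>rh" if "tor_at Z U j m" for m j unfolding rh_def by (rule Max_ge[OF fA]) (use that in \<open>auto simp: A_def\<close>)
 have up: "kvan V (null V) (full V) i S" if "finite S" "1\<le>i" "rh + i < card S" for i S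
	by (rule upper[of "int rh"]) (use le that in \<open>auto simp flip: of_nat_add\<close>)
 have t_le: "FI_t R i V\<le>ereal (real rh + real i)" if i: "1\<le>i" for i
 proof -
	have "FI_deg (FI_homology R i V)\<le>ereal (of_int (int rh + int i))"
	 by (subst FI_deg_le_iff) (use hom up i in \<open>auto simp flip: of_nat_add\<close>)
	then show ?thesis using i by (simp add: FI_t_def)
 qed
 have t_eq: "FI_t R i V = ereal (real rh + real i)" if h: "tor_at Z U j h" "h + j = rh" and i: "1\<le>i" "h\<le>i + j" for i j h
 proof -
	obtain S where S: "finite S" "card S = rh + i" "\<not> kvan V (null V) (full V) i S"
	 using tower_lower[OF tow h(1) _ i] le h(2) by auto
	have "FI_deg (FI_homology R i V) = ereal (real (rh + i))"
	 by (rule FI_deg_eqI[OF S(1,2)]) (use hom[OF S(1) i(1)] hom[OF _ i(1)] up[OF _ i(1)] S(3) in auto)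
	then show ?thesis using i(1) by (simp add: FI_t_def)
 qed
 have reg: "FI_reg R V = ereal (real rh)"
	unfolding FI_reg_def
 proof (rule antisym)
	show "(SUP i\<in>{1..}. FI_t R i V - ereal (real i))\<le>ereal (real rh)"
	proof (rule SUP_least)
	 fix i :: nat assume "i:{1..}"
	 then have "FI_t R i V\<le>ereal (real rh + real i)" by (intro t_le) simp
	 then show "FI_t R i V - ereal (real i)\<le>ereal (real rh)" by (cases "FI_t R i V") auto
	qed
	\<comment> \<open>An index for which \<open>t_eq\<close> certainly applies to the pair (j0, m0), so
	  the supremum is attained.\<close>
	have "FI_t R (max 1 m0) V = ereal (real rh + real (max 1 m0))" by (rule t_eq[OF mj(1)]) (use mj(2) in auto)
	then have "ereal (real rh) = FI_t R (max 1 m0) V - ereal (real (max 1 m0))" by simp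
	also have "...\<le>(SUP i\<in>{1..}. FI_t R i V - ereal (real i))" by (rule SUP_upper) simp
	finally show "ereal (real rh)\<le>(SUP i\<in>{1..}. FI_t R i V - ereal (real i))" .
 qed
 define gm where "gm = FI_crit R V"
 obtain h0 where h0: "m0\<le>h0" "tor_at Z U j0 h0" "FI_h R j0 V = ereal (real h0)" using tower_max[OF tow mj(1)] by blast
 have "h0 + j0 = rh" using le[OF h0(2)] h0(1) mj(2) by simp
 then have "EX j. FI_h R j V\<ge>0&FI_h R j V + ereal (real j) = FI_reg R V"
	unfolding reg using h0(3) by (intro exI[of _ j0]) auto
 then have g: "FI_h R gm V\<ge>0&FI_h R gm V + ereal (real gm) = FI_reg R V"
	unfolding gm_def FI_crit_def by (rule LeastI_ex)
 obtain m where "tor_at Z U gm m" using tower_nonneg[OF tow conjunct1[OF g]] by blast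
 from tower_max[OF tow this] obtain h where h: "tor_at Z U gm h" "FI_h R gm V = ereal (real h)" by blast
 have hg: "h + gm = rh" using g unfolding reg h(2) by simp
 have two: "2 * ereal (real h) = ereal (2 * real h)" by simp
 \<comment> \<open>Since h is nonnegative, 2h - gm is at least h - gm, so both cases of the
   hypothesis yield this inequality.\<close>
 have a: "1\<le>a" "real h - real gm\<le>real_of_int a"
	using assms(5) unfolding gm_def[symmetric] h(2) two by (auto split: if_splits simp: one_ereal_def)
 have "FI_t R (nat a) V = ereal (real rh + real (nat a))" by (rule t_eq[OF h(1) hg]) (use a in linarith)+
 then show ?thesis unfolding reg using a(1) by simp
qed

end
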